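(* Let $V:\mathbb R^3\to\mathbb R$ be in $L^\infty_{loc}(\mathbb R^3)$ with $V_0:=\operatorname{ess\,inf}_{x\in\mathbb R^3}V(x)>0$, and let $f:\mathbb R\to\mathbb R$ be continuous, odd, with $f(u)\ge 0$ for $u\ge0$, such that there is $q\in(2,6)$ with $\lim_{u\to\infty}f(u)/u^{q-1}=0$, and $\lim_{u\to0}f(u)/u=0$. Assume that for every $\varepsilon>0$ the space $W_\varepsilon$ embeds compactly into $L^p(\mathbb R^3)$ for every $p\in(2,6)$. Then, for any $\varepsilon>0$, the equation $$-\Delta u+V(\varepsilon x)u+\lambda\phi_u u+f(u)=0\quad\text{in }\mathbb R^3$$ possesses infinitely many solutions $(u_n,\lambda_n)\in W_\varepsilon\times\mathbb R$ with $$\|u_n\|_{W_\varepsilon}\to+\infty,\qquad \frac12\|u_n\|_{W_\varepsilon}^2+\int_{\mathbb R^3}F(u_n)\to+\infty,\qquad \lambda_n=-\Big(\|u_n\|_{W_\varepsilon}^2+\int_{\mathbb R^3}f(u_n)u_n\Big)\to-\infty.$$ The ground state solutions can be assumed of one sign.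
   Context: $F(t)=\int_0^t f(s)\,ds$. For $\varepsilon>0$, $W_\varepsilon:=\{u\in H^1(\mathbb R^3):\int_{\mathbb R^3}V(\varepsilon x)u^2<\infty\}$ with norm $\|u\|_{W_\varepsilon}^2=\int|\nabla u|^2+\int V(\varepsilon x)u^2$. For $u\in H^1(\mathbb R^3)$, $\phi_u(x)=\int_{\mathbb R^3}\frac{1-e^{-|x-y|}}{|x-y|}u^2(y)\,dy$. A solution is a pair $(u,\lambda)\in W_\varepsilon\times\mathbb R$ with $\int\nabla u\nabla v+\int V(\varepsilon x)uv+\lambda\int\phi_u uv+\int f(u)v=0$ for all $v\in W_\varepsilon$. Solutions are sought as critical points of $I_\varepsilon(u)=\frac12\|u\|_{W_\varepsilon}^2+\int F(u)$ restricted to $\mathcal M_\varepsilon=\{u\in W_\varepsilon:\int\phi_uu^2=1\}$, with $\lambda$ the Lagrange multiplier; a ground state solution is a solution whose energy $I_\varepsilon(u)$ is minimal on $\mathcal M_\varepsilon$ among all solutions. *)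

theory Defs
  imports "HOL-Analysis.Analysis"
begin

type_synonym R3 = "real^3"

definition pdiff :: "3 \<Rightarrow> (R3 \<Rightarrow> real) \<Rightarrow> R3 \<Rightarrow> real" where
  "pdiff i g x = (SOME d. ((\<lambda>t. g (x + t *\<^sub>R axis i 1)) has_real_derivative d) (at 0))"

fun iter_pdiff :: "3 list \<Rightarrow> (R3 \<Rightarrow> real) \<Rightarrow> R3 \<Rightarrow> real" where
  "iter_pdiff [] g = g"
| "iter_pdiff (i # is) g = pdiff i (iter_pdiff is g)"

definition smooth3 :: "(R3 \<Rightarrow> real) \<Rightarrow> bool" where
  "smooth3 g \<longleftrightarrow> (\<forall>is. continuous_on UNIV (iter_pdiff is g) \<and>
      (\<forall>i x. ((\<lambda>t. iter_pdiff is g (x + t *\<^sub>R axis i 1)) has_real_derivative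
               pdiff i (iter_pdiff is g) x) (at 0)))"

definition test_fun :: "(R3 \<Rightarrow> real) \<Rightarrow> bool" where
  "test_fun \<phi> \<longleftrightarrow> smooth3 \<phi> \<and> compact (closure {x. \<phi> x \<noteq> 0})"

definition weak_grad :: "(R3 \<Rightarrow> real) \<Rightarrow> (R3 \<Rightarrow> R3) \<Rightarrow> bool" where
  "weak_grad u g \<longleftrightarrow> (\<forall>i \<phi>. test_fun \<phi> \<longrightarrow>
      (LINT x|lborel. u x * pdiff i \<phi> x) = - (LINT x|lborel. (g x $ i) * \<phi> x))"

definition L2_grad :: "(R3 \<Rightarrow> real) \<Rightarrow> (R3 \<Rightarrow> R3) \<Rightarrow> bool" where
  "L2_grad u g \<longleftrightarrow> g \<in> borel_measurable lborel \<and>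
      integrable lborel (\<lambda>x. (norm (g x))\<^sup>2) \<and> weak_grad u g"

definition H1 :: "(R3 \<Rightarrow> real) set" where
  "H1 = {u. u \<in> borel_measurable lborel \<and> integrable lborel (\<lambda>x. (u x)\<^sup>2) \<and> (\<exists>g. L2_grad u g)}"

text \<open>The (a.e. unique) weak gradient.\<close>
definition grad :: "(R3 \<Rightarrow> real) \<Rightarrow> R3 \<Rightarrow> R3" where
  "grad u = (SOME g. L2_grad u g)"

definition W_space :: "(R3 \<Rightarrow> real) \<Rightarrow> real \<Rightarrow> (R3 \<Rightarrow> real) set" where
  "W_space V \<epsilon> = {u \<in> H1. integrable lborel (\<lambda>x. V (\<epsilon> *\<^sub>R x) * (u x)\<^sup>2)}"

definition W_norm :: "(R3 \<Rightarrow> real) \<Rightarrow> real \<Rightarrow> (R3 \<Rightarrow> real) \<Rightarrow> real" where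
  "W_norm V \<epsilon> u = sqrt ((LINT x|lborel. (norm (grad u x))\<^sup>2)
                        + (LINT x|lborel. V (\<epsilon> *\<^sub>R x) * (u x)\<^sup>2))"

definition Fprim :: "(real \<Rightarrow> real) \<Rightarrow> real \<Rightarrow> real" where
  "Fprim f t = (LBINT s=0..t. f s)"

definition phi :: "(R3 \<Rightarrow> real) \<Rightarrow> R3 \<Rightarrow> real" where
  "phi u x = (LINT y|lborel. (1 - exp (- dist x y)) / dist x y * (u y)\<^sup>2)"

definition compact_embed :: "(R3 \<Rightarrow> real) \<Rightarrow> real \<Rightarrow> real \<Rightarrow> bool" where
  "compact_embed V \<epsilon> p \<longleftrightarrow>
     (\<forall>u \<in> W_space V \<epsilon>. integrable lborel (\<lambda>x. \<bar>u x\<bar> powr p)) \<and>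
     (\<forall>us :: nat \<Rightarrow> R3 \<Rightarrow> real. (\<forall>n. us n \<in> W_space V \<epsilon>) \<longrightarrow>
        (\<exists>C. \<forall>n. W_norm V \<epsilon> (us n) \<le> C) \<longrightarrow>
        (\<exists>r w. strict_mono r \<and> w \<in> borel_measurable lborel \<and>
               integrable lborel (\<lambda>x. \<bar>w x\<bar> powr p) \<and>
               (\<lambda>n. LINT x|lborel. \<bar>us (r n) x - w x\<bar> powr p) \<longlonglongrightarrow> 0))"

definition is_solution :: "(R3 \<Rightarrow> real) \<Rightarrow> (real \<Rightarrow> real) \<Rightarrow> real \<Rightarrow> (R3 \<Rightarrow> real) \<Rightarrow> real \<Rightarrow> bool" where
  "is_solution V f \<epsilon> u lam \<longleftrightarrow> u \<in> W_space V \<epsilon> \<and>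
     (\<forall>v \<in> W_space V \<epsilon>.
        (LINT x|lborel. grad u x \<bullet> grad v x) + (LINT x|lborel. V (\<epsilon> *\<^sub>R x) * u x * v x)
        + lam * (LINT x|lborel. phi u x * u x * v x) + (LINT x|lborel. f (u x) * v x) = 0)"

definition M_set :: "(R3 \<Rightarrow> real) \<Rightarrow> real \<Rightarrow> (R3 \<Rightarrow> real) set" where
  "M_set V \<epsilon> = {u \<in> W_space V \<epsilon>. (LINT x|lborel. phi u x * (u x)\<^sup>2) = 1}"

definition energy :: "(R3 \<Rightarrow> real) \<Rightarrow> (real \<Rightarrow> real) \<Rightarrow> real \<Rightarrow> (R3 \<Rightarrow> real) \<Rightarrow> real" where
  "energy V f \<epsilon> u = (W_norm V \<epsilon> u)\<^sup>2 / 2 + (LINT x|lborel. Fprim f (u x))"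

definition ground_state :: "(R3 \<Rightarrow> real) \<Rightarrow> (real \<Rightarrow> real) \<Rightarrow> real \<Rightarrow> (R3 \<Rightarrow> real) \<Rightarrow> real \<Rightarrow> bool" where
  "ground_state V f \<epsilon> u lam \<longleftrightarrow> is_solution V f \<epsilon> u lam \<and> u \<in> M_set V \<epsilon> \<and>
     (\<forall>w \<mu>. is_solution V f \<epsilon> w \<mu> \<and> w \<in> M_set V \<epsilon> \<longrightarrow> energy V f \<epsilon> u \<le> energy V f \<epsilon> w)"

end

theory Submission
  imports Defs "HOL-Library.Z2"
begin

text \<open>
  Put \<open>I(u) = \<parallel>u\<parallel>\<^sup>2/2 + \<integral>F(u)\<close> and let \<open>M\<close> be the constraint set. The derivatives of \<open>\<integral>F(u)\<close> and of
  \<open>\<integral>\<phi>\<^sub>u u\<^sup>2\<close> are compact, hence uniformly continuous on bounded sets, so a single explicit Euler step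
  along the tangential gradient, followed by radial normalisation, is a continuous odd self-map of \<open>M\<close>
  that lowers \<open>I\<close> by a fixed amount wherever the gradient is bounded away from zero. This replaces the
  deformation flow of a pseudo-gradient, although \<open>I\<close> is only of class \<open>C\<^sup>1\<close>. If there were no critical
  points with \<open>I \<ge> a\<close>, iterating the step would push an odd image of a \<open>k\<close>-dimensional sphere in \<open>M\<close> into
  \<open>{I \<le> a + 1}\<close>. But such a sublevel set is mapped by the compact derivative of \<open>\<integral>\<phi>\<^sub>u u\<^sup>2\<close> to a relatively
  compact set avoiding \<open>0\<close>, so finitely many odd continuous functions have no common zero on it, and the
  Borsuk-Ulam theorem gives a contradiction once \<open>k\<close> is large. The same step shows that minimisers exist
  and are critical; one of them is nonnegative because \<open>\<bar>u\<bar>\<close> has no more energy than \<open>u\<close>.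

  Borsuk-Ulam is proved modulo 2: for odd 0-cochains \<open>s\<^sub>1, \<dots>, s\<^sub>k\<close> the cup product of their coboundaries
  evaluates to \<open>1\<close> on every subdivided hemisphere, whereas taking \<open>s\<^sub>i\<close> to be the sign of the \<open>i\<close>-th of
  \<open>k\<close> odd functions without common zero makes it vanish on a fine subdivision.
\<close>

section \<open>The Borsuk-Ulam theorem\<close>

text \<open>The variational argument is run on a subset \<open>WW\<close> of a Hilbert space type: u
  is sent to the pair (sqrt(V(eps x)) u, grad u) in L^2, which turns the W-norm into a norm on
  classes of functions. The embedding hypothesis enters at two exponents, q for f and 4 for the
  potential term: both derivatives are uniformly continuous on balls for the L^q and L^4 distance,
  and this makes them compact. For the potential term the reason is that the kernel is bounded and
  decays at infinity. The energy dominates half the squared norm, so sublevel sets are bounded. The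
  constraint functional is homogeneous of degree 4 and positive off 0, so every nonzero u has a
  multiple in \<open>M\<close>, and <K u, u> = 1 on \<open>M\<close> keeps K u away from 0 on
  bounded parts of \<open>M\<close>. This inequality bounds the multipliers in the Palais-Smale
  argument and is also behind the finiteness of the genus. Simplices are plain lists with
  coefficients modulo 2: degenerate simplices do no harm, and chains are handled through the
  cochains evaluated on them.\<close>

declare add_bit_eq_xor [simp del] mult_bit_eq_and [simp del]

section \<open>Cochains modulo 2 on ordered simplices\<close>

lemma bit_add_self: "(x::bit) + x = 0"
  by (cases x) simp_all

lemma bit_add_eq_0_iff: "(x::bit) + y = 0 \<longleftrightarrow> x = y"
  by (cases x; cases y) (simp_all add: bit_add_self)

text \<open>A list of length d + 1 stands for an ordered, possibly degenerate d-simplex. The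
  recursion deletes each entry in turn, so this is the simplicial coboundary modulo 2; the empty
  list counts as the simplex of dimension -1.\<close>

fun coboundary :: "('a list \<Rightarrow> bit) \<Rightarrow> 'a list \<Rightarrow> bit" where
  "coboundary \<alpha> [] = 0"
| "coboundary \<alpha> (b # t) = \<alpha> t + coboundary (\<lambda>r. \<alpha> (b # r)) t"

lemma coboundary_add: "coboundary (\<lambda>t. \<alpha> t + \<beta> t) \<sigma> = coboundary \<alpha> \<sigma> + coboundary \<beta> \<sigma>"
  by (induction \<sigma> arbitrary: \<alpha> \<beta>) (simp_all add: algebra_simps)

lemma coboundary_eq_0:
  assumes "\<And>\<tau>. Suc (length \<tau>) = length \<sigma> \<Longrightarrow> set \<tau> \<subseteq> set \<sigma> \<Longrightarrow> \<alpha> \<tau> = 0"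
  shows "coboundary \<alpha> \<sigma> = 0"
  using assms
proof (induction \<sigma> arbitrary: \<alpha>)
  case (Cons b t)
  have "coboundary (\<lambda>r. \<alpha> (b # r)) t = 0"
    by (rule Cons.IH) (auto intro!: Cons.prems)
  moreover have "\<alpha> t = 0" by (rule Cons.prems) auto
  ultimately show ?case by simp
qed simp

lemma coboundary_cong:
  assumes "\<And>\<tau>. Suc (length \<tau>) = length \<sigma> \<Longrightarrow> \<alpha> \<tau> = \<beta> \<tau>"
  shows "coboundary \<alpha> \<sigma> = coboundary \<beta> \<sigma>"
proof -
  have "coboundary (\<lambda>t. \<alpha> t + \<beta> t) \<sigma> = 0"
    by (rule coboundary_eq_0) (simp add: assms bit_add_self)
  thus ?thesis by (simp add: coboundary_add bit_add_eq_0_iff)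
qed

text \<open>Once the head is split off, the two copies of \<open>coboundary \<alpha> t\<close>
  cancel modulo 2, and what remains is the induction hypothesis for the tail.\<close>

lemma coboundary_coboundary: "coboundary (coboundary \<alpha>) \<sigma> = 0"
proof (induction \<sigma> arbitrary: \<alpha>)
  case (Cons b t)
  have "coboundary (coboundary \<alpha>) (b # t)
      = coboundary \<alpha> t + (coboundary \<alpha> t + coboundary (coboundary (\<lambda>r. \<alpha> (b # r))) t)"
    by (simp add: coboundary_add)
  thus ?case by (simp add: Cons.IH bit_add_self)
qed simp

lemma coboundary_map: "coboundary (\<lambda>t. \<alpha> (map h t)) \<sigma> = coboundary \<alpha> (map h \<sigma>)"
proof (induction \<sigma> arbitrary: \<alpha>)
  case (Cons b t)
  show ?case using Cons.IH[of "\<lambda>r. \<alpha> (h b # r)"] by simp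
qed simp

section \<open>Barycentric subdivision and its mesh\<close>

definition barycenter :: "'a::real_vector list \<Rightarrow> 'a" where
  "barycenter \<sigma> = (1 / real (length \<sigma>)) *\<^sub>R sum_list \<sigma>"

lemma barycenter_uminus: "barycenter (map uminus \<sigma>) = - barycenter \<sigma>"
proof -
  have "sum_list (map uminus \<sigma>) = - sum_list \<sigma>" by (induction \<sigma>) auto
  thus ?thesis by (simp add: barycenter_def)
qed

text \<open>The transpose of barycentric subdivision, on cochains evaluated at lists of length \<open>n\<close>.\<close>
fun subdiv :: "nat \<Rightarrow> ('a::real_vector list \<Rightarrow> bit) \<Rightarrow> 'a list \<Rightarrow> bit" where
  "subdiv 0 \<alpha> \<sigma> = \<alpha> []"
| "subdiv (Suc n) \<alpha> \<sigma> = coboundary (subdiv n (\<lambda>t. \<alpha> (barycenter \<sigma> # t))) \<sigma>"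

lemma subdiv_add: "subdiv n (\<lambda>t. \<alpha> t + \<beta> t) \<sigma> = subdiv n \<alpha> \<sigma> + subdiv n \<beta> \<sigma>"
proof (induction n arbitrary: \<alpha> \<beta> \<sigma>)
  case (Suc n)
  have "subdiv n (\<lambda>t. \<alpha> (barycenter \<sigma> # t) + \<beta> (barycenter \<sigma> # t))
     = (\<lambda>\<tau>. subdiv n (\<lambda>t. \<alpha> (barycenter \<sigma> # t)) \<tau> + subdiv n (\<lambda>t. \<beta> (barycenter \<sigma> # t)) \<tau>)"
    by (rule ext) (rule Suc.IH)
  thus ?case by (simp add: coboundary_add)
qed simp

lemma subdiv_uminus: "subdiv n (\<lambda>t. \<alpha> (map uminus t)) \<sigma> = subdiv n \<alpha> (map uminus \<sigma>)"
proof (induction n arbitrary: \<alpha> \<sigma>)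
  case (Suc n)
  have "subdiv n (\<lambda>t. \<alpha> (map uminus (barycenter \<sigma> # t)))
     = (\<lambda>\<tau>. subdiv n (\<lambda>t. \<alpha> (- barycenter \<sigma> # t)) (map uminus \<tau>))"
    using Suc.IH[of "\<lambda>t. \<alpha> (- barycenter \<sigma> # t)"] by auto
  thus ?case by (simp add: coboundary_map barycenter_uminus)
qed simp

text \<open>Subdivision is a chain map: the subdivided simplex is the cone from the barycenter over
  the subdivided boundary. The boundary of a cone is its base plus the cone over the boundary of the
  base, and the second part vanishes because a boundary has no boundary.\<close>

lemma subdiv_coboundary:
  "length \<sigma> = Suc n \<Longrightarrow> subdiv (Suc n) (coboundary \<alpha>) \<sigma> = coboundary (subdiv n \<alpha>) \<sigma>"
proof (induction n arbitrary: \<alpha> \<sigma>)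
  case 0
  then obtain x where "\<sigma> = [x]" by (auto simp: length_Suc_conv)
  thus ?case by simp
next
  case (Suc n)
  let ?a = "\<lambda>t. \<alpha> (barycenter \<sigma> # t)"
  have "subdiv (Suc (Suc n)) (coboundary \<alpha>) \<sigma>
      = coboundary (subdiv (Suc n) (\<lambda>t. \<alpha> t + coboundary ?a t)) \<sigma>"
    by (simp only: subdiv.simps(2)[of "Suc n"] coboundary.simps)
  also have "\<dots> = coboundary (\<lambda>\<tau>. subdiv (Suc n) \<alpha> \<tau> + subdiv (Suc n) (coboundary ?a) \<tau>) \<sigma>"
    by (rule arg_cong[where f="\<lambda>F. coboundary F \<sigma>"], rule ext, rule subdiv_add)
  also have "\<dots> = coboundary (subdiv (Suc n) \<alpha>) \<sigma> + coboundary (subdiv (Suc n) (coboundary ?a)) \<sigma>"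
    by (rule coboundary_add)
  also have "coboundary (subdiv (Suc n) (coboundary ?a)) \<sigma> = coboundary (coboundary (subdiv n ?a)) \<sigma>"
    by (rule coboundary_cong, rule Suc.IH) (use Suc.prems in auto)
  finally show ?case by (simp only: coboundary_coboundary add_0_right)
qed

lemma barycenter_in_hull:
  assumes "\<sigma> \<noteq> []" shows "barycenter \<sigma> \<in> convex hull (set \<sigma>)"
proof -
  have "(\<Sum>i<length \<sigma>. (1 / real (length \<sigma>)) *\<^sub>R (\<sigma> ! i)) \<in> convex hull (set \<sigma>)"
    by (rule convex_sum) (use assms in \<open>auto intro: hull_inc\<close>)
  thus ?thesis
    by (simp add: barycenter_def sum_list_sum_nth atLeast0LessThan scaleR_sum_right)
qed

text \<open>The difference of the barycenter and a vertex v is the average of n differences, one of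
  which is v - v = 0; hence the factor (n - 1)/n. It is weakened to 1 - 1/N so that one factor
  serves faces of every dimension.\<close>

lemma dist_barycenter:
  fixes \<sigma> :: "'a::real_normed_vector list"
  assumes len: "length \<sigma> \<le> N" and ne: "\<sigma> \<noteq> []" and D: "\<And>x y. x \<in> set \<sigma> \<Longrightarrow> y \<in> set \<sigma> \<Longrightarrow> dist x y \<le> D"
    and y: "y \<in> convex hull (set \<sigma>)"
  shows "dist (barycenter \<sigma>) y \<le> (1 - 1 / real N) * D"
proof -
  let ?n = "length \<sigma>"
  have n: "0 < ?n" using ne by simp
  have D0: "0 \<le> D" using D[of "hd \<sigma>" "hd \<sigma>"] ne by auto
  have v: "dist (barycenter \<sigma>) v \<le> (1 - 1 / real N) * D" if v: "v \<in> set \<sigma>" for v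
  proof -
    obtain k where k: "k < ?n" "v = \<sigma> ! k" using v by (auto simp: in_set_conv_nth)
    have "barycenter \<sigma> - v = (1 / real ?n) *\<^sub>R (\<Sum>i<?n. \<sigma> ! i - v)"
      using n by (simp add: barycenter_def sum_list_sum_nth atLeast0LessThan sum_subtractf
          scaleR_diff_right scaleR_sum_right sum_constant_scaleR)
    hence "dist (barycenter \<sigma>) v = (1 / real ?n) * norm (\<Sum>i<?n. \<sigma> ! i - v)"
      by (simp add: dist_norm)
    also have "(\<Sum>i<?n. \<sigma> ! i - v) = (\<Sum>i\<in>{..<?n}-{k}. \<sigma> ! i - v)"
      using k by (subst sum.remove[of _ k]) auto
    also have "norm \<dots> \<le> (\<Sum>i\<in>{..<?n}-{k}. D)"
      by (rule sum_norm_le) (use D v in \<open>auto simp: dist_norm[symmetric]\<close>)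
    also have "\<dots> = (real ?n - 1) * D" using k n by (simp add: of_nat_diff)
    finally have "dist (barycenter \<sigma>) v \<le> (1 - 1 / real ?n) * D"
      using n by (simp add: field_simps)
    also have "1 / real N \<le> 1 / real ?n" using len n by (intro frac_le) auto
    hence "(1 - 1 / real ?n) * D \<le> (1 - 1 / real N) * D" using D0 by (intro mult_right_mono) auto
    finally show ?thesis .
  qed
  have "convex hull (set \<sigma>) \<subseteq> cball (barycenter \<sigma>) ((1 - 1 / real N) * D)"
    by (rule hull_minimal) (use v in auto)
  thus ?thesis using y by auto
qed

text \<open>This is all that is used about the simplices of a subdivision: they lie in the hull and
  their mesh has shrunk. Such a simplex is the barycenter followed by a simplex of a subdivided
  face; distances within the tail are covered by induction, those to the head by
  \<open>dist_barycenter\<close>.\<close>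

lemma subdiv_eq_0:
  fixes \<sigma> :: "'a::real_normed_vector list"
  assumes "length \<sigma> = n" "n \<le> N" "\<And>x y. x \<in> set \<sigma> \<Longrightarrow> y \<in> set \<sigma> \<Longrightarrow> dist x y \<le> D" "0 \<le> D"
    and "\<And>\<tau>. length \<tau> = n \<Longrightarrow> set \<tau> \<subseteq> convex hull (set \<sigma>) \<Longrightarrow>
           (\<And>x y. x \<in> set \<tau> \<Longrightarrow> y \<in> set \<tau> \<Longrightarrow> dist x y \<le> (1 - 1 / real N) * D) \<Longrightarrow> \<alpha> \<tau> = 0"
  shows "subdiv n \<alpha> \<sigma> = 0"
  using assms
proof (induction n arbitrary: \<sigma> \<alpha>)
  case 0 thus ?case by simp
next
  case (Suc n)
  let ?b = "barycenter \<sigma>"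
  have ne: "\<sigma> \<noteq> []" using Suc.prems(1) by auto
  have "coboundary (subdiv n (\<lambda>t. \<alpha> (?b # t))) \<sigma> = 0"
  proof (rule coboundary_eq_0)
    fix \<tau> assume t: "Suc (length \<tau>) = length \<sigma>" "set \<tau> \<subseteq> set \<sigma>"
    have hm: "convex hull (set \<tau>) \<subseteq> convex hull (set \<sigma>)" using t(2) by (rule hull_mono)
    show "subdiv n (\<lambda>t. \<alpha> (?b # t)) \<tau> = 0"
    proof (rule Suc.IH)
      fix \<rho> assume r: "length \<rho> = n" "set \<rho> \<subseteq> convex hull (set \<tau>)"
        "\<And>x y. x \<in> set \<rho> \<Longrightarrow> y \<in> set \<rho> \<Longrightarrow> dist x y \<le> (1 - 1 / real N) * D"
      have rs: "set \<rho> \<subseteq> convex hull (set \<sigma>)" using r(2) hm by blast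
      have db: "dist ?b y \<le> (1 - 1 / real N) * D" if "y \<in> convex hull (set \<sigma>)" for y
        by (rule dist_barycenter[OF _ ne Suc.prems(3) that]) (use Suc.prems(1,2) in auto)
      show "\<alpha> (?b # \<rho>) = 0"
      proof (rule Suc.prems(5))
        show "set (?b # \<rho>) \<subseteq> convex hull (set \<sigma>)" using rs barycenter_in_hull[OF ne] by auto
        fix x y assume "x \<in> set (?b # \<rho>)" "y \<in> set (?b # \<rho>)"
        thus "dist x y \<le> (1 - 1 / real N) * D"
          using db rs r(3) barycenter_in_hull[OF ne] by (auto simp: dist_commute)
      qed (use r in auto)
    qed (use Suc.prems t in auto)
  qed
  thus ?case by simp
qed

text \<open>Modulo 2, two cochains agree where their sum vanishes, so locality is an instance of
  \<open>subdiv_eq_0\<close>. The diameter merely provides some bound D.\<close>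

lemma subdiv_cong:
  fixes \<sigma> :: "'a::real_normed_vector list"
  assumes "length \<sigma> = n" "\<And>\<tau>. length \<tau> = n \<Longrightarrow> \<alpha> \<tau> = \<beta> \<tau>"
  shows "subdiv n \<alpha> \<sigma> = subdiv n \<beta> \<sigma>"
proof -
  have "subdiv n (\<lambda>t. \<alpha> t + \<beta> t) \<sigma> = 0"
  proof (rule subdiv_eq_0[OF assms(1) order_refl])
    show "dist x y \<le> diameter (set \<sigma>)" if "x \<in> set \<sigma>" "y \<in> set \<sigma>" for x y
      by (rule diameter_bounded_bound) (use that in \<open>auto simp: finite_imp_bounded\<close>)
    show "0 \<le> diameter (set \<sigma>)" by (rule diameter_ge_0) (simp add: finite_imp_bounded)
  qed (simp add: assms(2) bit_add_self)
  thus ?thesis by (simp add: subdiv_add bit_add_eq_0_iff)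
qed

definition itsubdiv :: "nat \<Rightarrow> nat \<Rightarrow> ('a::real_vector list \<Rightarrow> bit) \<Rightarrow> 'a list \<Rightarrow> bit" where
  "itsubdiv n m = (subdiv n ^^ m)"

lemma itsubdiv_add: "itsubdiv n m (\<lambda>t. \<alpha> t + \<beta> t) \<sigma> = itsubdiv n m \<alpha> \<sigma> + itsubdiv n m \<beta> \<sigma>"
proof (induction m arbitrary: \<sigma>)
  case (Suc m)
  have "itsubdiv n m (\<lambda>t. \<alpha> t + \<beta> t) = (\<lambda>\<sigma>. itsubdiv n m \<alpha> \<sigma> + itsubdiv n m \<beta> \<sigma>)"
    by (rule ext) (rule Suc.IH)
  thus ?case by (simp add: itsubdiv_def subdiv_add)
qed (simp add: itsubdiv_def)

lemma itsubdiv_uminus: "itsubdiv n m (\<lambda>t. \<alpha> (map uminus t)) \<sigma> = itsubdiv n m \<alpha> (map uminus \<sigma>)"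
proof (induction m arbitrary: \<sigma>)
  case (Suc m)
  have "itsubdiv n m (\<lambda>t. \<alpha> (map uminus t)) = (\<lambda>\<sigma>. itsubdiv n m \<alpha> (map uminus \<sigma>))"
    by (rule ext) (rule Suc.IH)
  thus ?case by (simp add: itsubdiv_def subdiv_uminus)
qed (simp add: itsubdiv_def)

lemma itsubdiv_coboundary:
  fixes \<sigma> :: "'a::real_normed_vector list"
  shows "length \<sigma> = Suc n \<Longrightarrow> itsubdiv (Suc n) m (coboundary \<alpha>) \<sigma> = coboundary (itsubdiv n m \<alpha>) \<sigma>"
proof (induction m arbitrary: \<sigma>)
  case (Suc m)
  have "itsubdiv (Suc n) (Suc m) (coboundary \<alpha>) \<sigma> = subdiv (Suc n) (itsubdiv (Suc n) m (coboundary \<alpha>)) \<sigma>"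
    by (simp add: itsubdiv_def)
  also have "\<dots> = subdiv (Suc n) (coboundary (itsubdiv n m \<alpha>)) \<sigma>"
    by (rule subdiv_cong[OF Suc.prems Suc.IH])
  also have "\<dots> = coboundary (subdiv n (itsubdiv n m \<alpha>)) \<sigma>" by (rule subdiv_coboundary[OF Suc.prems])
  finally show ?case by (simp add: itsubdiv_def)
qed (simp add: itsubdiv_def)

lemma itsubdiv_eq_0:
  fixes \<sigma> :: "'a::real_normed_vector list"
  assumes "length \<sigma> = n" "n \<le> N" "0 < N" "\<And>x y. x \<in> set \<sigma> \<Longrightarrow> y \<in> set \<sigma> \<Longrightarrow> dist x y \<le> D" "0 \<le> D"
    and "\<And>\<tau>. length \<tau> = n \<Longrightarrow> set \<tau> \<subseteq> convex hull (set \<sigma>) \<Longrightarrow>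
           (\<And>x y. x \<in> set \<tau> \<Longrightarrow> y \<in> set \<tau> \<Longrightarrow> dist x y \<le> (1 - 1 / real N) ^ m * D) \<Longrightarrow> \<alpha> \<tau> = 0"
  shows "itsubdiv n m \<alpha> \<sigma> = 0"
  using assms
proof (induction m arbitrary: \<sigma> D)
  case 0
  have "\<alpha> \<sigma> = 0" by (rule 0) (use 0 in \<open>auto intro: hull_inc\<close>)
  thus ?case by (simp add: itsubdiv_def)
next
  case (Suc m)
  have "subdiv n (itsubdiv n m \<alpha>) \<sigma> = 0"
  proof (rule subdiv_eq_0[OF Suc.prems(1,2,4,5)], assumption, assumption)
    fix \<tau> assume t: "length \<tau> = n" "set \<tau> \<subseteq> convex hull (set \<sigma>)"
       "\<And>x y. x \<in> set \<tau> \<Longrightarrow> y \<in> set \<tau> \<Longrightarrow> dist x y \<le> (1 - 1 / real N) * D"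
    show "itsubdiv n m \<alpha> \<tau> = 0"
    proof (rule Suc.IH[OF t(1) Suc.prems(2,3)])
      show "0 \<le> (1 - 1 / real N) * D" using Suc.prems(3,5) by auto
      fix \<rho> assume r: "length \<rho> = n" "set \<rho> \<subseteq> convex hull (set \<tau>)"
         "\<And>x y. x \<in> set \<rho> \<Longrightarrow> y \<in> set \<rho> \<Longrightarrow> dist x y \<le> (1 - 1 / real N) ^ m * ((1 - 1 / real N) * D)"
      have "convex hull (set \<tau>) \<subseteq> convex hull (set \<sigma>)"
        by (rule hull_minimal) (use t in auto)
      thus "\<alpha> \<rho> = 0"
        by (intro Suc.prems(6)) (use r in \<open>auto simp: algebra_simps\<close>)
    qed (use t in auto)
  qed
  thus ?case by (simp add: itsubdiv_def)
qed

text \<open>The hemisphere chains of the cross polytope spanned by \<open>\<plusminus>e\<^sub>0, \<dots>, \<plusminus>e\<^sub>d\<close>, as functionals on cochains.\<close>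
fun hemi :: "(nat \<Rightarrow> 'a::real_vector) \<Rightarrow> nat \<Rightarrow> ('a list \<Rightarrow> bit) \<Rightarrow> bit" where
  "hemi e 0 \<alpha> = \<alpha> [e 0]"
| "hemi e (Suc d) \<alpha> = hemi e d (\<lambda>t. \<alpha> (e (Suc d) # t)) + hemi e d (\<lambda>t. \<alpha> (e (Suc d) # map uminus t))"

lemma hemi_add: "hemi e d (\<lambda>t. \<alpha> t + \<beta> t) = hemi e d \<alpha> + hemi e d \<beta>"
proof (induction d arbitrary: \<alpha> \<beta>)
  case (Suc d)
  show ?case by (simp add: Suc.IH algebra_simps)
qed simp

lemma map_uminus_uminus [simp]: "map uminus (map uminus (t::'a::group_add list)) = t"
  by (induction t) auto

text \<open>\<open>hemi e (Suc d)\<close> is the cone with apex \<open>e (Suc d)\<close> over the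
  d-sphere made of a hemisphere and its antipode. Its boundary is this sphere plus the cone over the
  boundary of the sphere, so \<open>step\<close> only needs that the d-sphere is a cycle. This
  follows by induction from \<open>step\<close> one dimension lower, since the two antipodal
  hemispheres have the same boundary.\<close>

lemma hemi_coboundary:
  "hemi e (Suc d) (coboundary \<alpha>) = hemi e d \<alpha> + hemi e d (\<lambda>t. \<alpha> (map uminus t))"
proof -
  have step: "hemi e (Suc d) (coboundary \<beta>) = hemi e d \<beta> + hemi e d (\<lambda>t. \<beta> (map uminus t))"
    if P: "\<And>\<gamma>. hemi e d (coboundary \<gamma>) + hemi e d (\<lambda>t. coboundary \<gamma> (map uminus t)) = 0" for d \<beta>
  proof -
    let ?g = "\<lambda>t. \<beta> (e (Suc d) # t)"
    have "hemi e (Suc d) (coboundary \<beta>)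
        = (hemi e d \<beta> + hemi e d (\<lambda>t. \<beta> (map uminus t)))
          + (hemi e d (coboundary ?g) + hemi e d (\<lambda>t. coboundary ?g (map uminus t)))"
      by (simp add: hemi_add algebra_simps)
    thus ?thesis by (simp only: P add_0_right)
  qed
  have "hemi e d (coboundary \<gamma>) + hemi e d (\<lambda>t. coboundary \<gamma> (map uminus t)) = 0" for \<gamma>
  proof (induction d arbitrary: \<gamma>)
    case 0
    show ?case by (simp add: bit_add_self)
  next
    case (Suc d)
    have "hemi e (Suc d) (\<lambda>t. coboundary \<gamma> (map uminus t)) = hemi e (Suc d) (coboundary (\<lambda>t. \<gamma> (map uminus t)))"
      by (simp add: coboundary_map[symmetric])
    thus ?case by (simp only: step[OF Suc.IH] map_uminus_uminus) (simp add: algebra_simps bit_add_self)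
  qed
  thus ?thesis by (rule step)
qed

text \<open>No simplex of the hemisphere contains both \<open>e i\<close> and its negative among the
  chosen vertices: one sign function \<open>s\<close> serves all entries, which places the simplex
  in a single face of the cross polytope.\<close>

lemma hemi_eq_0:
  assumes "\<And>\<tau> s. length \<tau> = Suc d \<Longrightarrow> (\<forall>i. s i = 1 \<or> s i = -1) \<Longrightarrow>
              set \<tau> \<subseteq> (\<lambda>i. s i *\<^sub>R e i) ` {..d} \<Longrightarrow> \<alpha> \<tau> = 0"
  shows "hemi e d \<alpha> = 0"
  using assms
proof (induction d arbitrary: \<alpha>)
  case 0
  have "\<alpha> [e 0] = 0" by (rule 0[of _ "\<lambda>_. 1"]) auto
  thus ?case by simp
next
  case (Suc d)
  have 1: "hemi e d (\<lambda>t. \<alpha> (e (Suc d) # t)) = 0"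
  proof (rule Suc.IH)
    fix \<tau> and s :: "nat \<Rightarrow> real"
    assume t: "length \<tau> = Suc d" "\<forall>i. s i = 1 \<or> s i = -1" "set \<tau> \<subseteq> (\<lambda>i. s i *\<^sub>R e i) ` {..d}"
    show "\<alpha> (e (Suc d) # \<tau>) = 0"
    proof (rule Suc.prems[of _ "s(Suc d := 1)"])
      have "x \<in> (\<lambda>i. (s(Suc d := 1)) i *\<^sub>R e i) ` {..Suc d}" if x: "x \<in> set \<tau>" for x
      proof -
        obtain i where "i \<le> d" "x = s i *\<^sub>R e i" using t(3) x by auto
        thus ?thesis by (intro image_eqI[of _ _ i]) auto
      qed
      moreover have "e (Suc d) \<in> (\<lambda>i. (s(Suc d := 1)) i *\<^sub>R e i) ` {..Suc d}"
        by (intro image_eqI[of _ _ "Suc d"]) auto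
      ultimately show "set (e (Suc d) # \<tau>) \<subseteq> (\<lambda>i. (s(Suc d := 1)) i *\<^sub>R e i) ` {..Suc d}"
        by auto
    qed (use t in auto)
  qed
  have 2: "hemi e d (\<lambda>t. \<alpha> (e (Suc d) # map uminus t)) = 0"
  proof (rule Suc.IH)
    fix \<tau> and s :: "nat \<Rightarrow> real"
    assume t: "length \<tau> = Suc d" "\<forall>i. s i = 1 \<or> s i = -1" "set \<tau> \<subseteq> (\<lambda>i. s i *\<^sub>R e i) ` {..d}"
    show "\<alpha> (e (Suc d) # map uminus \<tau>) = 0"
    \<comment> \<open>The tail is negated but the apex is not, so all signs flip except the one at
      the new index.\<close>
    proof (rule Suc.prems[of _ "(\<lambda>i. - s i)(Suc d := 1)"])
      have "- x \<in> (\<lambda>i. ((\<lambda>i. - s i)(Suc d := 1)) i *\<^sub>R e i) ` {..Suc d}" if x: "x \<in> set \<tau>" for x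
      proof -
        obtain i where "i \<le> d" "x = s i *\<^sub>R e i" using t(3) x by auto
        thus ?thesis by (intro image_eqI[of _ _ i]) auto
      qed
      moreover have "e (Suc d) \<in> (\<lambda>i. ((\<lambda>i. - s i)(Suc d := 1)) i *\<^sub>R e i) ` {..Suc d}"
        by (intro image_eqI[of _ _ "Suc d"]) auto
      ultimately show "set (e (Suc d) # map uminus \<tau>) \<subseteq> (\<lambda>i. ((\<lambda>i. - s i)(Suc d := 1)) i *\<^sub>R e i) ` {..Suc d}"
        by auto
    qed (use t in auto)
  qed
  show ?case using 1 2 by simp
qed

text \<open>The cup product of the 1-cochains \<open>(p, q) \<mapsto> s p + s q\<close>.\<close>
fun cupw :: "('a \<Rightarrow> bit) list \<Rightarrow> 'a list \<Rightarrow> bit" where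
  "cupw (s # ss) (p # q # t) = (s p + s q) * cupw ss (q # t)"
| "cupw (s # ss) t = 0"
| "cupw [] t = 1"

definition cupa :: "('a \<Rightarrow> bit) \<Rightarrow> ('a \<Rightarrow> bit) list \<Rightarrow> 'a list \<Rightarrow> bit" where
  "cupa s ss t = s (hd t) * cupw ss t"

lemma coboundary_const_mult: "coboundary (\<lambda>t. c * \<alpha> t) \<sigma> = c * coboundary \<alpha> \<sigma>"
  by (induction \<sigma> arbitrary: \<alpha>) (simp_all add: algebra_simps)

text \<open>The Leibniz rule, proved together with the cocycle property by induction on the number
  of factors: \<open>imp\<close> derives the formula from the fact that \<open>cupw ss\<close> is a
  cocycle, and the formula exhibits \<open>cupw (s # ss)\<close> as a coboundary, hence as a
  cocycle.\<close>

lemma coboundary_cupa: "length \<sigma> = length ss + 2 \<Longrightarrow> coboundary (cupa s ss) \<sigma> = cupw (s # ss) \<sigma>"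
proof -
  have imp: "coboundary (cupa s ss) \<sigma> = cupw (s # ss) \<sigma>"
    if w: "\<And>\<sigma>. length \<sigma> = length ss + 2 \<Longrightarrow> coboundary (cupw ss) \<sigma> = 0" and len: "length \<sigma> = length ss + 2"
    for s and ss :: "('a \<Rightarrow> bit) list" and \<sigma>
  proof -
    obtain p q t where \<sigma>: "\<sigma> = p # q # t"
      using len by (cases \<sigma>; cases "tl \<sigma>") auto
    have "coboundary (cupw ss) (p # q # t) = 0" using w len \<sigma> by blast
    hence eq: "coboundary (\<lambda>r. cupw ss (p # r)) (q # t) = cupw ss (q # t)"
      using bit_add_eq_0_iff[of "cupw ss (q # t)"] by auto
    have "coboundary (cupa s ss) (p # q # t)
       = cupa s ss (q # t) + coboundary (\<lambda>r. s p * cupw ss (p # r)) (q # t)"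
      by (simp add: cupa_def)
    also have "\<dots> = s q * cupw ss (q # t) + s p * cupw ss (q # t)"
      by (simp only: coboundary_const_mult eq) (simp add: cupa_def)
    finally show ?thesis by (simp add: \<sigma> algebra_simps)
  qed
  have w: "\<forall>\<sigma>. length \<sigma> = length ss + 2 \<longrightarrow> coboundary (cupw ss) \<sigma> = 0" for ss :: "('a \<Rightarrow> bit) list"
  proof (induction ss)
    case Nil
    show ?case
    proof (intro allI impI)
      fix \<sigma> :: "'a list" assume "length \<sigma> = length ([] :: ('a \<Rightarrow> bit) list) + 2"
      then obtain p q where "\<sigma> = [p, q]" by (cases \<sigma>; cases "tl \<sigma>") auto
      thus "coboundary (cupw []) \<sigma> = 0" by (simp add: bit_add_self)
    qed
  next
    case (Cons s ss)
    show ?case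
    proof (intro allI impI)
      fix \<sigma> :: "'a list" assume len: "length \<sigma> = length (s # ss) + 2"
      have "coboundary (cupw (s # ss)) \<sigma> = coboundary (coboundary (cupa s ss)) \<sigma>"
        by (rule coboundary_cong) (use imp[of ss _ s] Cons.IH len in auto)
      thus "coboundary (cupw (s # ss)) \<sigma> = 0" by (simp add: coboundary_coboundary)
    qed
  qed
  show "length \<sigma> = length ss + 2 \<Longrightarrow> coboundary (cupa s ss) \<sigma> = cupw (s # ss) \<sigma>"
    using imp w by blast
qed

text \<open>Each factor s p + s q is unchanged when both values flip.\<close>

lemma cupw_uminus:
  assumes "\<And>s p. s \<in> set ss \<Longrightarrow> p \<in> set \<tau> \<Longrightarrow> s (- p) = s p + 1"
  shows "cupw ss (map uminus \<tau>) = cupw ss \<tau>"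
  using assms
proof (induction ss \<tau> rule: cupw.induct)
  case (1 s ss p q t)
  have "s (- p) + s (- q) = s p + s q"
    using "1.prems"[of s p] "1.prems"[of s q] by (simp add: algebra_simps)
  moreover have "cupw ss (map uminus (q # t)) = cupw ss (q # t)"
    by (rule "1.IH") (use "1.prems" in auto)
  ultimately show ?case by simp
qed auto


text \<open>The factor belonging to \<open>s\<close> is the sum of its values at two consecutive
  vertices, hence 0. The length of the simplex ensures that this factor is reached.\<close>

lemma cupw_eq_0:
  assumes "s \<in> set ss" "length \<tau> = Suc (length ss)" "\<And>p q. p \<in> set \<tau> \<Longrightarrow> q \<in> set \<tau> \<Longrightarrow> s p = s q"
  shows "cupw ss \<tau> = 0"
  using assms
proof (induction ss \<tau> rule: cupw.induct)
  case (1 s' ss p q t)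
  show ?case
  proof (cases "s = s'")
    case True
    hence "s' p = s' q" using "1.prems"(3)[of p q] by simp
    thus ?thesis by (simp add: bit_add_self)
  next
    case False
    have "cupw ss (q # t) = 0"
      by (rule "1.IH") (use "1.prems" False in auto)
    thus ?thesis by simp
  qed
qed auto

lemma hemi_itsubdiv_eq_0:
  fixes e :: "nat \<Rightarrow> 'a::real_normed_vector"
  assumes "\<And>\<tau> s. length \<tau> = Suc d \<Longrightarrow> (\<forall>i. s i = 1 \<or> s i = -1) \<Longrightarrow>
              set \<tau> \<subseteq> convex hull ((\<lambda>i. s i *\<^sub>R e i) ` {..d}) \<Longrightarrow>
              (\<And>x y. x \<in> set \<tau> \<Longrightarrow> y \<in> set \<tau> \<Longrightarrow>
                 dist x y \<le> (1 - 1 / real (Suc d)) ^ m * (2 * (\<Sum>i\<le>d. norm (e i)))) \<Longrightarrow> \<alpha> \<tau> = 0"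
  shows "hemi e d (itsubdiv (Suc d) m \<alpha>) = 0"
proof (rule hemi_eq_0)
  fix \<tau> and s :: "nat \<Rightarrow> real"
  assume t: "length \<tau> = Suc d" "\<forall>i. s i = 1 \<or> s i = -1" "set \<tau> \<subseteq> (\<lambda>i. s i *\<^sub>R e i) ` {..d}"
  have nrm: "norm x \<le> (\<Sum>i\<le>d. norm (e i))" if x: "x \<in> set \<tau>" for x
  proof -
    obtain i where i: "i \<le> d" "x = s i *\<^sub>R e i" using t(3) x by auto
    have "norm x = norm (e i)" using i(2) t(2)[rule_format, of i] by auto
    also have "\<dots> \<le> (\<Sum>i\<le>d. norm (e i))" by (rule member_le_sum) (use i in auto)
    finally show ?thesis .
  qed
  show "itsubdiv (Suc d) m \<alpha> \<tau> = 0"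
  proof (rule itsubdiv_eq_0[OF t(1), of "Suc d" "2 * (\<Sum>i\<le>d. norm (e i))"])
    fix x y assume "x \<in> set \<tau>" "y \<in> set \<tau>"
    thus "dist x y \<le> 2 * (\<Sum>i\<le>d. norm (e i))"
      using nrm[of x] nrm[of y] norm_triangle_ineq4[of x y] by (simp add: dist_norm)
  next
    fix \<rho> assume r: "length \<rho> = Suc d" "set \<rho> \<subseteq> convex hull (set \<tau>)"
       "\<And>x y. x \<in> set \<rho> \<Longrightarrow> y \<in> set \<rho> \<Longrightarrow> dist x y \<le> (1 - 1 / real (Suc d)) ^ m * (2 * (\<Sum>i\<le>d. norm (e i)))"
    show "\<alpha> \<rho> = 0"
      by (rule assms[OF r(1) t(2) _ r(3)]) (use r(2) hull_mono[OF t(3)] in auto)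
  qed (auto intro!: sum_nonneg)
qed

lemma hemi_itsubdiv_cong:
  fixes e :: "nat \<Rightarrow> 'a::real_normed_vector"
  assumes "\<And>\<tau> s. length \<tau> = Suc d \<Longrightarrow> (\<forall>i. s i = 1 \<or> s i = -1) \<Longrightarrow>
              set \<tau> \<subseteq> convex hull ((\<lambda>i. s i *\<^sub>R e i) ` {..d}) \<Longrightarrow> \<alpha> \<tau> = \<beta> \<tau>"
  shows "hemi e d (itsubdiv (Suc d) m \<alpha>) = hemi e d (itsubdiv (Suc d) m \<beta>)"
proof -
  have "hemi e d (itsubdiv (Suc d) m (\<lambda>t. \<alpha> t + \<beta> t)) = 0"
    by (rule hemi_itsubdiv_eq_0) (simp add: assms bit_add_self)
  moreover have "itsubdiv (Suc d) m (\<lambda>t. \<alpha> t + \<beta> t) = (\<lambda>\<sigma>. itsubdiv (Suc d) m \<alpha> \<sigma> + itsubdiv (Suc d) m \<beta> \<sigma>)"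
    by (rule ext) (rule itsubdiv_add)
  ultimately show ?thesis by (simp add: hemi_add bit_add_eq_0_iff)
qed

text \<open>A point is its own barycenter, so subdivision fixes 0-simplices. This is the base case
  for the evaluation on hemispheres.\<close>

lemma itsubdiv_1: "itsubdiv (Suc 0) m \<alpha> [x] = \<alpha> [x]"
proof (induction m)
  case (Suc m)
  have "itsubdiv (Suc 0) (Suc m) \<alpha> [x] = itsubdiv (Suc 0) m \<alpha> [x]"
    by (simp add: itsubdiv_def barycenter_def)
  thus ?case using Suc by simp
qed (simp add: itsubdiv_def)

text \<open>The cup product \<open>(s \<union> \<delta>s\<^sub>1 \<union> \<dots>)\<close> is a primitive of \<open>\<delta>s \<union> \<delta>s\<^sub>1 \<union> \<dots>\<close>, and the boundary
  of a hemisphere is the sum of two antipodal hemispheres of one dimension less; so evaluation on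
  hemispheres does not depend on the dimension.\<close>
lemma hemi_cupw:
  fixes e :: "nat \<Rightarrow> 'a::real_normed_vector"
  assumes "\<And>s p. s \<in> set ss \<Longrightarrow> p \<in> P \<Longrightarrow> s (- p) = s p + 1"
    and "\<And>s. (\<forall>i. s i = 1 \<or> s i = -1) \<Longrightarrow> convex hull ((\<lambda>i. s i *\<^sub>R e i) ` {..length ss}) \<subseteq> P"
  shows "hemi e (length ss) (itsubdiv (Suc (length ss)) m (cupw ss)) = 1"
  using assms
proof (induction ss)
  case Nil
  show ?case by (simp add: itsubdiv_1)
next
  case (Cons s ss)
  let ?d = "length ss"
  have sub: "convex hull ((\<lambda>i. r i *\<^sub>R e i) ` {..?d}) \<subseteq> P" if "\<forall>i. r i = 1 \<or> r i = -1" for r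
    using Cons.prems(2)[OF that] hull_mono[of "(\<lambda>i. r i *\<^sub>R e i) ` {..?d}" "(\<lambda>i. r i *\<^sub>R e i) ` {..length (s # ss)}"]
    by fastforce
  have IH: "hemi e ?d (itsubdiv (Suc ?d) m (cupw ss)) = 1"
    by (rule Cons.IH) (use Cons.prems(1) sub in auto)
  have "hemi e (Suc ?d) (itsubdiv (Suc (Suc ?d)) m (cupw (s # ss)))
      = hemi e (Suc ?d) (itsubdiv (Suc (Suc ?d)) m (coboundary (cupa s ss)))"
    by (rule hemi_itsubdiv_cong) (simp add: coboundary_cupa)
  also have "\<dots> = hemi e (Suc ?d) (coboundary (itsubdiv (Suc ?d) m (cupa s ss)))"
  proof -
    have "hemi e (Suc ?d) (\<lambda>\<sigma>. itsubdiv (Suc (Suc ?d)) m (coboundary (cupa s ss)) \<sigma>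
            + coboundary (itsubdiv (Suc ?d) m (cupa s ss)) \<sigma>) = 0"
      by (rule hemi_eq_0) (simp add: itsubdiv_coboundary bit_add_self)
    thus ?thesis by (simp only: hemi_add bit_add_eq_0_iff)
  qed
  also have "\<dots> = hemi e ?d (itsubdiv (Suc ?d) m (cupa s ss))
       + hemi e ?d (\<lambda>t. itsubdiv (Suc ?d) m (cupa s ss) (map uminus t))"
    by (rule hemi_coboundary)
  also have "\<dots> = hemi e ?d (itsubdiv (Suc ?d) m (\<lambda>t. cupa s ss t + cupa s ss (map uminus t)))"
    by (simp add: itsubdiv_uminus[symmetric] hemi_add[symmetric] itsubdiv_add[symmetric])
  \<comment> \<open>Oddness gives s p + s (- p) = 1, while the product of the other factors is even;
    adding the antipodal value therefore strips off the factor \<open>s\<close>.\<close>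
  also have "\<dots> = hemi e ?d (itsubdiv (Suc ?d) m (cupw ss))"
  proof (rule hemi_itsubdiv_cong)
    fix \<tau> and s' :: "nat \<Rightarrow> real"
    assume t: "length \<tau> = Suc ?d" "\<forall>i. s' i = 1 \<or> s' i = -1"
      "set \<tau> \<subseteq> convex hull ((\<lambda>i. s' i *\<^sub>R e i) ` {..?d})"
    have P: "set \<tau> \<subseteq> P" using t(3) sub[OF t(2)] by blast
    have hd: "hd (map uminus \<tau>) = - hd \<tau>" "hd \<tau> \<in> P" using t(1) P by (cases \<tau>; auto)+
    have "cupw ss (map uminus \<tau>) = cupw ss \<tau>"
      by (rule cupw_uminus) (use Cons.prems(1) P in auto)
    moreover have "s (- hd \<tau>) = s (hd \<tau>) + 1" using Cons.prems(1) hd by auto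
    ultimately show "cupa s ss \<tau> + cupa s ss (map uminus \<tau>) = cupw ss \<tau>"
      using hd by (cases "s (hd \<tau>)") (simp_all add: cupa_def algebra_simps bit_add_self)
  qed
  finally show ?case using IH by simp
qed


section \<open>The cross polytope as a sphere, and the Borsuk-Ulam theorem\<close>

definition cross_polytope :: "(nat \<Rightarrow> 'a::real_vector) \<Rightarrow> nat \<Rightarrow> 'a set" where
  "cross_polytope e n = (\<Union>s\<in>{s :: nat \<Rightarrow> real. \<forall>i. s i = 1 \<or> s i = -1}. convex hull ((\<lambda>i. s i *\<^sub>R e i) ` {..n}))"

lemma cross_polytope_mono: "k \<le> n \<Longrightarrow> cross_polytope e k \<subseteq> cross_polytope e n"
  unfolding cross_polytope_def by (intro UN_mono hull_mono image_mono) auto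

text \<open>There are infinitely many sign functions, but only their values up to n matter, so the
  union is one of finitely many hulls.\<close>

lemma compact_cross_polytope:
  fixes e :: "nat \<Rightarrow> 'a::real_normed_vector"
  shows "compact (cross_polytope e n)"
proof -
  let ?S = "{s :: nat \<Rightarrow> real. \<forall>i. s i = 1 \<or> s i = -1}"
  let ?F = "\<lambda>s :: nat \<Rightarrow> real. (\<lambda>i. s i *\<^sub>R e i) ` {..n}"
  have finF: "finite (?F ` ?S)"
  proof (rule finite_subset)
    show "?F ` ?S \<subseteq> Pow (e ` {..n} \<union> (\<lambda>i. - e i) ` {..n})"
    proof safe
      fix s :: "nat \<Rightarrow> real" and j assume s: "\<forall>i. s i = 1 \<or> s i = -1" "j \<le> n" "s j *\<^sub>R e j \<notin> (\<lambda>i. - e i) ` {..n}"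
      hence "s j = 1" using s(1)[rule_format, of j] by force
      thus "s j *\<^sub>R e j \<in> e ` {..n}" using s(2) by simp
    qed
  qed auto
  have "compact (\<Union> ((\<lambda>B. convex hull B) ` (?F ` ?S)))"
    using finF by (intro compact_Union) (auto intro!: finite_imp_compact_convex_hull)
  thus ?thesis by (simp add: cross_polytope_def image_image)
qed

text \<open>If a convex combination of vectors \<plusminus>e i is zero, independence makes all its
  weights vanish, although they sum to 1.\<close>

lemma cross_polytope_subset_span:
  assumes indep: "\<And>c. (\<Sum>i\<le>n. c i *\<^sub>R e i) = 0 \<Longrightarrow> \<forall>i\<le>n. c i = 0"
  shows "cross_polytope e n \<subseteq> span (e ` {..n}) - {0}"
proof -
  have "convex hull ((\<lambda>i. s i *\<^sub>R e i) ` {..n}) \<subseteq> span (e ` {..n}) - {0}" (is "convex hull ?F \<subseteq> ?Y")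
    if s: "\<forall>i. s i = 1 \<or> s i = -1" for s :: "nat \<Rightarrow> real"
  proof -
    let ?C = "{(\<Sum>i\<le>n. (u i * s i) *\<^sub>R e i) | u. (\<forall>i\<le>n. 0 \<le> u i) \<and> sum u {..n} = 1}"
    have "convex ?C"
    proof (rule convexI)
      fix x y and a b :: real assume "x \<in> ?C" "y \<in> ?C" and ab: "0 \<le> a" "0 \<le> b" "a + b = 1"
      then obtain u w where u: "x = (\<Sum>i\<le>n. (u i * s i) *\<^sub>R e i)" "\<forall>i\<le>n. 0 \<le> u i" "sum u {..n} = 1"
         and w: "y = (\<Sum>i\<le>n. (w i * s i) *\<^sub>R e i)" "\<forall>i\<le>n. 0 \<le> w i" "sum w {..n} = 1" by auto
      have "a *\<^sub>R x + b *\<^sub>R y = (\<Sum>i\<le>n. ((a * u i + b * w i) * s i) *\<^sub>R e i)"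
        by (simp add: u w scaleR_sum_right sum.distrib algebra_simps)
      moreover have "(\<Sum>i\<le>n. a * u i + b * w i) = 1"
        using u(3) w(3) ab by (simp add: sum.distrib sum_distrib_left[symmetric])
      ultimately show "a *\<^sub>R x + b *\<^sub>R y \<in> ?C"
        using u(2) w(2) ab by (intro CollectI exI[of _ "\<lambda>i. a * u i + b * w i"]) auto
    qed
    moreover have "?F \<subseteq> ?C"
    proof
      fix x assume "x \<in> ?F"
      then obtain j where j: "j \<le> n" "x = s j *\<^sub>R e j" by auto
      have "x = (\<Sum>i\<le>n. ((if i = j then 1 else 0) * s i) *\<^sub>R e i)"
        using j by (simp add: if_distrib[of "\<lambda>x. x * _"] if_distrib[of "\<lambda>x. x *\<^sub>R _"] cong: if_cong)
      thus "x \<in> ?C" using j by (intro CollectI exI[of _ "\<lambda>i. if i = j then 1 else 0"]) auto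
    qed
    ultimately have "convex hull (?F) \<subseteq> ?C" by (rule hull_minimal[rotated])
    moreover have "?C \<subseteq> ?Y"
    proof
      fix x assume "x \<in> ?C"
      then obtain u where u: "x = (\<Sum>i\<le>n. (u i * s i) *\<^sub>R e i)" "\<forall>i\<le>n. 0 \<le> u i" "sum u {..n} = 1" by auto
      have "x \<in> span (e ` {..n})" unfolding u(1)
        by (intro span_sum span_scale span_base) auto
      moreover have "x \<noteq> 0"
      proof
        assume "x = 0"
        hence "(\<Sum>i\<le>n. (u i * s i) *\<^sub>R e i) = 0" using u(1) by simp
        from indep[OF this] have c: "\<forall>i\<le>n. u i * s i = 0" .
        have "u i = 0" if "i \<le> n" for i
          using c[rule_format, of i] that s[rule_format, of i] by auto
        thus False using u(3) by simp
      qed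
      ultimately show "x \<in> ?Y" by simp
    qed
    ultimately show ?thesis by blast
  qed
  thus ?thesis unfolding cross_polytope_def by blast
qed

text \<open>For independent \<open>e\<close> the set is an n-sphere. If k \<le> n, the contradiction
  arises on the k-dimensional polytope contained in it: k sign cochains have a cup product of degree
  k, which can be evaluated on a k-dimensional hemisphere.\<close>

theorem borsuk_ulam:
  fixes e :: "nat \<Rightarrow> 'a::real_normed_vector" and g :: "nat \<Rightarrow> 'a \<Rightarrow> real"
  assumes cont: "\<And>i. i < k \<Longrightarrow> continuous_on (cross_polytope e n) (g i)"
    and odd: "\<And>i x. i < k \<Longrightarrow> x \<in> cross_polytope e n \<Longrightarrow> g i (- x) = - g i x"
    and nz: "\<And>x. x \<in> cross_polytope e n \<Longrightarrow> \<exists>i<k. g i x \<noteq> 0"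
  shows "n < k"
proof (rule ccontr)
  assume "\<not> n < k"
  hence kn: "k \<le> n" by simp
  let ?Y = "cross_polytope e n"
  define X where "X = cross_polytope e k"
  have XY: "X \<subseteq> ?Y" unfolding X_def by (rule cross_polytope_mono[OF kn])
  have compX: "compact X" unfolding X_def by (rule compact_cross_polytope)
  \<comment> \<open>On a good set some g i has a constant strict sign; a simplex with vertices in
    such a set annihilates the cup product.\<close>
  define good where "good T \<longleftrightarrow> (\<exists>i<k. (\<forall>q\<in>T. g i q > 0) \<or> (\<forall>q\<in>T. g i q < 0))" for T
  define \<C> where "\<C> = {ball p r | p r. p \<in> X \<and> 0 < r \<and> good (X \<inter> ball p r)}"
  have cov: "X \<subseteq> \<Union>\<C>"
  proof
    fix p assume p: "p \<in> X"
    then obtain i where i: "i < k" "g i p \<noteq> 0" using nz XY by blast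
    have "continuous_on X (g i)" by (rule continuous_on_subset[OF cont[OF i(1)] XY])
    then obtain r where r: "0 < r" "\<And>q. q \<in> X \<Longrightarrow> dist q p < r \<Longrightarrow> dist (g i q) (g i p) < \<bar>g i p\<bar>"
      unfolding continuous_on_iff using p i(2) by (metis zero_less_abs_iff)
    have "good (X \<inter> ball p r)"
    proof (cases "g i p > 0")
      case True
      hence "\<forall>q\<in>X \<inter> ball p r. g i q > 0"
        using r(2) by (force simp: dist_commute dist_real_def)
      thus ?thesis using i(1) unfolding good_def by blast
    next
      case False
      hence "\<forall>q\<in>X \<inter> ball p r. g i q < 0"
        using r(2) i(2) by (force simp: dist_commute dist_real_def)
      thus ?thesis using i(1) unfolding good_def by blast
    qed
    thus "p \<in> \<Union>\<C>" using p r(1) by (auto simp: \<C>_def intro!: exI[of _ "ball p r"])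
  qed
  have "convex hull ((\<lambda>i. 1 *\<^sub>R e i) ` {..k}) \<subseteq> X"
    unfolding X_def cross_polytope_def by (rule UN_upper[of "\<lambda>_. 1"]) simp
  moreover have "e 0 \<in> convex hull ((\<lambda>i. 1 *\<^sub>R e i) ` {..k})" by (rule hull_inc) auto
  ultimately have "X \<noteq> {}" by blast
  hence "\<C> \<noteq> {}" using cov by auto
  moreover have "open B" if "B \<in> \<C>" for B using that by (auto simp: \<C>_def)
  ultimately obtain \<delta> where \<delta>: "0 < \<delta>" "\<And>T. T \<subseteq> X \<Longrightarrow> diameter T < \<delta> \<Longrightarrow> \<exists>B\<in>\<C>. T \<subseteq> B"
    using Lebesgue_number_lemma[OF compX _ cov] by metis
  let ?D = "2 * (\<Sum>i\<le>k. norm (e i))"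
  have "(\<lambda>m. (1 - 1 / real (Suc k)) ^ m * ?D) \<longlonglongrightarrow> 0 * ?D"
    by (intro tendsto_mult LIMSEQ_power_zero tendsto_const) (auto simp: field_simps)
  hence "\<forall>\<^sub>F m in sequentially. (1 - 1 / real (Suc k)) ^ m * ?D < \<delta>"
    using \<delta>(1) by (intro order_tendstoD) auto
  then obtain m where m: "(1 - 1 / real (Suc k)) ^ m * ?D < \<delta>" by (auto simp: eventually_sequentially)
  \<comment> \<open>The sign of g i fails to be odd where g i vanishes. There it is replaced by the
    sign of the first nonvanishing g j, which is odd. Every \<open>sg i\<close> is then odd on the
    whole polytope, and on good sets, where the relevant g i is nonzero, the replacement does not
    interfere.\<close>
  define c :: "'a \<Rightarrow> bit" where "c p = of_bool (g (LEAST j. j < k \<and> g j p \<noteq> 0) p > 0)" for p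
  define sg :: "nat \<Rightarrow> 'a \<Rightarrow> bit" where "sg i p = (if g i p \<noteq> 0 then of_bool (g i p > 0) else c p)" for i p
  have c_odd: "c (- p) = c p + 1" if p: "p \<in> ?Y" for p
  proof -
    define j where "j = (LEAST j. j < k \<and> g j p \<noteq> 0)"
    have j: "j < k \<and> g j p \<noteq> 0" unfolding j_def using nz[OF p] by (rule LeastI_ex)
    have "(\<lambda>j. j < k \<and> g j (- p) \<noteq> 0) = (\<lambda>j. j < k \<and> g j p \<noteq> 0)"
      using odd[OF _ p] by (auto simp: fun_eq_iff)
    hence "c (- p) = of_bool (g j (- p) > 0)" "c p = of_bool (g j p > 0)" by (simp_all add: c_def j_def)
    thus ?thesis using odd[OF _ p, of j] j by (auto simp: bit_add_self)
  qed
  have sg_odd: "sg i (- p) = sg i p + 1" if "i < k" "p \<in> ?Y" for i p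
    using odd[OF that] c_odd[OF that(2)] by (auto simp: sg_def bit_add_self)
  define ss where "ss = map sg [0..<k]"
  have len: "length ss = k" by (simp add: ss_def)
  have "hemi e (length ss) (itsubdiv (Suc (length ss)) m (cupw ss)) = 1"
  proof (rule hemi_cupw[where P="?Y"])
    fix s :: "nat \<Rightarrow> real" assume "\<forall>i. s i = 1 \<or> s i = -1"
    hence "convex hull ((\<lambda>i. s i *\<^sub>R e i) ` {..k}) \<subseteq> X"
      unfolding X_def cross_polytope_def by blast
    thus "convex hull ((\<lambda>i. s i *\<^sub>R e i) ` {..length ss}) \<subseteq> ?Y" using XY len by auto
  qed (use sg_odd in \<open>auto simp: ss_def\<close>)
  moreover have "hemi e k (itsubdiv (Suc k) m (cupw ss)) = 0"
  proof (rule hemi_itsubdiv_eq_0)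
    fix \<tau> and s :: "nat \<Rightarrow> real"
    assume t: "length \<tau> = Suc k" "\<forall>i. s i = 1 \<or> s i = -1"
      "set \<tau> \<subseteq> convex hull ((\<lambda>i. s i *\<^sub>R e i) ` {..k})"
      "\<And>x y. x \<in> set \<tau> \<Longrightarrow> y \<in> set \<tau> \<Longrightarrow> dist x y \<le> (1 - 1 / real (Suc k)) ^ m * ?D"
    have tX: "set \<tau> \<subseteq> X" using t(2,3) unfolding X_def cross_polytope_def by blast
    have "diameter (set \<tau>) \<le> (1 - 1 / real (Suc k)) ^ m * ?D"
      by (rule diameter_le) (use t in \<open>auto simp: dist_norm\<close>)
    hence "diameter (set \<tau>) < \<delta>" using m by simp
    then obtain B where B: "B \<in> \<C>" "set \<tau> \<subseteq> B" using \<delta>(2)[OF tX] by blast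
    then obtain i where i: "i < k" "(\<forall>q\<in>set \<tau>. g i q > 0) \<or> (\<forall>q\<in>set \<tau>. g i q < 0)"
      using tX unfolding \<C>_def good_def by blast
    show "cupw ss \<tau> = 0"
    proof (rule cupw_eq_0)
      show "sg i \<in> set ss" using i by (simp add: ss_def)
      show "sg i p = sg i q" if "p \<in> set \<tau>" "q \<in> set \<tau>" for p q
        using i(2) that by (fastforce simp: sg_def)
    qed (simp add: t len)
  qed
  ultimately show False by (simp add: len)
qed

section \<open>Hilbert spaces\<close>

text \<open>The representative minimises |v|^2 - 2 L v over W; by the parallelogram law
  (\<open>par\<close>) minimising sequences are Cauchy. Linearity is asked on W alone because the
  functionals to come are defined through representatives of the elements of a subspace.\<close>

lemma riesz_representation:
  fixes W :: "'h::{real_inner,complete_space} set" and L :: "'h \<Rightarrow> real"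
  assumes W: "subspace W" "closed W"
    and add: "\<And>u v. u \<in> W \<Longrightarrow> v \<in> W \<Longrightarrow> L (u + v) = L u + L v"
    and scale: "\<And>c u. u \<in> W \<Longrightarrow> L (c *\<^sub>R u) = c * L u"
    and bdd: "\<And>u. u \<in> W \<Longrightarrow> \<bar>L u\<bar> \<le> C * norm u"
  obtains r where "r \<in> W" "\<And>v. v \<in> W \<Longrightarrow> L v = inner r v"
proof -
  define Q where "Q v = (norm v)\<^sup>2 - 2 * L v" for v
  have C0: "0 \<le> C * norm u" if "u \<in> W" for u using bdd[OF that] by linarith
  have Qlow: "- C\<^sup>2 \<le> Q v" if "v \<in> W" for v
  proof -
    have "0 \<le> (norm v - C)\<^sup>2" by simp
    thus ?thesis using bdd[OF that] by (simp add: Q_def power2_eq_square algebra_simps)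
  qed
  define d where "d = Inf (Q ` W)"
  have bb: "bdd_below (Q ` W)" using Qlow by (intro bdd_belowI2[of _ "- C\<^sup>2"]) auto
  have ne: "Q ` W \<noteq> {}" using subspace_0[OF W(1)] by auto
  have dle: "d \<le> Q v" if "v \<in> W" for v unfolding d_def using bb that by (intro cInf_lower) auto
  have "\<exists>v\<in>W. Q v < d + inverse (real (Suc n))" for n
    using cInf_lessD[OF ne, of "d + inverse (real (Suc n))"] by (auto simp: d_def)
  then obtain x where x: "\<And>n. x n \<in> W" "\<And>n. Q (x n) < d + inverse (real (Suc n))" by metis
  have par: "(norm (u - v))\<^sup>2 \<le> 2 * (Q u - d) + 2 * (Q v - d)" if "u \<in> W" "v \<in> W" for u v
  proof -
    let ?m = "(1/2) *\<^sub>R (u + v)"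
    have m: "?m \<in> W" using W(1) that by (intro subspace_scale subspace_add)
    have "L ?m = (L u + L v) / 2" using scale[of "u + v" "1/2"] add[OF that] W(1) that
      by (simp add: subspace_add)
    moreover have "(norm ?m)\<^sup>2 = (norm (u + v))\<^sup>2 / 4" by (simp add: power_divide)
    ultimately have "4 * d \<le> (norm (u + v))\<^sup>2 - 4 * (L u + L v)" using dle[OF m] by (simp add: Q_def)
    moreover have "(norm (u + v))\<^sup>2 + (norm (u - v))\<^sup>2 = 2 * (norm u)\<^sup>2 + 2 * (norm v)\<^sup>2"
      by (simp add: power2_norm_eq_inner inner_simps inner_commute)
    ultimately show ?thesis by (simp add: Q_def)
  qed
  have "Cauchy x"
  proof (rule metric_CauchyI)
    fix e :: real assume e: "0 < e"
    obtain M where M: "inverse (real (Suc M)) < e\<^sup>2 / 4" using reals_Archimedean[of "e\<^sup>2 / 4"] e by auto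
    show "\<exists>M. \<forall>m\<ge>M. \<forall>n\<ge>M. dist (x m) (x n) < e"
    proof (intro exI allI impI)
      fix m n assume mn: "M \<le> m" "M \<le> n"
      have i: "inverse (real (Suc k)) \<le> inverse (real (Suc M))" if "M \<le> k" for k
        using that by (intro le_imp_inverse_le) auto
      have "(norm (x m - x n))\<^sup>2 < e\<^sup>2"
      proof -
        have "Q (x m) - d < e\<^sup>2 / 4" "Q (x n) - d < e\<^sup>2 / 4"
          using x(2)[of m] x(2)[of n] i[OF mn(1)] i[OF mn(2)] M by linarith+
        thus ?thesis using par[OF x(1)[of m] x(1)[of n]] by argo
      qed
      thus "dist (x m) (x n) < e" using e by (simp add: dist_norm power_less_imp_less_base)
    qed
  qed
  then obtain r where r: "x \<longlonglongrightarrow> r" using Cauchy_convergent convergent_def by blast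
  have rW: "r \<in> W" using closed_sequentially[OF W(2) _ r] x(1) by auto
  have Qr: "Q r \<le> d"
  proof -
    have Lc: "(\<lambda>n. L (x n)) \<longlonglongrightarrow> L r"
    proof -
      have "\<bar>L (x n) - L r\<bar> \<le> C * norm (x n - r)" for n
      proof -
        have "L (x n) = L (x n - r) + L r"
          using add[of "x n - r" r] x(1)[of n] rW W(1) by (simp add: subspace_diff)
        thus ?thesis using bdd[of "x n - r"] x(1)[of n] rW W(1) by (simp add: subspace_diff)
      qed
      moreover have "(\<lambda>n. C * norm (x n - r)) \<longlonglongrightarrow> C * norm (r - r)"
        by (intro tendsto_intros r)
      ultimately have "(\<lambda>n. L (x n) - L r) \<longlonglongrightarrow> 0"
        by (intro Lim_null_comparison[of "\<lambda>n. L (x n) - L r"]) auto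
      thus ?thesis by (simp add: LIM_zero_iff)
    qed
    have "(\<lambda>n. Q (x n)) \<longlonglongrightarrow> Q r" unfolding Q_def by (intro tendsto_intros r Lc)
    moreover have "(\<lambda>n. d + inverse (real (Suc n))) \<longlonglongrightarrow> d + 0"
      by (intro tendsto_intros LIMSEQ_inverse_real_of_nat)
    ultimately have "Q r \<le> d + 0" by (rule LIMSEQ_le) (use x(2) in \<open>auto intro: less_imp_le\<close>)
    thus ?thesis by simp
  qed
  have "L v = inner r v" if v: "v \<in> W" for v
  proof -
    define a where "a = inner r v - L v"
    have q: "0 \<le> 2 * t * a + t\<^sup>2 * (norm v)\<^sup>2" for t
    proof -
      have tv: "t *\<^sub>R v \<in> W" using v W(1) by (simp add: subspace_scale)
      have "Q r \<le> Q (r + t *\<^sub>R v)"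
        using Qr dle[of "r + t *\<^sub>R v"] tv rW W(1) by (simp add: subspace_add)
      moreover have "(norm (r + t *\<^sub>R v))\<^sup>2 = (norm r)\<^sup>2 + 2 * t * inner r v + t\<^sup>2 * (norm v)\<^sup>2"
        unfolding power2_norm_eq_inner by (simp add: inner_simps inner_commute power2_eq_square algebra_simps)
      ultimately show ?thesis using add[OF rW tv] scale[OF v]
        by (simp add: Q_def a_def algebra_simps)
    qed
    have "a = 0"
    proof (cases "norm v = 0")
      case True thus ?thesis using q[of 1] q[of "-1"] by simp
    next
      case False
      hence p: "0 < (norm v)\<^sup>2" by simp
      define N where "N = (norm v)\<^sup>2"
      \<comment> \<open>The choice t = - a / N minimises the quadratic in \<open>q\<close>, and the
        minimum is negative unless a = 0.\<close>
      have "2 * (- a / N) * a + (- a / N)\<^sup>2 * N = - (a\<^sup>2) / N"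
        using p by (simp add: N_def[symmetric] field_simps power2_eq_square)
      hence "0 \<le> - (a\<^sup>2) / N" using q[of "- a / N"] by (simp add: N_def)
      thus ?thesis using p by (simp add: N_def[symmetric] divide_le_0_iff field_simps)
    qed
    thus ?thesis by (simp add: a_def)
  qed
  thus ?thesis using that rW by blast
qed

lemma closure_subspace:
  fixes T :: "'a::real_normed_vector set"
  assumes T: "subspace T" shows "subspace (closure T)"
proof (rule subspaceI)
  show "0 \<in> closure T" using subspace_0[OF T] closure_subset by blast
  fix x y assume "x \<in> closure T" "y \<in> closure T"
  then obtain a b where "\<And>n. a n \<in> T" "a \<longlonglongrightarrow> x" "\<And>n. b n \<in> T" "b \<longlonglongrightarrow> y"
    unfolding closure_sequential by blast
  hence "\<And>n. a n + b n \<in> T" "(\<lambda>n. a n + b n) \<longlonglongrightarrow> x + y"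
    by (auto intro!: subspace_add[OF T] tendsto_add)
  thus "x + y \<in> closure T" unfolding closure_sequential by (intro exI[of _ "\<lambda>n. a n + b n"]) auto
next
  fix c :: real and x assume "x \<in> closure T"
  then obtain a where "\<And>n. a n \<in> T" "a \<longlonglongrightarrow> x" unfolding closure_sequential by blast
  hence "\<And>n. c *\<^sub>R a n \<in> T" "(\<lambda>n. c *\<^sub>R a n) \<longlonglongrightarrow> c *\<^sub>R x"
    by (auto intro!: subspace_scale[OF T] tendsto_scaleR)
  thus "c *\<^sub>R x \<in> closure T" unfolding closure_sequential by (intro exI[of _ "\<lambda>n. c *\<^sub>R a n"]) auto
qed

text \<open>Riesz representation on the closure yields the orthogonal projection r of G, and G - r
  is orthogonal to T.\<close>

lemma dense_subspace:
  fixes T :: "'h::{real_inner,complete_space} set"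
  assumes T: "subspace T" and orth: "\<And>G. (\<And>x. x \<in> T \<Longrightarrow> inner G x = 0) \<Longrightarrow> G = 0"
  shows "closure T = UNIV"
proof -
  have sub: "subspace (closure T)" using T by (rule closure_subspace)
  have "G \<in> closure T" for G
  proof -
    obtain r where r: "r \<in> closure T" "\<And>v. v \<in> closure T \<Longrightarrow> inner G v = inner r v"
      by (rule riesz_representation[OF sub closed_closure, of "inner G" "norm G"])
         (auto simp: inner_add_right Cauchy_Schwarz_ineq2)
    have "G - r = 0"
      by (rule orth) (use r(2) closure_subset in \<open>auto simp: inner_diff_left\<close>)
    thus ?thesis using r(1) by simp
  qed
  thus ?thesis by auto
qed

text \<open>The vectors z whose pairings with the sequence converge form a closed subspace Z. The
  limit functional is bounded there, and y is its representative. The conclusion speaks only of such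
  z, which suffices when the limits of the pairings in question are already known.\<close>

lemma bounded_sequence_weak_limit:
  fixes x :: "nat \<Rightarrow> 'h::{real_inner,complete_space}"
  assumes bd: "\<And>n. norm (x n) \<le> C"
  obtains y where "norm y \<le> C" "\<And>z l. (\<lambda>n. inner (x n) z) \<longlonglongrightarrow> l \<Longrightarrow> inner y z = l"
proof -
  define Z where "Z = {z. convergent (\<lambda>n. inner (x n) z)}"
  define L where "L z = lim (\<lambda>n. inner (x n) z)" for z
  have lim: "(\<lambda>n. inner (x n) z) \<longlonglongrightarrow> L z" if "z \<in> Z" for z
    using that by (simp add: Z_def L_def convergent_LIMSEQ_iff)
  have C0: "0 \<le> C" using bd[of 0] norm_ge_zero[of "x 0"] by linarith
  have Zadd: "u + v \<in> Z" "L (u + v) = L u + L v" if "u \<in> Z" "v \<in> Z" for u v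
  proof -
    have "(\<lambda>n. inner (x n) (u + v)) \<longlonglongrightarrow> L u + L v"
      unfolding inner_add_right by (intro tendsto_add lim that)
    thus "u + v \<in> Z" "L (u + v) = L u + L v" by (auto simp: Z_def L_def convergent_def limI)
  qed
  have Zscale: "c *\<^sub>R u \<in> Z" "L (c *\<^sub>R u) = c * L u" if "u \<in> Z" for u c
  proof -
    have "(\<lambda>n. inner (x n) (c *\<^sub>R u)) \<longlonglongrightarrow> c * L u"
      unfolding inner_scaleR_right by (intro tendsto_mult_left lim that)
    thus "c *\<^sub>R u \<in> Z" "L (c *\<^sub>R u) = c * L u" by (auto simp: Z_def L_def convergent_def limI)
  qed
  have sub: "subspace Z" unfolding subspace_def using Zadd(1) Zscale(1) by (auto simp: Z_def convergent_const)
  have est: "\<bar>inner (x n) z\<bar> \<le> C * norm z" for n z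
    using Cauchy_Schwarz_ineq2[of "x n" z] mult_right_mono[OF bd[of n] norm_ge_zero[of z]] by linarith
  have bdd: "\<bar>L z\<bar> \<le> C * norm z" if "z \<in> Z" for z
    using tendsto_rabs[OF lim[OF that]] by (rule LIMSEQ_le_const2) (use est in auto)
  have "closed Z"
  proof (rule closed_sequential_limits[THEN iffD2], intro allI impI, elim conjE)
    fix z l assume z: "\<forall>k. z k \<in> Z" "z \<longlonglongrightarrow> l"
    have "Cauchy (\<lambda>n. inner (x n) l)"
    proof (rule metric_CauchyI)
      fix e :: real assume e: "0 < e"
      have "(\<lambda>k. C * norm (l - z k)) \<longlonglongrightarrow> C * norm (l - l)" by (intro tendsto_intros z)
      hence "\<forall>\<^sub>F k in sequentially. C * norm (l - z k) < e / 3" using e by (intro order_tendstoD) auto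
      then obtain k where k: "C * norm (l - z k) < e / 3" by (auto simp: eventually_sequentially)
      have "Cauchy (\<lambda>n. inner (x n) (z k))" using z(1) by (auto simp: Z_def Cauchy_convergent_iff)
      then obtain M where M: "\<And>m n. m \<ge> M \<Longrightarrow> n \<ge> M \<Longrightarrow> dist (inner (x m) (z k)) (inner (x n) (z k)) < e / 3"
        using e by (meson metric_CauchyD zero_less_divide_iff zero_less_numeral)
      have sp: "inner (x n) l = inner (x n) (l - z k) + inner (x n) (z k)" for n by (simp add: inner_diff_right)
      show "\<exists>M. \<forall>m\<ge>M. \<forall>n\<ge>M. dist (inner (x m) l) (inner (x n) l) < e"
      proof (intro exI allI impI)
        fix m n assume "M \<le> m" "M \<le> n"
        thus "dist (inner (x m) l) (inner (x n) l) < e"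
          using M[of m n] est[of m "l - z k"] est[of n "l - z k"] k sp[of m] sp[of n]
          unfolding dist_real_def by linarith
      qed
    qed
    thus "l \<in> Z" by (simp add: Z_def Cauchy_convergent_iff)
  qed
  from riesz_representation[OF sub this, of L C]
  obtain y where y: "y \<in> Z" "\<And>z. z \<in> Z \<Longrightarrow> L z = inner y z" using Zadd Zscale bdd by metis
  have "norm y * norm y \<le> C * norm y"
    using bdd[OF y(1)] y(2)[OF y(1)] by (simp add: power2_norm_eq_inner[symmetric] power2_eq_square)
  hence "norm y \<le> C" using C0 by (cases "norm y = 0") (auto simp: mult_le_cancel_right)
  moreover have "inner y z = l" if "(\<lambda>n. inner (x n) z) \<longlonglongrightarrow> l" for z l
  proof -
    have "z \<in> Z" using that by (auto simp: Z_def convergent_def)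
    thus ?thesis using LIMSEQ_unique[OF lim that] y(2) by metis
  qed
  ultimately show ?thesis using that by blast
qed

lemma compact_closure_sequential:
  fixes S :: "'a::metric_space set"
  assumes "\<And>x. (\<And>n. x n \<in> S) \<Longrightarrow> \<exists>r l. strict_mono (r :: nat \<Rightarrow> nat) \<and> (x \<circ> r) \<longlonglongrightarrow> l"
  shows "compact (closure S)"
proof -
  have "seq_compact (closure S)"
  proof (rule seq_compactI)
    fix y :: "nat \<Rightarrow> 'a" assume y: "\<forall>n. y n \<in> closure S"
    have "\<exists>x\<in>S. dist x (y n) < inverse (real (Suc n))" for n :: nat
      using y closure_approachable[of "y n" S] by (metis inverse_positive_iff_positive of_nat_0_less_iff zero_less_Suc)
    then obtain x where x: "\<And>n. x n \<in> S" "\<And>n. dist (x n) (y n) < inverse (real (Suc n))" by metis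
    obtain r l where r: "strict_mono (r :: nat \<Rightarrow> nat)" "(x \<circ> r) \<longlonglongrightarrow> l" using assms[of x, OF x(1)] by blast
    have "(\<lambda>n. dist (x n) (y n)) \<longlonglongrightarrow> 0"
    proof (rule Lim_null_comparison[OF _ LIMSEQ_inverse_real_of_nat])
      show "\<forall>\<^sub>F n in sequentially. norm (dist (x n) (y n)) \<le> inverse (real (Suc n))"
        by (intro always_eventually allI) (use x(2) in \<open>force intro: less_imp_le simp del: of_nat_Suc\<close>)
    qed
    hence d: "(\<lambda>n. dist ((x \<circ> r) n) ((y \<circ> r) n)) \<longlonglongrightarrow> 0"
      using LIMSEQ_subseq_LIMSEQ[OF _ r(1)] by (force simp: o_def)
    have "(y \<circ> r) \<longlonglongrightarrow> l"
    proof -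
      have "(\<lambda>n. dist ((x \<circ> r) n) ((y \<circ> r) n) + dist ((x \<circ> r) n) l) \<longlonglongrightarrow> 0 + 0"
        by (intro tendsto_add d r(2)[THEN tendsto_dist_iff[THEN iffD1]])
      moreover have "dist ((y \<circ> r) n) l \<le> dist ((x \<circ> r) n) ((y \<circ> r) n) + dist ((x \<circ> r) n) l" for n
        by (metis dist_commute dist_triangle)
      ultimately have "(\<lambda>n. dist ((y \<circ> r) n) l) \<longlonglongrightarrow> 0"
        by (intro Lim_null_comparison[of "\<lambda>n. dist ((y \<circ> r) n) l"]) auto
      thus ?thesis by (simp add: tendsto_dist_iff[of "y \<circ> r"])
    qed
    moreover have "l \<in> closure S"
      by (rule closed_sequentially[OF closed_closure _ r(2)]) (use x(1) closure_subset in auto)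
    ultimately show "\<exists>l\<in>closure S. \<exists>r. strict_mono r \<and> (y \<circ> r) \<longlonglongrightarrow> l" using r(1) by blast
  qed
  thus ?thesis by (simp add: compact_eq_seq_compact_metric)
qed

section \<open>Even constrained functionals\<close>

text \<open>Here s = (1 + e)^(-1/4) is the factor of the radial normalisation. The number s^4 - 1 is
  s - 1 times a quantity of at least 1, and it equals - e s^4, where s^4 \<le> 2 because 1 + e \<ge>
  1/2.\<close>

lemma abs_root4_inverse_minus_one:
  fixes e s :: real
  assumes e: "\<bar>e\<bar> \<le> 1/2" and s: "0 < s" "s ^ 4 * (1 + e) = 1"
  shows "\<bar>s - 1\<bar> \<le> 2 * \<bar>e\<bar>"
proof -
  have e1: "1 + e \<ge> 1/2" using e by linarith
  have f: "s ^ 4 - 1 = (s - 1) * ((s + 1) * (s\<^sup>2 + 1))" by algebra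
  have g: "1 \<le> (s + 1) * (s\<^sup>2 + 1)" using mult_mono[of 1 "s + 1" 1 "s\<^sup>2 + 1"] s by simp
  have "\<bar>s - 1\<bar> \<le> \<bar>s - 1\<bar> * ((s + 1) * (s\<^sup>2 + 1))" using g by (simp add: mult_le_cancel_left1)
  also have "\<dots> = \<bar>s ^ 4 - 1\<bar>" unfolding f using s(1) by (simp add: abs_mult)
  also have "s ^ 4 - 1 = - e * s ^ 4" using s(2) by (simp add: algebra_simps)
  also have "\<bar>- e * s ^ 4\<bar> = \<bar>e\<bar> * s ^ 4" using s(1) by (simp add: abs_mult)
  also have "s ^ 4 \<le> 2"
  proof (rule ccontr)
    assume "\<not> s ^ 4 \<le> 2"
    hence "2 * (1/2) < s ^ 4 * (1 + e)" using e1 by (intro mult_less_le_imp_less) auto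
    thus False using s(2) by simp
  qed
  finally show ?thesis by (simp add: mult_left_mono)
qed

text \<open>\<open>R\<close> is the gradient of \<open>J\<close>, and 4 K that of \<Psi>; together
  with <K u, u> = \<Psi> u this is Euler's relation in degree 4. The Taylor remainders are uniform
  on bounded sets because one step size has to serve all points of a ball. Everything is relative to
  a closed subspace, since the weighted space is a subset and not a type.\<close>

locale constrained_functional =
  fixes W :: "'h::{real_inner,complete_space} set"
    and J \<Psi> :: "'h \<Rightarrow> real" and R K :: "'h \<Rightarrow> 'h"
  assumes subspace_W: "subspace W" and closed_W: "closed W"
    and J_nonneg: "\<And>u. u \<in> W \<Longrightarrow> 0 \<le> J u"
    and R_in: "\<And>u. u \<in> W \<Longrightarrow> R u \<in> W" and K_in: "\<And>u. u \<in> W \<Longrightarrow> K u \<in> W"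
    and R_odd: "\<And>u. u \<in> W \<Longrightarrow> R (- u) = - R u" and K_odd: "\<And>u. u \<in> W \<Longrightarrow> K (- u) = - K u"
    and R_cont: "continuous_on W R" and K_cont: "continuous_on W K"
    and compactness: "\<And>x B. (\<And>n::nat. x n \<in> W) \<Longrightarrow> (\<And>n. norm (x n) \<le> B) \<Longrightarrow>
       \<exists>r l l'. strict_mono (r :: nat \<Rightarrow> nat) \<and> (R \<circ> x \<circ> r) \<longlonglongrightarrow> l \<and> (K \<circ> x \<circ> r) \<longlonglongrightarrow> l'"
    and J_taylor: "\<And>B \<eta>. 0 < \<eta> \<Longrightarrow> \<exists>\<delta>>0. \<forall>u\<in>W. \<forall>h\<in>W. norm u \<le> B \<longrightarrow> norm h \<le> \<delta> \<longrightarrow>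
       \<bar>J (u + h) - J u - inner (R u) h\<bar> \<le> \<eta> * norm h"
    and \<Psi>_taylor: "\<And>B \<eta>. 0 < \<eta> \<Longrightarrow> \<exists>\<delta>>0. \<forall>u\<in>W. \<forall>h\<in>W. norm u \<le> B \<longrightarrow> norm h \<le> \<delta> \<longrightarrow>
       \<bar>\<Psi> (u + h) - \<Psi> u - 4 * inner (K u) h\<bar> \<le> \<eta> * norm h"
    and \<Psi>_hom: "\<And>u t. u \<in> W \<Longrightarrow> \<Psi> (t *\<^sub>R u) = t ^ 4 * \<Psi> u"
    and K_pair: "\<And>u. u \<in> W \<Longrightarrow> inner (K u) u = \<Psi> u"
    and \<Psi>_pos: "\<And>u. u \<in> W \<Longrightarrow> u \<noteq> 0 \<Longrightarrow> 0 < \<Psi> u"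
    and infinite_dim: "\<And>n::nat. \<exists>e :: nat \<Rightarrow> 'h. (\<forall>i. e i \<in> W) \<and>
       (\<forall>c. (\<Sum>i\<le>n. c i *\<^sub>R e i) = 0 \<longrightarrow> (\<forall>i\<le>n. c i = 0))"
begin

section \<open>Tangential gradient and normalised gradient step\<close>

definition I where "I u = (norm u)\<^sup>2 / 2 + J u"
definition M where "M = {u \<in> W. \<Psi> u = 1}"
definition G where "G u = u + R u"
text \<open>The part of the gradient \<open>G\<close> of \<open>I\<close> that is orthogonal to
  \<open>K u\<close>, i.e. tangent to \<open>M\<close>; its vanishing is the Lagrange
  condition.\<close>

definition H where "H u = G u - (inner (G u) (K u) / inner (K u) (K u)) *\<^sub>R K u"
definition normalize where "normalize z = (\<Psi> z powr (-1/4)) *\<^sub>R z"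
definition step where "step \<tau> u = normalize (u - \<tau> *\<^sub>R H u)"

lemmas W_intros = subspace_add[OF subspace_W] subspace_diff[OF subspace_W]
  subspace_scale[OF subspace_W] subspace_neg[OF subspace_W] R_in K_in

lemma MW: "u \<in> M \<Longrightarrow> u \<in> W" and M\<Psi>: "u \<in> M \<Longrightarrow> \<Psi> u = 1"
  by (auto simp: M_def)

lemma G_in: "u \<in> W \<Longrightarrow> G u \<in> W" by (auto simp: G_def intro!: W_intros)
lemma H_in: "u \<in> W \<Longrightarrow> H u \<in> W" by (auto simp: H_def intro!: W_intros G_in)

lemma G_odd: "u \<in> W \<Longrightarrow> G (- u) = - G u" by (simp add: G_def R_odd)
lemma H_odd: "u \<in> W \<Longrightarrow> H (- u) = - H u" by (simp add: H_def G_odd K_odd)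

lemma \<Psi>_even: "u \<in> W \<Longrightarrow> \<Psi> (- u) = \<Psi> u"
  using \<Psi>_hom[of u "-1"] by simp

lemma normalize_odd: "u \<in> W \<Longrightarrow> normalize (- u) = - normalize u"
  by (simp add: normalize_def \<Psi>_even)

lemma step_odd: "u \<in> W \<Longrightarrow> step \<tau> (- u) = - step \<tau> u"
proof -
  assume u: "u \<in> W"
  have "- u - \<tau> *\<^sub>R H (- u) = - (u - \<tau> *\<^sub>R H u)" by (simp add: H_odd u)
  thus ?thesis unfolding step_def using normalize_odd[of "u - \<tau> *\<^sub>R H u"] u
    by (simp only: W_intros H_in)
qed

lemma normalize_in:
  assumes "z \<in> W" "0 < \<Psi> z" shows "normalize z \<in> M"
proof -
  have "(\<Psi> z powr (-1/4)) ^ 4 * \<Psi> z = 1"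
    using assms by (simp add: powr_realpow[symmetric] powr_powr powr_minus field_simps)
  thus ?thesis using assms by (simp add: M_def normalize_def \<Psi>_hom W_intros)
qed

lemma taylor_imp_continuous_on:
  fixes F :: "'h \<Rightarrow> real" and A :: "'h \<Rightarrow> 'h"
  assumes "\<And>B \<eta>. 0 < \<eta> \<Longrightarrow> \<exists>\<delta>>0. \<forall>u\<in>W. \<forall>h\<in>W. norm u \<le> B \<longrightarrow> norm h \<le> \<delta> \<longrightarrow>
       \<bar>F (u + h) - F u - inner (A u) h\<bar> \<le> \<eta> * norm h"
  shows "continuous_on W F"
  unfolding continuous_on_iff
proof (intro ballI allI impI)
  fix u and e :: real assume u: "u \<in> W" and e: "0 < e"
  obtain \<delta> where \<delta>: "0 < \<delta>" "\<And>h. h \<in> W \<Longrightarrow> norm h \<le> \<delta> \<Longrightarrow> \<bar>F (u + h) - F u - inner (A u) h\<bar> \<le> 1 * norm h"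
    using assms[of 1 "norm u"] u by auto
  let ?C = "norm (A u) + 1"
  have C: "0 < ?C" by (simp add: add_nonneg_pos)
  show "\<exists>d>0. \<forall>x'\<in>W. dist x' u < d \<longrightarrow> dist (F x') (F u) < e"
  proof (intro exI[of _ "min \<delta> (e / ?C)"] conjI ballI impI)
    show "0 < min \<delta> (e / ?C)" using \<delta>(1) e C by simp
    fix v assume v: "v \<in> W" "dist v u < min \<delta> (e / ?C)"
    have "\<bar>F v - F u - inner (A u) (v - u)\<bar> \<le> norm (v - u)"
      using \<delta>(2)[of "v - u"] u v by (simp add: W_intros dist_norm)
    hence "\<bar>F v - F u\<bar> \<le> ?C * norm (v - u)"
      using Cauchy_Schwarz_ineq2[of "A u" "v - u"] by (simp add: algebra_simps)
    also have "\<dots> < e" using v C by (simp add: dist_norm field_simps)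
    finally show "dist (F v) (F u) < e" by (simp add: dist_real_def)
  qed
qed

lemma J_cont: "continuous_on W J" by (rule taylor_imp_continuous_on[OF J_taylor])

lemma \<Psi>_cont: "continuous_on W \<Psi>"
  by (rule taylor_imp_continuous_on[of _ "\<lambda>u. 4 *\<^sub>R K u"]) (use \<Psi>_taylor in simp)

lemma I_cont: "continuous_on W I"
  unfolding I_def by (intro continuous_intros J_cont) auto

lemma G_cont: "continuous_on W G"
  unfolding G_def by (intro continuous_intros R_cont)

lemma normalize_cont: "continuous_on {z \<in> W. 0 < \<Psi> z} normalize"
  unfolding normalize_def
  by (intro continuous_intros continuous_on_powr' continuous_on_subset[OF \<Psi>_cont]) auto

lemma K_nonzero: "u \<in> M \<Longrightarrow> K u \<noteq> 0"
  using K_pair[of u] by (auto simp: M_def)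

lemma H_cont: "continuous_on M H"
proof -
  have MW': "M \<subseteq> W" by (auto simp: M_def)
  show ?thesis unfolding H_def
    by (intro continuous_intros continuous_on_subset[OF K_cont MW'] continuous_on_subset[OF G_cont MW'])
       (auto simp: K_nonzero)
qed

text \<open>Cauchy-Schwarz applied to 1 = \<Psi> u = <K u, u>.\<close>

lemma K_lower: "u \<in> M \<Longrightarrow> norm u \<le> B \<Longrightarrow> 1 \<le> B * norm (K u)"
  using K_pair[of u] Cauchy_Schwarz_ineq2[of "K u" u] mult_right_mono[of "norm u" B "norm (K u)"]
  by (simp add: M_def mult.commute)

lemma inner_K_H: "u \<in> M \<Longrightarrow> inner (K u) (H u) = 0"
  using K_nonzero[of u] by (simp add: H_def inner_diff_right inner_commute)

lemma inner_G_H: "u \<in> M \<Longrightarrow> inner (G u) (H u) = (norm (H u))\<^sup>2"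
proof -
  assume u: "u \<in> M"
  have "G u = H u + (inner (G u) (K u) / inner (K u) (K u)) *\<^sub>R K u" by (simp add: H_def)
  hence "inner (G u) (H u) = inner (H u) (H u) + (inner (G u) (K u) / inner (K u) (K u)) * inner (K u) (H u)"
    by (metis inner_add_left inner_scaleR_left)
  thus ?thesis using inner_K_H[OF u] by (simp add: power2_norm_eq_inner)
qed

lemma H_le_G: "u \<in> M \<Longrightarrow> norm (H u) \<le> norm (G u)"
proof -
  assume u: "u \<in> M"
  have "norm (H u) * norm (H u) \<le> norm (G u) * norm (H u)"
    using inner_G_H[OF u] Cauchy_Schwarz_ineq2[of "G u" "H u"] by (simp add: power2_eq_square)
  thus ?thesis by (cases "norm (H u) = 0") (auto simp: mult_le_cancel_right)
qed

lemma norm_le_I: "u \<in> W \<Longrightarrow> (norm u)\<^sup>2 \<le> 2 * I u"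
  using J_nonneg[of u] by (simp add: I_def)

text \<open>Points of a ball with |R u| above every n would, by compactness, have a subsequence with
  convergent and hence bounded images.\<close>

lemma R_bounded: "\<exists>C. \<forall>u\<in>W. norm u \<le> B \<longrightarrow> norm (R u) \<le> C"
proof (rule ccontr)
  assume "\<not> ?thesis"
  hence "\<forall>n::nat. \<exists>u\<in>W. norm u \<le> B \<and> norm (R u) > real n" by (meson not_le)
  then obtain x where x: "\<And>n::nat. x n \<in> W" "\<And>n. norm (x n) \<le> B" "\<And>n. norm (R (x n)) > real n" by metis
  obtain r l where r: "strict_mono (r :: nat \<Rightarrow> nat)" "(R \<circ> x \<circ> r) \<longlonglongrightarrow> l"
    using compactness[of x B] x by blast
  have "Bseq (R \<circ> x \<circ> r)" using r(2) by (intro convergent_imp_Bseq) (auto simp: convergent_def)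
  then obtain D where D: "\<And>n. norm (R (x (r n))) \<le> D" by (auto simp: Bseq_def)
  obtain n :: nat where n: "D < real n" using reals_Archimedean2 by blast
  have "real n \<le> real (r n)" using seq_suble[OF r(1), of n] by simp
  thus False using D[of n] x(3)[of "r n"] n by linarith
qed

text \<open>H u is orthogonal to K u, so moving by - \<tau> H u changes \<Psi> by o(\<tau>) only,
  and normalisation then moves the point by o(\<tau>). To first order I changes by - \<tau> <G u, H
  u> = - \<tau> |H u|^2; all errors together stay below \<tau> \<epsilon>, uniformly on the ball.
  The bound \<tau> \<epsilon> \<le> 1 serves \<open>high_critical\<close>, where points below level
  a must not rise above a + 1.\<close>

lemma step_decrease:
  assumes \<epsilon>: "0 < \<epsilon>"
  shows "\<exists>\<tau>>0. \<tau> * \<epsilon> \<le> 1 \<and> (\<forall>u\<in>M. norm u \<le> B \<longrightarrow> 0 < \<Psi> (u - \<tau> *\<^sub>R H u) \<and>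
     I (step \<tau> u) \<le> I u - \<tau> * (norm (H u))\<^sup>2 + \<tau> * \<epsilon>)"
proof -
  obtain C1 where C1: "\<And>u. u \<in> W \<Longrightarrow> norm u \<le> B \<Longrightarrow> norm (R u) \<le> C1" using R_bounded by blast
  define B' where "B' = max B 0"
  define C where "C = B' + \<bar>C1\<bar> + 1"
  have B': "0 \<le> B'" "B \<le> B'" by (auto simp: B'_def)
  have C: "1 \<le> C" using B' by (simp add: C_def)
  have GC: "norm (G u) \<le> C" if "u \<in> M" "norm u \<le> B" for u
    using norm_triangle_ineq[of u "R u"] C1[OF MW[OF that(1)] that(2)] that(2) B' by (simp add: G_def C_def)
  \<comment> \<open>A1 gathers the coefficients of \<tau> \<eta> in the error: 2 C^2 (B' + 1) from
    <G u, k>, and C (2 B' + 3), the bound for |h| / \<tau>, from the Taylor remainder of J. A2 is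
    the square of that bound and comes from |h|^2.\<close>
  define A1 where "A1 = 2 * C\<^sup>2 * (B' + 1) + C * (2 * B' + 3)"
  define A2 where "A2 = (C * (2 * B' + 3))\<^sup>2"
  have A: "1 \<le> A1" "1 \<le> A2"
  proof -
    have "1 * 1 \<le> C * (2 * B' + 3)" using C B' by (intro mult_mono) auto
    moreover have "0 \<le> 2 * C\<^sup>2 * (B' + 1)" using B' by simp
    ultimately show "1 \<le> A1" "1 \<le> A2" unfolding A1_def A2_def by (linarith, simp add: one_le_power)
  qed
  define \<eta> where "\<eta> = min 1 (\<epsilon> / (2 * A1))"
  have \<eta>: "0 < \<eta>" "\<eta> \<le> 1" "\<eta> * A1 \<le> \<epsilon> / 2"
  proof -
    show "0 < \<eta>" "\<eta> \<le> 1" using A \<epsilon> by (auto simp: \<eta>_def)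
    have "\<eta> * A1 \<le> \<epsilon> / (2 * A1) * A1" using A by (intro mult_right_mono) (auto simp: \<eta>_def)
    also have "\<dots> = \<epsilon> / 2" using A by simp
    finally show "\<eta> * A1 \<le> \<epsilon> / 2" .
  qed
  obtain \<delta>J where \<delta>J: "0 < \<delta>J" "\<And>u h. u \<in> W \<Longrightarrow> h \<in> W \<Longrightarrow> norm u \<le> B \<Longrightarrow> norm h \<le> \<delta>J \<Longrightarrow>
       \<bar>J (u + h) - J u - inner (R u) h\<bar> \<le> \<eta> * norm h" using J_taylor[OF \<eta>(1), of B] by blast
  obtain \<delta>P where \<delta>P: "0 < \<delta>P" "\<And>u h. u \<in> W \<Longrightarrow> h \<in> W \<Longrightarrow> norm u \<le> B \<Longrightarrow> norm h \<le> \<delta>P \<Longrightarrow>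
       \<bar>\<Psi> (u + h) - \<Psi> u - 4 * inner (K u) h\<bar> \<le> \<eta> * norm h" using \<Psi>_taylor[OF \<eta>(1), of B] by blast
  define D where "D = C * (2 * B' + 3)"
  have D: "1 \<le> D" using mult_mono[of 1 C 1 "2 * B' + 3"] C B' by (simp add: D_def)
  \<comment> \<open>The five bounds ensure in turn: the expansion of \<Psi> applies, |e| \<le> 1/2,
    the expansion of J applies, |h|^2 \<le> \<tau> \<epsilon>, and \<tau> \<epsilon> \<le>
    1.\<close>
  define \<tau> where "\<tau> = Min {\<delta>P / C, 1 / (2 * C), \<delta>J / D, \<epsilon> / A2, 1 / \<epsilon>}"
  have \<tau>le: "\<tau> \<le> \<delta>P / C" "\<tau> \<le> 1 / (2 * C)" "\<tau> \<le> \<delta>J / D" "\<tau> \<le> \<epsilon> / A2" "\<tau> \<le> 1 / \<epsilon>"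
    unfolding \<tau>_def by (auto intro: Min_le)
  have \<tau>0: "0 < \<tau>" unfolding \<tau>_def using C D A \<delta>J(1) \<delta>P(1) \<epsilon> by (subst Min_gr_iff) auto
  have \<tau>: "\<tau> * C \<le> \<delta>P" "\<tau> * C \<le> 1/2" "\<tau> * D \<le> \<delta>J" "\<tau> * A2 \<le> \<epsilon>" "\<tau> * \<epsilon> \<le> 1"
    using \<tau>le C D A \<epsilon> by (auto simp: field_simps)
  have main: "0 < \<Psi> (u - \<tau> *\<^sub>R H u) \<and> I (step \<tau> u) \<le> I u - \<tau> * (norm (H u))\<^sup>2 + \<tau> * \<epsilon>"
    if u: "u \<in> M" "norm u \<le> B" for u
  proof -
    define z where "z = u - \<tau> *\<^sub>R H u"
    define e where "e = \<Psi> z - 1"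
    have uW: "u \<in> W" using u by (simp add: M_def)
    have HW: "H u \<in> W" using H_in[OF uW] .
    have zW: "z \<in> W" unfolding z_def by (intro W_intros uW HW)
    have HC: "norm (H u) \<le> C" using H_le_G[OF u(1)] GC[OF u] by simp
    have \<tau>H: "norm (- \<tau> *\<^sub>R H u) \<le> \<tau> * C" "norm (\<tau> *\<^sub>R H u) \<le> \<tau> * C" using HC \<tau>0 by simp_all
    have "\<bar>\<Psi> (u + (- \<tau> *\<^sub>R H u)) - \<Psi> u - 4 * inner (K u) (- \<tau> *\<^sub>R H u)\<bar> \<le> \<eta> * norm (- \<tau> *\<^sub>R H u)"
      by (rule \<delta>P(2)) (use uW HW u(2) \<tau>H \<tau>(1) W_intros in auto)
    hence "\<bar>e\<bar> \<le> \<eta> * norm (- \<tau> *\<^sub>R H u)"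
      using M\<Psi>[OF u(1)] inner_K_H[OF u(1)] by (simp add: e_def z_def)
    also have "\<dots> \<le> \<eta> * (\<tau> * C)" by (rule mult_left_mono[OF \<tau>H(1)]) (use \<eta> in simp)
    finally have e: "\<bar>e\<bar> \<le> \<eta> * (\<tau> * C)" .
    have "\<eta> * (\<tau> * C) \<le> 1 * (\<tau> * C)" using \<eta> \<tau>0 C by (intro mult_right_mono) auto
    hence e2: "\<bar>e\<bar> \<le> 1/2" using e \<tau>(2) by linarith
    have \<Psi>z: "0 < \<Psi> z" using e2 unfolding e_def by linarith
    define s where "s = \<Psi> z powr (-1/4)"
    have s: "0 < s" "s ^ 4 * (1 + e) = 1"
      using \<Psi>z by (auto simp: s_def e_def powr_realpow[symmetric] powr_powr powr_minus field_simps)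
    have s1: "\<bar>s - 1\<bar> \<le> 2 * (\<eta> * (\<tau> * C))"
      using abs_root4_inverse_minus_one[OF e2 s] e by linarith
    \<comment> \<open>The whole displacement h consists of the tangential step and the radial
      correction k, which is small of order \<eta> \<tau>.\<close>
    define k where "k = (s - 1) *\<^sub>R z"
    define h where "h = k - \<tau> *\<^sub>R H u"
    have kW: "k \<in> W" and hW: "h \<in> W" unfolding h_def k_def by (intro W_intros zW HW)+
    have sz: "step \<tau> u = u + h"
    proof -
      have "step \<tau> u = s *\<^sub>R z" by (simp add: step_def normalize_def z_def s_def)
      also have "\<dots> = z + k" by (simp add: k_def algebra_simps)
      finally show ?thesis by (simp add: h_def z_def)
    qed
    have nz: "norm z \<le> B' + 1"
      using norm_triangle_ineq4[of u "\<tau> *\<^sub>R H u"] u(2) B' \<tau>H(2) \<tau>(2) unfolding z_def by linarith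
    have nk: "norm k \<le> 2 * (\<eta> * (\<tau> * C)) * (B' + 1)"
      unfolding k_def norm_scaleR by (rule mult_mono[OF s1 nz]) (use \<eta> \<tau>0 C in auto)
    also have "\<dots> \<le> 2 * (1 * (\<tau> * C)) * (B' + 1)"
      using \<eta> \<tau>0 C B' by (intro mult_right_mono mult_left_mono) auto
    finally have nk2: "norm k \<le> 2 * (\<tau> * C) * (B' + 1)" by simp
    have nh: "norm h \<le> \<tau> * D"
      using norm_triangle_ineq4[of k "\<tau> *\<^sub>R H u"] nk2 \<tau>H(2) unfolding h_def D_def by (simp add: algebra_simps del: norm_scaleR)
    have Jh: "\<bar>J (u + h) - J u - inner (R u) h\<bar> \<le> \<eta> * norm h"
      by (rule \<delta>J(2)) (use uW hW u(2) nh \<tau>(3) in auto)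
    have sq: "(norm (u + h))\<^sup>2 = (norm u)\<^sup>2 + 2 * inner u h + (norm h)\<^sup>2"
      unfolding power2_norm_eq_inner by (simp add: inner_simps inner_commute)
    have "I (u + h) - I u \<le> inner (G u) h + (norm h)\<^sup>2 / 2 + \<eta> * norm h"
      using Jh unfolding I_def sq G_def inner_add_left by argo
    also have "inner (G u) h = inner (G u) k - \<tau> * (norm (H u))\<^sup>2"
      using inner_G_H[OF u(1)] by (simp add: h_def inner_diff_right)
    finally have 1: "I (u + h) \<le> I u - \<tau> * (norm (H u))\<^sup>2 + (inner (G u) k + (norm h)\<^sup>2 / 2 + \<eta> * norm h)"
      by simp
    have "inner (G u) k \<le> norm (G u) * norm k" by (rule norm_cauchy_schwarz)
    also have "\<dots> \<le> C * (2 * (\<eta> * (\<tau> * C)) * (B' + 1))"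
      by (rule mult_mono[OF GC[OF u] nk]) (use C in auto)
    finally have 2: "inner (G u) k \<le> \<tau> * (\<eta> * (2 * C\<^sup>2 * (B' + 1)))" by (simp add: power2_eq_square algebra_simps)
    have 3: "\<eta> * norm h \<le> \<tau> * (\<eta> * D)" using mult_left_mono[OF nh, of \<eta>] \<eta> by (simp add: algebra_simps)
    have "(norm h)\<^sup>2 \<le> (\<tau> * D)\<^sup>2" using nh by (intro power_mono) auto
    also have "\<dots> = \<tau> * (\<tau> * A2)" by (simp add: D_def A2_def power2_eq_square algebra_simps)
    also have "\<dots> \<le> \<tau> * \<epsilon>" using \<tau>(4) \<tau>0 by (intro mult_left_mono) auto
    finally have 4: "(norm h)\<^sup>2 / 2 \<le> \<tau> * (\<epsilon> / 2)" by simp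
    have "\<tau> * (\<eta> * (2 * C\<^sup>2 * (B' + 1))) + \<tau> * (\<eta> * D) = \<tau> * (\<eta> * A1)"
      by (simp add: A1_def D_def algebra_simps)
    also have "\<dots> \<le> \<tau> * (\<epsilon> / 2)" using \<eta>(3) \<tau>0 by (intro mult_left_mono) auto
    finally have "inner (G u) k + (norm h)\<^sup>2 / 2 + \<eta> * norm h \<le> \<tau> * \<epsilon>" using 2 3 4 by (simp add: algebra_simps)
    thus ?thesis using 1 \<Psi>z unfolding sz z_def by linarith
  qed
  show ?thesis using \<tau>0 \<tau>(5) main by blast
qed

lemma step_in: "u \<in> M \<Longrightarrow> 0 < \<Psi> (u - \<tau> *\<^sub>R H u) \<Longrightarrow> step \<tau> u \<in> M"
  unfolding step_def by (intro normalize_in W_intros H_in MW)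

lemma step_cont: "continuous_on {u \<in> M. 0 < \<Psi> (u - \<tau> *\<^sub>R H u)} (step \<tau>)"
proof -
  let ?S = "{u \<in> M. 0 < \<Psi> (u - \<tau> *\<^sub>R H u)}"
  have "continuous_on ?S (\<lambda>u. u - \<tau> *\<^sub>R H u)"
    by (intro continuous_intros continuous_on_subset[OF H_cont]) auto
  moreover have "(\<lambda>u. u - \<tau> *\<^sub>R H u) ` ?S \<subseteq> {z \<in> W. 0 < \<Psi> z}"
    by (auto intro!: W_intros H_in dest: MW)
  ultimately have "continuous_on ?S (normalize \<circ> (\<lambda>u. u - \<tau> *\<^sub>R H u))"
    using continuous_on_compose continuous_on_subset[OF normalize_cont] by blast
  thus ?thesis by (simp add: step_def[abs_def] o_def)
qed

text \<open>Solving the definition of H for x gives x = H x - R x + m K x with a multiplier m. By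
  \<open>K_lower\<close> the multipliers are bounded; R and K are compact and H x tends to 0, so a
  subsequence of x converges.\<close>

lemma palais_smale:
  assumes x: "\<And>n::nat. x n \<in> M" "\<And>n. norm (x n) \<le> B" and Hx: "(\<lambda>n. H (x n)) \<longlonglongrightarrow> 0"
  shows "\<exists>r u. strict_mono (r :: nat \<Rightarrow> nat) \<and> u \<in> M \<and> (x \<circ> r) \<longlonglongrightarrow> u \<and> H u = 0"
proof -
  obtain r l l' where r: "strict_mono (r :: nat \<Rightarrow> nat)" "(R \<circ> x \<circ> r) \<longlonglongrightarrow> l" "(K \<circ> x \<circ> r) \<longlonglongrightarrow> l'"
    using compactness[of x B] x MW by blast
  define m where "m n = inner (G (x n)) (K (x n)) / inner (K (x n)) (K (x n))" for n
  have l': "l' \<noteq> 0"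
  proof
    assume "l' = 0"
    hence "(\<lambda>n. B * norm ((K \<circ> x \<circ> r) n)) \<longlonglongrightarrow> B * norm (0::'h)" using r(3) by (intro tendsto_intros) (simp only:)
    hence "1 \<le> B * norm (0::'h)"
      by (rule LIMSEQ_le_const) (use K_lower[OF x] in auto)
    thus False by simp
  qed
  have "Bseq (m \<circ> r)"
  proof -
    have "Bseq (R \<circ> x \<circ> r)" using r(2) by (intro convergent_imp_Bseq) (auto simp: convergent_def)
    then obtain D where D: "\<And>n. norm (R (x (r n))) \<le> D" by (auto simp: Bseq_def)
    have "\<bar>m (r n)\<bar> \<le> (B + D) * B" for n
    proof -
      let ?u = "x (r n)"
      have p: "0 < norm (K ?u)" using K_nonzero[OF x(1)] by simp
      have "\<bar>inner (G ?u) (K ?u)\<bar> \<le> norm (G ?u) * norm (K ?u)" by (rule Cauchy_Schwarz_ineq2)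
      hence "\<bar>m (r n)\<bar> \<le> norm (G ?u) * norm (K ?u) / (norm (K ?u))\<^sup>2"
        unfolding m_def abs_divide power2_norm_eq_inner[symmetric] by (simp add: divide_right_mono)
      also have "\<dots> = norm (G ?u) * (1 / norm (K ?u))" using p by (simp add: power2_eq_square)
      also have "\<dots> \<le> (B + D) * B"
      proof (rule mult_mono)
        show "norm (G ?u) \<le> B + D" unfolding G_def using norm_triangle_ineq[of ?u "R ?u"] x(2)[of "r n"] D[of n] by linarith
        show "1 / norm (K ?u) \<le> B" using K_lower[OF x] p by (simp add: field_simps)
        show "0 \<le> B + D" using norm_ge_zero[of ?u] x(2)[of "r n"] D[of n] norm_ge_zero[of "R ?u"] by linarith
      qed simp
      finally show ?thesis .
    qed
    thus ?thesis by (intro BseqI'[of _ "(B + D) * B"]) simp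
  qed
  then obtain r2 \<mu> where r2: "strict_mono (r2 :: nat \<Rightarrow> nat)" "(m \<circ> r \<circ> r2) \<longlonglongrightarrow> \<mu>"
    using bounded_imp_convergent_subsequence[of "m \<circ> r"] by (auto simp: Bseq_eq_bounded)
  define q where "q = r \<circ> r2"
  have q: "strict_mono q" unfolding q_def using r(1) r2(1) by (rule strict_mono_o)
  have eq: "x n = H (x n) - R (x n) + m n *\<^sub>R K (x n)" for n
    by (simp add: H_def G_def m_def)
  have "(\<lambda>n. H (x (q n)) - R (x (q n)) + m (q n) *\<^sub>R K (x (q n))) \<longlonglongrightarrow> 0 - l + \<mu> *\<^sub>R l'"
    using LIMSEQ_subseq_LIMSEQ[OF Hx q] LIMSEQ_subseq_LIMSEQ[OF r(2) r2(1)] LIMSEQ_subseq_LIMSEQ[OF r(3) r2(1)] r2(2)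
    by (intro tendsto_intros) (auto simp: o_def q_def)
  hence lim: "(x \<circ> q) \<longlonglongrightarrow> - l + \<mu> *\<^sub>R l'" using eq by (simp add: o_def)
  define u where "u = - l + \<mu> *\<^sub>R l'"
  have xu: "(x \<circ> q) \<longlonglongrightarrow> u" using lim by (simp add: u_def)
  have uW: "u \<in> W" by (rule closed_sequentially[OF closed_W _ xu]) (use x(1) MW in auto)
  have "(\<lambda>n. \<Psi> ((x \<circ> q) n)) \<longlonglongrightarrow> \<Psi> u"
    by (rule continuous_on_tendsto_compose[OF \<Psi>_cont xu uW]) (use x(1) MW in auto)
  moreover have "(\<lambda>n. \<Psi> ((x \<circ> q) n)) = (\<lambda>n. 1)" using x(1) M\<Psi> by auto
  ultimately have "\<Psi> u = 1" using LIMSEQ_unique[OF _ tendsto_const] by metis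
  hence uM: "u \<in> M" using uW by (simp add: M_def)
  have "(\<lambda>n. H ((x \<circ> q) n)) \<longlonglongrightarrow> H u"
    by (rule continuous_on_tendsto_compose[OF H_cont xu uM]) (use x(1) in auto)
  hence "H u = 0" using LIMSEQ_unique LIMSEQ_subseq_LIMSEQ[OF Hx q] by (fastforce simp: o_def)
  thus ?thesis using q uM xu by blast
qed

text \<open>Pairing G u = \<mu> K u with u identifies \<mu>, because <K u, u> = 1 on M. This is the
  origin of the formula for the Lagrange multiplier of the equation.\<close>

lemma critical_eq:
  assumes "u \<in> M" "H u = 0"
  shows "u + R u - ((norm u)\<^sup>2 + inner (R u) u) *\<^sub>R K u = 0"
proof -
  define \<mu> where "\<mu> = inner (G u) (K u) / inner (K u) (K u)"
  have "G u = \<mu> *\<^sub>R K u" using assms(2) by (simp add: H_def \<mu>_def)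
  hence eq: "u + R u = \<mu> *\<^sub>R K u" by (simp add: G_def)
  have "inner (u + R u) u = \<mu> * inner (K u) u" using eq by simp
  hence "(norm u)\<^sup>2 + inner (R u) u = \<mu>"
    using K_pair[of u] assms(1) by (simp add: M_def inner_add_left power2_norm_eq_inner)
  thus ?thesis using eq by simp
qed

section \<open>Minimisers, and critical values of arbitrary height\<close>

lemma M_nonempty: "M \<noteq> {}"
proof -
  obtain e :: "nat \<Rightarrow> 'h" where e: "\<And>i. e i \<in> W" "\<And>c. (\<Sum>i\<le>0. c i *\<^sub>R e i) = 0 \<Longrightarrow> \<forall>i\<le>(0::nat). c i = 0"
    using infinite_dim[of 0] by blast
  have "e 0 \<noteq> 0" using e(2)[of "\<lambda>_. 1"] by auto
  thus ?thesis using normalize_in[OF e(1) \<Psi>_pos[OF e(1)]] by blast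
qed

text \<open>A step whose error is half of |H u|^2 would strictly lower the energy if H u were
  nonzero.\<close>

lemma minimizer_imp_critical:
  assumes u: "u \<in> M" and min: "\<And>v. v \<in> M \<Longrightarrow> I u \<le> I v"
  shows "H u = 0"
proof (rule ccontr)
  assume "H u \<noteq> 0"
  hence "0 < (norm (H u))\<^sup>2 / 2" by simp
  from step_decrease[OF this, of "norm u"] obtain \<tau> where \<tau>: "0 < \<tau>"
    "0 < \<Psi> (u - \<tau> *\<^sub>R H u)" "I (step \<tau> u) \<le> I u - \<tau> * (norm (H u))\<^sup>2 + \<tau> * ((norm (H u))\<^sup>2 / 2)"
    using u by blast
  have "I u \<le> I (step \<tau> u)" by (rule min[OF step_in[OF u \<tau>(2)]])
  hence "\<tau> * (norm (H u))\<^sup>2 \<le> 0" using \<tau>(3) by (simp add: algebra_simps)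
  thus False using \<tau>(1) \<open>H u \<noteq> 0\<close> by (simp add: mult_le_0_iff)
qed

text \<open>A step from x n cannot fall below the infimum c, so \<tau> |H (x n)|^2 is at most I (x
  n) - c plus a small multiple of \<tau>. Hence every minimising sequence is a Palais-Smale
  sequence.\<close>

lemma minimizer_exists: "\<exists>u\<in>M. \<forall>v\<in>M. I u \<le> I v"
proof -
  define c where "c = Inf (I ` M)"
  have bb: "bdd_below (I ` M)" using J_nonneg MW by (intro bdd_belowI2[of _ 0]) (auto simp: I_def)
  have cle: "c \<le> I v" if "v \<in> M" for v unfolding c_def using bb that by (intro cInf_lower) auto
  have "\<exists>v\<in>M. I v < c + inverse (real (Suc n))" for n :: nat
    using cInf_lessD[of "I ` M" "c + inverse (real (Suc n))"] M_nonempty by (auto simp: c_def)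
  then obtain x where x: "\<And>n::nat. x n \<in> M" "\<And>n. I (x n) < c + inverse (real (Suc n))" by metis
  have inv1: "inverse (real (Suc n)) \<le> 1" for n :: nat
    using le_imp_inverse_le[of 1 "real (Suc n)"] by simp
  define B where "B = sqrt (2 * (c + 1))"
  have xB: "norm (x n) \<le> B" for n
  proof -
    have "(norm (x n))\<^sup>2 \<le> 2 * (c + 1)" using norm_le_I[OF MW[OF x(1)[of n]]] x(2)[of n] inv1[of n] by argo
    thus ?thesis unfolding B_def by (rule real_le_rsqrt)
  qed
  have "(\<lambda>n. (norm (H (x n)))\<^sup>2) \<longlonglongrightarrow> 0"
  proof (rule LIMSEQ_I)
    fix \<epsilon> :: real assume \<epsilon>: "0 < \<epsilon>"
    hence "0 < \<epsilon> / 2" by simp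
    from step_decrease[OF this, of B] obtain \<tau> where \<tau>: "0 < \<tau>"
      "\<And>u. u \<in> M \<Longrightarrow> norm u \<le> B \<Longrightarrow> 0 < \<Psi> (u - \<tau> *\<^sub>R H u)"
      "\<And>u. u \<in> M \<Longrightarrow> norm u \<le> B \<Longrightarrow> I (step \<tau> u) \<le> I u - \<tau> * (norm (H u))\<^sup>2 + \<tau> * (\<epsilon> / 2)"
      by blast
    obtain N where N: "inverse (real (Suc N)) < \<tau> * (\<epsilon> / 2)"
      using reals_Archimedean[of "\<tau> * (\<epsilon> / 2)"] \<tau>(1) \<epsilon> by auto
    show "\<exists>no. \<forall>n\<ge>no. norm ((norm (H (x n)))\<^sup>2 - 0) < \<epsilon>"
    proof (intro exI allI impI)
      fix n assume "N \<le> n"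
      hence "inverse (real (Suc n)) \<le> inverse (real (Suc N))" by (intro le_imp_inverse_le) auto
      moreover have "c \<le> I (step \<tau> (x n))" by (rule cle[OF step_in[OF x(1) \<tau>(2)[OF x(1) xB]]])
      ultimately have "\<tau> * (norm (H (x n)))\<^sup>2 < \<tau> * (\<epsilon> / 2) + \<tau> * (\<epsilon> / 2)"
        using \<tau>(3)[OF x(1) xB, of n] x(2)[of n] N by linarith
      hence "\<tau> * (norm (H (x n)))\<^sup>2 < \<tau> * \<epsilon>" by (simp add: algebra_simps)
      thus "norm ((norm (H (x n)))\<^sup>2 - 0) < \<epsilon>" using \<tau>(1) by simp
    qed
  qed
  hence "(\<lambda>n. sqrt ((norm (H (x n)))\<^sup>2)) \<longlonglongrightarrow> sqrt 0" by (rule tendsto_real_sqrt)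
  hence "(\<lambda>n. H (x n)) \<longlonglongrightarrow> 0" by (simp add: tendsto_norm_zero_iff)
  from palais_smale[OF x(1) xB this] obtain r u where
    r: "strict_mono (r :: nat \<Rightarrow> nat)" "u \<in> M" "(x \<circ> r) \<longlonglongrightarrow> u" by blast
  have "(\<lambda>n. I ((x \<circ> r) n)) \<longlonglongrightarrow> I u"
    by (rule continuous_on_tendsto_compose[OF I_cont r(3) MW[OF r(2)]]) (use x(1) MW in auto)
  moreover have "(\<lambda>n. c + inverse (real (Suc (r n)))) \<longlonglongrightarrow> c + 0"
    using LIMSEQ_subseq_LIMSEQ[OF LIMSEQ_inverse_real_of_nat r(1)] by (intro tendsto_intros) (simp add: o_def)
  ultimately have "I u \<le> c + 0" by (rule LIMSEQ_le) (use x(2) in \<open>auto intro: less_imp_le simp del: of_nat_Suc\<close>)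
  thus ?thesis using r(2) cle by force
qed

text \<open>Finiteness of the genus: the image under \<open>K\<close> is relatively compact and stays away from \<open>0\<close>.\<close>
lemma finite_genus:
  "\<exists>k (g :: nat \<Rightarrow> 'h \<Rightarrow> real). (\<forall>i<k. continuous_on {u \<in> M. norm u \<le> B} (g i)) \<and>
     (\<forall>i<k. \<forall>u\<in>M. g i (- u) = - g i u) \<and> (\<forall>u\<in>M. norm u \<le> B \<longrightarrow> (\<exists>i<k. g i u \<noteq> 0))"
proof -
  let ?A = "{u \<in> M. norm u \<le> B}"
  \<comment> \<open>\<open>K_lower\<close> gives |K u| \<ge> 1 / B; the added 1 makes the inequality
    strict and \<rho> positive for every B.\<close>
  define \<rho> where "\<rho> = 1 / (\<bar>B\<bar> + 1)"
  have \<rho>: "0 < \<rho>" by (simp add: \<rho>_def)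
  have low: "\<rho> < norm (K u)" if "u \<in> ?A" for u
  proof -
    have "1 \<le> B * norm (K u)" using K_lower that by auto
    also have "\<dots> < (\<bar>B\<bar> + 1) * norm (K u)" using K_nonzero[of u] that by (intro mult_strict_right_mono) auto
    finally show ?thesis by (simp add: \<rho>_def field_simps)
  qed
  have "compact (closure (K ` ?A))"
  proof (rule compact_closure_sequential)
    fix y :: "nat \<Rightarrow> 'h" assume "\<And>n. y n \<in> K ` ?A"
    hence "\<forall>n. \<exists>u. u \<in> ?A \<and> y n = K u" by blast
    then obtain x where x: "\<And>n. x n \<in> ?A" "\<And>n. y n = K (x n)" by metis
    obtain r l where "strict_mono (r :: nat \<Rightarrow> nat)" "(K \<circ> x \<circ> r) \<longlonglongrightarrow> l"
      using compactness[of x B] x(1) MW by blast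
    moreover have "K \<circ> x \<circ> r = y \<circ> r" using x(2) by (auto simp: fun_eq_iff)
    ultimately show "\<exists>r l. strict_mono r \<and> (y \<circ> r) \<longlonglongrightarrow> l" by auto
  qed
  then obtain F where F: "finite F" "closure (K ` ?A) \<subseteq> (\<Union>x\<in>F. ball x \<rho>)"
    using \<rho> compact_eq_totally_bounded[of "closure (K ` ?A)"] by blast
  obtain xs where xs: "set xs = F" using finite_list[OF F(1)] by blast
  \<comment> \<open>The difference of two tents around \<open>xs ! i\<close> and its antipode is odd
    in K u. As |K u| > \<rho>, the balls of radius \<rho> around these two points cannot both
    contain K u, so the tents do not cancel.\<close>
  define g where "g i u = max 0 (\<rho> - norm (K u - xs ! i)) - max 0 (\<rho> - norm (K u + xs ! i))" for i u
  have "continuous_on ?A (g i)" for i unfolding g_def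
    by (intro continuous_intros continuous_on_subset[OF K_cont]) (use MW in auto)
  moreover have "g i (- u) = - g i u" if "u \<in> M" for i u
  proof -
    have "norm (- K u - xs ! i) = norm (K u + xs ! i)" "norm (- K u + xs ! i) = norm (K u - xs ! i)"
      by (metis minus_add_distrib norm_minus_cancel uminus_add_conv_diff minus_diff_eq add.commute diff_minus_eq_add)+
    thus ?thesis using K_odd[OF MW[OF that]] by (simp add: g_def)
  qed
  moreover have "\<exists>i<length xs. g i u \<noteq> 0" if u: "u \<in> ?A" for u
  proof -
    have "K u \<in> closure (K ` ?A)" using closure_subset[of "K ` ?A"] u by (intro subsetD[OF closure_subset] imageI)
    then obtain y where "y \<in> set xs" "dist y (K u) < \<rho>" using F(2) xs by auto
    then obtain i where i: "i < length xs" "dist (xs ! i) (K u) < \<rho>" by (metis in_set_conv_nth)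
    have d: "norm (K u - xs ! i) < \<rho>" using i(2) by (simp add: dist_norm norm_minus_commute)
    have "2 * norm (K u) = norm ((K u + xs ! i) + (K u - xs ! i))" by (simp add: scaleR_2[symmetric])
    also have "\<dots> \<le> norm (K u + xs ! i) + norm (K u - xs ! i)" by (rule norm_triangle_ineq)
    finally have "\<rho> < norm (K u + xs ! i)" using d low[OF u] by linarith
    hence "g i u > 0" using d by (simp add: g_def)
    thus ?thesis using i(1) by (intro exI[of _ i]) auto
  qed
  ultimately show ?thesis by (intro exI[of _ "length xs"] exI[of _ g]) auto
qed

text \<open>The number k belongs to the level a + 1 and is fixed before the sphere is chosen. The
  sphere has dimension k, one more than k odd functions without common zero permit. The maximal
  energy b on it, the gap \<epsilon> and the step size \<tau> depend on this sphere, and finitely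
  many steps bring it below a + 1.\<close>

theorem high_critical: "\<exists>u\<in>M. a \<le> I u \<and> H u = 0"
proof (rule ccontr)
  assume neg: "\<not> ?thesis"
  define B1 where "B1 = sqrt (2 * (a + 1))"
  obtain k and g :: "nat \<Rightarrow> 'h \<Rightarrow> real" where gk: "(\<forall>i<k. continuous_on {u \<in> M. norm u \<le> B1} (g i)) \<and>
     (\<forall>i<k. \<forall>u\<in>M. g i (- u) = - g i u) \<and> (\<forall>u\<in>M. norm u \<le> B1 \<longrightarrow> (\<exists>i<k. g i u \<noteq> 0))"
    using finite_genus[of B1] by (elim exE)
  have g: "\<And>i. i < k \<Longrightarrow> continuous_on {u \<in> M. norm u \<le> B1} (g i)"
     "\<And>i u. i < k \<Longrightarrow> u \<in> M \<Longrightarrow> g i (- u) = - g i u"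
     "\<And>u. u \<in> M \<Longrightarrow> norm u \<le> B1 \<Longrightarrow> \<exists>i<k. g i u \<noteq> 0"
    using gk by simp_all
  obtain e :: "nat \<Rightarrow> 'h" where e: "\<And>i. e i \<in> W" "\<And>c. (\<Sum>i\<le>k. c i *\<^sub>R e i) = 0 \<Longrightarrow> \<forall>i\<le>k. c i = 0"
    using infinite_dim[of k] by blast
  let ?X = "cross_polytope e k"
  have "span (e ` {..k}) \<subseteq> W" by (rule span_minimal[OF _ subspace_W]) (use e(1) in auto)
  hence XW: "x \<in> W" "x \<noteq> 0" if "x \<in> ?X" for x
    using cross_polytope_subset_span[OF e(2)] that by auto
  have XP: "?X \<subseteq> {z \<in> W. 0 < \<Psi> z}" using XW \<Psi>_pos by auto
  have ncont: "continuous_on ?X normalize" by (rule continuous_on_subset[OF normalize_cont XP])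
  have nM: "normalize x \<in> M" if "x \<in> ?X" for x using XP that by (intro normalize_in) auto
  have "compact ((\<lambda>x. I (normalize x)) ` ?X)"
    by (intro compact_continuous_image compact_cross_polytope
          continuous_on_compose2[OF I_cont ncont]) (use nM MW in auto)
  then obtain b0 where b0: "\<And>x. x \<in> ?X \<Longrightarrow> \<bar>I (normalize x)\<bar> \<le> b0"
    using compact_imp_bounded bounded_real by (metis (no_types, lifting) imageI)
  define b where "b = max b0 (a + 1)"
  have b: "a + 1 \<le> b" "\<And>x. x \<in> ?X \<Longrightarrow> I (normalize x) \<le> b" using b0 by (force simp: b_def)+
  define B where "B = sqrt (2 * b)"
  have IB: "norm u \<le> sqrt (2 * c)" if "u \<in> M" "I u \<le> c" for u c
    using norm_le_I[OF MW[OF that(1)]] that(2) by (intro real_le_rsqrt) linarith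
  \<comment> \<open>Otherwise \<open>palais_smale\<close> would produce a critical point with energy
    at least a. The factor 2 pays for the error \<tau> \<epsilon> of a step.\<close>
  have "\<exists>\<epsilon>>0. \<forall>u\<in>M. a \<le> I u \<longrightarrow> I u \<le> b \<longrightarrow> 2 * \<epsilon> \<le> (norm (H u))\<^sup>2"
  proof (rule ccontr)
    assume c: "\<not> ?thesis"
    have "\<exists>u\<in>M. a \<le> I u \<and> I u \<le> b \<and> (norm (H u))\<^sup>2 < 2 * inverse (real (Suc n))" for n
    proof -
      have "0 < inverse (real (Suc n))" by simp
      thus ?thesis using c by (meson not_le)
    qed
    then obtain x where x: "\<And>n::nat. x n \<in> M" "\<And>n. a \<le> I (x n)" "\<And>n. I (x n) \<le> b"
      "\<And>n. (norm (H (x n)))\<^sup>2 < 2 * inverse (real (Suc n))" by metis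
    have "(\<lambda>n. 2 * inverse (real (Suc n))) \<longlonglongrightarrow> 2 * 0" by (intro tendsto_intros LIMSEQ_inverse_real_of_nat)
    hence "(\<lambda>n. (norm (H (x n)))\<^sup>2) \<longlonglongrightarrow> 0"
      by (intro Lim_null_comparison[of "\<lambda>n. (norm (H (x n)))\<^sup>2" "\<lambda>n. 2 * inverse (real (Suc n))"])
         (use x(4) in \<open>auto intro!: always_eventually less_imp_le simp del: of_nat_Suc\<close>)
    hence "(\<lambda>n. sqrt ((norm (H (x n)))\<^sup>2)) \<longlonglongrightarrow> sqrt 0" by (rule tendsto_real_sqrt)
    hence "(\<lambda>n. H (x n)) \<longlonglongrightarrow> 0" by (simp add: tendsto_norm_zero_iff)
    from palais_smale[OF x(1) IB[OF x(1) x(3)] this] obtain r u where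
      r: "strict_mono (r :: nat \<Rightarrow> nat)" "u \<in> M" "(x \<circ> r) \<longlonglongrightarrow> u" "H u = 0" by blast
    have "(\<lambda>n. I ((x \<circ> r) n)) \<longlonglongrightarrow> I u"
      by (rule continuous_on_tendsto_compose[OF I_cont r(3) MW[OF r(2)]]) (use x(1) MW in auto)
    hence "a \<le> I u" by (rule LIMSEQ_le_const) (use x(2) in auto)
    thus False using neg r by blast
  qed
  then obtain \<epsilon> where \<epsilon>: "0 < \<epsilon>" "\<And>u. u \<in> M \<Longrightarrow> a \<le> I u \<Longrightarrow> I u \<le> b \<Longrightarrow> 2 * \<epsilon> \<le> (norm (H u))\<^sup>2" by blast
  from step_decrease[OF \<epsilon>(1), of B] obtain \<tau> where \<tau>: "0 < \<tau>" "\<tau> * \<epsilon> \<le> 1"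
    "\<And>u. u \<in> M \<Longrightarrow> norm u \<le> B \<Longrightarrow> 0 < \<Psi> (u - \<tau> *\<^sub>R H u)"
    "\<And>u. u \<in> M \<Longrightarrow> norm u \<le> B \<Longrightarrow> I (step \<tau> u) \<le> I u - \<tau> * (norm (H u))\<^sup>2 + \<tau> * \<epsilon>" by blast
  define S where "S = {u \<in> M. I u \<le> b}"
  have SB: "norm u \<le> B" "u \<in> M" if "u \<in> S" for u using that IB by (auto simp: S_def B_def)
  \<comment> \<open>At energy a or higher a step gains at least \<tau> \<epsilon>. Below a it may
    lose, but at most \<tau> \<epsilon> \<le> 1, so the point stays below a + 1.\<close>
  have dec: "I (step \<tau> u) \<le> max (c - \<tau> * \<epsilon>) (a + 1)" if u: "u \<in> S" "I u \<le> max c (a + 1)" for u c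
  proof (cases "a \<le> I u")
    case True
    have "\<tau> * (2 * \<epsilon>) \<le> \<tau> * (norm (H u))\<^sup>2"
      using \<epsilon>(2)[OF SB(2)[OF u(1)] True] u(1) \<tau>(1) by (intro mult_left_mono) (auto simp: S_def)
    hence "I (step \<tau> u) \<le> I u - \<tau> * \<epsilon>" using \<tau>(4)[OF SB(2,1)[OF u(1)]] by (simp add: algebra_simps)
    moreover have "0 < \<tau> * \<epsilon>" using \<tau>(1) \<epsilon>(1) by simp
    ultimately show ?thesis using u(2) by linarith
  next
    case False
    have "0 \<le> \<tau> * (norm (H u))\<^sup>2" using \<tau>(1) by simp
    thus ?thesis using \<tau>(4)[OF SB(2,1)[OF u(1)]] \<tau>(2) False by linarith
  qed
  have stepS: "step \<tau> u \<in> S" if u: "u \<in> S" for u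
  proof -
    have "I (step \<tau> u) \<le> max (b - \<tau> * \<epsilon>) (a + 1)" by (rule dec[OF u]) (use u in \<open>auto simp: S_def\<close>)
    also have "\<dots> \<le> b" using b(1) \<tau>(1) \<epsilon>(1) by simp
    finally show ?thesis using step_in[OF SB(2)[OF u] \<tau>(3)[OF SB(2,1)[OF u]]] by (simp add: S_def)
  qed
  have scont: "continuous_on S (step \<tau>)"
    by (rule continuous_on_subset[OF step_cont]) (use SB \<tau>(3) in auto)
  define T where "T n = (step \<tau> ^^ n) \<circ> normalize" for n
  have T: "(\<forall>x\<in>?X. T n x \<in> S \<and> I (T n x) \<le> max (b - real n * (\<tau> * \<epsilon>)) (a + 1)) \<and> continuous_on ?X (T n)
     \<and> (\<forall>x\<in>?X. T n (- x) = - T n x)" for n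
  proof (induction n)
    case 0
    show ?case using nM b ncont XW normalize_odd by (auto simp: T_def S_def le_max_iff_disj)
  next
    case (Suc n)
    have Ts: "T (Suc n) x = step \<tau> (T n x)" for x by (simp add: T_def)
    have "continuous_on ?X (\<lambda>x. step \<tau> (T n x))"
      using Suc.IH by (intro continuous_on_compose2[OF scont]) auto
    moreover have "T (Suc n) (- x) = - T (Suc n) x" if "x \<in> ?X" for x
      using Suc.IH that step_odd[of "T n x" \<tau>] SB(2) MW by (simp add: Ts)
    moreover have "I (T (Suc n) x) \<le> max (b - real (Suc n) * (\<tau> * \<epsilon>)) (a + 1)" if "x \<in> ?X" for x
      using dec[of "T n x" "b - real n * (\<tau> * \<epsilon>)"] Suc.IH that by (simp add: Ts algebra_simps)
    ultimately show ?case using Suc.IH stepS by (auto simp: Ts[abs_def])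
  qed
  obtain n :: nat where n: "(b - (a + 1)) / (\<tau> * \<epsilon>) < real n" using reals_Archimedean2 by blast
  have "b - real n * (\<tau> * \<epsilon>) \<le> a + 1" using n \<tau>(1) \<epsilon>(1) by (simp add: field_simps)
  hence fin: "I (T n x) \<le> a + 1" if "x \<in> ?X" for x using T[of n] that by fastforce
  have TA: "T n x \<in> M" "norm (T n x) \<le> B1" if "x \<in> ?X" for x
    using T[of n] that SB(2) IB[OF _ fin[OF that]] by (auto simp: B1_def)
  have "k < k"
  proof (rule borsuk_ulam)
    fix i assume i: "i < k"
    show "continuous_on ?X (\<lambda>x. g i (T n x))"
      by (rule continuous_on_compose2[OF g(1)[OF i]]) (use T[of n] TA in auto)
    show "g i (T n (- x)) = - g i (T n x)" if "x \<in> ?X" for x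
      using T[of n] that g(2)[OF i TA(1)[OF that]] by simp
  qed (use g(3) TA in auto)
  thus False by simp
qed

end

section \<open>The space \<open>L\<^sup>2\<close>\<close>

text \<open>The codomain is any Euclidean space: scalar functions, gradients and pairs of both are
  all needed.\<close>

definition sq_integrable :: "('a::euclidean_space \<Rightarrow> 'b::euclidean_space) \<Rightarrow> bool" where
  "sq_integrable f \<longleftrightarrow> f \<in> borel_measurable lborel \<and> integrable lborel (\<lambda>x. (norm (f x))\<^sup>2)"

lemma sq_integrableD:
  assumes "sq_integrable f"
  shows "f \<in> borel_measurable lborel" "integrable lborel (\<lambda>x. (norm (f x))\<^sup>2)"
  using assms by (auto simp: sq_integrable_def)

lemma sq_integrable_inner:
  fixes f g :: "'a::euclidean_space \<Rightarrow> 'b::euclidean_space"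
  assumes "sq_integrable f" "sq_integrable g"
  shows "integrable lborel (\<lambda>x. inner (f x) (g x))"
proof (rule Bochner_Integration.integrable_bound)
  show "integrable lborel (\<lambda>x. (norm (f x))\<^sup>2 + (norm (g x))\<^sup>2)"
    using assms by (auto simp: sq_integrable_def)
  show "(\<lambda>x. inner (f x) (g x)) \<in> borel_measurable lborel"
    using sq_integrableD(1)[OF assms(1)] sq_integrableD(1)[OF assms(2)] by measurable
  have "\<bar>inner a b\<bar> \<le> (norm a)\<^sup>2 + (norm b)\<^sup>2" for a b :: 'b
    using Cauchy_Schwarz_ineq2[of a b] sum_squares_bound[of "norm a" "norm b"]
      mult_nonneg_nonneg[of "norm a" "norm b"] by simp
  thus "AE x in lborel. norm (inner (f x) (g x)) \<le> norm ((norm (f x))\<^sup>2 + (norm (g x))\<^sup>2)"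
    by (intro AE_I2) (auto intro: order_trans)
qed

lemma sq_integrable_add:
  fixes f g :: "'a::euclidean_space \<Rightarrow> 'b::euclidean_space"
  assumes "sq_integrable f" "sq_integrable g"
  shows "sq_integrable (\<lambda>x. f x + g x)"
proof -
  have "(\<lambda>x. (norm (f x + g x))\<^sup>2) = (\<lambda>x. (norm (f x))\<^sup>2 + 2 * inner (f x) (g x) + (norm (g x))\<^sup>2)"
    by (auto simp: fun_eq_iff power2_norm_eq_inner inner_simps inner_commute)
  moreover have "integrable lborel (\<lambda>x. (norm (f x))\<^sup>2 + 2 * inner (f x) (g x) + (norm (g x))\<^sup>2)"
    using sq_integrableD(2)[OF assms(1)] sq_integrableD(2)[OF assms(2)] sq_integrable_inner[OF assms] by auto
  moreover have "(\<lambda>x. f x + g x) \<in> borel_measurable lborel"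
    using sq_integrableD(1)[OF assms(1)] sq_integrableD(1)[OF assms(2)] by measurable
  ultimately show ?thesis by (simp add: sq_integrable_def)
qed

lemma sq_integrable_scaleR: "sq_integrable f \<Longrightarrow> sq_integrable (\<lambda>x. c *\<^sub>R f x)"
  unfolding sq_integrable_def by (auto simp: power_mult_distrib)

lemma sq_integrable_diff:
  fixes f g :: "'a::euclidean_space \<Rightarrow> 'b::euclidean_space"
  assumes "sq_integrable f" "sq_integrable g" shows "sq_integrable (\<lambda>x. f x - g x)"
  using sq_integrable_add[OF assms(1) sq_integrable_scaleR[OF assms(2), of "-1"]] by simp

lemma sq_integrable_zero: "sq_integrable (\<lambda>x. 0)"
  by (simp add: sq_integrable_def)

lemma sq_integrable_real:
  "sq_integrable (f :: 'a::euclidean_space \<Rightarrow> real) \<longleftrightarrow> f \<in> borel_measurable lborel \<and> integrable lborel (\<lambda>x. (f x)\<^sup>2)"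
  by (simp add: sq_integrable_def)

lemma sq_integrable_mult:
  fixes f g :: "'a::euclidean_space \<Rightarrow> real"
  assumes "sq_integrable f" "sq_integrable g" shows "integrable lborel (\<lambda>x. f x * g x)"
  using sq_integrable_inner[OF assms] by simp

text \<open>The predicate under the choice operator depends on f only through its class modulo null
  sets, so functions that agree almost everywhere receive the same representative. Equality in the
  type built from these is then equality almost everywhere.\<close>

definition canonical_rep :: "('a::euclidean_space \<Rightarrow> 'b::euclidean_space) \<Rightarrow> ('a \<Rightarrow> 'b)" where
  "canonical_rep f = (SOME g. sq_integrable g \<and> (AE x in lborel. g x = f x))"

lemma canonical_rep:
  assumes "sq_integrable f"
  shows "sq_integrable (canonical_rep f)" "AE x in lborel. canonical_rep f x = f x"
proof -
  have "sq_integrable (canonical_rep f) \<and> (AE x in lborel. canonical_rep f x = f x)"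
    unfolding canonical_rep_def by (rule someI[of _ f]) (use assms in auto)
  thus "sq_integrable (canonical_rep f)" "AE x in lborel. canonical_rep f x = f x" by auto
qed

lemma canonical_rep_cong:
  assumes "AE x in lborel. f x = g x"
  shows "canonical_rep f = canonical_rep g"
proof -
  have "(AE x in lborel. h x = f x) \<longleftrightarrow> (AE x in lborel. h x = g x)" for h
  proof
    assume "AE x in lborel. h x = f x"
    with assms show "AE x in lborel. h x = g x" by eventually_elim simp
  next
    assume "AE x in lborel. h x = g x"
    with assms show "AE x in lborel. h x = f x" by eventually_elim simp
  qed
  thus ?thesis by (simp add: canonical_rep_def)
qed

text \<open>Elements of \<open>L\<^sup>2\<close> are canonical representatives of almost-everywhere classes.\<close>
typedef (overloaded) ('a::euclidean_space, 'b::euclidean_space) L2 =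
  "{canonical_rep f | f :: 'a \<Rightarrow> 'b. sq_integrable f}" morphisms fn L2_Abs
  using sq_integrable_zero by blast

definition mk :: "('a::euclidean_space \<Rightarrow> 'b::euclidean_space) \<Rightarrow> ('a, 'b) L2" where
  "mk f = L2_Abs (canonical_rep f)"

lemma fn_mk: "sq_integrable f \<Longrightarrow> fn (mk f) = canonical_rep f"
  unfolding mk_def by (rule L2_Abs_inverse) auto

lemma AE_fn_mk: "sq_integrable f \<Longrightarrow> AE x in lborel. fn (mk f) x = f x"
  by (simp add: fn_mk canonical_rep)

lemma sq_integrable_fn: "sq_integrable (fn U)"
  using fn[of U] canonical_rep(1) by auto

lemma mk_cong: "AE x in lborel. f x = g x \<Longrightarrow> mk f = mk g"
  by (simp add: mk_def canonical_rep_cong)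

lemma mk_fn: "mk (fn U) = U"
proof -
  obtain f where f: "fn U = canonical_rep f" "sq_integrable f" using fn[of U] by auto
  have "canonical_rep (fn U) = canonical_rep f"
    unfolding f(1) by (rule canonical_rep_cong[OF canonical_rep(2)[OF f(2)]])
  thus ?thesis by (metis f(1) fn_inverse mk_def)
qed

lemma L2_eqI: "AE x in lborel. fn U x = fn V x \<Longrightarrow> U = V"
  using mk_cong[of "fn U" "fn V"] by (simp add: mk_fn)

instantiation L2 :: (euclidean_space, euclidean_space) real_inner
begin

definition zero_L2 :: "('a, 'b) L2" where "zero_L2 = mk (\<lambda>x. 0)"
definition plus_L2 :: "('a, 'b) L2 \<Rightarrow> ('a, 'b) L2 \<Rightarrow> ('a, 'b) L2" where
  "plus_L2 U V = mk (\<lambda>x. fn U x + fn V x)"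
definition scaleR_L2 :: "real \<Rightarrow> ('a, 'b) L2 \<Rightarrow> ('a, 'b) L2" where
  "scaleR_L2 c U = mk (\<lambda>x. c *\<^sub>R fn U x)"
definition uminus_L2 :: "('a, 'b) L2 \<Rightarrow> ('a, 'b) L2" where "uminus_L2 U = (-1) *\<^sub>R U"
definition minus_L2 :: "('a, 'b) L2 \<Rightarrow> ('a, 'b) L2 \<Rightarrow> ('a, 'b) L2" where "minus_L2 U V = U + (- V)"
definition inner_L2 :: "('a, 'b) L2 \<Rightarrow> ('a, 'b) L2 \<Rightarrow> real" where
  "inner_L2 U V = (LINT x|lborel. inner (fn U x) (fn V x))"
definition norm_L2 :: "('a, 'b) L2 \<Rightarrow> real" where "norm_L2 U = sqrt (inner U U)"
definition dist_L2 :: "('a, 'b) L2 \<Rightarrow> ('a, 'b) L2 \<Rightarrow> real" where "dist_L2 U V = norm (U - V)"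
definition sgn_L2 :: "('a, 'b) L2 \<Rightarrow> ('a, 'b) L2" where "sgn_L2 U = scaleR (inverse (norm U)) U"
definition [code del]: "uniformity_L2 = (INF e\<in>{0 <..}. principal {(x :: ('a, 'b) L2, y). dist x y < e})"
definition [code del]: "open_L2 (S :: ('a, 'b) L2 set) =
  (\<forall>x\<in>S. \<forall>\<^sub>F (x', y) in uniformity. x' = x \<longrightarrow> y \<in> S)"

lemma AE_fn_0: "AE x in lborel. fn (0 :: ('a, 'b) L2) x = 0"
  unfolding zero_L2_def by (rule AE_fn_mk[OF sq_integrable_zero])

lemma AE_fn_add: "AE x in lborel. fn (U + V :: ('a, 'b) L2) x = fn U x + fn V x"
  unfolding plus_L2_def by (rule AE_fn_mk[OF sq_integrable_add[OF sq_integrable_fn sq_integrable_fn]])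

lemma AE_fn_scaleR: "AE x in lborel. fn (c *\<^sub>R U :: ('a, 'b) L2) x = c *\<^sub>R fn U x"
  unfolding scaleR_L2_def by (rule AE_fn_mk[OF sq_integrable_scaleR[OF sq_integrable_fn]])

lemma AE_fn_uminus: "AE x in lborel. fn (- U :: ('a, 'b) L2) x = - fn U x"
  unfolding uminus_L2_def using AE_fn_scaleR[of "-1" U] by simp

instance
proof
  fix a b c :: "('a, 'b) L2" and r s :: real
  show "a + b + c = a + (b + c)"
    by (rule L2_eqI, use AE_fn_add[of "a + b" c] AE_fn_add[of a b] AE_fn_add[of a "b + c"] AE_fn_add[of b c]
      in eventually_elim) simp
  show "a + b = b + a"
    by (rule L2_eqI, use AE_fn_add[of a b] AE_fn_add[of b a] in eventually_elim) simp
  show "0 + a = a"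
    by (rule L2_eqI, use AE_fn_add[of 0 a] AE_fn_0 in eventually_elim) simp
  show "- a + a = 0"
    by (rule L2_eqI, use AE_fn_add[of "- a" a] AE_fn_uminus[of a] AE_fn_0 in eventually_elim) simp
  show "a - b = a + - b" by (simp add: minus_L2_def)
  show "r *\<^sub>R (a + b) = r *\<^sub>R a + r *\<^sub>R b"
    by (rule L2_eqI, use AE_fn_add[of a b] AE_fn_add[of "r *\<^sub>R a" "r *\<^sub>R b"] AE_fn_scaleR[of r a] AE_fn_scaleR[of r b]
       AE_fn_scaleR[of r "a + b"] in eventually_elim) (simp add: scaleR_add_right)
  show "(r + s) *\<^sub>R a = r *\<^sub>R a + s *\<^sub>R a"
    by (rule L2_eqI, use AE_fn_add[of "r *\<^sub>R a" "s *\<^sub>R a"] AE_fn_scaleR[of r a] AE_fn_scaleR[of s a]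
       AE_fn_scaleR[of "r + s" a] in eventually_elim) (simp add: scaleR_add_left)
  show "r *\<^sub>R s *\<^sub>R a = (r * s) *\<^sub>R a"
    by (rule L2_eqI, use AE_fn_scaleR[of r "s *\<^sub>R a"] AE_fn_scaleR[of s a]
       AE_fn_scaleR[of "r * s" a] in eventually_elim) simp
  show "1 *\<^sub>R a = a"
    by (rule L2_eqI, use AE_fn_scaleR[of 1 a] in eventually_elim) simp
  show "dist a b = norm (a - b)" by (simp add: dist_L2_def)
  show "sgn a = scaleR (inverse (norm a)) a" by (simp add: sgn_L2_def)
  show "uniformity = (INF e\<in>{0 <..}. principal {(x :: ('a, 'b) L2, y). dist x y < e})"
    by (rule uniformity_L2_def)
  show "open S = (\<forall>x\<in>S. \<forall>\<^sub>F (x', y) in uniformity. x' = x \<longrightarrow> y \<in> S)" for S :: "('a, 'b) L2 set"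
    by (rule open_L2_def)
  show "inner a b = inner b a" by (simp add: inner_L2_def inner_commute)
  have int: "integrable lborel (\<lambda>x. inner (fn u x) (fn v x))" for u v :: "('a, 'b) L2"
    by (rule sq_integrable_inner[OF sq_integrable_fn sq_integrable_fn])
  show "inner (a + b) c = inner a c + inner b c"
  proof -
    have "inner (a + b) c = (LINT x|lborel. inner (fn a x) (fn c x) + inner (fn b x) (fn c x))"
      unfolding inner_L2_def
    proof (rule integral_cong_AE)
      show "AE x in lborel. inner (fn (a + b) x) (fn c x) = inner (fn a x) (fn c x) + inner (fn b x) (fn c x)"
        using AE_fn_add[of a b] by eventually_elim (simp add: inner_add_left)
    qed (use int[THEN borel_measurable_integrable] in auto)
    thus ?thesis by (simp add: inner_L2_def int)
  qed
  show "inner (r *\<^sub>R a) b = r * inner a b"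
  proof -
    have "inner (r *\<^sub>R a) b = (LINT x|lborel. r * inner (fn a x) (fn b x))"
      unfolding inner_L2_def
    proof (rule integral_cong_AE)
      show "AE x in lborel. inner (fn (r *\<^sub>R a) x) (fn b x) = r * inner (fn a x) (fn b x)"
        using AE_fn_scaleR[of r a] by eventually_elim simp
    qed (use int[THEN borel_measurable_integrable] in auto)
    thus ?thesis by (simp add: inner_L2_def)
  qed
  show "0 \<le> inner a a" by (simp add: inner_L2_def)
  show "inner a a = 0 \<longleftrightarrow> a = 0"
  proof
    assume "inner a a = 0"
    hence "AE x in lborel. inner (fn a x) (fn a x) = 0"
      using integral_nonneg_eq_0_iff_AE[OF int[of a a]] by (simp add: inner_L2_def)
    hence "AE x in lborel. fn a x = fn 0 x" using AE_fn_0 by eventually_elim simp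
    thus "a = 0" by (rule L2_eqI)
  next
    assume "a = 0"
    have "AE x in lborel. inner (fn (0::('a, 'b) L2) x) (fn (0::('a, 'b) L2) x) = 0" using AE_fn_0 by eventually_elim simp
    thus "inner a a = 0" unfolding \<open>a = 0\<close> inner_L2_def
      by (rule integral_eq_zero_AE)
  qed
  show "norm a = sqrt (inner a a)" by (simp add: norm_L2_def)
qed

end

lemma inner_mk:
  assumes f: "sq_integrable f" and g: "sq_integrable g"
  shows "inner (mk f) (mk g) = (LINT x|lborel. inner (f x) (g x))"
  unfolding inner_L2_def
proof (rule integral_cong_AE)
  show "AE x in lborel. inner (fn (mk f) x) (fn (mk g) x) = inner (f x) (g x)"
    using AE_fn_mk[OF f] AE_fn_mk[OF g] by eventually_elim simp
qed (use sq_integrable_inner[THEN borel_measurable_integrable] f g sq_integrable_fn in auto)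

lemma norm_mk_sq:
  assumes "sq_integrable f"
  shows "(norm (mk f))\<^sup>2 = (LINT x|lborel. (norm (f x))\<^sup>2)"
  by (simp add: power2_norm_eq_inner inner_mk[OF assms assms])

lemma mk_add: "sq_integrable f \<Longrightarrow> sq_integrable g \<Longrightarrow> mk (\<lambda>x. f x + g x) = mk f + mk g"
  unfolding plus_L2_def
proof (rule mk_cong)
  assume f: "sq_integrable f" and g: "sq_integrable g"
  show "AE x in lborel. f x + g x = fn (mk f) x + fn (mk g) x"
    using AE_fn_mk[OF f] AE_fn_mk[OF g] by eventually_elim simp
qed

lemma mk_scaleR: "sq_integrable f \<Longrightarrow> mk (\<lambda>x. c *\<^sub>R f x) = c *\<^sub>R mk f"
  unfolding scaleR_L2_def
proof (rule mk_cong)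
  assume f: "sq_integrable f"
  show "AE x in lborel. c *\<^sub>R f x = c *\<^sub>R fn (mk f) x"
    using AE_fn_mk[OF f] by eventually_elim simp
qed

lemma mk_diff: "sq_integrable f \<Longrightarrow> sq_integrable g \<Longrightarrow> mk (\<lambda>x. f x - g x) = mk f - mk g"
  using mk_add[of f "\<lambda>x. (-1) *\<^sub>R g x"] mk_scaleR[of g "-1"] sq_integrable_scaleR[of g "-1"] by simp

text \<open>The sum of the 2^n |d n|^2 has an integral of at most the sum of the 2^(-n), so it is
  finite almost everywhere. At such points |d n| is O(2^(-n/2)), and the telescoping series
  converges.\<close>

lemma fast_Cauchy_L2_AE_limit:
  fixes X :: "nat \<Rightarrow> ('a::euclidean_space, 'b::euclidean_space) L2"
  assumes X: "\<And>n. (norm (X (Suc n) - X n))\<^sup>2 \<le> (1/4) ^ n"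
  shows "AE x in lborel. convergent (\<lambda>n. fn (X n) x)"
proof -
  define d where "d n x = fn (X (Suc n)) x - fn (X n) x" for n x
  have d: "sq_integrable (d n)" for n unfolding d_def by (intro sq_integrable_diff sq_integrable_fn)
  have dm: "d n \<in> borel_measurable lborel" for n using sq_integrableD(1)[OF d] .
  have int: "(LINT x|lborel. (norm (d n x))\<^sup>2) \<le> (1/4) ^ n" for n
  proof -
    have "(LINT x|lborel. (norm (d n x))\<^sup>2) = (norm (mk (d n)))\<^sup>2" by (rule norm_mk_sq[OF d, symmetric])
    also have "mk (d n) = X (Suc n) - X n" unfolding d_def by (simp add: mk_diff sq_integrable_fn mk_fn)
    finally show ?thesis using X[of n] by simp
  qed
  have nn: "(\<integral>\<^sup>+x. ennreal (2 ^ n * (norm (d n x))\<^sup>2) \<partial>lborel) \<le> ennreal ((1/2) ^ n)" for n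
  proof -
    have "(\<integral>\<^sup>+x. ennreal (2 ^ n * (norm (d n x))\<^sup>2) \<partial>lborel) = ennreal (LINT x|lborel. 2 ^ n * (norm (d n x))\<^sup>2)"
      by (rule nn_integral_eq_integral) (use sq_integrableD(2)[OF d[of n]] in auto)
    also have "(LINT x|lborel. 2 ^ n * (norm (d n x))\<^sup>2) \<le> 2 ^ n * (1/4) ^ n"
      using int[of n] by simp
    also have "(2::real) ^ n * (1/4) ^ n = (1/2) ^ n" by (simp add: power_mult_distrib[symmetric])
    finally show ?thesis by (simp add: ennreal_leI)
  qed
  have "(\<integral>\<^sup>+x. (\<Sum>n. ennreal (2 ^ n * (norm (d n x))\<^sup>2)) \<partial>lborel) = (\<Sum>n. \<integral>\<^sup>+x. ennreal (2 ^ n * (norm (d n x))\<^sup>2) \<partial>lborel)"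
    by (rule nn_integral_suminf) (use dm in measurable)
  also have "\<dots> \<le> (\<Sum>n. ennreal ((1/2) ^ n))" by (rule suminf_le[OF nn]) auto
  also have "\<dots> = ennreal (\<Sum>n. (1/2) ^ n)"
    by (rule suminf_ennreal2) (auto intro: summable_geometric)
  finally have "(\<integral>\<^sup>+x. (\<Sum>n. ennreal (2 ^ n * (norm (d n x))\<^sup>2)) \<partial>lborel) \<noteq> \<infinity>"
    by (auto simp: top_unique)
  hence "AE x in lborel. (\<Sum>n. ennreal (2 ^ n * (norm (d n x))\<^sup>2)) \<noteq> \<infinity>"
    by (intro nn_integral_PInf_AE) (use dm in measurable)
  thus ?thesis
  proof eventually_elim
    case (elim x)
    have "summable (\<lambda>n. 2 ^ n * (norm (d n x))\<^sup>2)"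
      by (rule summable_suminf_not_top) (use elim in auto)
    hence "(\<lambda>n. 2 ^ n * (norm (d n x))\<^sup>2) \<longlonglongrightarrow> 0" by (rule summable_LIMSEQ_zero)
    hence "Bseq (\<lambda>n. 2 ^ n * (norm (d n x))\<^sup>2)" by (intro convergent_imp_Bseq) (auto simp: convergent_def)
    then obtain K where K: "0 < K" "\<And>n. 2 ^ n * (norm (d n x))\<^sup>2 \<le> K" by (auto simp: Bseq_def)
    have "norm (d n x) \<le> sqrt K * (1 / sqrt 2) ^ n" for n
    proof (rule power2_le_imp_le)
      have "(norm (d n x))\<^sup>2 \<le> K * (1/2) ^ n" using K(2)[of n] by (simp add: field_simps)
      also have "\<dots> = (sqrt K * (1 / sqrt 2) ^ n)\<^sup>2"
        using K(1) by (simp add: power_mult_distrib power_mult[symmetric] mult.commute[of n] power_divide)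
           (simp add: power_mult)
      finally show "(norm (d n x))\<^sup>2 \<le> (sqrt K * (1 / sqrt 2) ^ n)\<^sup>2" .
    qed (use K in auto)
    moreover have "summable (\<lambda>n. sqrt K * (1 / sqrt 2) ^ n)"
      by (intro summable_mult summable_geometric) auto
    ultimately have "summable (\<lambda>n. d n x)" by (rule summable_comparison_test'[rotated])
    hence "convergent (\<lambda>n. \<Sum>i<n. d i x)" by (simp add: summable_iff_convergent)
    moreover have "(\<Sum>i<n. d i x) = fn (X n) x - fn (X 0) x" for n
      by (induction n) (auto simp: d_def)
    ultimately have "convergent (\<lambda>n. (fn (X n) x - fn (X 0) x) + fn (X 0) x)"
      by (intro convergent_add convergent_const) (simp only:)
    thus ?case by simp
  qed
qed

instance L2 :: (euclidean_space, euclidean_space) complete_space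
proof
  fix X :: "nat \<Rightarrow> ('a, 'b) L2"
  assume C: "Cauchy X"
  have "\<exists>N. \<forall>m\<ge>N. \<forall>n\<ge>N. norm (X m - X n) < (1/2) ^ k" for k
    using CauchyD[OF C, of "(1/2) ^ k"] by auto
  then obtain N where N: "\<And>k m n. N k \<le> m \<Longrightarrow> N k \<le> n \<Longrightarrow> norm (X m - X n) < (1/2) ^ k" by metis
  \<comment> \<open>Adding the N i and k makes r strictly increasing and keeps r k \<ge> N
    k.\<close>
  define r where "r k = (\<Sum>i\<le>k. N i) + k" for k
  have rN: "N k \<le> r k" for k
    using member_le_sum[of k "{..k}" N] by (auto simp: r_def)
  have r: "strict_mono r" by (rule strict_monoI_Suc) (simp add: r_def)
  have "(norm (X (r (Suc k)) - X (r k)))\<^sup>2 \<le> (1/4) ^ k" for k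
  proof -
    have "r k \<le> r (Suc k)" using strict_mono_leD[OF r] by simp
    hence "norm (X (r (Suc k)) - X (r k)) \<le> (1/2) ^ k" using N[of k] rN[of k] by (intro less_imp_le) auto
    hence "(norm (X (r (Suc k)) - X (r k)))\<^sup>2 \<le> ((1/2) ^ k)\<^sup>2" by (intro power_mono) auto
    thus ?thesis by (simp add: power_mult[symmetric] mult.commute[of k]) (simp add: power_mult power2_eq_square)
  qed
  from fast_Cauchy_L2_AE_limit[of "X \<circ> r"] this
  have ae: "AE x in lborel. convergent (\<lambda>n. fn (X (r n)) x)" by simp
  define l where "l x = lim (\<lambda>n. fn (X (r n)) x)" for x
  have fnm: "fn U \<in> borel_measurable lborel" for U :: "('a, 'b) L2" using sq_integrableD(1)[OF sq_integrable_fn] .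
  have lm: "l \<in> borel_measurable lborel" unfolding l_def
    by (rule borel_measurable_lim_metric) (rule fnm)
  have AEl: "AE x in lborel. (\<lambda>n. fn (X (r n)) x) \<longlonglongrightarrow> l x"
    using ae by eventually_elim (simp add: l_def convergent_LIMSEQ_iff)
  \<comment> \<open>Fatou's lemma carries the Cauchy estimate over to the pointwise limit l. It
    yields both the square integrability of l and the convergence of X.\<close>
  have fatou: "(\<integral>\<^sup>+x. ennreal ((norm (l x - fn (X m) x))\<^sup>2) \<partial>lborel) \<le> ennreal (((1/2) ^ k)\<^sup>2)"
    if m: "N k \<le> m" for k m
  proof -
    have lim: "AE x in lborel. ennreal ((norm (l x - fn (X m) x))\<^sup>2)
        = liminf (\<lambda>n. ennreal ((norm (fn (X (r n)) x - fn (X m) x))\<^sup>2))"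
      using AEl
    proof eventually_elim
      case (elim x)
      have "(\<lambda>n. ennreal ((norm (fn (X (r n)) x - fn (X m) x))\<^sup>2)) \<longlonglongrightarrow> ennreal ((norm (l x - fn (X m) x))\<^sup>2)"
        by (intro tendsto_ennrealI tendsto_intros elim)
      thus ?case using lim_imp_Liminf trivial_limit_sequentially by metis
    qed
    have "(\<integral>\<^sup>+x. ennreal ((norm (l x - fn (X m) x))\<^sup>2) \<partial>lborel)
       = (\<integral>\<^sup>+x. liminf (\<lambda>n. ennreal ((norm (fn (X (r n)) x - fn (X m) x))\<^sup>2)) \<partial>lborel)"
      by (rule nn_integral_cong_AE[OF lim])
    also have "\<dots> \<le> liminf (\<lambda>n. \<integral>\<^sup>+x. ennreal ((norm (fn (X (r n)) x - fn (X m) x))\<^sup>2) \<partial>lborel)"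
      by (rule nn_integral_liminf) (use fnm in measurable)
    also have "\<dots> \<le> ennreal (((1/2) ^ k)\<^sup>2)"
    proof (rule Liminf_le)
      show "\<forall>\<^sub>F n in sequentially. (\<integral>\<^sup>+x. ennreal ((norm (fn (X (r n)) x - fn (X m) x))\<^sup>2) \<partial>lborel) \<le> ennreal (((1/2) ^ k)\<^sup>2)"
        unfolding eventually_sequentially
      proof (intro exI[of _ "N k"] allI impI)
        fix n assume "N k \<le> n"
        hence "N k \<le> r n" using seq_suble[OF r, of n] by simp
        hence "norm (X (r n) - X m) \<le> (1/2) ^ k" using N[OF _ m] by (intro less_imp_le) auto
        hence le: "(norm (X (r n) - X m))\<^sup>2 \<le> ((1/2) ^ k)\<^sup>2" by (intro power_mono) auto
        have s: "sq_integrable (\<lambda>x. fn (X (r n)) x - fn (X m) x)" by (intro sq_integrable_diff sq_integrable_fn)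
        have "(\<integral>\<^sup>+x. ennreal ((norm (fn (X (r n)) x - fn (X m) x))\<^sup>2) \<partial>lborel)
            = ennreal (LINT x|lborel. (norm (fn (X (r n)) x - fn (X m) x))\<^sup>2)"
          by (rule nn_integral_eq_integral) (use sq_integrableD(2)[OF s] in auto)
        also have "(LINT x|lborel. (norm (fn (X (r n)) x - fn (X m) x))\<^sup>2) = (norm (X (r n) - X m))\<^sup>2"
          using norm_mk_sq[OF s] by (simp add: mk_diff sq_integrable_fn mk_fn)
        finally show "(\<integral>\<^sup>+x. ennreal ((norm (fn (X (r n)) x - fn (X m) x))\<^sup>2) \<partial>lborel) \<le> ennreal (((1/2) ^ k)\<^sup>2)"
          using le by (simp add: ennreal_leI)
      qed
    qed simp
    finally show ?thesis .
  qed
  have dsq: "sq_integrable (\<lambda>x. l x - fn (X m) x)" if "N k \<le> m" for k m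
  proof -
    have "integrable lborel (\<lambda>x. (norm (l x - fn (X m) x))\<^sup>2)"
    proof (rule integrableI_bounded)
      show "(\<lambda>x. (norm (l x - fn (X m) x))\<^sup>2) \<in> borel_measurable lborel" using lm fnm by measurable
      show "(\<integral>\<^sup>+x. ennreal (norm ((norm (l x - fn (X m) x))\<^sup>2)) \<partial>lborel) < \<infinity>"
        using fatou[OF that] by (auto intro: le_less_trans)
    qed
    thus ?thesis using lm fnm by (auto simp: sq_integrable_def)
  qed
  have lsq: "sq_integrable l"
    using sq_integrable_add[OF dsq[OF order_refl[of "N 0"]] sq_integrable_fn[of "X (N 0)"]] by simp
  have "X \<longlonglongrightarrow> mk l"
  proof (rule LIMSEQ_I)
    fix e :: real assume e: "0 < e"
    obtain k where k: "(1/2::real) ^ k < e" using real_arch_pow_inv[OF e, of "1/2"] by auto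
    show "\<exists>no. \<forall>n\<ge>no. norm (X n - mk l) < e"
    proof (intro exI[of _ "N k"] allI impI)
      fix n assume n: "N k \<le> n"
      have eq: "mk l - X n = mk (\<lambda>x. l x - fn (X n) x)" by (simp add: mk_diff lsq sq_integrable_fn mk_fn)
      have "ennreal ((norm (mk l - X n))\<^sup>2) = (\<integral>\<^sup>+x. ennreal ((norm (l x - fn (X n) x))\<^sup>2) \<partial>lborel)"
        unfolding eq norm_mk_sq[OF dsq[OF n]]
        by (rule nn_integral_eq_integral[symmetric]) (use sq_integrableD(2)[OF dsq[OF n]] in auto)
      also have "\<dots> \<le> ennreal (((1/2) ^ k)\<^sup>2)" by (rule fatou[OF n])
      finally have "(norm (mk l - X n))\<^sup>2 \<le> ((1/2) ^ k)\<^sup>2" by (simp add: ennreal_le_iff)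
      hence "norm (mk l - X n) \<le> (1/2) ^ k" by (rule power2_le_imp_le) auto
      thus "norm (X n - mk l) < e" using k by (simp add: norm_minus_commute)
    qed
  qed
  thus "convergent X" by (auto simp: convergent_def)
qed

section \<open>Test functions\<close>

lemma pdiff_eqI: "((\<lambda>t. g (x + t *\<^sub>R axis i 1)) has_real_derivative d) (at 0) \<Longrightarrow> pdiff i g x = d"
  unfolding pdiff_def by (rule some_equality) (auto intro: DERIV_unique)

text \<open>A set of continuous functions that is closed under partial derivatives contains all
  iterated derivatives of its members. Each closure property of smooth functions below supplies such
  a set.\<close>

lemma smooth3_coinduct:
  assumes "g \<in> \<C>" and cont: "\<And>h. h \<in> \<C> \<Longrightarrow> continuous_on UNIV h"
    and der: "\<And>h i. h \<in> \<C> \<Longrightarrow>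
       \<exists>h'\<in>\<C>. \<forall>x. ((\<lambda>t. h (x + t *\<^sub>R axis i 1)) has_real_derivative h' x) (at 0)"
  shows "smooth3 g"
proof -
  have in\<C>: "iter_pdiff is g \<in> \<C>" for "is"
  proof (induction "is")
    case (Cons i "is")
    obtain h' where h': "h' \<in> \<C>"
      "\<And>x. ((\<lambda>t. iter_pdiff is g (x + t *\<^sub>R axis i 1)) has_real_derivative h' x) (at 0)"
      using der[OF Cons.IH, of i] by blast
    have "iter_pdiff (i # is) g = h'" using pdiff_eqI[OF h'(2)] by (simp add: fun_eq_iff)
    thus ?case using h'(1) by simp
  qed (use assms(1) in simp)
  have "((\<lambda>t. iter_pdiff is g (x + t *\<^sub>R axis i 1)) has_real_derivative pdiff i (iter_pdiff is g) x) (at 0)" for "is" i x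
    using der[OF in\<C>[of "is"], of i] pdiff_eqI by metis
  thus ?thesis unfolding smooth3_def using cont[OF in\<C>] by blast
qed

lemma smooth3_cont: "smooth3 g \<Longrightarrow> continuous_on UNIV g"
  unfolding smooth3_def by (metis iter_pdiff.simps(1))

lemma smooth3_deriv0:
  "smooth3 g \<Longrightarrow> ((\<lambda>t. g (x + t *\<^sub>R axis i 1)) has_real_derivative pdiff i g x) (at 0)"
  unfolding smooth3_def by (metis iter_pdiff.simps(1))

lemma smooth3_deriv:
  assumes "smooth3 g"
  shows "((\<lambda>t. g (x + t *\<^sub>R axis i 1)) has_real_derivative pdiff i g (x + s *\<^sub>R axis i 1)) (at s)"
proof -
  have "((\<lambda>t. g ((x + s *\<^sub>R axis i 1) + t *\<^sub>R axis i 1)) has_real_derivative pdiff i g (x + s *\<^sub>R axis i 1)) (at 0)"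
    by (rule smooth3_deriv0[OF assms])
  hence "((\<lambda>t. g (x + (t + s) *\<^sub>R axis i 1)) has_real_derivative pdiff i g (x + s *\<^sub>R axis i 1)) (at 0)"
    by (simp add: algebra_simps)
  thus ?thesis using DERIV_shift[of "\<lambda>t. g (x + t *\<^sub>R axis i 1)" _ 0 s] by simp
qed

lemma iter_pdiff_pdiff: "iter_pdiff is (pdiff i g) = iter_pdiff (is @ [i]) g"
  by (induction "is") auto

lemma smooth3_pdiff: "smooth3 g \<Longrightarrow> smooth3 (pdiff i g)"
  unfolding smooth3_def iter_pdiff_pdiff by blast

lemma smooth3_add:
  assumes "smooth3 g" "smooth3 h" shows "smooth3 (\<lambda>x. g x + h x)"
proof (rule smooth3_coinduct[where \<C>="{\<lambda>x. a x + b x | a b. smooth3 a \<and> smooth3 b}"])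
  fix k i assume "k \<in> {\<lambda>x. a x + b x | a b. smooth3 a \<and> smooth3 b}"
  then obtain a b where k: "k = (\<lambda>x. a x + b x)" and ab: "smooth3 a" "smooth3 b" by auto
  show "continuous_on UNIV k" unfolding k by (intro continuous_intros smooth3_cont ab)
  show "\<exists>h'\<in>{\<lambda>x. a x + b x | a b. smooth3 a \<and> smooth3 b}. \<forall>x. ((\<lambda>t. k (x + t *\<^sub>R axis i 1)) has_real_derivative h' x) (at 0)"
    by (rule bexI[of _ "\<lambda>x. pdiff i a x + pdiff i b x"])
       (use ab in \<open>auto simp: k intro!: DERIV_add smooth3_deriv0 smooth3_pdiff\<close>)
qed (use assms in auto)

lemma smooth3_cmult:
  assumes "smooth3 g" shows "smooth3 (\<lambda>x. c * g x)"
proof (rule smooth3_coinduct[where \<C>="{\<lambda>x. c * a x | a. smooth3 a}"])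
  fix k i assume "k \<in> {\<lambda>x. c * a x | a. smooth3 a}"
  then obtain a where k: "k = (\<lambda>x. c * a x)" and ab: "smooth3 a" by auto
  show "continuous_on UNIV k" unfolding k by (intro continuous_intros smooth3_cont ab)
  show "\<exists>h'\<in>{\<lambda>x. c * a x | a. smooth3 a}. \<forall>x. ((\<lambda>t. k (x + t *\<^sub>R axis i 1)) has_real_derivative h' x) (at 0)"
    by (rule bexI[of _ "\<lambda>x. c * pdiff i a x"])
       (use ab in \<open>auto simp: k intro!: DERIV_cmult smooth3_deriv0 smooth3_pdiff\<close>)
qed (use assms in auto)

lemma pdiff_translate: "pdiff i (\<lambda>x. g (x + a)) x = pdiff i g (x + a)"
  unfolding pdiff_def by (simp add: algebra_simps)

lemma smooth3_translate:
  assumes "smooth3 g" shows "smooth3 (\<lambda>x. g (x + c))"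
proof (rule smooth3_coinduct[where \<C>="{\<lambda>x. a (x + c) | a. smooth3 a}"])
  fix k i assume "k \<in> {\<lambda>x. a (x + c) | a. smooth3 a}"
  then obtain a where k: "k = (\<lambda>x. a (x + c))" and ab: "smooth3 a" by auto
  show "continuous_on UNIV k" unfolding k
    by (rule continuous_on_compose2[OF smooth3_cont[OF ab]]) (auto intro!: continuous_intros)
  have "((\<lambda>t. k (x + t *\<^sub>R axis i 1)) has_real_derivative pdiff i a (x + c)) (at 0)" for x
    using smooth3_deriv0[OF ab, of "x + c" i] by (simp add: k algebra_simps)
  thus "\<exists>h'\<in>{\<lambda>x. a (x + c) | a. smooth3 a}. \<forall>x. ((\<lambda>t. k (x + t *\<^sub>R axis i 1)) has_real_derivative h' x) (at 0)"
    by (intro bexI[of _ "\<lambda>x. pdiff i a (x + c)"]) (use smooth3_pdiff[OF ab] in auto)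
qed (use assms in auto)

lemma test_fun_iff: "test_fun \<phi> \<longleftrightarrow> smooth3 \<phi> \<and> (\<exists>r. \<forall>x. \<phi> x \<noteq> 0 \<longrightarrow> norm x \<le> r)"
proof -
  have "compact (closure {x. \<phi> x \<noteq> 0}) \<longleftrightarrow> (\<exists>r. \<forall>x. \<phi> x \<noteq> 0 \<longrightarrow> norm x \<le> r)"
    by (simp add: bounded_iff)
  thus ?thesis by (auto simp: test_fun_def)
qed

lemma test_fun_add: "test_fun \<phi> \<Longrightarrow> test_fun \<psi> \<Longrightarrow> test_fun (\<lambda>x. \<phi> x + \<psi> x)"
proof -
  assume a: "test_fun \<phi>" "test_fun \<psi>"
  then obtain r s where rs: "\<And>x. \<phi> x \<noteq> 0 \<Longrightarrow> norm x \<le> r" "\<And>x. \<psi> x \<noteq> 0 \<Longrightarrow> norm x \<le> s"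
    by (auto simp: test_fun_iff)
  have "norm x \<le> max r s" if "\<phi> x + \<psi> x \<noteq> 0" for x
  proof -
    have "\<phi> x \<noteq> 0 \<or> \<psi> x \<noteq> 0" using that by auto
    thus ?thesis using rs by force
  qed
  thus ?thesis using a by (auto simp: test_fun_iff smooth3_add)
qed

lemma test_fun_cmult: "test_fun \<phi> \<Longrightarrow> test_fun (\<lambda>x. c * \<phi> x)"
  by (auto simp: test_fun_iff smooth3_cmult)

lemma test_fun_translate: "test_fun \<phi> \<Longrightarrow> test_fun (\<lambda>x. \<phi> (x + c))"
proof -
  assume a: "test_fun \<phi>"
  then obtain r where r: "\<And>x. \<phi> x \<noteq> 0 \<Longrightarrow> norm x \<le> r" by (auto simp: test_fun_iff)
  have "norm x \<le> r + norm c" if "\<phi> (x + c) \<noteq> 0" for x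
    using r[OF that] norm_triangle_ineq4[of "x + c" c] by simp
  thus ?thesis using a by (auto simp: test_fun_iff smooth3_translate)
qed

lemma test_fun_pdiff_support:
  assumes a: "smooth3 \<phi>" and r: "\<And>x. \<phi> x \<noteq> 0 \<Longrightarrow> norm x \<le> r" and x: "pdiff i \<phi> x \<noteq> 0"
  shows "norm x \<le> r"
proof (rule ccontr)
  assume nx: "\<not> norm x \<le> r"
  have "((\<lambda>t. \<phi> (x + t *\<^sub>R axis i 1)) has_real_derivative 0) (at 0)"
  proof (rule has_field_derivative_transform_within[where f="\<lambda>_. 0" and d="norm x - r"])
    fix t :: real assume "dist t 0 < norm x - r"
    hence "r < norm x - norm (t *\<^sub>R axis i (1::real) :: R3)" by (simp add: norm_axis_1)
    also have "\<dots> \<le> norm (x + t *\<^sub>R axis i 1)" using norm_diff_ineq[of x "t *\<^sub>R axis i 1"] by simp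
    finally show "0 = \<phi> (x + t *\<^sub>R axis i 1)" using r[of "x + t *\<^sub>R axis i 1"] by fastforce
  qed (use nx in auto)
  hence "pdiff i \<phi> x = 0" by (rule pdiff_eqI)
  thus False using x by simp
qed

lemma test_fun_pdiff: "test_fun \<phi> \<Longrightarrow> test_fun (pdiff i \<phi>)"
  unfolding test_fun_iff using test_fun_pdiff_support smooth3_pdiff by metis

lemma test_fun_cont: "test_fun \<phi> \<Longrightarrow> continuous_on UNIV \<phi>"
  by (simp add: test_fun_def smooth3_cont)

lemma test_fun_measurable: "test_fun \<phi> \<Longrightarrow> \<phi> \<in> borel_measurable lborel"
  using borel_measurable_continuous_onI[OF test_fun_cont] by simp

lemma test_fun_bounded: "test_fun \<phi> \<Longrightarrow> \<exists>C\<ge>0. \<forall>x. \<bar>\<phi> x\<bar> \<le> C"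
proof -
  assume a: "test_fun \<phi>"
  then obtain r where r: "\<And>x. \<phi> x \<noteq> 0 \<Longrightarrow> norm x \<le> r" by (auto simp: test_fun_iff)
  have "compact (\<phi> ` cball 0 r)"
    by (intro compact_continuous_image continuous_on_subset[OF test_fun_cont[OF a]]) auto
  then obtain C where C: "\<And>x. x \<in> cball 0 r \<Longrightarrow> \<bar>\<phi> x\<bar> \<le> C"
    using compact_imp_bounded bounded_real by (metis imageI)
  have "\<bar>\<phi> x\<bar> \<le> max C 0" for x using r[of x] C[of x] by (cases "\<phi> x = 0") auto
  thus ?thesis by (intro exI[of _ "max C 0"]) auto
qed

lemma test_fun_sq_integrable: "test_fun \<phi> \<Longrightarrow> sq_integrable \<phi>"
proof -
  assume a: "test_fun \<phi>"
  then obtain r where r: "\<And>x. \<phi> x \<noteq> 0 \<Longrightarrow> norm x \<le> r" by (auto simp: test_fun_iff)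
  have "integrable lborel (\<lambda>x. indicator (cball 0 r) x *\<^sub>R (\<phi> x)\<^sup>2)"
    by (intro borel_integrable_compact continuous_intros continuous_on_subset[OF test_fun_cont[OF a]]) auto
  moreover have "(\<lambda>x. indicator (cball 0 r) x *\<^sub>R (\<phi> x)\<^sup>2) = (\<lambda>x. (\<phi> x)\<^sup>2)"
    using r by (auto simp: fun_eq_iff indicator_def)
  ultimately show ?thesis using test_fun_measurable[OF a] by (simp add: sq_integrable_real)
qed

section \<open>Smooth bump functions\<close>

text \<open>The profile t^(-k) exp(-1/t), extended by 0 to t \<le> 0. Differentiation leads to
  combinations of the same profiles with larger k, so the family is stable.\<close>

definition expinv :: "nat \<Rightarrow> real \<Rightarrow> real" where
  "expinv k t = (if t \<le> 0 then 0 else (1 / t) ^ k * exp (- (1 / t)))"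

lemma expinv_tendsto_0: "(expinv k \<longlongrightarrow> 0) (at 0)"
proof -
  have "((\<lambda>t::real. (inverse t) ^ k / exp (inverse t)) \<longlongrightarrow> 0) (at_right 0)"
    by (rule filterlim_compose[OF tendsto_power_div_exp_0 filterlim_inverse_at_top_right])
  moreover have "\<forall>\<^sub>F t in at_right (0::real). (inverse t) ^ k / exp (inverse t) = expinv k t"
    by (rule eventually_at_right_less[THEN eventually_mono])
       (auto simp: expinv_def exp_minus field_simps)
  ultimately have r: "(expinv k \<longlongrightarrow> 0) (at_right 0)" by (rule Lim_transform_eventually)
  have "\<forall>\<^sub>F t in at_left (0::real). 0 = expinv k t"
    by (rule eventually_at_left_real[of "-1" 0, THEN eventually_mono]) (auto simp: expinv_def)
  hence "(expinv k \<longlongrightarrow> 0) (at_left 0)" by (rule Lim_transform_eventually[OF tendsto_const])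
  thus ?thesis using r by (simp add: filterlim_at_split)
qed

lemma expinv_deriv: "(expinv k has_real_derivative expinv (k + 2) t - real k * expinv (k + 1) t) (at t)"
proof -
  consider "t < 0" | "t = 0" | "t > 0" by linarith
  thus ?thesis
  proof cases
    case 1
    have "(expinv k has_real_derivative 0) (at t)"
      by (rule has_field_derivative_transform_within[where f="\<lambda>_. 0" and d="-t"])
         (use 1 in \<open>auto simp: expinv_def dist_real_def\<close>)
    thus ?thesis using 1 by (simp add: expinv_def)
  next
    case 2
    have "((\<lambda>h. (expinv k h - expinv k 0) / (h - 0)) \<longlongrightarrow> 0) (at 0)"
    proof (rule Lim_transform_eventually[OF expinv_tendsto_0[of "k + 1"]])
      show "\<forall>\<^sub>F h in at 0. expinv (k + 1) h = (expinv k h - expinv k 0) / (h - 0)"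
        by (auto simp: eventually_at_filter expinv_def)
    qed
    thus ?thesis using 2 by (simp add: has_field_derivative_iff expinv_def)
  next
    case 3
    have "((\<lambda>t. (1 / t) ^ k * exp (- (1 / t))) has_real_derivative
        (real k * (1 / t) ^ (k - 1) * (- 1 / t\<^sup>2)) * exp (- (1 / t)) + (exp (- (1 / t)) * (1 / t\<^sup>2)) * (1 / t) ^ k) (at t)"
      by (rule derivative_eq_intros refl | (use 3 in simp; fail))+
         (use 3 in \<open>auto simp: power2_eq_square\<close>)
    also have "(real k * (1 / t) ^ (k - 1) * (- 1 / t\<^sup>2)) * exp (- (1 / t)) + (exp (- (1 / t)) * (1 / t\<^sup>2)) * (1 / t) ^ k
       = expinv (k + 2) t - real k * expinv (k + 1) t"
      using 3 by (cases k) (simp_all add: expinv_def power2_eq_square field_simps)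
    finally have d: "((\<lambda>t. (1 / t) ^ k * exp (- (1 / t))) has_real_derivative expinv (k + 2) t - real k * expinv (k + 1) t) (at t)" .
    show ?thesis
      by (rule has_field_derivative_transform_within[OF d, where d=t])
         (use 3 in \<open>auto simp: expinv_def dist_real_def\<close>)
  qed
qed

text \<open>The algebra generated by these profiles in affine functions of a single coordinate. It
  is closed under partial derivatives and thus fits \<open>smooth3_coinduct\<close>.\<close>

inductive_set bump_class :: "(R3 \<Rightarrow> real) set" where
  base: "(\<lambda>x. expinv k (c * x $ i + d)) \<in> bump_class"
| const: "(\<lambda>x. a) \<in> bump_class"
| add: "g \<in> bump_class \<Longrightarrow> h \<in> bump_class \<Longrightarrow> (\<lambda>x. g x + h x) \<in> bump_class"
| mult: "g \<in> bump_class \<Longrightarrow> h \<in> bump_class \<Longrightarrow> (\<lambda>x. g x * h x) \<in> bump_class"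

lemma continuous_on_expinv: "continuous_on UNIV (expinv k)"
  by (intro DERIV_continuous_on) (use expinv_deriv in auto)

lemma bump_class_smooth: "g \<in> bump_class \<Longrightarrow> smooth3 g"
proof (rule smooth3_coinduct[where \<C>=bump_class])
  fix h assume "h \<in> bump_class"
  thus "continuous_on UNIV h"
    by induction (auto intro!: continuous_intros continuous_on_compose2[OF continuous_on_expinv])
next
  fix h i assume "h \<in> bump_class"
  thus "\<exists>h'\<in>bump_class. \<forall>x. ((\<lambda>t. h (x + t *\<^sub>R axis i 1)) has_real_derivative h' x) (at 0)"
  proof induction
    case (base k c j d)
    let ?e = "c * (if i = j then 1 else 0)"
    let ?h = "\<lambda>x. ?e * (expinv (k + 2) (c * x $ j + d) + (- real k) * expinv (k + 1) (c * x $ j + d))"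
    have "?h \<in> bump_class" by (intro bump_class.intros)
    moreover have "((\<lambda>t. expinv k (c * (x + t *\<^sub>R axis i 1) $ j + d)) has_real_derivative ?h x) (at 0)" for x
    proof -
      have l: "((\<lambda>t. c * (x + t *\<^sub>R axis i 1) $ j + d) has_real_derivative ?e) (at 0)"
        by (auto intro!: derivative_eq_intros simp: axis_def)
      have "((\<lambda>t. expinv k (c * (x + t *\<^sub>R axis i 1) $ j + d)) has_real_derivative
          (expinv (k + 2) (c * (x + 0 *\<^sub>R axis i 1) $ j + d) - real k * expinv (k + 1) (c * (x + 0 *\<^sub>R axis i 1) $ j + d)) * ?e) (at 0)"
        by (rule DERIV_chain2[OF expinv_deriv l])
      thus ?thesis by (simp add: algebra_simps)
    qed
    ultimately show ?case by (intro bexI[of _ ?h] allI)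
  next
    case (const a)
    show ?case by (intro bexI[of _ "\<lambda>_. 0"]) (auto intro: bump_class.const)
  next
    case (add g h)
    then obtain g' h' where g': "g' \<in> bump_class" "h' \<in> bump_class"
      "\<And>x. ((\<lambda>t. g (x + t *\<^sub>R axis i 1)) has_real_derivative g' x) (at 0)"
      "\<And>x. ((\<lambda>t. h (x + t *\<^sub>R axis i 1)) has_real_derivative h' x) (at 0)" by blast
    show ?case
      by (rule bexI[of _ "\<lambda>x. g' x + h' x"]) (auto intro!: DERIV_add g' bump_class.add)
  next
    case (mult g h)
    then obtain g' h' where g': "g' \<in> bump_class" "h' \<in> bump_class"
      "\<And>x. ((\<lambda>t. g (x + t *\<^sub>R axis i 1)) has_real_derivative g' x) (at 0)"
      "\<And>x. ((\<lambda>t. h (x + t *\<^sub>R axis i 1)) has_real_derivative h' x) (at 0)" by blast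
    have d: "((\<lambda>t. g (x + t *\<^sub>R axis i 1) * h (x + t *\<^sub>R axis i 1)) has_real_derivative g' x * h x + h' x * g x) (at 0)" for x
      using DERIV_mult[OF g'(3,4), of x] by simp
    show ?case
      by (rule bexI[of _ "\<lambda>x. g' x * h x + h' x * g x"]) (intro allI d bump_class.intros g' mult)+
  qed
qed

text \<open>For n > 0 it is positive exactly on \<open>box a b\<close>, and as n grows it tends to
  the indicator of the box. The arguments are spelled as c * x $ i + d in order to match the
  generators of \<open>bump_class\<close>.\<close>

definition bump :: "real \<Rightarrow> R3 \<Rightarrow> R3 \<Rightarrow> R3 \<Rightarrow> real" where
  "bump n a b x = (\<Prod>i\<in>UNIV. expinv 0 (n * x $ i + (- n * a $ i)) * expinv 0 ((- n) * x $ i + n * b $ i))"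

lemma bump_class_prod:
  "finite A \<Longrightarrow> (\<And>i. i \<in> A \<Longrightarrow> F i \<in> bump_class) \<Longrightarrow> (\<lambda>x. \<Prod>i\<in>A. F i x) \<in> bump_class"
  by (induction A rule: finite_induct) (auto intro: bump_class.intros)

lemma expinv_0_bounds: "0 \<le> expinv 0 t" "expinv 0 t \<le> 1" "0 < t \<Longrightarrow> 0 < expinv 0 t" "t \<le> 0 \<Longrightarrow> expinv 0 t = 0"
  by (auto simp: expinv_def)

lemma bump_bounds: "0 \<le> bump n a b x" "bump n a b x \<le> 1"
  unfolding bump_def
  by (auto intro!: prod_nonneg prod_le_1 mult_nonneg_nonneg mult_le_one simp: expinv_0_bounds)

lemma mem_box_vec: "x \<in> box a b \<longleftrightarrow> (\<forall>i. a $ i < x $ i \<and> x $ i < b $ i)" for x a b :: R3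
  by (simp add: mem_box_cart)

lemma bump_eq_0: "0 < n \<Longrightarrow> x \<notin> box a b \<Longrightarrow> bump n a b x = 0"
proof -
  assume n: "0 < n" and "x \<notin> box a b"
  then obtain i where "x $ i \<le> a $ i \<or> b $ i \<le> x $ i" by (auto simp: mem_box_vec not_less)
  hence "n * x $ i + (- n * a $ i) \<le> 0 \<or> (- n) * x $ i + n * b $ i \<le> 0"
    using n by (auto simp: mult_left_mono)
  hence f: "expinv 0 (n * x $ i + (- n * a $ i)) * expinv 0 ((- n) * x $ i + n * b $ i) = 0"
    using expinv_0_bounds(4) by (metis mult_eq_0_iff)
  show ?thesis unfolding bump_def by (rule prod_zero, simp, rule bexI[of _ i], rule f, simp)
qed

lemma bump_pos: "0 < n \<Longrightarrow> x \<in> box a b \<Longrightarrow> 0 < bump n a b x"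
  unfolding bump_def mem_box_vec
  by (intro prod_pos) (auto intro!: mult_pos_pos expinv_0_bounds(3))

lemma test_fun_bump: "0 < n \<Longrightarrow> test_fun (bump n a b)"
proof -
  assume n: "0 < n"
  have "(\<lambda>x. \<Prod>i\<in>(UNIV :: 3 set). expinv 0 (n * x $ i + (- n * a $ i)) * expinv 0 ((- n) * x $ i + n * b $ i)) \<in> bump_class"
    by (rule bump_class_prod, simp, intro bump_class.intros)
  hence "smooth3 (bump n a b)" unfolding bump_def[abs_def] by (rule bump_class_smooth)
  moreover obtain r where "\<forall>x\<in>box a b. norm x \<le> r" using bounded_box bounded_iff by blast
  ultimately show ?thesis using bump_eq_0[OF n] unfolding test_fun_iff by blast
qed

lemma bump_tendsto: "(\<lambda>n. bump (real (Suc n)) a b x) \<longlonglongrightarrow> indicator (box a b) x"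
proof (cases "x \<in> box a b")
  case False
  thus ?thesis by (simp add: bump_eq_0 del: of_nat_Suc)
next
  case True
  have e: "(\<lambda>n. expinv 0 (real (Suc n) * s)) \<longlonglongrightarrow> 1" if s: "0 < s" for s
  proof -
    have "(\<lambda>n. exp (- (inverse (real (Suc n)) * (1 / s)))) \<longlonglongrightarrow> exp (- (0 * (1 / s)))"
      by (intro tendsto_intros LIMSEQ_inverse_real_of_nat)
    moreover have "expinv 0 (real (Suc n) * s) = exp (- (inverse (real (Suc n)) * (1 / s)))" for n
    proof -
      have "\<not> real (Suc n) * s \<le> 0" using s by (simp add: not_le del: of_nat_Suc)
      thus ?thesis by (simp add: expinv_def inverse_eq_divide del: of_nat_Suc)
    qed
    ultimately show ?thesis by simp
  qed
  have "(\<lambda>n. \<Prod>i\<in>(UNIV :: 3 set). expinv 0 (real (Suc n) * (x $ i - a $ i)) * expinv 0 (real (Suc n) * (b $ i - x $ i)))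
     \<longlonglongrightarrow> (\<Prod>i\<in>(UNIV :: 3 set). 1 * 1)"
    by (intro tendsto_prod tendsto_mult e) (use True in \<open>auto simp: mem_box_vec\<close>)
  moreover have "bump (real (Suc n)) a b x = (\<Prod>i\<in>(UNIV :: 3 set). expinv 0 (real (Suc n) * (x $ i - a $ i)) * expinv 0 (real (Suc n) * (b $ i - x $ i)))" for n
    unfolding bump_def by (rule prod.cong) (auto simp: algebra_simps)
  ultimately show ?thesis using True by simp
qed

section \<open>Density of test functions\<close>

lemma sq_integrable_indicator:
  assumes "A \<in> sets borel" "bounded (A :: 'a::euclidean_space set)"
  shows "sq_integrable (indicator A :: 'a \<Rightarrow> real)"
proof -
  have "emeasure lborel A < \<infinity>" using assms emeasure_bounded_finite by auto
  hence "integrable lborel (indicator A :: 'a \<Rightarrow> real)" using assms by (simp add: integrable_indicator_iff)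
  moreover have "(\<lambda>x. (indicator A x :: real)\<^sup>2) = indicator A" by (auto simp: indicator_def)
  ultimately show ?thesis using assms by (simp add: sq_integrable_real)
qed

text \<open>The sets A for which g has integral 0 over A \<inter> box a b form a Dynkin system
  containing the boxes; these are stable under intersection and generate the Borel sets. The fixed
  box keeps all integrals finite, and at the end boxes exhaust the space.\<close>

lemma integral_over_boxes_zero_imp_AE:
  fixes g :: "'a::euclidean_space \<Rightarrow> real"
  assumes g: "g \<in> borel_measurable lborel" "\<And>A. A \<in> sets borel \<Longrightarrow> bounded A \<Longrightarrow> integrable lborel (\<lambda>x. indicator A x * g x)"
    and box: "\<And>a b. (LINT x|lborel. indicator (box a b) x * g x) = 0"
  shows "AE x in lborel. g x = 0"
proof -
  have all: "(LINT x|lborel. indicator (A \<inter> box a b) x * g x) = 0" if A: "A \<in> sets borel" for A and a b :: 'a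
  proof -
    have int: "integrable lborel (\<lambda>x. indicator (S \<inter> box a b) x * g x)" if "S \<in> sets borel" for S
      using that by (intro g(2)) (auto intro: bounded_subset[OF bounded_box])
    have A': "A \<in> sigma_sets UNIV (range (\<lambda>(a, b). box a b :: 'a set))"
      using A unfolding borel_eq_box by (simp add: sets_measure_of)
    have stable: "Int_stable (range (\<lambda>(a, b). box a b :: 'a set))"
      by (auto simp: Int_stable_def box_Int_box)
    show ?thesis
    proof (rule sigma_sets_induct_disjoint[OF stable _ A'])
      show "range (\<lambda>(a, b). box a b :: 'a set) \<subseteq> Pow UNIV" by simp
    next
      fix S assume "S \<in> range (\<lambda>(a, b). box a b :: 'a set)"
      thus "(LINT x|lborel. indicator (S \<inter> box a b) x * g x) = 0" by (auto simp: box_Int_box box)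
    next
      show "(LINT x|lborel. indicator ({} \<inter> box a b) x * g x) = 0" by simp
    next
      fix S assume S: "S \<in> sigma_sets UNIV (range (\<lambda>(a, b). box a b :: 'a set))"
        "(LINT x|lborel. indicator (S \<inter> box a b) x * g x) = 0"
      have Sb: "S \<in> sets borel" using S(1) unfolding borel_eq_box by (simp add: sets_measure_of)
      have "(LINT x|lborel. indicator ((UNIV - S) \<inter> box a b) x * g x)
         = (LINT x|lborel. indicator (UNIV \<inter> box a b) x * g x - indicator (S \<inter> box a b) x * g x)"
        by (rule Bochner_Integration.integral_cong) (auto simp: indicator_def)
      also have "\<dots> = 0" using int[of UNIV] int[OF Sb] S(2) box by simp
      finally show "(LINT x|lborel. indicator ((UNIV - S) \<inter> box a b) x * g x) = 0" .
    next
      fix S :: "nat \<Rightarrow> 'a set"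
      assume S: "disjoint_family S" "range S \<subseteq> sigma_sets UNIV (range (\<lambda>(a, b). box a b :: 'a set))"
        "\<And>i. (LINT x|lborel. indicator (S i \<inter> box a b) x * g x) = 0"
      have Sb: "S i \<in> sets borel" for i using S(2) unfolding borel_eq_box by (auto simp: sets_measure_of)
      have "set_lebesgue_integral lborel (\<Union>i. S i \<inter> box a b) g = (\<Sum>i. set_lebesgue_integral lborel (S i \<inter> box a b) g)"
      proof (rule lebesgue_integral_countable_add)
        show "set_integrable lborel (\<Union>i. S i \<inter> box a b) g"
          using int[of "\<Union>i. S i"] Sb by (auto simp: set_integrable_def)
      qed (use Sb S(1) in \<open>auto simp: disjoint_family_on_def\<close>)
      thus "(LINT x|lborel. indicator (\<Union> (range S) \<inter> box a b) x * g x) = 0"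
        using S(3) by (simp add: set_lebesgue_integral_def)
    qed
  qed
  have "AE x in lborel. indicator (box (- real n *\<^sub>R One) (real n *\<^sub>R One)) x * g x = 0" for n
  proof -
    let ?B = "box (- real n *\<^sub>R One) (real n *\<^sub>R One) :: 'a set"
    show ?thesis
    proof (rule density_unique_real)
      show "integrable lborel (\<lambda>x. indicator ?B x * g x)" by (rule g(2)) auto
      fix A :: "'a set" assume "A \<in> sets lborel"
      hence "(LINT x|lborel. indicator (A \<inter> ?B) x * g x) = 0" by (intro all) simp
      moreover have "(LINT x|lborel. indicator A x *\<^sub>R (indicator ?B x * g x)) = (LINT x|lborel. indicator (A \<inter> ?B) x * g x)"
        by (rule Bochner_Integration.integral_cong) (auto simp: indicator_def)
      ultimately show "(\<integral>x\<in>A. (indicator ?B x * g x) \<partial>lborel) = (\<integral>x\<in>A. 0 \<partial>lborel)"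
        by (simp only: set_lebesgue_integral_def) simp
    qed simp
  qed
  hence "AE x in lborel. \<forall>n. indicator (box (- real n *\<^sub>R One) (real n *\<^sub>R One)) x * g x = 0"
    unfolding AE_all_countable by blast
  thus ?thesis
  proof eventually_elim
    case (elim x)
    obtain n :: nat where "norm x < real n" using reals_Archimedean2 by blast
    hence "x \<in> box (- real n *\<^sub>R One) (real n *\<^sub>R One)"
      using Basis_le_norm[of _ x] by (fastforce simp: mem_box abs_less_iff inner_simps)
    thus ?case using elim[rule_format, of n] by simp
  qed
qed

text \<open>The bumps converge to the indicator of a box and are dominated by it, so g has integral
  0 over every box.\<close>

lemma fundamental_lemma:
  assumes g: "sq_integrable (g :: R3 \<Rightarrow> real)"
    and z: "\<And>\<phi>. test_fun \<phi> \<Longrightarrow> (LINT x|lborel. g x * \<phi> x) = 0"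
  shows "AE x in lborel. g x = 0"
proof (rule integral_over_boxes_zero_imp_AE)
  have gm: "g \<in> borel_measurable lborel" using sq_integrableD(1)[OF g] .
  thus "g \<in> borel_measurable lborel" .
  show ind: "integrable lborel (\<lambda>x. indicator A x * g x)" if "A \<in> sets borel" "bounded A" for A
    by (rule sq_integrable_mult[OF sq_integrable_indicator[OF that] g])
  fix a b :: R3
  have "(\<lambda>n. LINT x|lborel. g x * bump (real (Suc n)) a b x) \<longlonglongrightarrow> (LINT x|lborel. indicator (box a b) x * g x)"
  proof (rule integral_dominated_convergence[where w="\<lambda>x. \<bar>indicator (box a b) x * g x\<bar>"])
    show "integrable lborel (\<lambda>x. \<bar>indicator (box a b) x * g x\<bar>)" by (intro integrable_abs ind) auto
    show "AE x in lborel. (\<lambda>n. g x * bump (real (Suc n)) a b x) \<longlonglongrightarrow> indicator (box a b) x * g x"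
      using tendsto_mult_left[OF bump_tendsto] by (auto simp: mult.commute)
    show "AE x in lborel. norm (g x * bump (real (Suc n)) a b x) \<le> \<bar>indicator (box a b) x * g x\<bar>" for n
    proof (intro AE_I2)
      fix x
      show "norm (g x * bump (real (Suc n)) a b x) \<le> \<bar>indicator (box a b) x * g x\<bar>"
        using bump_bounds[of "real (Suc n)" a b x] bump_eq_0[of "real (Suc n)" x a b]
        by (cases "x \<in> box a b") (auto simp: abs_mult mult_left_le simp del: of_nat_Suc)
    qed
  next
    show "(\<lambda>x. g x * bump (real (Suc n)) a b x) \<in> borel_measurable lborel" for n
      using gm test_fun_measurable[OF test_fun_bump[of "real (Suc n)" a b]] by auto
  qed (use gm in measurable)
  moreover have "(LINT x|lborel. g x * bump (real (Suc n)) a b x) = 0" for n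
    by (rule z[OF test_fun_bump]) simp
  ultimately have "(\<lambda>n::nat. 0::real) \<longlonglongrightarrow> (LINT x|lborel. indicator (box a b) x * g x)"
    by (simp only:)
  thus "(LINT x|lborel. indicator (box a b) x * g x) = 0"
    by (simp add: LIMSEQ_const_iff)
qed

definition tests :: "(R3, real) L2 set" where "tests = mk ` {\<phi>. test_fun \<phi>}"

lemma subspace_tests: "subspace tests"
proof (rule subspaceI)
  have "test_fun (\<lambda>x. 0)" using test_fun_cmult[OF test_fun_bump[of 1 0 0], of 0] by simp
  thus "0 \<in> tests" by (auto simp: tests_def zero_L2_def)
  fix U V assume "U \<in> tests" "V \<in> tests"
  then obtain \<phi> \<psi> where "U = mk \<phi>" "V = mk \<psi>" "test_fun \<phi>" "test_fun \<psi>" by (auto simp: tests_def)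
  thus "U + V \<in> tests"
    using test_fun_add[of \<phi> \<psi>] mk_add[of \<phi> \<psi>] test_fun_sq_integrable by (force simp: tests_def)
next
  fix c U assume "U \<in> tests"
  then obtain \<phi> where "U = mk \<phi>" "test_fun \<phi>" by (auto simp: tests_def)
  thus "c *\<^sub>R U \<in> tests"
    using test_fun_cmult[of \<phi> c] mk_scaleR[of \<phi> c] test_fun_sq_integrable by (force simp: tests_def)
qed

lemma closure_tests: "closure tests = UNIV"
proof (rule dense_subspace[OF subspace_tests])
  fix G :: "(R3, real) L2" assume orth: "\<And>x. x \<in> tests \<Longrightarrow> inner G x = 0"
  have "AE x in lborel. fn G x = 0"
  proof (rule fundamental_lemma[OF sq_integrable_fn])
    fix \<phi> :: "R3 \<Rightarrow> real" assume "test_fun \<phi>"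
    hence "inner (mk (fn G)) (mk \<phi>) = 0" "sq_integrable \<phi>"
      using orth by (auto simp: tests_def mk_fn test_fun_sq_integrable)
    thus "(LINT x|lborel. fn G x * \<phi> x) = 0" using inner_mk[OF sq_integrable_fn, of \<phi> G] by simp
  qed
  hence "AE x in lborel. fn G x = fn 0 x" using AE_fn_0 by eventually_elim simp
  thus "G = 0" by (rule L2_eqI)
qed

lemma norm_le_by_tests:
  fixes G :: "(R3, real) L2"
  assumes "0 \<le> C" and "\<And>\<phi>. test_fun \<phi> \<Longrightarrow> inner G (mk \<phi>) \<le> C * norm (mk \<phi>)"
  shows "norm G \<le> C"
proof -
  obtain X where X: "\<And>n. X n \<in> tests" "X \<longlonglongrightarrow> G"
    using closure_sequential[of G tests] unfolding closure_tests by auto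
  have "inner G (X n) \<le> C * norm (X n)" for n
  proof -
    obtain \<phi> where "X n = mk \<phi>" "test_fun \<phi>" using X(1)[of n] unfolding tests_def by blast
    thus ?thesis using assms(2)[of \<phi>] by simp
  qed
  moreover have "(\<lambda>n. inner G (X n)) \<longlonglongrightarrow> inner G G" "(\<lambda>n. C * norm (X n)) \<longlonglongrightarrow> C * norm G"
    by (rule tendsto_inner[OF tendsto_const X(2)], rule tendsto_mult_left[OF tendsto_norm[OF X(2)]])
  ultimately have "inner G G \<le> C * norm G" by (intro LIMSEQ_le[of "\<lambda>n. inner G (X n)"]) auto
  hence "norm G * norm G \<le> C * norm G" by (simp add: power2_norm_eq_inner[symmetric] power2_eq_square)
  thus ?thesis using assms(1) by (cases "norm G = 0") (auto simp: mult_le_cancel_right)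
qed

section \<open>Weak gradients\<close>

lemma integral_test_mult:
  "sq_integrable u \<Longrightarrow> test_fun \<phi> \<Longrightarrow> integrable lborel (\<lambda>x. u x * \<phi> x)"
  by (rule sq_integrable_mult[OF _ test_fun_sq_integrable])

lemma sq_integrable_component:
  fixes g :: "R3 \<Rightarrow> R3"
  assumes "sq_integrable g" shows "sq_integrable (\<lambda>x. g x $ i)"
proof -
  have "(\<lambda>x. inner (g x) (axis i 1)) \<in> borel_measurable lborel"
    using sq_integrableD(1)[OF assms] by measurable
  hence gi: "(\<lambda>x. g x $ i) \<in> borel_measurable lborel" by (simp add: inner_axis)
  have "integrable lborel (\<lambda>x. (g x $ i)\<^sup>2)"
  proof (rule Bochner_Integration.integrable_bound[OF sq_integrableD(2)[OF assms]])
    have "(g x $ i)\<^sup>2 \<le> (norm (g x))\<^sup>2" for x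
      using power_mono[OF component_le_norm_cart[of "g x" i], of 2] by simp
    thus "AE x in lborel. norm ((g x $ i)\<^sup>2) \<le> norm ((norm (g x))\<^sup>2)" by simp
  qed (use gi in auto)
  thus ?thesis using gi by (simp add: sq_integrable_real)
qed

lemma L2_grad_sq: "L2_grad u g \<Longrightarrow> sq_integrable g"
  by (simp add: L2_grad_def sq_integrable_def)

lemma L2_gradI:
  "sq_integrable g \<Longrightarrow> (\<And>i \<phi>. test_fun \<phi> \<Longrightarrow>
     (LINT x|lborel. u x * pdiff i \<phi> x) = - (LINT x|lborel. (g x $ i) * \<phi> x)) \<Longrightarrow> L2_grad u g"
  by (simp add: L2_grad_def sq_integrable_def weak_grad_def)

lemma L2_gradD:
  "L2_grad u g \<Longrightarrow> test_fun \<phi> \<Longrightarrow>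
     (LINT x|lborel. u x * pdiff i \<phi> x) = - (LINT x|lborel. (g x $ i) * \<phi> x)"
  by (simp add: L2_grad_def weak_grad_def)

lemma L2_grad_unique:
  assumes "L2_grad u g" "L2_grad u h"
  shows "AE x in lborel. g x = h x"
proof -
  have "AE x in lborel. g x $ i - h x $ i = 0" for i
  proof (rule fundamental_lemma)
    show "sq_integrable (\<lambda>x. g x $ i - h x $ i)"
      by (intro sq_integrable_diff sq_integrable_component L2_grad_sq[OF assms(1)] L2_grad_sq[OF assms(2)])
    fix \<phi> :: "R3 \<Rightarrow> real" assume \<phi>: "test_fun \<phi>"
    have "(LINT x|lborel. (g x $ i) * \<phi> x) = (LINT x|lborel. (h x $ i) * \<phi> x)"
      using L2_gradD[OF assms(1) \<phi>, of i] L2_gradD[OF assms(2) \<phi>, of i] by simp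
    thus "(LINT x|lborel. (g x $ i - h x $ i) * \<phi> x) = 0"
      using integral_test_mult[OF sq_integrable_component[OF L2_grad_sq[OF assms(1)], of i] \<phi>]
        integral_test_mult[OF sq_integrable_component[OF L2_grad_sq[OF assms(2)], of i] \<phi>]
      by (simp add: left_diff_distrib)
  qed
  hence "AE x in lborel. \<forall>i\<in>UNIV. g x $ i - h x $ i = 0" by (intro AE_finite_allI) auto
  thus ?thesis by eventually_elim (simp add: vec_eq_iff)
qed

lemma H1_iff: "u \<in> H1 \<longleftrightarrow> sq_integrable u \<and> (\<exists>g. L2_grad u g)"
  by (simp add: H1_def sq_integrable_real)

lemma H1_sq: "u \<in> H1 \<Longrightarrow> sq_integrable u" by (simp add: H1_iff)

lemma L2_grad_grad: "u \<in> H1 \<Longrightarrow> L2_grad u (grad u)"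
  unfolding grad_def H1_iff using someI_ex[of "L2_grad u"] by blast

lemma grad_sq: "u \<in> H1 \<Longrightarrow> sq_integrable (grad u)"
  by (rule L2_grad_sq[OF L2_grad_grad])

lemma grad_eqI: "u \<in> H1 \<Longrightarrow> L2_grad u g \<Longrightarrow> AE x in lborel. grad u x = g x"
  by (rule L2_grad_unique[OF L2_grad_grad])

lemma L2_grad_linear:
  assumes u: "sq_integrable u" "L2_grad u g" and v: "sq_integrable v" "L2_grad v h"
  shows "L2_grad (\<lambda>x. a * u x + b * v x) (\<lambda>x. a *\<^sub>R g x + b *\<^sub>R h x)"
proof (rule L2_gradI)
  show "sq_integrable (\<lambda>x. a *\<^sub>R g x + b *\<^sub>R h x)"
    by (intro sq_integrable_add sq_integrable_scaleR L2_grad_sq[OF u(2)] L2_grad_sq[OF v(2)])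
  fix i :: 3 and \<phi> :: "R3 \<Rightarrow> real" assume \<phi>: "test_fun \<phi>"
  note p = test_fun_pdiff[OF \<phi>, of i]
  have i: "integrable lborel (\<lambda>x. u x * pdiff i \<phi> x)" "integrable lborel (\<lambda>x. v x * pdiff i \<phi> x)"
    "integrable lborel (\<lambda>x. g x $ i * \<phi> x)" "integrable lborel (\<lambda>x. h x $ i * \<phi> x)"
    by (intro integral_test_mult u v p \<phi> sq_integrable_component L2_grad_sq[OF u(2)] L2_grad_sq[OF v(2)])+
  have "(LINT x|lborel. (a * u x + b * v x) * pdiff i \<phi> x)
     = (LINT x|lborel. a * (u x * pdiff i \<phi> x) + b * (v x * pdiff i \<phi> x))"
    by (simp add: algebra_simps)
  also have "\<dots> = a * (LINT x|lborel. u x * pdiff i \<phi> x) + b * (LINT x|lborel. v x * pdiff i \<phi> x)"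
    using i by simp
  also have "\<dots> = - (a * (LINT x|lborel. g x $ i * \<phi> x) + b * (LINT x|lborel. h x $ i * \<phi> x))"
    by (simp add: L2_gradD[OF u(2) \<phi>] L2_gradD[OF v(2) \<phi>])
  also have "\<dots> = - (LINT x|lborel. a * (g x $ i * \<phi> x) + b * (h x $ i * \<phi> x))"
    using i by simp
  also have "\<dots> = - (LINT x|lborel. (a *\<^sub>R g x + b *\<^sub>R h x) $ i * \<phi> x)"
    by (simp add: algebra_simps)
  finally show "(LINT x|lborel. (a * u x + b * v x) * pdiff i \<phi> x) = - (LINT x|lborel. (a *\<^sub>R g x + b *\<^sub>R h x) $ i * \<phi> x)" .
qed

lemma H1_linear:
  assumes "u \<in> H1" "v \<in> H1"
  shows "(\<lambda>x. a * u x + b * v x) \<in> H1"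
    and "AE x in lborel. grad (\<lambda>x. a * u x + b * v x) x = a *\<^sub>R grad u x + b *\<^sub>R grad v x"
proof -
  have g: "L2_grad (\<lambda>x. a * u x + b * v x) (\<lambda>x. a *\<^sub>R grad u x + b *\<^sub>R grad v x)"
    by (intro L2_grad_linear H1_sq L2_grad_grad assms)
  have "sq_integrable (\<lambda>x. a *\<^sub>R u x + b *\<^sub>R v x)"
    by (intro sq_integrable_add sq_integrable_scaleR H1_sq assms)
  thus h: "(\<lambda>x. a * u x + b * v x) \<in> H1" using g by (auto simp: H1_iff)
  show "AE x in lborel. grad (\<lambda>x. a * u x + b * v x) x = a *\<^sub>R grad u x + b *\<^sub>R grad v x"
    by (rule grad_eqI[OF h g])
qed

lemma L2_grad_cong:
  assumes g: "L2_grad u g" and eq: "AE x in lborel. u x = v x" and m: "u \<in> borel_measurable lborel" "v \<in> borel_measurable lborel"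
  shows "L2_grad v g"
proof (rule L2_gradI[OF L2_grad_sq[OF g]])
  fix i :: 3 and \<phi> :: "R3 \<Rightarrow> real" assume \<phi>: "test_fun \<phi>"
  have "(LINT x|lborel. v x * pdiff i \<phi> x) = (LINT x|lborel. u x * pdiff i \<phi> x)"
  proof (rule integral_cong_AE)
    show "AE x in lborel. v x * pdiff i \<phi> x = u x * pdiff i \<phi> x" using eq by eventually_elim simp
  qed (use m test_fun_measurable[OF test_fun_pdiff[OF \<phi>]] in auto)
  thus "(LINT x|lborel. v x * pdiff i \<phi> x) = - (LINT x|lborel. g x $ i * \<phi> x)"
    using L2_gradD[OF g \<phi>] by simp
qed

text \<open>The defining identity equates inner products with fixed elements of L^2, and these are
  continuous. The i-th component of a gradient is tested by the vector field \<phi> times the i-th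
  unit vector.\<close>

lemma L2_grad_limit:
  assumes u: "\<And>n. sq_integrable (u n)" "\<And>n. L2_grad (u n) (g n)" "sq_integrable v" "sq_integrable h"
    and lim: "(\<lambda>n. mk (u n)) \<longlonglongrightarrow> mk v" "(\<lambda>n. mk (g n)) \<longlonglongrightarrow> mk h"
  shows "L2_grad v h"
proof (rule L2_gradI[OF u(4)])
  fix i :: 3 and \<phi> :: "R3 \<Rightarrow> real" assume \<phi>: "test_fun \<phi>"
  have \<psi>: "sq_integrable (\<lambda>x. axis i (\<phi> x) :: R3)"
  proof -
    have "(\<lambda>x. axis i (\<phi> x) :: R3) = (\<lambda>x. \<phi> x *\<^sub>R axis i 1)"
      by (auto simp: fun_eq_iff vec_eq_iff axis_def)
    thus ?thesis using test_fun_sq_integrable[OF \<phi>] by (auto simp: sq_integrable_def norm_axis_1)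
  qed
  have a: "inner (mk f) (mk (\<lambda>x. axis i (\<phi> x) :: R3)) = (LINT x|lborel. f x $ i * \<phi> x)" if "sq_integrable f" for f :: "R3 \<Rightarrow> R3"
    by (simp add: inner_mk[OF that \<psi>] inner_axis)
  have b: "inner (mk f) (mk (pdiff i \<phi>)) = (LINT x|lborel. f x * pdiff i \<phi> x)" if "sq_integrable f" for f
    using inner_mk[OF that test_fun_sq_integrable[OF test_fun_pdiff[OF \<phi>]], of i] by simp
  have "(\<lambda>n. inner (mk (u n)) (mk (pdiff i \<phi>))) \<longlonglongrightarrow> inner (mk v) (mk (pdiff i \<phi>))"
    "(\<lambda>n. - inner (mk (g n)) (mk (\<lambda>x. axis i (\<phi> x) :: R3))) \<longlonglongrightarrow> - inner (mk h) (mk (\<lambda>x. axis i (\<phi> x) :: R3))"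
    by (intro tendsto_intros lim)+
  moreover have "inner (mk (u n)) (mk (pdiff i \<phi>)) = - inner (mk (g n)) (mk (\<lambda>x. axis i (\<phi> x) :: R3))" for n
    using L2_gradD[OF u(2)[of n] \<phi>, of i] by (simp add: a[OF L2_grad_sq[OF u(2)]] b[OF u(1)])
  ultimately have "inner (mk v) (mk (pdiff i \<phi>)) = - inner (mk h) (mk (\<lambda>x. axis i (\<phi> x) :: R3))"
    using LIMSEQ_unique by simp
  thus "(LINT x|lborel. v x * pdiff i \<phi> x) = - (LINT x|lborel. h x $ i * \<phi> x)"
    by (simp add: a[OF u(4)] b[OF u(3)])
qed

section \<open>Translations and difference quotients\<close>

lemma lborel_integral_translate:
  fixes f :: "'a::euclidean_space \<Rightarrow> 'b::{banach, second_countable_topology}"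
  shows "(LINT x|lborel. f (x + c)) = (LINT x|lborel. f x)"
proof -
  have "(LINT x|lborel. f x) = (LINT x|distr lborel borel ((+) c). f x)" by (simp add: lborel_distr_plus)
  also have "\<dots> = (LINT x|lborel. f (c + x))"
  proof (cases "f \<in> borel_measurable borel")
    case True
    thus ?thesis by (intro integral_distr) auto
  next
    \<comment> \<open>For a function that is not Borel measurable both integrals take the default
      value 0.\<close>
    case False
    have "(\<lambda>x. f (c + x)) \<notin> borel_measurable borel"
    proof
      assume "(\<lambda>x. f (c + x)) \<in> borel_measurable borel"
      hence "(\<lambda>x. f (c + (- c + x))) \<in> borel_measurable borel"
        by (rule measurable_compose[rotated]) auto
      thus False using False by simp
    qed
    hence "\<not> integrable lborel (\<lambda>x. f (c + x))" by (auto dest: borel_measurable_integrable)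
    moreover have "\<not> integrable lborel f" using False by (auto dest: borel_measurable_integrable)
    ultimately show ?thesis by (simp add: lborel_distr_plus not_integrable_integral_eq)
  qed
  finally show ?thesis by (simp add: add.commute)
qed

lemma sq_integrable_translate:
  assumes "sq_integrable f" shows "sq_integrable (\<lambda>x. f (x + c))"
proof -
  have m: "f \<in> borel_measurable borel" using sq_integrableD(1)[OF assms] by simp
  have "(\<lambda>x. f (x + c)) \<in> borel_measurable borel"
    by (rule measurable_compose[OF _ m]) auto
  moreover have "integrable (distr lborel borel ((+) c)) (\<lambda>x. (norm (f x))\<^sup>2)"
    using sq_integrableD(2)[OF assms] by (simp add: lborel_distr_plus)
  hence "integrable lborel (\<lambda>x. (norm (f (c + x)))\<^sup>2)"
    by (subst (asm) integrable_distr_eq) (use m in auto)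
  ultimately show ?thesis by (simp add: sq_integrable_def add.commute)
qed

lemma test_fun_difference_bound:
  assumes \<phi>: "test_fun \<phi>" and C: "\<And>x. \<bar>pdiff i \<phi> x\<bar> \<le> C"
  shows "\<bar>\<phi> (x + t *\<^sub>R axis i 1) - \<phi> x\<bar> \<le> C * \<bar>t\<bar>"
proof -
  have "norm (\<phi> (x + t *\<^sub>R axis i 1) - \<phi> (x + 0 *\<^sub>R axis i 1)) \<le> C * norm (t - 0)"
  proof (rule field_differentiable_bound[where S=UNIV])
    show "((\<lambda>t. \<phi> (x + t *\<^sub>R axis i 1)) has_field_derivative pdiff i \<phi> (x + s *\<^sub>R axis i 1)) (at s within UNIV)" for s
      using smooth3_deriv \<phi> by (auto simp: test_fun_def)
  qed (use C in auto)
  thus ?thesis by simp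
qed

text \<open>Differentiation in the translation parameter links weak derivatives, difference
  quotients and integration by parts. The difference quotients of \<phi> are bounded by C and
  supported in one ball, so convergence is dominated.\<close>

lemma translate_pairing_deriv0:
  assumes u: "sq_integrable u" and \<phi>: "test_fun \<phi>"
  shows "((\<lambda>t. LINT x|lborel. u x * \<phi> (x + t *\<^sub>R axis i 1)) has_real_derivative
     (LINT x|lborel. u x * pdiff i \<phi> x)) (at 0)"
proof -
  let ?e = "axis i 1 :: R3"
  define G where "G t = (LINT x|lborel. u x * \<phi> (x + t *\<^sub>R ?e))" for t
  have G0: "G 0 = (LINT x|lborel. u x * \<phi> x)" by (simp add: G_def)
  obtain C where C: "0 \<le> C" "\<And>x. \<bar>pdiff i \<phi> x\<bar> \<le> C" using test_fun_bounded[OF test_fun_pdiff[OF \<phi>]] by blast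
  obtain r where r: "\<And>x. \<phi> x \<noteq> 0 \<Longrightarrow> norm x \<le> r" using \<phi> by (auto simp: test_fun_iff)
  have quot: "(G t - G 0) / (t - 0) = (LINT x|lborel. u x * ((\<phi> (x + t *\<^sub>R ?e) - \<phi> x) / t))" for t
  proof -
    have i: "integrable lborel (\<lambda>x. u x * \<phi> (x + t *\<^sub>R ?e))" "integrable lborel (\<lambda>x. u x * \<phi> x)"
      by (intro integral_test_mult u \<phi> test_fun_translate)+
    have "(LINT x|lborel. u x * ((\<phi> (x + t *\<^sub>R ?e) - \<phi> x) / t))
        = (LINT x|lborel. (u x * \<phi> (x + t *\<^sub>R ?e) - u x * \<phi> x) / t)"
      by (simp add: right_diff_distrib)
    also have "\<dots> = (G t - G 0) / (t - 0)" unfolding G_def using i by simp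
    finally show ?thesis by (rule sym)
  qed
  have "((\<lambda>t. (G t - G 0) / (t - 0)) \<longlongrightarrow> (LINT x|lborel. u x * pdiff i \<phi> x)) (at 0)"
    unfolding tendsto_at_iff_sequentially o_def
  proof (intro allI impI)
    fix t :: "nat \<Rightarrow> real" assume t0: "\<forall>n. t n \<in> UNIV - {0}" and t: "t \<longlonglongrightarrow> 0"
    have "Bseq t" using t by (intro convergent_imp_Bseq) (auto simp: convergent_def)
    then obtain T where T: "\<And>n. \<bar>t n\<bar> \<le> T" by (auto simp: Bseq_def)
    \<comment> \<open>The radius covers the support of \<phi> and all shifts t n, which are bounded
      by T.\<close>
    let ?B = "cball 0 (\<bar>r\<bar> + T) :: R3 set"
    have "sq_integrable (indicator ?B :: R3 \<Rightarrow> real)" by (rule sq_integrable_indicator) auto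
    hence intB: "integrable lborel (\<lambda>x. u x * indicator ?B x)" by (rule sq_integrable_mult[OF u])
    have "(\<lambda>n. LINT x|lborel. u x * ((\<phi> (x + t n *\<^sub>R ?e) - \<phi> x) / t n)) \<longlonglongrightarrow> (LINT x|lborel. u x * pdiff i \<phi> x)"
    proof (rule integral_dominated_convergence[where w="\<lambda>x. C * \<bar>u x * indicator ?B x\<bar>"])
      show "integrable lborel (\<lambda>x. C * \<bar>u x * indicator ?B x\<bar>)" using intB by auto
      have um: "u \<in> borel_measurable lborel" using sq_integrableD(1)[OF u] .
      show "(\<lambda>x. u x * pdiff i \<phi> x) \<in> borel_measurable lborel"
        using um test_fun_measurable[OF test_fun_pdiff[OF \<phi>]] by measurable
      show "(\<lambda>x. u x * ((\<phi> (x + t n *\<^sub>R ?e) - \<phi> x) / t n)) \<in> borel_measurable lborel" for n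
        using um test_fun_measurable[OF test_fun_translate[OF \<phi>]] test_fun_measurable[OF \<phi>] by measurable
      show "AE x in lborel. (\<lambda>n. u x * ((\<phi> (x + t n *\<^sub>R ?e) - \<phi> x) / t n)) \<longlonglongrightarrow> u x * pdiff i \<phi> x"
      proof (intro AE_I2 tendsto_mult_left)
        fix x
        have "((\<lambda>s. (\<phi> (x + s *\<^sub>R ?e) - \<phi> (x + 0 *\<^sub>R ?e)) / (s - 0)) \<longlongrightarrow> pdiff i \<phi> x) (at 0)"
          using smooth3_deriv0[of \<phi> x i] \<phi> unfolding test_fun_def has_field_derivative_iff by blast
        hence "((\<lambda>s. (\<phi> (x + s *\<^sub>R ?e) - \<phi> x) / s) \<longlongrightarrow> pdiff i \<phi> x) (at 0)" by simp
        thus "(\<lambda>n. (\<phi> (x + t n *\<^sub>R ?e) - \<phi> x) / t n) \<longlonglongrightarrow> pdiff i \<phi> x"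
          using t t0 unfolding tendsto_at_iff_sequentially o_def by blast
      qed
      show "AE x in lborel. norm (u x * ((\<phi> (x + t n *\<^sub>R ?e) - \<phi> x) / t n)) \<le> C * \<bar>u x * indicator ?B x\<bar>" for n
      proof (intro AE_I2)
        fix x
        have tn: "t n \<noteq> 0" using t0 by auto
        show "norm (u x * ((\<phi> (x + t n *\<^sub>R ?e) - \<phi> x) / t n)) \<le> C * \<bar>u x * indicator ?B x\<bar>"
        proof (cases "x \<in> ?B")
          case True
          have "\<bar>(\<phi> (x + t n *\<^sub>R ?e) - \<phi> x) / t n\<bar> \<le> C"
            using test_fun_difference_bound[OF \<phi> C(2), of x "t n"] tn by (simp add: abs_divide field_simps)
          hence "\<bar>u x\<bar> * \<bar>(\<phi> (x + t n *\<^sub>R ?e) - \<phi> x) / t n\<bar> \<le> \<bar>u x\<bar> * C" by (intro mult_left_mono) auto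
          thus ?thesis using True by (simp add: abs_mult mult.commute)
        next
          case False
          have "norm (x + t n *\<^sub>R ?e) > \<bar>r\<bar>"
            using False norm_diff_ineq[of x "t n *\<^sub>R ?e"] T[of n] by (simp add: norm_axis_1)
          moreover have "norm x > \<bar>r\<bar>" using False T[of n] by simp
          ultimately have "\<phi> (x + t n *\<^sub>R ?e) = 0" "\<phi> x = 0"
            using r[of x] r[of "x + t n *\<^sub>R ?e"] by (meson abs_ge_self not_le order_trans)+
          thus ?thesis using False by simp
        qed
      qed
    qed
    thus "(\<lambda>n. (G (t n) - G 0) / (t n - 0)) \<longlonglongrightarrow> (LINT x|lborel. u x * pdiff i \<phi> x)"
      by (simp only: quot)
  qed
  thus ?thesis unfolding has_field_derivative_iff G_def by simp
qed

lemma translate_pairing_deriv: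
  assumes u: "sq_integrable u" and \<phi>: "test_fun \<phi>"
  shows "((\<lambda>t. LINT x|lborel. u x * \<phi> (x + t *\<^sub>R axis i 1)) has_real_derivative
     (LINT x|lborel. u x * pdiff i \<phi> (x + s *\<^sub>R axis i 1))) (at s)"
proof -
  have "((\<lambda>t. LINT x|lborel. u x * \<phi> (x + t *\<^sub>R axis i 1 + s *\<^sub>R axis i 1)) has_real_derivative
     (LINT x|lborel. u x * pdiff i (\<lambda>x. \<phi> (x + s *\<^sub>R axis i 1)) x)) (at 0)"
    by (rule translate_pairing_deriv0[OF u test_fun_translate[OF \<phi>]])
  hence "((\<lambda>t. LINT x|lborel. u x * \<phi> (x + (t + s) *\<^sub>R axis i 1)) has_real_derivative
     (LINT x|lborel. u x * pdiff i \<phi> (x + s *\<^sub>R axis i 1))) (at 0)"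
    by (simp add: pdiff_translate algebra_simps)
  thus ?thesis
    using DERIV_shift[of "\<lambda>t. LINT x|lborel. u x * \<phi> (x + t *\<^sub>R axis i 1)" _ 0 s] by simp
qed

text \<open>Under the integral, translating \<phi> by t amounts to translating \<psi> by - t.
  Differentiating this identity at t = 0 gives the claim.\<close>

lemma test_fun_by_parts:
  assumes "test_fun \<phi>" "test_fun \<psi>"
  shows "(LINT x|lborel. \<psi> x * pdiff i \<phi> x) = - (LINT x|lborel. pdiff i \<psi> x * \<phi> x)"
proof -
  let ?e = "axis i 1 :: R3"
  have 1: "((\<lambda>t. LINT x|lborel. \<psi> x * \<phi> (x + t *\<^sub>R ?e)) has_real_derivative (LINT x|lborel. \<psi> x * pdiff i \<phi> x)) (at 0)"
    by (rule translate_pairing_deriv0[OF test_fun_sq_integrable[OF assms(2)] assms(1)])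
  have "((\<lambda>t. LINT x|lborel. \<phi> x * \<psi> (x + t *\<^sub>R ?e)) has_real_derivative (LINT x|lborel. \<phi> x * pdiff i \<psi> x)) (at (- 0))"
    using translate_pairing_deriv0[OF test_fun_sq_integrable[OF assms(1)] assms(2)] by simp
  hence "((\<lambda>t. LINT x|lborel. \<phi> x * \<psi> (x + (- t) *\<^sub>R ?e)) has_real_derivative (LINT x|lborel. \<phi> x * pdiff i \<psi> x) * (- 1)) (at 0)"
    by (rule DERIV_chain2) (auto intro!: derivative_eq_intros)
  moreover have "(LINT x|lborel. \<phi> x * \<psi> (x + (- t) *\<^sub>R ?e)) = (LINT x|lborel. \<psi> x * \<phi> (x + t *\<^sub>R ?e))" for t
    using lborel_integral_translate[of "\<lambda>x. \<phi> x * \<psi> (x + (- t) *\<^sub>R ?e)" "t *\<^sub>R ?e"] by (simp add: mult.commute)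
  ultimately have "((\<lambda>t. LINT x|lborel. \<psi> x * \<phi> (x + t *\<^sub>R ?e)) has_real_derivative (LINT x|lborel. \<phi> x * pdiff i \<psi> x) * (- 1)) (at 0)"
    by simp
  from DERIV_unique[OF 1 this] show ?thesis by (simp add: mult.commute)
qed

lemma test_fun_H1:
  assumes \<phi>: "test_fun \<phi>" shows "\<phi> \<in> H1"
proof -
  have c: "sq_integrable (\<lambda>x. pdiff i \<phi> x *\<^sub>R axis i 1 :: R3)" for i
  proof -
    note p = test_fun_sq_integrable[OF test_fun_pdiff[OF \<phi>], of i]
    have "(\<lambda>x. pdiff i \<phi> x *\<^sub>R axis i 1 :: R3) \<in> borel_measurable lborel"
      using sq_integrableD(1)[OF p] by measurable
    thus ?thesis using sq_integrableD(2)[OF p] by (simp add: sq_integrable_def norm_axis_1)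
  qed
  have "sq_integrable (\<lambda>x. pdiff 1 \<phi> x *\<^sub>R axis 1 1 + pdiff 2 \<phi> x *\<^sub>R axis 2 1 + pdiff 3 \<phi> x *\<^sub>R axis 3 1 :: R3)"
    by (intro sq_integrable_add c)
  moreover have "(\<lambda>x. pdiff 1 \<phi> x *\<^sub>R axis 1 1 + pdiff 2 \<phi> x *\<^sub>R axis 2 1 + pdiff 3 \<phi> x *\<^sub>R axis 3 1 :: R3) = (\<lambda>x. \<chi> i. pdiff i \<phi> x)"
    by (auto simp: fun_eq_iff vec_eq_iff axis_def forall_3)
  ultimately have "L2_grad \<phi> (\<lambda>x. \<chi> i. pdiff i \<phi> x)"
    using \<phi> by (intro L2_gradI) (auto simp: test_fun_by_parts)
  thus ?thesis using test_fun_sq_integrable[OF \<phi>] by (auto simp: H1_iff)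
qed

lemma inner_le_test:
  assumes "sq_integrable (f :: R3 \<Rightarrow> real)" "sq_integrable g"
  shows "\<bar>LINT x|lborel. f x * g x\<bar> \<le> norm (mk f) * norm (mk g)"
  using Cauchy_Schwarz_ineq2[of "mk f" "mk g"] inner_mk[OF assms] by simp

lemma norm_mk_translate:
  assumes "sq_integrable f" shows "norm (mk (\<lambda>x. f (x + c))) = norm (mk f)"
proof -
  have "(norm (mk (\<lambda>x. f (x + c))))\<^sup>2 = (norm (mk f))\<^sup>2"
    using lborel_integral_translate[of "\<lambda>x. (norm (f x))\<^sup>2" c]
    by (simp add: norm_mk_sq assms sq_integrable_translate)
  thus ?thesis by simp
qed

text \<open>By duality: paired with a test function, the difference is the increment over [0, - h]
  of the pairing of u with the translated test function. Its derivative is a pairing with the weak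
  gradient, so the mean value inequality and Cauchy-Schwarz apply.\<close>

lemma difference_quotient_norm_le:
  assumes u: "u \<in> H1"
  shows "norm (mk (\<lambda>x. u (x + h *\<^sub>R axis i 1) - u x)) \<le> \<bar>h\<bar> * norm (mk (\<lambda>x. grad u x $ i))"
proof (rule norm_le_by_tests)
  let ?e = "axis i 1 :: R3"
  let ?N = "norm (mk (\<lambda>x. grad u x $ i))"
  note us = H1_sq[OF u] note gs = sq_integrable_component[OF grad_sq[OF u], of i]
  fix \<phi> :: "R3 \<Rightarrow> real" assume \<phi>: "test_fun \<phi>"
  note \<phi>s = test_fun_sq_integrable[OF \<phi>]
  define G where "G t = (LINT x|lborel. u x * \<phi> (x + t *\<^sub>R ?e))" for t
  have "norm (G (- h) - G 0) \<le> (?N * norm (mk \<phi>)) * norm (- h - 0)"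
  proof (rule field_differentiable_bound[where S=UNIV])
    show "(G has_field_derivative (LINT x|lborel. u x * pdiff i \<phi> (x + s *\<^sub>R ?e))) (at s within UNIV)" for s
      using translate_pairing_deriv[OF us \<phi>] by (simp add: G_def[abs_def])
    fix s
    have "(LINT x|lborel. u x * pdiff i \<phi> (x + s *\<^sub>R ?e)) = - (LINT x|lborel. (grad u x $ i) * \<phi> (x + s *\<^sub>R ?e))"
      using L2_gradD[OF L2_grad_grad[OF u] test_fun_translate[OF \<phi>], of i "s *\<^sub>R ?e"] by (simp add: pdiff_translate)
    thus "norm (LINT x|lborel. u x * pdiff i \<phi> (x + s *\<^sub>R ?e)) \<le> ?N * norm (mk \<phi>)"
      using inner_le_test[OF gs sq_integrable_translate[OF \<phi>s], of "s *\<^sub>R ?e"] by (simp add: norm_mk_translate[OF \<phi>s])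
  qed auto
  moreover have "inner (mk (\<lambda>x. u (x + h *\<^sub>R ?e) - u x)) (mk \<phi>) = G (- h) - G 0"
  proof -
    have "inner (mk (\<lambda>x. u (x + h *\<^sub>R ?e) - u x)) (mk \<phi>) = (LINT x|lborel. (u (x + h *\<^sub>R ?e) - u x) * \<phi> x)"
      by (subst inner_mk) (auto intro!: sq_integrable_diff sq_integrable_translate us \<phi>s)
    also have "\<dots> = (LINT x|lborel. u (x + h *\<^sub>R ?e) * \<phi> x) - (LINT x|lborel. u x * \<phi> x)"
      using sq_integrable_mult[OF sq_integrable_translate[OF us] \<phi>s] sq_integrable_mult[OF us \<phi>s]
      by (simp add: left_diff_distrib)
    also have "(LINT x|lborel. u (x + h *\<^sub>R ?e) * \<phi> x) = G (- h)"
      unfolding G_def using lborel_integral_translate[of "\<lambda>x. u x * \<phi> (x + (- h) *\<^sub>R ?e)" "h *\<^sub>R ?e"] by simp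
    finally show ?thesis by (simp add: G_def)
  qed
  ultimately show "inner (mk (\<lambda>x. u (x + h *\<^sub>R ?e) - u x)) (mk \<phi>) \<le> \<bar>h\<bar> * ?N * norm (mk \<phi>)"
    by (simp add: algebra_simps abs_le_iff)
qed simp

text \<open>Taking absolute values decreases difference quotients, and a weak limit of the difference
  quotients of \<open>\<bar>u\<bar>\<close> is its weak partial derivative.\<close>
lemma H1_abs_partial:
  assumes u: "u \<in> H1"
  shows "\<exists>y :: R3 \<Rightarrow> real. sq_integrable y \<and> norm (mk y) \<le> norm (mk (\<lambda>x. grad u x $ i)) \<and>
    (\<forall>\<phi>. test_fun \<phi> \<longrightarrow> (LINT x|lborel. \<bar>u x\<bar> * pdiff i \<phi> x) = - (LINT x|lborel. y x * \<phi> x))"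
proof -
  let ?e = "axis i 1 :: R3"
  define h where "h n = inverse (real (Suc n))" for n
  have h: "0 < h n" for n by (simp add: h_def)
  note us = H1_sq[OF u]
  have vs: "sq_integrable (\<lambda>x. \<bar>u x\<bar>)" using us by (auto simp: sq_integrable_real)
  define d where "d n x = (1 / h n) *\<^sub>R (\<bar>u (x + h n *\<^sub>R ?e)\<bar> - \<bar>u x\<bar>)" for n x
  have ds: "sq_integrable (d n)" for n
    unfolding d_def by (intro sq_integrable_scaleR sq_integrable_diff vs sq_integrable_translate[OF vs])
  have uds: "sq_integrable (\<lambda>x. u (x + h n *\<^sub>R ?e) - u x)" for n
    by (intro sq_integrable_diff us sq_integrable_translate[OF us])
  have bd: "norm (mk (d n)) \<le> norm (mk (\<lambda>x. grad u x $ i))" for n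
  proof -
    have "(norm (mk (d n)))\<^sup>2 = (LINT x|lborel. (norm (d n x))\<^sup>2)" by (rule norm_mk_sq[OF ds])
    also have "\<dots> \<le> (LINT x|lborel. (norm ((1 / h n) *\<^sub>R (u (x + h n *\<^sub>R ?e) - u x)))\<^sup>2)"
    proof (rule integral_mono)
      show "integrable lborel (\<lambda>x. (norm (d n x))\<^sup>2)" by (rule sq_integrableD(2)[OF ds])
      show "integrable lborel (\<lambda>x. (norm ((1 / h n) *\<^sub>R (u (x + h n *\<^sub>R ?e) - u x)))\<^sup>2)"
        by (rule sq_integrableD(2)[OF sq_integrable_scaleR[OF uds]])
      fix x
      show "(norm (d n x))\<^sup>2 \<le> (norm ((1 / h n) *\<^sub>R (u (x + h n *\<^sub>R ?e) - u x)))\<^sup>2"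
        unfolding d_def norm_scaleR by (intro power_mono mult_left_mono) auto
    qed
    also have "\<dots> = (norm ((1 / h n) *\<^sub>R mk (\<lambda>x. u (x + h n *\<^sub>R ?e) - u x)))\<^sup>2"
      by (simp only: norm_mk_sq[OF sq_integrable_scaleR[OF uds], symmetric] mk_scaleR[OF uds])
    finally have "norm (mk (d n)) \<le> norm ((1 / h n) *\<^sub>R mk (\<lambda>x. u (x + h n *\<^sub>R ?e) - u x))"
      by (rule power2_le_imp_le) simp
    also have "\<dots> \<le> (1 / h n) * (\<bar>h n\<bar> * norm (mk (\<lambda>x. grad u x $ i)))"
      unfolding norm_scaleR using h[of n] difference_quotient_norm_le[OF u, of "h n" i]
      by (intro mult_mono) auto
    also have "\<dots> = norm (mk (\<lambda>x. grad u x $ i))" using h[of n] by simp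
    finally show ?thesis .
  qed
  obtain Y :: "(R3, real) L2" where Y: "norm Y \<le> norm (mk (\<lambda>x. grad u x $ i))"
    "\<And>z l. (\<lambda>n. inner (mk (d n)) z) \<longlonglongrightarrow> l \<Longrightarrow> inner Y z = l"
    by (rule bounded_sequence_weak_limit[OF bd]) (rule that)
  have "(LINT x|lborel. \<bar>u x\<bar> * pdiff i \<phi> x) = - (LINT x|lborel. fn Y x * \<phi> x)" if \<phi>: "test_fun \<phi>" for \<phi>
  proof -
    note \<phi>s = test_fun_sq_integrable[OF \<phi>]
    define G where "G t = (LINT x|lborel. \<bar>u x\<bar> * \<phi> (x + t *\<^sub>R ?e))" for t
    \<comment> \<open>The shift passes to \<phi> with the opposite sign, whence the step - h n. The
      limit of these pairings exists, as the weak limit Y requires.\<close>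
    have "inner (mk (d n)) (mk \<phi>) = - ((G (- h n) - G 0) / (- h n - 0))" for n
    proof -
      have "inner (mk (d n)) (mk \<phi>) = (LINT x|lborel. (1 / h n) * (\<bar>u (x + h n *\<^sub>R ?e)\<bar> * \<phi> x - \<bar>u x\<bar> * \<phi> x))"
        by (subst inner_mk[OF ds \<phi>s]) (simp add: d_def left_diff_distrib diff_divide_distrib)
      also have "\<dots> = (1 / h n) * ((LINT x|lborel. \<bar>u (x + h n *\<^sub>R ?e)\<bar> * \<phi> x) - (LINT x|lborel. \<bar>u x\<bar> * \<phi> x))"
        using sq_integrable_mult[OF sq_integrable_translate[OF vs] \<phi>s] sq_integrable_mult[OF vs \<phi>s] by simp
      also have "(LINT x|lborel. \<bar>u (x + h n *\<^sub>R ?e)\<bar> * \<phi> x) = G (- h n)"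
        unfolding G_def using lborel_integral_translate[of "\<lambda>x. \<bar>u x\<bar> * \<phi> (x + (- h n) *\<^sub>R ?e)" "h n *\<^sub>R ?e"] by simp
      finally show ?thesis using h[of n] by (simp add: G_def field_simps)
    qed
    moreover have "(\<lambda>n. - ((G (- h n) - G 0) / (- h n - 0))) \<longlonglongrightarrow> - (LINT x|lborel. \<bar>u x\<bar> * pdiff i \<phi> x)"
    proof (rule tendsto_minus)
      have D: "((\<lambda>t. (G t - G 0) / (t - 0)) \<longlongrightarrow> (LINT x|lborel. \<bar>u x\<bar> * pdiff i \<phi> x)) (at 0)"
        using translate_pairing_deriv0[OF vs \<phi>, of i] unfolding has_field_derivative_iff G_def .
      have "(\<lambda>n. - h n) \<longlonglongrightarrow> - 0" unfolding h_def by (intro tendsto_minus LIMSEQ_inverse_real_of_nat)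
      thus "(\<lambda>n. (G (- h n) - G 0) / (- h n - 0)) \<longlonglongrightarrow> (LINT x|lborel. \<bar>u x\<bar> * pdiff i \<phi> x)"
        using D[unfolded tendsto_at_iff_sequentially o_def, rule_format, of "\<lambda>n. - h n"] h
        by (simp add: less_imp_neq[symmetric])
    qed
    ultimately have "inner Y (mk \<phi>) = - (LINT x|lborel. \<bar>u x\<bar> * pdiff i \<phi> x)" by (intro Y(2)) simp
    moreover have "inner Y (mk \<phi>) = (LINT x|lborel. fn Y x * \<phi> x)"
      using inner_mk[OF sq_integrable_fn[of Y] \<phi>s] by (simp add: mk_fn)
    ultimately show ?thesis by simp
  qed
  thus ?thesis using Y(1) sq_integrable_fn[of Y] by (intro exI[of _ "fn Y"]) (auto simp: mk_fn)
qed

lemma H1_abs: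
  assumes u: "u \<in> H1"
  shows "(\<lambda>x. \<bar>u x\<bar>) \<in> H1"
    and "(LINT x|lborel. (norm (grad (\<lambda>x. \<bar>u x\<bar>) x))\<^sup>2) \<le> (LINT x|lborel. (norm (grad u x))\<^sup>2)"
proof -
  have "\<exists>y :: 3 \<Rightarrow> R3 \<Rightarrow> real. \<forall>i. sq_integrable (y i) \<and> norm (mk (y i)) \<le> norm (mk (\<lambda>x. grad u x $ i)) \<and>
    (\<forall>\<phi>. test_fun \<phi> \<longrightarrow> (LINT x|lborel. \<bar>u x\<bar> * pdiff i \<phi> x) = - (LINT x|lborel. y i x * \<phi> x))"
    by (intro choice allI H1_abs_partial[OF u])
  then obtain y :: "3 \<Rightarrow> R3 \<Rightarrow> real" where y: "\<And>i. sq_integrable (y i)" "\<And>i. norm (mk (y i)) \<le> norm (mk (\<lambda>x. grad u x $ i))"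
    "\<And>i \<phi>. test_fun \<phi> \<Longrightarrow> (LINT x|lborel. \<bar>u x\<bar> * pdiff i \<phi> x) = - (LINT x|lborel. y i x * \<phi> x)"
    by (elim exE) blast
  have sq: "(norm (v :: R3))\<^sup>2 = (v $ 1)\<^sup>2 + (v $ 2)\<^sup>2 + (v $ 3)\<^sup>2" for v
    unfolding power2_norm_eq_inner by (simp add: inner_vec_def sum_3 power2_eq_square)
  have c: "sq_integrable (\<lambda>x. y i x *\<^sub>R axis i 1 :: R3)" for i
  proof -
    have "(\<lambda>x. y i x *\<^sub>R axis i 1 :: R3) \<in> borel_measurable lborel"
      using sq_integrableD(1)[OF y(1)[of i]] by measurable
    thus ?thesis using sq_integrableD(2)[OF y(1)[of i]] by (simp add: sq_integrable_def norm_axis_1)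
  qed
  have "sq_integrable (\<lambda>x. y 1 x *\<^sub>R axis 1 1 + y 2 x *\<^sub>R axis 2 1 + y 3 x *\<^sub>R axis 3 1 :: R3)"
    by (intro sq_integrable_add c)
  moreover have "(\<lambda>x. y 1 x *\<^sub>R axis 1 1 + y 2 x *\<^sub>R axis 2 1 + y 3 x *\<^sub>R axis 3 1 :: R3) = (\<lambda>x. \<chi> i. y i x)"
    by (auto simp: fun_eq_iff vec_eq_iff axis_def forall_3)
  ultimately have g: "L2_grad (\<lambda>x. \<bar>u x\<bar>) (\<lambda>x. \<chi> i. y i x)"
    by (intro L2_gradI) (auto simp: y(3))
  have "sq_integrable (\<lambda>x. \<bar>u x\<bar>)" using H1_sq[OF u] by (auto simp: sq_integrable_real)
  thus v: "(\<lambda>x. \<bar>u x\<bar>) \<in> H1" using g by (auto simp: H1_iff)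
  have comp: "(LINT x|lborel. (y i x)\<^sup>2) \<le> (LINT x|lborel. (grad u x $ i)\<^sup>2)" for i
  proof -
    have "(norm (mk (y i)))\<^sup>2 \<le> (norm (mk (\<lambda>x. grad u x $ i)))\<^sup>2" using y(2) by (intro power_mono) auto
    thus ?thesis using norm_mk_sq[OF y(1)[of i]] norm_mk_sq[OF sq_integrable_component[OF grad_sq[OF u], of i]] by simp
  qed
  have i1: "integrable lborel (\<lambda>x. (y i x)\<^sup>2)" for i using y(1)[of i] by (simp add: sq_integrable_real)
  have i2: "integrable lborel (\<lambda>x. (grad u x $ i)\<^sup>2)" for i
    using sq_integrable_component[OF grad_sq[OF u], of i] by (simp add: sq_integrable_real)
  have "(LINT x|lborel. (norm (grad (\<lambda>x. \<bar>u x\<bar>) x))\<^sup>2) = (LINT x|lborel. (norm (\<chi> i. y i x :: real ^ 3))\<^sup>2)"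
  proof (rule integral_cong_AE)
    show "AE x in lborel. (norm (grad (\<lambda>x. \<bar>u x\<bar>) x))\<^sup>2 = (norm (\<chi> i. y i x :: real ^ 3))\<^sup>2"
      using grad_eqI[OF v g] by eventually_elim simp
  qed (use sq_integrableD(2)[OF grad_sq[OF v]] sq_integrableD(2)[OF L2_grad_sq[OF g]] in auto)
  also have "\<dots> = (LINT x|lborel. (y 1 x)\<^sup>2) + (LINT x|lborel. (y 2 x)\<^sup>2) + (LINT x|lborel. (y 3 x)\<^sup>2)"
    using i1 by (simp add: sq)
  also have "\<dots> \<le> (LINT x|lborel. (grad u x $ 1)\<^sup>2) + (LINT x|lborel. (grad u x $ 2)\<^sup>2) + (LINT x|lborel. (grad u x $ 3)\<^sup>2)"
    using comp by (intro add_mono) auto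
  also have "\<dots> = (LINT x|lborel. (norm (grad u x))\<^sup>2)" using i2 by (simp add: sq)
  finally show "(LINT x|lborel. (norm (grad (\<lambda>x. \<bar>u x\<bar>) x))\<^sup>2) \<le> (LINT x|lborel. (norm (grad u x))\<^sup>2)" .
qed

section \<open>The weighted space as a closed subspace of \<open>L\<^sup>2\<close>\<close>

text \<open>Dilations preserve null sets; this transfers the bounds on V to V(\<epsilon> x).\<close>

lemma AE_lborel_scaleR:
  fixes P :: "'a::euclidean_space \<Rightarrow> bool"
  assumes "AE x in lborel. P x" and e: "e \<noteq> 0"
  shows "AE x in lborel. P (e *\<^sub>R x)"
proof -
  obtain N where N: "N \<in> null_sets lborel" "{x. \<not> P x} \<subseteq> N"
    using assms(1) by (auto simp: eventually_ae_filter)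
  have "AE y in density (distr lborel borel (\<lambda>x. 0 + e *\<^sub>R x)) (\<lambda>_. ennreal (\<bar>e\<bar> ^ DIM('a))). y \<notin> N"
    using N(1) lborel_affine[OF e, of 0] by (metis AE_not_in)
  hence "AE y in distr lborel borel (\<lambda>x. 0 + e *\<^sub>R x). y \<notin> N" using e by (subst (asm) AE_density) (auto simp: add_0_left)
  hence "AE x in lborel. e *\<^sub>R x \<notin> N"
    using N(1) by (subst (asm) AE_distr_iff) auto
  thus ?thesis by eventually_elim (use N(2) in auto)
qed

text \<open>\<open>c0\<close> is any positive lower bound of V. The local bound \<open>V_loc\<close>
  puts test functions into the weighted space, which makes that space infinite-dimensional.\<close>

locale potential_space =
  fixes V :: "R3 \<Rightarrow> real" and \<epsilon> c0 :: real
  assumes V_meas: "V \<in> borel_measurable lborel"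
    and V_loc: "\<And>S. compact S \<Longrightarrow> \<exists>C. AE x in lborel. x \<in> S \<longrightarrow> \<bar>V x\<bar> \<le> C"
    and c0: "0 < c0" "AE x in lborel. c0 \<le> V x"
    and \<epsilon>: "0 < \<epsilon>"
    and embed: "\<And>p. 2 < p \<Longrightarrow> p < 6 \<Longrightarrow> compact_embed V \<epsilon> p"
begin

abbreviation W where "W \<equiv> W_space V \<epsilon>"
definition Ve where "Ve x = V (\<epsilon> *\<^sub>R x)"
text \<open>The real square root of HOL is odd, so the square of \<open>wt x\<close> is |Ve x| at
  every point, including the null set where \<open>Ve\<close> might be negative.\<close>

definition wt where "wt x = sqrt (Ve x)"

lemma Ve_meas: "Ve \<in> borel_measurable lborel"
  unfolding Ve_def by (rule measurable_compose[OF _ V_meas]) auto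

lemma wt_meas: "wt \<in> borel_measurable lborel"
  unfolding wt_def[abs_def] using Ve_meas by measurable

lemma Ve_ge: "AE x in lborel. c0 \<le> Ve x"
  unfolding Ve_def using AE_lborel_scaleR[OF c0(2), of \<epsilon>] \<epsilon> by simp

lemma wt_sq: "(wt x)\<^sup>2 = \<bar>Ve x\<bar>"
  by (simp add: wt_def real_sqrt_power[symmetric])

lemma W_iff: "u \<in> W \<longleftrightarrow> u \<in> H1 \<and> integrable lborel (\<lambda>x. Ve x * (u x)\<^sup>2)"
  by (simp add: W_space_def Ve_def)

lemma W_H1: "u \<in> W \<Longrightarrow> u \<in> H1" by (simp add: W_iff)
lemma W_sq: "u \<in> W \<Longrightarrow> sq_integrable u" by (simp add: W_iff H1_sq)
lemma W_meas: "u \<in> W \<Longrightarrow> u \<in> borel_measurable lborel" using W_sq sq_integrableD(1) by blast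

lemma wt_mult_sq: "u \<in> W \<Longrightarrow> sq_integrable (\<lambda>x. wt x * u x)"
proof -
  assume u: "u \<in> W"
  have "(\<lambda>x. wt x * u x) \<in> borel_measurable lborel" using wt_meas W_meas[OF u] by measurable
  moreover have "integrable lborel (\<lambda>x. \<bar>Ve x * (u x)\<^sup>2\<bar>)" using u by (intro integrable_abs) (simp add: W_iff)
  hence "integrable lborel (\<lambda>x. (wt x * u x)\<^sup>2)" by (simp add: power_mult_distrib wt_sq abs_mult)
  ultimately show ?thesis by (simp add: sq_integrable_real)
qed

lemma W_I:
  assumes "u \<in> H1" "integrable lborel (\<lambda>x. (wt x * u x)\<^sup>2)" shows "u \<in> W"
proof -
  have "integrable lborel (\<lambda>x. Ve x * (u x)\<^sup>2)"
  proof (rule Bochner_Integration.integrable_bound[OF assms(2)])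
    show "(\<lambda>x. Ve x * (u x)\<^sup>2) \<in> borel_measurable lborel"
      using Ve_meas sq_integrableD(1)[OF H1_sq[OF assms(1)]] by measurable
  qed (auto simp: power_mult_distrib wt_sq abs_mult)
  thus ?thesis using assms(1) by (simp add: W_iff)
qed

definition comb :: "(R3 \<Rightarrow> real) \<Rightarrow> R3 \<Rightarrow> real \<times> R3" where
  "comb u x = (wt x * u x, grad u x)"

text \<open>An isometric copy of the weighted space, by \<open>emb_inner\<close>. It is linear
  although \<open>grad\<close> is a choice, because weak gradients are unique almost
  everywhere.\<close>

definition emb :: "(R3 \<Rightarrow> real) \<Rightarrow> (R3, real \<times> R3) L2" where "emb u = mk (comb u)"

lemma sq_integrable_Pair:
  assumes "sq_integrable (a :: R3 \<Rightarrow> real)" "sq_integrable (g :: R3 \<Rightarrow> R3)"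
  shows "sq_integrable (\<lambda>x. (a x, g x))"
proof -
  have "(\<lambda>x. (a x, g x)) \<in> borel_measurable lborel"
    using sq_integrableD(1)[OF assms(1)] sq_integrableD(1)[OF assms(2)] by measurable
  moreover have "(\<lambda>x. (norm (a x, g x))\<^sup>2) = (\<lambda>x. (norm (a x))\<^sup>2 + (norm (g x))\<^sup>2)"
    by (simp add: norm_Pair fun_eq_iff)
  ultimately show ?thesis using sq_integrableD(2)[OF assms(1)] sq_integrableD(2)[OF assms(2)]
    by (simp add: sq_integrable_def)
qed

lemma comb_sq: "u \<in> W \<Longrightarrow> sq_integrable (comb u)"
  unfolding comb_def by (intro sq_integrable_Pair wt_mult_sq grad_sq W_H1)

lemma W_linear: "u \<in> W \<Longrightarrow> v \<in> W \<Longrightarrow> (\<lambda>x. a * u x + b * v x) \<in> W"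
proof (rule W_I)
  assume u: "u \<in> W" and v: "v \<in> W"
  show "(\<lambda>x. a * u x + b * v x) \<in> H1" by (rule H1_linear(1)[OF W_H1[OF u] W_H1[OF v]])
  have "sq_integrable (\<lambda>x. a *\<^sub>R (wt x * u x) + b *\<^sub>R (wt x * v x))"
    by (intro sq_integrable_add sq_integrable_scaleR wt_mult_sq u v)
  thus "integrable lborel (\<lambda>x. (wt x * (a * u x + b * v x))\<^sup>2)"
    by (simp add: sq_integrable_real algebra_simps)
qed

lemma emb_linear:
  assumes u: "u \<in> W" and v: "v \<in> W"
  shows "emb (\<lambda>x. a * u x + b * v x) = a *\<^sub>R emb u + b *\<^sub>R emb v"
proof -
  have "emb (\<lambda>x. a * u x + b * v x) = mk (\<lambda>x. a *\<^sub>R comb u x + b *\<^sub>R comb v x)"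
    unfolding emb_def
  proof (rule mk_cong)
    show "AE x in lborel. comb (\<lambda>x. a * u x + b * v x) x = a *\<^sub>R comb u x + b *\<^sub>R comb v x"
      using H1_linear(2)[OF W_H1[OF u] W_H1[OF v], of a b]
      by eventually_elim (simp add: comb_def algebra_simps)
  qed
  also have "\<dots> = a *\<^sub>R emb u + b *\<^sub>R emb v"
    unfolding emb_def using comb_sq[OF u] comb_sq[OF v] by (simp add: mk_add mk_scaleR sq_integrable_scaleR)
  finally show ?thesis .
qed

lemma W_add: "u \<in> W \<Longrightarrow> v \<in> W \<Longrightarrow> (\<lambda>x. u x + v x) \<in> W" using W_linear[of u v 1 1] by simp
lemma W_diff: "u \<in> W \<Longrightarrow> v \<in> W \<Longrightarrow> (\<lambda>x. u x - v x) \<in> W" using W_linear[of u v 1 "-1"] by simp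
lemma W_cmult: "u \<in> W \<Longrightarrow> (\<lambda>x. a * u x) \<in> W" using W_linear[of u u a 0] by simp
lemma emb_add: "u \<in> W \<Longrightarrow> v \<in> W \<Longrightarrow> emb (\<lambda>x. u x + v x) = emb u + emb v" using emb_linear[of u v 1 1] by simp
lemma emb_diff: "u \<in> W \<Longrightarrow> v \<in> W \<Longrightarrow> emb (\<lambda>x. u x - v x) = emb u - emb v" using emb_linear[of u v 1 "-1"] by simp
lemma emb_cmult: "u \<in> W \<Longrightarrow> emb (\<lambda>x. a * u x) = a *\<^sub>R emb u" using emb_linear[of u u a 0] by simp

lemma emb_inner:
  assumes u: "u \<in> W" and v: "v \<in> W"
  shows "inner (emb u) (emb v) = (LINT x|lborel. grad u x \<bullet> grad v x) + (LINT x|lborel. V (\<epsilon> *\<^sub>R x) * u x * v x)"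
proof -
  have i1: "integrable lborel (\<lambda>x. grad u x \<bullet> grad v x)"
    by (intro sq_integrable_inner grad_sq W_H1 u v)
  have i2: "integrable lborel (\<lambda>x. (wt x * u x) * (wt x * v x))"
    by (intro sq_integrable_mult wt_mult_sq u v)
  have "inner (emb u) (emb v) = (LINT x|lborel. (wt x * u x) * (wt x * v x) + grad u x \<bullet> grad v x)"
    unfolding emb_def inner_mk[OF comb_sq[OF u] comb_sq[OF v]] by (simp add: comb_def)
  also have "\<dots> = (LINT x|lborel. (wt x * u x) * (wt x * v x)) + (LINT x|lborel. grad u x \<bullet> grad v x)"
    using i1 i2 by simp
  also have "(LINT x|lborel. (wt x * u x) * (wt x * v x)) = (LINT x|lborel. V (\<epsilon> *\<^sub>R x) * u x * v x)"
  proof (rule integral_cong_AE)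
    show "AE x in lborel. (wt x * u x) * (wt x * v x) = V (\<epsilon> *\<^sub>R x) * u x * v x"
      using Ve_ge
    proof eventually_elim
      case (elim x)
      have "wt x * wt x = Ve x" using wt_sq[of x] elim c0(1) by (simp add: power2_eq_square)
      thus ?case by (simp add: Ve_def mult.assoc mult.left_commute)
    qed
    show "(\<lambda>x. V (\<epsilon> *\<^sub>R x) * u x * v x) \<in> borel_measurable lborel"
      using Ve_meas W_meas[OF u] W_meas[OF v] unfolding Ve_def by measurable
  qed (use i2 in auto)
  finally show ?thesis by simp
qed

lemma emb_norm: "u \<in> W \<Longrightarrow> norm (emb u) = W_norm V \<epsilon> u"
  unfolding W_norm_def norm_eq_sqrt_inner
  by (simp add: emb_inner power2_norm_eq_inner power2_eq_square[of "u _"] mult.assoc)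

lemma L2_le:
  assumes u: "u \<in> W" shows "(LINT x|lborel. (u x)\<^sup>2) \<le> (norm (emb u))\<^sup>2 / c0"
proof -
  have i1: "integrable lborel (\<lambda>x. (wt x * u x)\<^sup>2)" using wt_mult_sq[OF u] by (simp add: sq_integrable_real)
  have i2: "integrable lborel (\<lambda>x. (norm (grad u x))\<^sup>2)" using sq_integrableD(2)[OF grad_sq[OF W_H1[OF u]]] .
  have "(LINT x|lborel. (u x)\<^sup>2) \<le> (LINT x|lborel. ((wt x * u x)\<^sup>2 + (norm (grad u x))\<^sup>2) / c0)"
  proof (rule integral_mono_AE)
    show "integrable lborel (\<lambda>x. (u x)\<^sup>2)" using W_sq[OF u] by (simp add: sq_integrable_real)
    show "integrable lborel (\<lambda>x. ((wt x * u x)\<^sup>2 + (norm (grad u x))\<^sup>2) / c0)" using i1 i2 by simp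
    show "AE x in lborel. (u x)\<^sup>2 \<le> ((wt x * u x)\<^sup>2 + (norm (grad u x))\<^sup>2) / c0"
      using Ve_ge
    proof eventually_elim
      case (elim x)
      have "c0 * (u x)\<^sup>2 \<le> \<bar>Ve x\<bar> * (u x)\<^sup>2" using elim c0(1) by (intro mult_right_mono) auto
      hence "c0 * (u x)\<^sup>2 \<le> (wt x * u x)\<^sup>2 + (norm (grad u x))\<^sup>2"
        by (simp add: power_mult_distrib wt_sq add_increasing2)
      thus ?case using c0(1) by (simp add: field_simps)
    qed
  qed
  also have "\<dots> = (norm (emb u))\<^sup>2 / c0"
    unfolding emb_def norm_mk_sq[OF comb_sq[OF u]] by (simp add: comb_def norm_Pair)
  finally show ?thesis .
qed

lemma emb_eq_imp_AE:
  assumes u: "u \<in> W" and v: "v \<in> W" and eq: "emb u = emb v"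
  shows "AE x in lborel. u x = v x"
proof -
  have "(LINT x|lborel. (u x - v x)\<^sup>2) \<le> 0" using L2_le[OF W_diff[OF u v]] eq by (simp add: emb_diff u v)
  moreover have i: "integrable lborel (\<lambda>x. (u x - v x)\<^sup>2)" using W_sq[OF W_diff[OF u v]] by (simp add: sq_integrable_real)
  ultimately have "AE x in lborel. (u x - v x)\<^sup>2 = 0"
    using integral_nonneg_eq_0_iff_AE[OF i] by (simp add: antisym)
  thus ?thesis by eventually_elim simp
qed

definition WW where "WW = emb ` W"

text \<open>One function per class, compatible with the linear structure almost everywhere but not
  pointwise. Functionals written with \<open>pull\<close> are therefore shown to respect equality
  almost everywhere.\<close>

definition pull where "pull U = (SOME u. u \<in> W \<and> emb u = U)"

lemma pull: "U \<in> WW \<Longrightarrow> pull U \<in> W" "U \<in> WW \<Longrightarrow> emb (pull U) = U"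
proof -
  assume "U \<in> WW"
  hence "\<exists>u. u \<in> W \<and> emb u = U" by (auto simp: WW_def)
  from someI_ex[OF this] show "pull U \<in> W" "emb (pull U) = U" by (auto simp: pull_def)
qed

lemma pull_emb: "u \<in> W \<Longrightarrow> AE x in lborel. pull (emb u) x = u x"
  by (rule emb_eq_imp_AE) (auto simp: pull WW_def)

lemma pull_linear:
  assumes "U \<in> WW" "Z \<in> WW" "a *\<^sub>R U + b *\<^sub>R Z \<in> WW"
  shows "AE x in lborel. pull (a *\<^sub>R U + b *\<^sub>R Z) x = a * pull U x + b * pull Z x"
  by (rule emb_eq_imp_AE) (auto simp: pull assms W_linear emb_linear)

lemma zero_W: "(\<lambda>x. 0) \<in> W"
  using W_cmult[OF W_I[OF test_fun_H1], of "\<lambda>x. 0 * bump 1 0 0 x" 0] test_fun_cmult[OF test_fun_bump, of 1 0 0 0]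
  by simp

lemma subspace_WW: "subspace WW"
proof (rule subspaceI)
  show "0 \<in> WW" using emb_cmult[OF zero_W, of 0] zero_W unfolding WW_def by (metis image_eqI mult_zero_left scaleR_zero_left)
  show "U + Z \<in> WW" if UZ: "U \<in> WW" "Z \<in> WW" for U Z
  proof -
    obtain u z where u: "u \<in> W" "z \<in> W" "U = emb u" "Z = emb z" using UZ unfolding WW_def by blast
    have "emb (\<lambda>x. u x + z x) \<in> WW" unfolding WW_def by (rule imageI[OF W_add[OF u(1,2)]])
    thus ?thesis by (simp add: emb_add u)
  qed
  show "a *\<^sub>R U \<in> WW" if UW: "U \<in> WW" for a U
  proof -
    obtain u where u: "u \<in> W" "U = emb u" using UW unfolding WW_def by blast
    have "emb (\<lambda>x. a * u x) \<in> WW" unfolding WW_def by (rule imageI[OF W_cmult[OF u(1)]])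
    thus ?thesis by (simp add: emb_cmult u)
  qed
qed

text \<open>The limit is a pair (a, g). Since the squared weight is at least c0, v = a / wt is the
  L^2 limit of the functions u n, and g is its gradient because the weak gradient is a closed
  operator.\<close>

lemma closed_WW: "closed WW"
proof (rule closed_sequential_limits[THEN iffD2], intro allI impI, elim conjE)
  fix X U assume X: "\<forall>n. X n \<in> WW" "X \<longlonglongrightarrow> U"
  define u where "u n = pull (X n)" for n
  have u: "u n \<in> W" "emb (u n) = X n" for n using X(1) pull by (auto simp: u_def)
  define a where "a x = fst (fn U x)" for x
  define g where "g x = snd (fn U x)" for x
  have Um: "fn U \<in> borel_measurable lborel" using sq_integrableD(1)[OF sq_integrable_fn] .
  have Ui: "integrable lborel (\<lambda>x. (norm (fn U x))\<^sup>2)" using sq_integrableD(2)[OF sq_integrable_fn] .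
  have am: "a \<in> borel_measurable lborel" and gm: "g \<in> borel_measurable lborel"
  proof -
    have "fst \<in> borel_measurable (borel :: (real \<times> R3) measure)" "snd \<in> borel_measurable (borel :: (real \<times> R3) measure)"
      by (auto intro!: borel_measurable_continuous_onI continuous_intros)
    from measurable_compose[OF Um this(1)] measurable_compose[OF Um this(2)]
    show "a \<in> borel_measurable lborel" "g \<in> borel_measurable lborel" by (simp_all add: a_def[abs_def] g_def[abs_def])
  qed
  have nm: "(norm (fn U x))\<^sup>2 = (a x)\<^sup>2 + (norm (g x))\<^sup>2" for x
    by (simp add: norm_prod_def a_def g_def)
  have as: "sq_integrable a"
    using am Bochner_Integration.integrable_bound[OF Ui, of "\<lambda>x. (a x)\<^sup>2"] by (auto simp: sq_integrable_real nm)
  have gs: "sq_integrable g"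
    using gm Bochner_Integration.integrable_bound[OF Ui, of "\<lambda>x. (norm (g x))\<^sup>2"] by (auto simp: sq_integrable_def nm)
  define v where "v x = a x / wt x" for x
  have vm: "v \<in> borel_measurable lborel" unfolding v_def[abs_def] using am wt_meas by measurable
  have wtv: "AE x in lborel. wt x * v x = a x"
    using Ve_ge by eventually_elim (use c0(1) in \<open>auto simp: v_def wt_def\<close>)
  have v2: "AE x in lborel. (v x)\<^sup>2 \<le> (a x)\<^sup>2 / c0"
    using Ve_ge wtv
  proof eventually_elim
    case (elim x)
    have "c0 * (v x)\<^sup>2 \<le> \<bar>Ve x\<bar> * (v x)\<^sup>2" using elim c0(1) by (intro mult_right_mono) auto
    also have "\<dots> = (wt x * v x)\<^sup>2" by (simp add: power_mult_distrib wt_sq)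
    finally have "c0 * (v x)\<^sup>2 \<le> (a x)\<^sup>2" by (simp only: elim(2))
    thus ?case using c0(1) by (simp add: field_simps)
  qed
  have vs: "sq_integrable v"
  proof -
    have "integrable lborel (\<lambda>x. (v x)\<^sup>2)"
    proof (rule Bochner_Integration.integrable_bound)
      show "integrable lborel (\<lambda>x. (a x)\<^sup>2 / c0)" using as by (simp add: sq_integrable_real)
      show "AE x in lborel. norm ((v x)\<^sup>2) \<le> norm ((a x)\<^sup>2 / c0)"
        using v2 by eventually_elim (use c0(1) in simp)
    qed (use vm in measurable)
    thus ?thesis using vm by (simp add: sq_integrable_real)
  qed
  have dist_sq: "(norm (X n - U))\<^sup>2 = (LINT x|lborel. (wt x * u n x - a x)\<^sup>2 + (norm (grad (u n) x - g x))\<^sup>2)" for n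
  proof -
    have s: "sq_integrable (\<lambda>x. comb (u n) x - fn U x)" by (intro sq_integrable_diff comb_sq u sq_integrable_fn)
    have "X n - U = mk (\<lambda>x. comb (u n) x - fn U x)"
      by (simp add: mk_diff comb_sq u sq_integrable_fn mk_fn emb_def[symmetric])
    thus ?thesis unfolding norm_mk_sq[OF s, symmetric]
      by (simp only: norm_mk_sq[OF s]) (simp add: norm_prod_def comb_def a_def g_def)
  qed
  have iw: "integrable lborel (\<lambda>x. (wt x * u n x - a x)\<^sup>2)" for n
    using sq_integrable_diff[OF wt_mult_sq[OF u(1)] as, of n] by (simp add: sq_integrable_real)
  have ig: "integrable lborel (\<lambda>x. (norm (grad (u n) x - g x))\<^sup>2)" for n
    using sq_integrableD(2)[OF sq_integrable_diff[OF grad_sq[OF W_H1[OF u(1)]] gs]] .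
  have XU: "(\<lambda>n. (norm (X n - U))\<^sup>2) \<longlonglongrightarrow> 0"
    using tendsto_power[OF tendsto_norm_zero[OF LIM_zero[OF X(2)]], of 2] by simp
  have gl: "(\<lambda>n. mk (grad (u n))) \<longlonglongrightarrow> mk g"
  proof -
    have "(norm (mk (grad (u n)) - mk g))\<^sup>2 \<le> (norm (X n - U))\<^sup>2" for n
      unfolding dist_sq mk_diff[OF grad_sq[OF W_H1[OF u(1)]] gs, symmetric]
        norm_mk_sq[OF sq_integrable_diff[OF grad_sq[OF W_H1[OF u(1)]] gs]]
      by (rule integral_mono) (use iw ig in auto)
    hence "norm (mk (grad (u n)) - mk g) \<le> norm (X n - U)" for n by (rule power2_le_imp_le) simp
    hence "(\<lambda>n. mk (grad (u n)) - mk g) \<longlonglongrightarrow> 0"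
      by (intro Lim_null_comparison[OF _ tendsto_norm_zero[OF LIM_zero[OF X(2)]]] always_eventually allI)
    thus ?thesis by (rule LIM_zero_cancel)
  qed
  have ul: "(\<lambda>n. mk (u n)) \<longlonglongrightarrow> mk v"
  proof -
    have "(norm (mk (u n) - mk v))\<^sup>2 \<le> (norm (X n - U))\<^sup>2 / c0" for n
    proof -
      have "(norm (mk (u n) - mk v))\<^sup>2 = (LINT x|lborel. (u n x - v x)\<^sup>2)"
        unfolding mk_diff[OF W_sq[OF u(1)] vs, symmetric] norm_mk_sq[OF sq_integrable_diff[OF W_sq[OF u(1)] vs]] by simp
      also have "\<dots> \<le> (LINT x|lborel. ((wt x * u n x - a x)\<^sup>2 + (norm (grad (u n) x - g x))\<^sup>2) / c0)"
      proof (rule integral_mono_AE)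
        show "integrable lborel (\<lambda>x. (u n x - v x)\<^sup>2)"
          using sq_integrable_diff[OF W_sq[OF u(1)] vs, of n] by (simp add: sq_integrable_real)
        show "integrable lborel (\<lambda>x. ((wt x * u n x - a x)\<^sup>2 + (norm (grad (u n) x - g x))\<^sup>2) / c0)"
          using iw ig by simp
        show "AE x in lborel. (u n x - v x)\<^sup>2 \<le> ((wt x * u n x - a x)\<^sup>2 + (norm (grad (u n) x - g x))\<^sup>2) / c0"
          using Ve_ge wtv
        proof eventually_elim
          case (elim x)
          have "c0 * (u n x - v x)\<^sup>2 \<le> \<bar>Ve x\<bar> * (u n x - v x)\<^sup>2" using elim c0(1) by (intro mult_right_mono) auto
          also have "\<dots> = (wt x * (u n x - v x))\<^sup>2" by (simp add: power_mult_distrib wt_sq)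
          also have "wt x * (u n x - v x) = wt x * u n x - a x" using elim(2) by (simp add: right_diff_distrib)
          finally have "c0 * (u n x - v x)\<^sup>2 \<le> (wt x * u n x - a x)\<^sup>2 + (norm (grad (u n) x - g x))\<^sup>2"
            by (simp add: add_increasing2)
          thus ?case using c0(1) by (simp add: field_simps)
        qed
      qed
      also have "\<dots> = (norm (X n - U))\<^sup>2 / c0" by (simp add: dist_sq)
      finally show ?thesis .
    qed
    moreover have "(\<lambda>n. (norm (X n - U))\<^sup>2 / c0) \<longlonglongrightarrow> 0" using tendsto_divide[OF XU tendsto_const[of c0]] c0(1) by simp
    ultimately have "(\<lambda>n. (norm (mk (u n) - mk v))\<^sup>2) \<longlonglongrightarrow> 0"
      by (intro Lim_null_comparison[of "\<lambda>n. (norm (mk (u n) - mk v))\<^sup>2"]) auto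
    hence "(\<lambda>n. sqrt ((norm (mk (u n) - mk v))\<^sup>2)) \<longlonglongrightarrow> sqrt 0" by (rule tendsto_real_sqrt)
    hence "(\<lambda>n. norm (mk (u n) - mk v)) \<longlonglongrightarrow> 0" by simp
    thus ?thesis by (intro LIM_zero_cancel[of "\<lambda>n. mk (u n)"]) (rule tendsto_norm_zero_cancel)
  qed
  have vg: "L2_grad v g"
    by (rule L2_grad_limit[OF _ _ vs gs ul gl]) (auto intro: W_sq L2_grad_grad W_H1 u)
  hence vH: "v \<in> H1" using vs by (auto simp: H1_iff)
  have vW: "v \<in> W"
  proof (rule W_I[OF vH])
    have "integrable lborel (\<lambda>x. (a x)\<^sup>2)" using as by (simp add: sq_integrable_real)
    thus "integrable lborel (\<lambda>x. (wt x * v x)\<^sup>2)"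
    proof (rule Bochner_Integration.integrable_bound)
      show "AE x in lborel. norm ((wt x * v x)\<^sup>2) \<le> norm ((a x)\<^sup>2)" using wtv by eventually_elim simp
    qed (use wt_meas vm in measurable)
  qed
  have "emb v = mk (fn U)" unfolding emb_def
  proof (rule mk_cong)
    show "AE x in lborel. comb v x = fn U x"
      using wtv grad_eqI[OF vH vg] by eventually_elim (simp add: comb_def a_def g_def)
  qed
  thus "U \<in> WW" using vW by (auto simp: mk_fn WW_def)
qed

lemma test_fun_W:
  assumes \<phi>: "test_fun \<phi>" shows "\<phi> \<in> W"
proof (rule W_I[OF test_fun_H1[OF \<phi>]])
  obtain r where r: "\<And>x. \<phi> x \<noteq> 0 \<Longrightarrow> norm x \<le> r" using \<phi> by (auto simp: test_fun_iff)
  obtain C where C: "AE x in lborel. x \<in> cball 0 (\<epsilon> * r) \<longrightarrow> \<bar>V x\<bar> \<le> C" using V_loc[of "cball 0 (\<epsilon> * r)"] by auto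
  have "AE x in lborel. \<epsilon> *\<^sub>R x \<in> cball 0 (\<epsilon> * r) \<longrightarrow> \<bar>V (\<epsilon> *\<^sub>R x)\<bar> \<le> C"
    by (rule AE_lborel_scaleR[OF C]) (use \<epsilon> in simp)
  hence ae: "AE x in lborel. norm ((wt x * \<phi> x)\<^sup>2) \<le> norm (\<bar>C\<bar> * (\<phi> x)\<^sup>2)"
  proof eventually_elim
    case (elim x)
    show ?case
    proof (cases "\<phi> x = 0")
      case False
      hence "\<bar>Ve x\<bar> \<le> \<bar>C\<bar>" using elim r[OF False] \<epsilon> by (auto simp: Ve_def)
      thus ?thesis by (simp add: power_mult_distrib wt_sq abs_mult mult_right_mono)
    qed simp
  qed
  show "integrable lborel (\<lambda>x. (wt x * \<phi> x)\<^sup>2)"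
  proof (rule Bochner_Integration.integrable_bound[OF _ _ ae])
    show "integrable lborel (\<lambda>x. \<bar>C\<bar> * (\<phi> x)\<^sup>2)" using test_fun_sq_integrable[OF \<phi>] by (simp add: sq_integrable_real)
  qed (use wt_meas test_fun_measurable[OF \<phi>] in measurable)
qed

text \<open>Bumps on the disjoint open cubes with corners (j, j, j) and (j+1, j+1, j+1): multiplying
  a vanishing combination by b k isolates the coefficient c k.\<close>

lemma infinite_dim_WW:
  "\<exists>e :: nat \<Rightarrow> (R3, real \<times> R3) L2. (\<forall>i. e i \<in> WW) \<and>
     (\<forall>c. (\<Sum>i\<le>n. c i *\<^sub>R e i) = 0 \<longrightarrow> (\<forall>i\<le>n. c i = 0))"
proof -
  define lo hi :: "nat \<Rightarrow> R3" where "lo j = (\<chi> i. real j)" and "hi j = (\<chi> i. real j + 1)" for j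
  define b where "b j = bump 1 (lo j) (hi j)" for j
  have b: "test_fun (b j)" for j unfolding b_def by (rule test_fun_bump) simp
  have b0: "b j x * b k x = 0" if "j \<noteq> k" for j k x
  proof -
    have "\<not> (x \<in> box (lo j) (hi j) \<and> x \<in> box (lo k) (hi k))"
    proof
      assume a: "x \<in> box (lo j) (hi j) \<and> x \<in> box (lo k) (hi k)"
      have "real j < x $ 1 \<and> x $ 1 < real j + 1 \<and> real k < x $ 1 \<and> x $ 1 < real k + 1"
        using a unfolding mem_box_vec by (simp add: lo_def hi_def)
      hence "real j < real k + 1" "real k < real j + 1" by linarith+
      thus False using that by simp
    qed
    thus ?thesis using bump_eq_0[of 1 x] by (auto simp: b_def)
  qed
  have sum: "(\<lambda>x. \<Sum>i\<in>A. c i * b i x) \<in> W \<and> emb (\<lambda>x. \<Sum>i\<in>A. c i * b i x) = (\<Sum>i\<in>A. c i *\<^sub>R emb (b i))"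
    if "finite A" for A c using that
  proof (induction A rule: finite_induct)
    case empty
    show ?case using zero_W emb_cmult[OF zero_W, of 0] by simp
  next
    case (insert k A)
    have k: "(\<lambda>x. c k * b k x) \<in> W" "emb (\<lambda>x. c k * b k x) = c k *\<^sub>R emb (b k)"
      by (intro W_cmult emb_cmult test_fun_W b)+
    show ?case using insert k W_add[OF k(1)] emb_add[OF k(1)] by simp
  qed
  have "c k = 0" if z: "(\<Sum>i\<le>n. c i *\<^sub>R emb (b i)) = 0" and k: "k \<le> n" for c k
  proof -
    have "emb (\<lambda>x. \<Sum>i\<le>n. c i * b i x) = emb (\<lambda>x. 0)"
      using sum[of "{..n}" c] z emb_cmult[OF zero_W, of 0] by simp
    hence ae: "AE x in lborel. (\<Sum>i\<le>n. c i * b i x) = 0"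
      by (intro emb_eq_imp_AE[OF _ zero_W]) (use sum[of "{..n}" c] in auto)
    hence ae2: "AE x in lborel. c k * (b k x)\<^sup>2 = 0"
    proof eventually_elim
      case (elim x)
      have "0 = (\<Sum>i\<le>n. c i * b i x) * b k x" using elim by simp
      also have "\<dots> = (\<Sum>i\<le>n. c i * (b i x * b k x))" by (simp add: sum_distrib_right mult.assoc)
      also have "\<dots> = (\<Sum>i\<in>{k}. c i * (b i x * b k x))"
        by (rule sum.mono_neutral_right) (use k b0 in auto)
      finally show ?case by (simp add: power2_eq_square)
    qed
    show "c k = 0"
    proof (rule ccontr)
      assume c: "c k \<noteq> 0"
      have "AE x in lborel. x \<notin> box (lo k) (hi k)"
        using ae2
      proof eventually_elim
        case (elim x)
        thus ?case using c bump_pos[of 1 x "lo k" "hi k"] by (auto simp: b_def)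
      qed
      hence "emeasure lborel (box (lo k) (hi k)) = 0" by (subst (asm) AE_iff_measurable[of "box (lo k) (hi k)"]) auto
      moreover have "box (lo k) (hi k) \<noteq> {}"
      proof -
        have "(\<chi> i. real k + 1/2) \<in> box (lo k) (hi k)" unfolding mem_box_vec by (simp add: lo_def hi_def)
        thus ?thesis by blast
      qed
      hence "\<forall>i\<in>Basis. lo k \<bullet> i < hi k \<bullet> i" by (simp add: box_ne_empty)
      hence "0 < (\<Prod>i\<in>Basis. (hi k - lo k) \<bullet> i)" "\<forall>i\<in>Basis. lo k \<bullet> i \<le> hi k \<bullet> i"
        by (auto intro!: prod_pos simp: inner_diff_left)
      moreover from this(2) have "emeasure lborel (box (lo k) (hi k)) = ennreal (\<Prod>i\<in>Basis. (hi k - lo k) \<bullet> i)"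
        by (simp add: emeasure_lborel_box_eq del: prod_zero_iff)
      ultimately show False by (metis ennreal_eq_0_iff not_le)
    qed
  qed
  thus ?thesis using test_fun_W[OF b] by (intro exI[of _ "\<lambda>i. emb (b i)"]) (auto simp: WW_def)
qed

section \<open>Embeddings into \<open>L\<^sup>p\<close>\<close>

lemma Lp_integrable: "2 < p \<Longrightarrow> p < 6 \<Longrightarrow> u \<in> W \<Longrightarrow> integrable lborel (\<lambda>x. \<bar>u x\<bar> powr p)"
  using embed unfolding compact_embed_def by blast

lemma powr_diff_le: "0 \<le> p \<Longrightarrow> \<bar>a - b\<bar> powr p \<le> 2 powr p * (\<bar>a\<bar> powr p + \<bar>b\<bar> powr p)" for a b :: real
proof -
  assume p: "0 \<le> p"
  have "\<bar>a - b\<bar> powr p \<le> (2 * max \<bar>a\<bar> \<bar>b\<bar>) powr p" using p by (intro powr_mono2) auto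
  also have "\<dots> = 2 powr p * (max \<bar>a\<bar> \<bar>b\<bar>) powr p" by (simp add: powr_mult)
  also have "(max \<bar>a\<bar> \<bar>b\<bar>) powr p \<le> \<bar>a\<bar> powr p + \<bar>b\<bar> powr p" by (auto simp: max_def)
  finally show ?thesis by simp
qed

lemma powr_diff_integrable:
  assumes "0 \<le> p" "u \<in> borel_measurable lborel" "v \<in> borel_measurable lborel"
    "integrable lborel (\<lambda>x. \<bar>u x\<bar> powr p)" "integrable lborel (\<lambda>x. \<bar>v x\<bar> powr p)"
  shows "integrable lborel (\<lambda>x::'a::euclidean_space. \<bar>u x - v x :: real\<bar> powr p)"
proof (rule Bochner_Integration.integrable_bound)
  show "integrable lborel (\<lambda>x. 2 powr p * (\<bar>u x\<bar> powr p + \<bar>v x\<bar> powr p))" using assms by auto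
  show "(\<lambda>x. \<bar>u x - v x\<bar> powr p) \<in> borel_measurable lborel" using assms by measurable
qed (use powr_diff_le[OF assms(1)] in auto)

lemma powr_diff_integral_le:
  assumes "0 \<le> p" "u \<in> borel_measurable lborel" "v \<in> borel_measurable lborel"
    "integrable lborel (\<lambda>x. \<bar>u x\<bar> powr p)" "integrable lborel (\<lambda>x. \<bar>v x\<bar> powr p)"
  shows "(LINT x|lborel. \<bar>u x - v x\<bar> powr p) \<le> 2 powr p * ((LINT x|lborel. \<bar>u x\<bar> powr p) + (LINT x|lborel. \<bar>v (x::'a::euclidean_space) :: real\<bar> powr p))"
proof -
  have "(LINT x|lborel. \<bar>u x - v x\<bar> powr p) \<le> (LINT x|lborel. 2 powr p * (\<bar>u x\<bar> powr p + \<bar>v x\<bar> powr p))"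
    by (rule integral_mono[OF powr_diff_integrable[OF assms]]) (use assms powr_diff_le in auto)
  also have "\<dots> = 2 powr p * ((LINT x|lborel. \<bar>u x\<bar> powr p) + (LINT x|lborel. \<bar>v x\<bar> powr p))" using assms by simp
  finally show ?thesis .
qed

text \<open>Boundedness of the embedding follows from its compactness.\<close>
lemma Lp_bound:
  assumes p: "2 < p" "p < 6"
  shows "\<exists>C>0. \<forall>u\<in>W. (LINT x|lborel. \<bar>u x\<bar> powr p) \<le> C * norm (emb u) powr p"
proof -
  have "\<exists>C. \<forall>u\<in>W. norm (emb u) \<le> 1 \<longrightarrow> (LINT x|lborel. \<bar>u x\<bar> powr p) \<le> C"
  proof (rule ccontr)
    assume "\<not> ?thesis"
    hence "\<forall>n::nat. \<exists>u\<in>W. norm (emb u) \<le> 1 \<and> (LINT x|lborel. \<bar>u x\<bar> powr p) > real n" by (meson not_le)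
    then obtain x where x: "\<And>n::nat. x n \<in> W" "\<And>n. norm (emb (x n)) \<le> 1" "\<And>n. (LINT y|lborel. \<bar>x n y\<bar> powr p) > real n" by metis
    have "\<forall>n. W_norm V \<epsilon> (x n) \<le> 1" using x(1,2) emb_norm by metis
    then obtain r w where r: "strict_mono (r :: nat \<Rightarrow> nat)" "w \<in> borel_measurable lborel"
      "integrable lborel (\<lambda>y. \<bar>w y\<bar> powr p)" "(\<lambda>n. LINT y|lborel. \<bar>x (r n) y - w y\<bar> powr p) \<longlonglongrightarrow> 0"
      using embed[OF p] x(1) unfolding compact_embed_def by blast
    have "Bseq (\<lambda>n. LINT y|lborel. \<bar>x (r n) y - w y\<bar> powr p)"
      by (rule convergent_imp_Bseq) (use r(4) in \<open>auto simp: convergent_def\<close>)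
    then obtain D where "\<And>n. \<bar>LINT y|lborel. \<bar>x (r n) y - w y\<bar> powr p\<bar> \<le> D" unfolding Bseq_def by auto
    hence D: "(LINT y|lborel. \<bar>x (r n) y - w y\<bar> powr p) \<le> D" for n by (rule abs_le_D1)
    define E where "E = 2 powr p * (D + (LINT y|lborel. \<bar>w y\<bar> powr p))"
    have "(LINT y|lborel. \<bar>x (r n) y\<bar> powr p) \<le> E" for n
    proof -
      have xi: "integrable lborel (\<lambda>y. \<bar>x (r n) y\<bar> powr p)" by (rule Lp_integrable[OF p x(1)])
      have xm: "x (r n) \<in> borel_measurable lborel" by (rule W_meas[OF x(1)])
      have "(LINT y|lborel. \<bar>(x (r n) y - w y) - (- w y)\<bar> powr p)
          \<le> 2 powr p * ((LINT y|lborel. \<bar>x (r n) y - w y\<bar> powr p) + (LINT y|lborel. \<bar>- w y\<bar> powr p))"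
      proof (rule powr_diff_integral_le)
        show "integrable lborel (\<lambda>y. \<bar>x (r n) y - w y\<bar> powr p)"
          by (rule powr_diff_integrable) (use p xi xm r in auto)
      qed (use p xi xm r in auto)
      also have "\<dots> \<le> E" unfolding E_def using D[of n] by (intro mult_left_mono) auto
      finally show ?thesis by simp
    qed
    moreover obtain n :: nat where "E < real n" using reals_Archimedean2 by blast
    moreover have "real n \<le> real (r n)" using seq_suble[OF r(1), of n] by simp
    ultimately show False using x(3)[of "r n"] by (meson less_le_trans less_trans not_le)
  qed
  then obtain C where C: "\<And>u. u \<in> W \<Longrightarrow> norm (emb u) \<le> 1 \<Longrightarrow> (LINT x|lborel. \<bar>u x\<bar> powr p) \<le> C" by blast
  have "(LINT x|lborel. \<bar>u x\<bar> powr p) \<le> (\<bar>C\<bar> + 1) * norm (emb u) powr p" if u: "u \<in> W" for u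
  proof (cases "norm (emb u) = 0")
    case True
    hence "emb u = emb (\<lambda>x. 0)" using emb_cmult[OF zero_W, of 0] by simp
    hence "AE x in lborel. u x = 0" by (rule emb_eq_imp_AE[OF u zero_W])
    hence "AE x in lborel. \<bar>u x\<bar> powr p = 0" by eventually_elim simp
    hence "(LINT x|lborel. \<bar>u x\<bar> powr p) = 0" by (rule integral_eq_zero_AE)
    thus ?thesis by simp
  next
    case False
    define \<rho> where "\<rho> = norm (emb u)"
    have \<rho>: "0 < \<rho>" using False by (simp add: \<rho>_def)
    have "norm (emb (\<lambda>x. (1 / \<rho>) * u x)) \<le> 1"
      unfolding emb_cmult[OF u] using \<rho> by (simp add: \<rho>_def)
    hence "(LINT x|lborel. \<bar>(1 / \<rho>) * u x\<bar> powr p) \<le> C" by (rule C[OF W_cmult[OF u]])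
    also have "(\<lambda>x. \<bar>(1 / \<rho>) * u x\<bar> powr p) = (\<lambda>x. (1 / \<rho>) powr p * \<bar>u x\<bar> powr p)"
      using \<rho> by (simp add: abs_mult powr_mult fun_eq_iff powr_divide)
    finally have "(1 / \<rho>) powr p * (LINT x|lborel. \<bar>u x\<bar> powr p) \<le> C" by simp
    hence "(LINT x|lborel. \<bar>u x\<bar> powr p) \<le> C * \<rho> powr p"
      using \<rho> by (simp add: powr_divide field_simps)
    also have "\<dots> \<le> (\<bar>C\<bar> + 1) * \<rho> powr p" by (intro mult_right_mono) auto
    finally show ?thesis by (simp add: \<rho>_def)
  qed
  thus ?thesis by (intro exI[of _ "\<bar>C\<bar> + 1"]) auto
qed

text \<open>The bounded embedding turns small norm distance into small L^p distance, for which T is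
  uniformly continuous on balls.\<close>

lemma Lp_uniform_imp_continuous:
  fixes T :: "(R3, real \<times> R3) L2 \<Rightarrow> (R3, real \<times> R3) L2"
  assumes p: "2 < p" "p < 6"
    and T: "\<And>B \<eta>. 0 < \<eta> \<Longrightarrow> \<exists>\<delta>>0. \<forall>U\<in>WW. \<forall>Z\<in>WW. norm U \<le> B \<longrightarrow> norm Z \<le> B \<longrightarrow>
       (LINT x|lborel. \<bar>pull U x - pull Z x\<bar> powr p) \<le> \<delta> \<longrightarrow> norm (T U - T Z) \<le> \<eta>"
  shows "continuous_on WW T"
  unfolding continuous_on_iff
proof (intro ballI allI impI)
  fix U and e :: real assume U: "U \<in> WW" and e: "0 < e"
  obtain C where C: "0 < C" "\<And>u. u \<in> W \<Longrightarrow> (LINT x|lborel. \<bar>u x\<bar> powr p) \<le> C * norm (emb u) powr p"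
    using Lp_bound[OF p] by blast
  have "0 < e / 2" using e by simp
  from T[OF this, of "norm U + 1"] obtain \<delta> where \<delta>0: "0 < \<delta>" and \<delta>': "\<And>U' Z. U' \<in> WW \<Longrightarrow> Z \<in> WW \<Longrightarrow>
     norm U' \<le> norm U + 1 \<Longrightarrow> norm Z \<le> norm U + 1 \<Longrightarrow>
     (LINT x|lborel. \<bar>pull U' x - pull Z x\<bar> powr p) \<le> \<delta> \<Longrightarrow> norm (T U' - T Z) \<le> e / 2" by blast
  have \<delta>: "0 < \<delta>" "\<And>Z. Z \<in> WW \<Longrightarrow> norm Z \<le> norm U + 1 \<Longrightarrow>
     (LINT x|lborel. \<bar>pull Z x - pull U x\<bar> powr p) \<le> \<delta> \<Longrightarrow> norm (T Z - T U) \<le> e / 2"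
    using \<delta>0 \<delta>'[OF _ U] by auto
  \<comment> \<open>The second entry solves C d^p = \<delta>; the cap 1 keeps the points in the ball
    of radius |U| + 1.\<close>
  define d where "d = min 1 ((\<delta> / C) powr (1 / p))"
  have d: "0 < d" using \<delta>(1) C(1) by (simp add: d_def)
  show "\<exists>d>0. \<forall>x'\<in>WW. dist x' U < d \<longrightarrow> dist (T x') (T U) < e"
  proof (intro exI[of _ d] conjI ballI impI d)
    fix Z assume Z: "Z \<in> WW" "dist Z U < d"
    have nZ: "norm Z \<le> norm U + 1"
      using Z(2) norm_triangle_ineq2[of Z U] by (simp add: dist_norm d_def)
    have "(LINT x|lborel. \<bar>pull Z x - pull U x\<bar> powr p) \<le> C * norm (Z - U) powr p"
      using C(2)[OF W_diff[OF pull(1)[OF Z(1)] pull(1)[OF U]]] by (simp add: emb_diff pull Z U)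
    also have "\<dots> \<le> C * ((\<delta> / C) powr (1 / p)) powr p"
      using Z(2) C(1) p by (intro mult_left_mono powr_mono2) (auto simp: dist_norm d_def)
    also have "\<dots> = \<delta>" using C(1) \<delta>(1) p by (simp add: powr_powr)
    finally have "norm (T Z - T U) \<le> e / 2" using \<delta>(2)[OF Z(1) nZ] by simp
    thus "dist (T Z) (T U) < e" using e by (simp add: dist_norm)
  qed
qed

text \<open>The L^p limit w of a subsequence is not known to lie in the weighted space, so T cannot
  be applied to it. The images are shown to be Cauchy instead, with 2 powr p as the price of a
  triangle inequality for p-th powers.\<close>

lemma Lp_uniform_imp_compact:
  fixes T :: "(R3, real \<times> R3) L2 \<Rightarrow> (R3, real \<times> R3) L2"
  assumes p: "2 < p" "p < 6"
    and T: "\<And>B \<eta>. 0 < \<eta> \<Longrightarrow> \<exists>\<delta>>0. \<forall>U\<in>WW. \<forall>Z\<in>WW. norm U \<le> B \<longrightarrow> norm Z \<le> B \<longrightarrow>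
       (LINT x|lborel. \<bar>pull U x - pull Z x\<bar> powr p) \<le> \<delta> \<longrightarrow> norm (T U - T Z) \<le> \<eta>"
    and X: "\<And>n::nat. X n \<in> WW" "\<And>n. norm (X n) \<le> B"
  shows "\<exists>r l. strict_mono (r :: nat \<Rightarrow> nat) \<and> (T \<circ> X \<circ> r) \<longlonglongrightarrow> l"
proof -
  define x where "x n = pull (X n)" for n
  have x: "x n \<in> W" "emb (x n) = X n" for n using X(1) pull by (auto simp: x_def)
  have "\<forall>n. W_norm V \<epsilon> (x n) \<le> B" using x X(2) emb_norm by metis
  then obtain r w where r: "strict_mono (r :: nat \<Rightarrow> nat)" "w \<in> borel_measurable lborel"
    "integrable lborel (\<lambda>y. \<bar>w y\<bar> powr p)" "(\<lambda>n. LINT y|lborel. \<bar>x (r n) y - w y\<bar> powr p) \<longlonglongrightarrow> 0"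
    using embed[OF p] x(1) unfolding compact_embed_def by blast
  have "Cauchy (T \<circ> X \<circ> r)"
  proof (rule metric_CauchyI)
    fix e :: real assume e: "0 < e"
    hence "0 < e / 2" by simp
    from T[OF this, of B] obtain \<delta> where \<delta>: "0 < \<delta>"
      "\<And>U Z. U \<in> WW \<Longrightarrow> Z \<in> WW \<Longrightarrow> norm U \<le> B \<Longrightarrow> norm Z \<le> B \<Longrightarrow>
         (LINT x|lborel. \<bar>pull U x - pull Z x\<bar> powr p) \<le> \<delta> \<Longrightarrow> norm (T U - T Z) \<le> e / 2" by blast
    have "0 < \<delta> / (2 * 2 powr p)" using \<delta>(1) by simp
    hence "\<forall>\<^sub>F n in sequentially. (LINT y|lborel. \<bar>x (r n) y - w y\<bar> powr p) < \<delta> / (2 * 2 powr p)"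
      using order_tendstoD(2)[OF r(4)] by blast
    then obtain N where N: "\<And>n. N \<le> n \<Longrightarrow> (LINT y|lborel. \<bar>x (r n) y - w y\<bar> powr p) < \<delta> / (2 * 2 powr p)"
      by (auto simp: eventually_sequentially)
    show "\<exists>N. \<forall>m\<ge>N. \<forall>n\<ge>N. dist ((T \<circ> X \<circ> r) m) ((T \<circ> X \<circ> r) n) < e"
    proof (intro exI allI impI)
      fix m n assume mn: "N \<le> m" "N \<le> n"
      have xi: "integrable lborel (\<lambda>y. \<bar>x (r k) y - w y\<bar> powr p)" for k
        by (rule powr_diff_integrable) (use p r(2,3) Lp_integrable[OF p x(1)] W_meas[OF x(1)] in auto)
      have xm: "(\<lambda>y. x (r k) y - w y) \<in> borel_measurable lborel" for k
        using W_meas[OF x(1)] r(2) by measurable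
      have "(LINT y|lborel. \<bar>(x (r m) y - w y) - (x (r n) y - w y)\<bar> powr p)
          \<le> 2 powr p * ((LINT y|lborel. \<bar>x (r m) y - w y\<bar> powr p) + (LINT y|lborel. \<bar>x (r n) y - w y\<bar> powr p))"
        by (rule powr_diff_integral_le) (use p xi xm in auto)
      also have "\<dots> \<le> 2 powr p * (\<delta> / (2 * 2 powr p) + \<delta> / (2 * 2 powr p))"
        using N[OF mn(1)] N[OF mn(2)] by (intro mult_left_mono add_mono) auto
      also have "\<dots> = \<delta>" by (simp add: field_simps)
      finally have "(LINT y|lborel. \<bar>x (r m) y - x (r n) y\<bar> powr p) \<le> \<delta>" by simp
      hence "norm (T (X (r m)) - T (X (r n))) \<le> e / 2"
        unfolding x_def by (rule \<delta>(2)[OF X(1) X(1) X(2) X(2)])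
      thus "dist ((T \<circ> X \<circ> r) m) ((T \<circ> X \<circ> r) n) < e" using e by (simp add: dist_norm)
    qed
  qed
  thus ?thesis using r(1) Cauchy_convergent convergent_def by blast
qed

lemma norm_le_by_pairing:
  assumes "r \<in> WW" "0 \<le> C" and h: "\<And>h. h \<in> W \<Longrightarrow> norm (emb h) \<le> 1 \<Longrightarrow> inner r (emb h) \<le> C"
  shows "norm r \<le> C"
proof (cases "r = 0")
  case False
  have e: "emb (\<lambda>x. (1 / norm r) * pull r x) = (1 / norm r) *\<^sub>R r"
    unfolding emb_cmult[OF pull(1)[OF assms(1)]] pull(2)[OF assms(1)] ..
  have "inner r (emb (\<lambda>x. (1 / norm r) * pull r x)) \<le> C"
    by (rule h[OF W_cmult[OF pull(1)[OF assms(1)]]]) (simp only: e, use False in simp)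
  thus ?thesis using False unfolding e by (simp add: power2_norm_eq_inner[symmetric] power2_eq_square)
qed (use assms in simp)

end

section \<open>The nonlinearity\<close>

text \<open>According to whether \<theta> b \<le> a or not, one of the two terms alone suffices. A
  small \<theta> makes the b-term small at the expense of the a-term, which in the application is an
  L^q distance.\<close>

lemma young_powr:
  fixes a b :: real
  assumes "0 \<le> a" "0 \<le> b" "1 < q" "0 < \<theta>"
  shows "a powr (q - 1) * b \<le> a powr q / \<theta> + \<theta> powr (q - 1) * b powr q"
proof -
  have pp: "x powr (q - 1) * x = x powr q" if "0 \<le> x" for x :: real
    using that assms(3) powr_add[of x "q - 1" 1] by (cases "x = 0") auto
  show ?thesis
  proof (cases "\<theta> * b \<le> a")
    case True
    have "a powr (q - 1) * b \<le> a powr (q - 1) * (a / \<theta>)"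
      using True assms by (intro mult_left_mono) (auto simp: field_simps)
    also have "\<dots> = a powr q / \<theta>" using pp[OF assms(1)] by simp
    finally show ?thesis using assms by (simp add: add_increasing2)
  next
    case False
    have "a powr (q - 1) * b \<le> (\<theta> * b) powr (q - 1) * b"
      using False assms by (intro mult_right_mono powr_mono2) auto
    also have "\<dots> = \<theta> powr (q - 1) * (b powr (q - 1) * b)" using assms by (simp add: powr_mult)
    also have "\<dots> = \<theta> powr (q - 1) * b powr q" using pp[OF assms(2)] by simp
    finally show ?thesis using assms by (simp add: add_increasing)
  qed
qed

lemma young_powr1: "0 \<le> a \<Longrightarrow> 0 \<le> b \<Longrightarrow> 1 < q \<Longrightarrow> a powr (q - 1) * b \<le> a powr q + b powr q" for a b :: real
  using young_powr[of a b q 1] by simp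

lemma abs_integral_le:
  fixes g G :: "'a \<Rightarrow> real"
  assumes "integrable M G" "g \<in> borel_measurable M" "\<And>x. \<bar>g x\<bar> \<le> G x"
  shows "integrable M g" "\<bar>LINT x|M. g x\<bar> \<le> (LINT x|M. G x)"
proof -
  show i: "integrable M g"
  proof (rule Bochner_Integration.integrable_bound[OF assms(1,2)], intro AE_I2)
    show "norm (g x) \<le> norm (G x)" for x using assms(3)[of x] by simp
  qed
  have "\<bar>LINT x|M. g x\<bar> \<le> (LINT x|M. \<bar>g x\<bar>)" by (rule integral_abs_bound)
  also have "\<dots> \<le> (LINT x|M. G x)" by (rule integral_mono[OF integrable_abs[OF i] assms(1)]) (rule assms(3))
  finally show "\<bar>LINT x|M. g x\<bar> \<le> (LINT x|M. G x)" .
qed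

locale nonlinearity =
  fixes f :: "real \<Rightarrow> real" and q :: real
  assumes f_cont: "continuous_on UNIV f"
    and f_odd: "\<And>t. f (- t) = - f t"
    and f_nonneg: "\<And>t. t \<ge> 0 \<Longrightarrow> f t \<ge> 0"
    and q: "2 < q" "q < 6"
    and f_infty: "((\<lambda>t. f t / t powr (q - 1)) \<longlongrightarrow> 0) at_top"
    and f_zero: "((\<lambda>t. f t / t) \<longlongrightarrow> 0) (at 0)"
begin

lemma f0: "f 0 = 0" using f_odd[of 0] by simp

lemma f_abs: "\<bar>f \<bar>t\<bar>\<bar> = \<bar>f t\<bar>" using f_odd[of t] by (auto simp: abs_if)

lemma f_small: "0 < \<eta> \<Longrightarrow> \<exists>d>0. \<forall>t. \<bar>t\<bar> \<le> d \<longrightarrow> \<bar>f t\<bar> \<le> \<eta> * \<bar>t\<bar>"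
proof -
  assume \<eta>: "0 < \<eta>"
  have "\<forall>\<^sub>F t in at 0. dist (f t / t) 0 < \<eta>" using f_zero \<eta> by (rule tendstoD)
  then obtain d where d: "0 < d" "\<And>t. t \<noteq> 0 \<Longrightarrow> \<bar>t\<bar> < d \<Longrightarrow> \<bar>f t / t\<bar> < \<eta>"
    by (auto simp: eventually_at)
  have "\<bar>f t\<bar> \<le> \<eta> * \<bar>t\<bar>" if "\<bar>t\<bar> \<le> d / 2" for t
  proof (cases "t = 0")
    case False
    have "\<bar>f t\<bar> / \<bar>t\<bar> < \<eta>" using d(2)[OF False] that d(1) by (simp add: abs_divide)
    thus ?thesis using False by (simp add: field_simps)
  qed (simp add: f0)
  thus ?thesis using d(1) by (intro exI[of _ "d / 2"]) auto
qed

lemma f_large: "0 < \<eta> \<Longrightarrow> \<exists>L>0. \<forall>t. L \<le> \<bar>t\<bar> \<longrightarrow> \<bar>f t\<bar> \<le> \<eta> * \<bar>t\<bar> powr (q - 1)"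
proof -
  assume \<eta>: "0 < \<eta>"
  have "\<forall>\<^sub>F t in at_top. dist (f t / t powr (q - 1)) 0 < \<eta>" using f_infty \<eta> by (rule tendstoD)
  then obtain L where L: "\<And>t. L \<le> t \<Longrightarrow> \<bar>f t / t powr (q - 1)\<bar> < \<eta>"
    by (auto simp: eventually_at_top_linorder)
  have "\<bar>f t\<bar> \<le> \<eta> * \<bar>t\<bar> powr (q - 1)" if t: "max L 1 \<le> \<bar>t\<bar>" for t
  proof -
    have "0 < \<bar>t\<bar>" using t by linarith
    hence p: "0 < \<bar>t\<bar> powr (q - 1)" by simp
    have "\<bar>f \<bar>t\<bar> / \<bar>t\<bar> powr (q - 1)\<bar> < \<eta>" by (rule L) (use t in simp)
    hence "\<bar>f t\<bar> / \<bar>t\<bar> powr (q - 1) < \<eta>" using p by (simp add: abs_divide f_abs)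
    thus ?thesis using p by (simp add: pos_divide_less_eq)
  qed
  thus ?thesis by (intro exI[of _ "max L 1"]) auto
qed

lemma f_bounded_on: "\<exists>M\<ge>0. \<forall>t. \<bar>t\<bar> \<le> L \<longrightarrow> \<bar>f t\<bar> \<le> M"
proof -
  have "compact (f ` {- L..L})" by (intro compact_continuous_image continuous_on_subset[OF f_cont]) auto
  then obtain M where "\<And>t. t \<in> {- L..L} \<Longrightarrow> \<bar>f t\<bar> \<le> M" using compact_imp_bounded bounded_real by (metis imageI)
  thus ?thesis by (intro exI[of _ "max M 0"]) (auto simp: abs_le_iff le_max_iff_disj)
qed

text \<open>The substitute for a Lipschitz estimate, as f is merely continuous. Near 0 and near
  infinity the growth conditions bring f below the first two terms. In between, either s and t are
  so close that uniform continuity applies, or they are apart and a large C covers the bounded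
  difference.\<close>

lemma f_diff_bound:
  assumes \<eta>: "0 < \<eta>"
  shows "\<exists>C>0. \<forall>s t. \<bar>f s - f t\<bar> \<le> \<eta> * (\<bar>s\<bar> + \<bar>t\<bar>) + \<eta> * (\<bar>s\<bar> powr (q - 1) + \<bar>t\<bar> powr (q - 1)) + C * \<bar>s - t\<bar> powr (q - 1)"
proof -
  define e where "e = \<eta> / 2"
  have e: "0 < e" using \<eta> by (simp add: e_def)
  obtain d where d: "0 < d" "\<And>t. \<bar>t\<bar> \<le> d \<Longrightarrow> \<bar>f t\<bar> \<le> e * \<bar>t\<bar>" using f_small[OF e] by blast
  obtain L1 where L1: "0 < L1" "\<And>t. L1 \<le> \<bar>t\<bar> \<Longrightarrow> \<bar>f t\<bar> \<le> e * \<bar>t\<bar> powr (q - 1)" using f_large[OF e] by blast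
  obtain M1 where M1: "0 \<le> M1" "\<And>t. \<bar>t\<bar> \<le> L1 \<Longrightarrow> \<bar>f t\<bar> \<le> M1" using f_bounded_on by blast
  \<comment> \<open>Beyond L the bound M1 for f on the middle range is absorbed by e |s|^(q-1), even
    if only one of the two arguments is large.\<close>
  define L where "L = max L1 ((M1 / e) powr (1 / (q - 1)))"
  have L: "L1 \<le> L" "0 < L" using L1 by (auto simp: L_def)
  have Mle: "M1 \<le> e * t powr (q - 1)" if "L \<le> t" for t
  proof -
    have "M1 / e = ((M1 / e) powr (1 / (q - 1))) powr (q - 1)" using M1 e q by (simp add: powr_powr)
    also have "\<dots> \<le> t powr (q - 1)" using that q by (intro powr_mono2) (auto simp: L_def)
    finally show ?thesis using e by (simp add: field_simps)
  qed
  have fall: "\<bar>f t\<bar> \<le> M1 + e * \<bar>t\<bar> powr (q - 1)" for t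
    using M1(1) M1(2)[of t] L1(2)[of t] e by (cases "\<bar>t\<bar> \<le> L1") (auto intro: add_increasing2 add_increasing)
  obtain M where M: "0 \<le> M" "\<And>t. \<bar>t\<bar> \<le> L \<Longrightarrow> \<bar>f t\<bar> \<le> M" using f_bounded_on by blast
  have "uniformly_continuous_on {- L..L} f"
    by (intro compact_uniformly_continuous continuous_on_subset[OF f_cont]) auto
  \<comment> \<open>The tolerance e * d is good enough because this estimate is used only when |s| +
    |t| \<ge> d.\<close>
  then obtain \<sigma> where \<sigma>: "0 < \<sigma>" "\<And>s t. \<bar>s\<bar> \<le> L \<Longrightarrow> \<bar>t\<bar> \<le> L \<Longrightarrow> \<bar>s - t\<bar> < \<sigma> \<Longrightarrow> \<bar>f s - f t\<bar> < e * d"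
    using e d(1) unfolding uniformly_continuous_on_def dist_real_def
    by (metis abs_le_iff atLeastAtMost_iff minus_le_iff mult_pos_pos abs_minus_commute)
  define C where "C = 2 * (M + 1) / \<sigma> powr (q - 1)"
  have C: "0 < C" using M(1) \<sigma>(1) by (simp add: C_def)
  have big: "\<bar>f s - f t\<bar> \<le> \<eta> * (\<bar>s\<bar> powr (q - 1) + \<bar>t\<bar> powr (q - 1))" if s: "L \<le> \<bar>s\<bar>" for s t
  proof -
    have "\<bar>f s\<bar> \<le> e * \<bar>s\<bar> powr (q - 1)" using L1(2) s L by auto
    moreover have "\<bar>f t\<bar> \<le> e * \<bar>s\<bar> powr (q - 1) + e * \<bar>t\<bar> powr (q - 1)" using fall[of t] Mle[OF s] by linarith
    moreover have "0 \<le> e * \<bar>t\<bar> powr (q - 1)" using e by simp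
    ultimately have "\<bar>f s - f t\<bar> \<le> 2 * (e * \<bar>s\<bar> powr (q - 1)) + 2 * (e * \<bar>t\<bar> powr (q - 1))" by linarith
    thus ?thesis by (simp add: e_def algebra_simps)
  qed
  have "\<bar>f s - f t\<bar> \<le> \<eta> * (\<bar>s\<bar> + \<bar>t\<bar>) + \<eta> * (\<bar>s\<bar> powr (q - 1) + \<bar>t\<bar> powr (q - 1)) + C * \<bar>s - t\<bar> powr (q - 1)" for s t
  proof -
    have nn: "0 \<le> \<eta> * (\<bar>s\<bar> + \<bar>t\<bar>)" "0 \<le> \<eta> * (\<bar>s\<bar> powr (q - 1) + \<bar>t\<bar> powr (q - 1))" "0 \<le> C * \<bar>s - t\<bar> powr (q - 1)"
      using \<eta> C by simp_all
    consider "L \<le> \<bar>s\<bar>" | "L \<le> \<bar>t\<bar>" | "\<bar>s\<bar> \<le> L" "\<bar>t\<bar> \<le> L" "\<bar>s\<bar> \<le> d" "\<bar>t\<bar> \<le> d"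
      | "\<bar>s\<bar> \<le> L" "\<bar>t\<bar> \<le> L" "d \<le> \<bar>s\<bar> + \<bar>t\<bar>" "\<bar>s - t\<bar> < \<sigma>" | "\<bar>s\<bar> \<le> L" "\<bar>t\<bar> \<le> L" "\<sigma> \<le> \<bar>s - t\<bar>"
      by linarith
    thus ?thesis
    proof cases
      case 1 thus ?thesis using big[of s t] nn by linarith
    next
      case 2 thus ?thesis using big[of t s] nn by (simp add: abs_minus_commute add.commute)
    next
      case 3
      have "\<bar>f s - f t\<bar> \<le> e * \<bar>s\<bar> + e * \<bar>t\<bar>" using d(2)[OF 3(3)] d(2)[OF 3(4)] by linarith
      also have "\<dots> \<le> \<eta> * (\<bar>s\<bar> + \<bar>t\<bar>)" using \<eta> by (simp add: e_def field_simps)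
      finally show ?thesis using nn by linarith
    next
      case 4
      have "\<bar>f s - f t\<bar> \<le> e * d" using \<sigma>(2)[OF 4(1,2,4)] by simp
      also have "\<dots> \<le> \<eta> * (\<bar>s\<bar> + \<bar>t\<bar>)" using 4(3) d(1) \<eta> by (intro mult_mono) (auto simp: e_def)
      finally show ?thesis using nn by linarith
    next
      case 5
      have "\<bar>f s - f t\<bar> \<le> 2 * (M + 1)" using M(2)[OF 5(1)] M(2)[OF 5(2)] abs_triangle_ineq4[of "f s" "f t"] by argo
      also have "\<dots> = C * \<sigma> powr (q - 1)" using \<sigma>(1) by (simp add: C_def)
      also have "\<dots> \<le> C * \<bar>s - t\<bar> powr (q - 1)" using 5(3) \<sigma>(1) C q by (intro mult_left_mono powr_mono2) auto
      finally show ?thesis using nn by linarith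
    qed
  qed
  thus ?thesis using C by blast
qed

lemma f_growth: "\<exists>A>0. \<forall>s. \<bar>f s\<bar> \<le> A * (\<bar>s\<bar> + \<bar>s\<bar> powr (q - 1))"
proof -
  obtain C where C: "0 < C" "\<And>s t. \<bar>f s - f t\<bar> \<le> 1 * (\<bar>s\<bar> + \<bar>t\<bar>) + 1 * (\<bar>s\<bar> powr (q - 1) + \<bar>t\<bar> powr (q - 1)) + C * \<bar>s - t\<bar> powr (q - 1)"
    using f_diff_bound[of 1] by auto
  have "\<bar>f s\<bar> \<le> (1 + C) * (\<bar>s\<bar> + \<bar>s\<bar> powr (q - 1))" for s
  proof -
    have "\<bar>f s\<bar> \<le> \<bar>s\<bar> + \<bar>s\<bar> powr (q - 1) + C * \<bar>s\<bar> powr (q - 1)" using C(2)[of s 0] f0 by simp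
    moreover have "0 \<le> C * \<bar>s\<bar>" using C(1) by simp
    ultimately show ?thesis by (simp add: algebra_simps)
  qed
  thus ?thesis using C(1) by (intro exI[of _ "1 + C"]) auto
qed

lemma F_deriv: "(Fprim f has_real_derivative f t) (at t)"
proof -
  let ?a = "- \<bar>t\<bar> - 1" and ?b = "\<bar>t\<bar> + 1"
  have "((\<lambda>u. LBINT y=ereal 0..ereal u. f y) has_vector_derivative f t) (at t within {?a..?b})"
    by (rule interval_integral_FTC2) (auto intro: continuous_on_subset[OF f_cont])
  moreover have "t \<in> {?a<..<?b}" by auto
  hence "at t within {?a..?b} = at t" by (intro at_within_interior) auto
  ultimately show ?thesis
    unfolding has_real_derivative_iff_has_vector_derivative Fprim_def zero_ereal_def by simp
qed

lemma F0: "Fprim f 0 = 0"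
  by (simp add: Fprim_def zero_ereal_def)

lemma F_even: "Fprim f (- t) = Fprim f t"
proof -
  have "((\<lambda>t. Fprim f t - Fprim f (- t)) has_real_derivative 0) (at t)" for t
  proof -
    have "((\<lambda>t. Fprim f (- t)) has_real_derivative f (- t) * (- 1)) (at t)"
      by (rule DERIV_chain2[OF F_deriv]) (auto intro!: derivative_eq_intros)
    from DERIV_diff[OF F_deriv this] show ?thesis by (simp add: f_odd)
  qed
  hence "Fprim f t - Fprim f (- t) = Fprim f 0 - Fprim f (- 0)"
    by (rule DERIV_isconst_all[OF allI])
  thus ?thesis by simp
qed

lemma F_nonneg: "0 \<le> Fprim f t"
proof -
  have pos: "0 \<le> Fprim f t" if "0 \<le> t" for t
  proof -
    have "Fprim f 0 \<le> Fprim f t"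
      by (rule DERIV_nonneg_imp_nondecreasing[OF that]) (use F_deriv f_nonneg in blast)
    thus ?thesis by (simp add: F0)
  qed
  show ?thesis using F_even[of t] pos[of t] pos[of "- t"] by (cases "0 \<le> t") auto
qed

text \<open>The mean value inequality for F x - f s * x, whose derivative is f x - f s.\<close>

lemma F_taylor:
  assumes "\<And>\<xi>. \<bar>\<xi> - s\<bar> \<le> \<bar>t\<bar> \<Longrightarrow> \<bar>f \<xi> - f s\<bar> \<le> B"
  shows "\<bar>Fprim f (s + t) - Fprim f s - f s * t\<bar> \<le> B * \<bar>t\<bar>"
proof -
  have "norm ((Fprim f (s + t) - f s * (s + t)) - (Fprim f s - f s * s)) \<le> B * norm (s + t - s)"
  proof (rule field_differentiable_bound[where S="cball s \<bar>t\<bar>"])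
    show "((\<lambda>x. Fprim f x - f s * x) has_field_derivative f x - f s) (at x within cball s \<bar>t\<bar>)" for x
      by (rule has_field_derivative_at_within) (auto intro!: derivative_eq_intros F_deriv)
    show "norm (f x - f s) \<le> B" if "x \<in> cball s \<bar>t\<bar>" for x
      using assms[of x] that by (simp add: dist_real_def abs_minus_commute)
  qed (auto simp: dist_real_def)
  thus ?thesis by (simp add: algebra_simps)
qed

lemma powr_add_le: "0 \<le> p \<Longrightarrow> (\<bar>a\<bar> + \<bar>b\<bar>) powr p \<le> 2 powr p * (\<bar>a\<bar> powr p + \<bar>b\<bar> powr p)" for a b :: real
proof -
  assume p: "0 \<le> p"
  have "(\<bar>a\<bar> + \<bar>b\<bar>) powr p \<le> (2 * max \<bar>a\<bar> \<bar>b\<bar>) powr p" using p by (intro powr_mono2) auto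
  also have "\<dots> = 2 powr p * (max \<bar>a\<bar> \<bar>b\<bar>) powr p" by (simp add: powr_mult)
  also have "(max \<bar>a\<bar> \<bar>b\<bar>) powr p \<le> \<bar>a\<bar> powr p + \<bar>b\<bar> powr p" by (auto simp: max_def)
  finally show ?thesis by simp
qed

text \<open>The remainder is estimated for an increment \<open>\<rho> * k\<close> so as to make it visibly \<open>o(\<rho>)\<close>.\<close>
lemma F_taylor_scaled:
  assumes \<eta>: "0 < \<eta>"
  shows "\<exists>C>0. \<forall>s k \<rho>. 0 \<le> \<rho> \<longrightarrow> \<rho> \<le> 1 \<longrightarrow>
     \<bar>Fprim f (s + \<rho> * k) - Fprim f s - f s * (\<rho> * k)\<bar>
       \<le> \<rho> * (\<eta> * (s\<^sup>2 + k\<^sup>2 + \<bar>s\<bar> powr q + \<bar>k\<bar> powr q) + \<rho> powr (q - 1) * (C * \<bar>k\<bar> powr q))"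
proof -
  \<comment> \<open>The denominator collects the factors that arise from (|s| + |k|) |k| and (|s| +
    |k|)^(q-1) |k| when they are split into pure powers.\<close>
  define e where "e = \<eta> / (3 + 3 * 2 powr q)"
  have den: "0 < 3 + 3 * 2 powr q" by (simp add: add_pos_nonneg)
  have e: "0 < e" "e * (3 + 3 * 2 powr q) = \<eta>" using \<eta> den by (auto simp: e_def)
  obtain C where C: "0 < C" "\<And>s t. \<bar>f s - f t\<bar> \<le> e * (\<bar>s\<bar> + \<bar>t\<bar>) + e * (\<bar>s\<bar> powr (q - 1) + \<bar>t\<bar> powr (q - 1)) + C * \<bar>s - t\<bar> powr (q - 1)"
    using f_diff_bound[OF e(1)] by blast
  have "\<bar>Fprim f (s + \<rho> * k) - Fprim f s - f s * (\<rho> * k)\<bar>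
       \<le> \<rho> * (\<eta> * (s\<^sup>2 + k\<^sup>2 + \<bar>s\<bar> powr q + \<bar>k\<bar> powr q) + \<rho> powr (q - 1) * (C * \<bar>k\<bar> powr q))"
    if \<rho>: "0 \<le> \<rho>" "\<rho> \<le> 1" for s k \<rho>
  proof -
    let ?m = "\<bar>s\<bar> + \<bar>k\<bar>"
    have \<rho>k: "\<rho> * \<bar>k\<bar> \<le> \<bar>k\<bar>" using \<rho> by (simp add: mult_left_le_one_le)
    have "\<bar>Fprim f (s + \<rho> * k) - Fprim f s - f s * (\<rho> * k)\<bar>
        \<le> (e * (2 * ?m) + e * (2 * ?m powr (q - 1)) + C * (\<rho> * \<bar>k\<bar>) powr (q - 1)) * \<bar>\<rho> * k\<bar>"
    proof (rule F_taylor)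
      fix \<xi> assume \<xi>: "\<bar>\<xi> - s\<bar> \<le> \<bar>\<rho> * k\<bar>"
      have \<xi>2: "\<bar>\<xi> - s\<bar> \<le> \<rho> * \<bar>k\<bar>" using \<xi> \<rho> by (simp add: abs_mult)
      have \<xi>m: "\<bar>\<xi>\<bar> \<le> ?m" using \<xi>2 \<rho>k by linarith
      have "\<bar>f \<xi> - f s\<bar> \<le> e * (\<bar>\<xi>\<bar> + \<bar>s\<bar>) + e * (\<bar>\<xi>\<bar> powr (q - 1) + \<bar>s\<bar> powr (q - 1)) + C * \<bar>\<xi> - s\<bar> powr (q - 1)"
        by (rule C(2))
      also have "\<dots> \<le> e * (?m + ?m) + e * (?m powr (q - 1) + ?m powr (q - 1)) + C * (\<rho> * \<bar>k\<bar>) powr (q - 1)"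
        using \<xi>m \<xi>2 e(1) C(1) q by (intro add_mono mult_left_mono powr_mono2) auto
      finally show "\<bar>f \<xi> - f s\<bar> \<le> e * (2 * ?m) + e * (2 * ?m powr (q - 1)) + C * (\<rho> * \<bar>k\<bar>) powr (q - 1)" by simp
    qed
    also have "\<dots> = \<rho> * (e * (2 * (?m * \<bar>k\<bar>)) + e * (2 * (?m powr (q - 1) * \<bar>k\<bar>)) + \<rho> powr (q - 1) * (C * (\<bar>k\<bar> powr (q - 1) * \<bar>k\<bar>)))"
      using \<rho> by (simp add: abs_mult powr_mult algebra_simps)
    also have "\<dots> \<le> \<rho> * (e * (3 * (s\<^sup>2 + k\<^sup>2)) + e * (3 * 2 powr q * (\<bar>s\<bar> powr q + \<bar>k\<bar> powr q)) + \<rho> powr (q - 1) * (C * \<bar>k\<bar> powr q))"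
    proof (intro mult_left_mono add_mono)
      have "0 \<le> (\<bar>s\<bar> - \<bar>k\<bar>)\<^sup>2" by simp
      hence "2 * \<bar>s\<bar> * \<bar>k\<bar> \<le> s\<^sup>2 + k\<^sup>2" by (simp add: power2_diff)
      moreover have "2 * (?m * \<bar>k\<bar>) = 2 * \<bar>s\<bar> * \<bar>k\<bar> + 2 * k\<^sup>2"
        by (simp add: distrib_right power2_eq_square)
      ultimately have "2 * (?m * \<bar>k\<bar>) \<le> (s\<^sup>2 + k\<^sup>2) + 2 * k\<^sup>2" by simp
      also have "\<dots> \<le> 3 * (s\<^sup>2 + k\<^sup>2)" by simp
      finally show "2 * (?m * \<bar>k\<bar>) \<le> 3 * (s\<^sup>2 + k\<^sup>2)" .
      have "?m powr (q - 1) * \<bar>k\<bar> \<le> ?m powr (q - 1) * ?m" by (intro mult_left_mono) auto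
      also have "\<dots> = ?m powr q" using q powr_add[of ?m "q - 1" 1] by (cases "?m = 0") auto
      also have "\<dots> \<le> 2 powr q * (\<bar>s\<bar> powr q + \<bar>k\<bar> powr q)" by (rule powr_add_le) (use q in simp)
      finally have "2 * (?m powr (q - 1) * \<bar>k\<bar>) \<le> 2 * (2 powr q * (\<bar>s\<bar> powr q + \<bar>k\<bar> powr q))" by simp
      moreover have "0 \<le> 2 powr q * (\<bar>s\<bar> powr q + \<bar>k\<bar> powr q)" by simp
      ultimately show "2 * (?m powr (q - 1) * \<bar>k\<bar>) \<le> 3 * 2 powr q * (\<bar>s\<bar> powr q + \<bar>k\<bar> powr q)" by linarith
      show "\<bar>k\<bar> powr (q - 1) * \<bar>k\<bar> \<le> \<bar>k\<bar> powr q" using q powr_add[of "\<bar>k\<bar>" "q - 1" 1] by (cases "k = 0") auto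
    qed (simp_all add: less_imp_le[OF C(1)] less_imp_le[OF e(1)] \<rho>)
    also have "\<dots> \<le> \<rho> * (\<eta> * (s\<^sup>2 + k\<^sup>2 + \<bar>s\<bar> powr q + \<bar>k\<bar> powr q) + \<rho> powr (q - 1) * (C * \<bar>k\<bar> powr q))"
    proof (intro mult_left_mono add_mono order_refl \<rho>(1))
      have "e * 3 \<le> \<eta>" "e * (3 * 2 powr q) \<le> \<eta>" using e by (auto simp: e(2)[symmetric] algebra_simps)
      hence "(e * 3) * (s\<^sup>2 + k\<^sup>2) + (e * (3 * 2 powr q)) * (\<bar>s\<bar> powr q + \<bar>k\<bar> powr q)
         \<le> \<eta> * (s\<^sup>2 + k\<^sup>2) + \<eta> * (\<bar>s\<bar> powr q + \<bar>k\<bar> powr q)"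
        by (intro add_mono mult_right_mono) auto
      thus "e * (3 * (s\<^sup>2 + k\<^sup>2)) + e * (3 * 2 powr q * (\<bar>s\<bar> powr q + \<bar>k\<bar> powr q)) \<le> \<eta> * (s\<^sup>2 + k\<^sup>2 + \<bar>s\<bar> powr q + \<bar>k\<bar> powr q)"
        by (simp add: algebra_simps)
    qed (simp_all add: less_imp_le[OF C(1)])
    finally show ?thesis .
  qed
  thus ?thesis using C(1) by blast
qed

end

section \<open>The Bopp-Podolsky kernel\<close>

text \<open>On the diagonal, division by zero yields 0 in place of the limit 1; for each x this
  concerns a single y and does not affect integrals.\<close>

definition ker :: "R3 \<Rightarrow> R3 \<Rightarrow> real" where "ker x y = (1 - exp (- dist x y)) / dist x y"

text \<open>Linear in the density, whereas \<open>phi\<close> is quadratic in u. Differences and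
  expansions of \<open>phi\<close> thus become potentials of products.\<close>

definition pot :: "(R3 \<Rightarrow> real) \<Rightarrow> R3 \<Rightarrow> real" where "pot a x = (LINT y|lborel. ker x y * a y)"

lemma phi_eq_pot: "phi u = pot (\<lambda>y. (u y)\<^sup>2)"
  by (simp add: fun_eq_iff phi_def pot_def ker_def)

lemma ker_nonneg: "0 \<le> ker x y" by (simp add: ker_def)

lemma ker_pos: "x \<noteq> y \<Longrightarrow> 0 < ker x y" by (simp add: ker_def)

lemma ker_le_1: "ker x y \<le> 1"
proof (cases "x = y")
  case False
  have "1 - exp (- dist x y) \<le> dist x y" using exp_ge_add_one_self[of "- dist x y"] by linarith
  thus ?thesis using False by (simp add: ker_def)
qed (simp add: ker_def)

lemma ker_le_inverse: "0 < r \<Longrightarrow> r \<le> dist x y \<Longrightarrow> ker x y \<le> 1 / r"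
  unfolding ker_def by (rule frac_le) auto

lemma ker_commute: "ker x y = ker y x" by (simp add: ker_def dist_commute)

lemma ker_meas2: "(\<lambda>p. ker (fst p) (snd p)) \<in> borel_measurable (lborel \<Otimes>\<^sub>M lborel)"
  unfolding ker_def by measurable

lemma ker_meas: "ker x \<in> borel_measurable lborel"
  unfolding ker_def[abs_def] by measurable

lemma abs_ker_mult_le: "\<bar>ker x y * a\<bar> \<le> \<bar>a\<bar>"
  using mult_right_mono[OF ker_le_1, of "\<bar>a\<bar>" x y] ker_nonneg[of x y] by (simp add: abs_mult)

lemma pot_integrable: "integrable lborel a \<Longrightarrow> integrable lborel (\<lambda>y. ker x y * a y)"
  by (rule abs_integral_le(1)[of lborel "\<lambda>y. \<bar>a y\<bar>"])
     (auto simp: abs_ker_mult_le intro!: borel_measurable_times ker_meas[simplified] dest: borel_measurable_integrable)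

lemma pot_bound: "integrable lborel a \<Longrightarrow> \<bar>pot a x\<bar> \<le> (LINT y|lborel. \<bar>a y\<bar>)"
  unfolding pot_def
  by (rule abs_integral_le(2)[of lborel "\<lambda>y. \<bar>a y\<bar>"])
     (auto simp: abs_ker_mult_le intro!: borel_measurable_times ker_meas[simplified] dest: borel_measurable_integrable)

lemma pot_meas: "integrable lborel a \<Longrightarrow> pot a \<in> borel_measurable lborel"
  unfolding pot_def[abs_def]
proof (rule lborel.borel_measurable_lebesgue_integral)
  assume "integrable lborel a"
  hence "a \<in> borel_measurable lborel" by auto
  hence "(\<lambda>p. ker (fst p) (snd p) * a (snd p)) \<in> borel_measurable (lborel \<Otimes>\<^sub>M lborel)"
    using ker_meas2 by measurable
  thus "(\<lambda>(x, y). ker x y * a y) \<in> borel_measurable (lborel \<Otimes>\<^sub>M lborel)"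
    by (simp add: case_prod_beta')
qed

lemma pot_mult_integrable:
  assumes a: "integrable lborel a" and b: "integrable lborel b"
  shows "integrable lborel (\<lambda>x. pot a x * b x)"
    and "\<bar>LINT x|lborel. pot a x * b x\<bar> \<le> (LINT x|lborel. \<bar>a x\<bar>) * (LINT x|lborel. \<bar>b x\<bar>)"
proof -
  have 1: "integrable lborel (\<lambda>x. (LINT x|lborel. \<bar>a x\<bar>) * \<bar>b x\<bar>)" using b by simp
  have 2: "(\<lambda>x. pot a x * b x) \<in> borel_measurable lborel" using pot_meas[OF a] b by measurable
  have 3: "\<bar>pot a x * b x\<bar> \<le> (LINT x|lborel. \<bar>a x\<bar>) * \<bar>b x\<bar>" for x
    unfolding abs_mult by (intro mult_right_mono pot_bound a) simp
  show "integrable lborel (\<lambda>x. pot a x * b x)" by (rule abs_integral_le(1)[OF 1 2 3])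
  show "\<bar>LINT x|lborel. pot a x * b x\<bar> \<le> (LINT x|lborel. \<bar>a x\<bar>) * (LINT x|lborel. \<bar>b x\<bar>)"
    using abs_integral_le(2)[OF 1 2 3] by simp
qed

lemma pot_mult_le_sup:
  assumes a: "integrable lborel a" and b: "integrable lborel b" and S: "\<And>x. \<bar>pot a x\<bar> \<le> S"
  shows "\<bar>LINT x|lborel. pot a x * b x\<bar> \<le> S * (LINT x|lborel. \<bar>b x\<bar>)"
proof -
  have "\<bar>LINT x|lborel. pot a x * b x\<bar> \<le> (LINT x|lborel. S * \<bar>b x\<bar>)"
  proof (rule abs_integral_le(2))
    show "(\<lambda>x. pot a x * b x) \<in> borel_measurable lborel" using pot_meas[OF a] b by measurable
    show "\<bar>pot a x * b x\<bar> \<le> S * \<bar>b x\<bar>" for x unfolding abs_mult by (intro mult_right_mono S) simp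
  qed (use b in simp)
  thus ?thesis by simp
qed

lemma pot_linear:
  assumes "integrable lborel a" "integrable lborel b"
  shows "pot (\<lambda>y. c * a y + d * b y) x = c * pot a x + d * pot b x"
proof -
  have "pot (\<lambda>y. c * a y + d * b y) x = (LINT y|lborel. c * (ker x y * a y) + d * (ker x y * b y))"
    unfolding pot_def by (simp add: algebra_simps)
  also have "\<dots> = c * pot a x + d * pot b x"
    unfolding pot_def using pot_integrable[OF assms(1), of x] pot_integrable[OF assms(2), of x] by simp
  finally show ?thesis .
qed

lemma pot_cong:
  assumes "AE x in lborel. a x = b x" "a \<in> borel_measurable lborel" "b \<in> borel_measurable lborel"
  shows "pot a = pot b"
proof
  fix x
  show "pot a x = pot b x" unfolding pot_def
  proof (rule integral_cong_AE)
    show "AE y in lborel. ker x y * a y = ker x y * b y" using assms(1) by eventually_elim simp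
  qed (use assms ker_meas in measurable)
qed

lemma pot_symmetric:
  assumes a: "integrable lborel a" and b: "integrable lborel b"
  shows "(LINT x|lborel. pot a x * b x) = (LINT x|lborel. pot b x * a x)"
proof -
  have am: "a \<in> borel_measurable lborel" and bm: "b \<in> borel_measurable lborel" using a b by auto
  have int: "integrable (lborel \<Otimes>\<^sub>M lborel) (\<lambda>(x, y). ker x y * a y * b x)"
  proof (rule lborel_pair.Fubini_integrable)
    have "(\<lambda>p. ker (fst p) (snd p) * a (snd p) * b (fst p)) \<in> borel_measurable (lborel \<Otimes>\<^sub>M lborel)"
      using ker_meas2 am bm by measurable
    thus "(\<lambda>(x, y). ker x y * a y * b x) \<in> borel_measurable (lborel \<Otimes>\<^sub>M lborel)"
      by (simp add: case_prod_beta')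
    have "(LINT y|lborel. norm (case (x, y) of (x, y) \<Rightarrow> ker x y * a y * b x)) = pot (\<lambda>y. \<bar>a y\<bar>) x * \<bar>b x\<bar>" for x
    proof -
      have "(LINT y|lborel. norm (case (x, y) of (x, y) \<Rightarrow> ker x y * a y * b x)) = (LINT y|lborel. (ker x y * \<bar>a y\<bar>) * \<bar>b x\<bar>)"
        by (rule Bochner_Integration.integral_cong) (simp_all add: abs_mult ker_nonneg)
      thus ?thesis by (simp add: pot_def)
    qed
    moreover have "integrable lborel (\<lambda>x. pot (\<lambda>y. \<bar>a y\<bar>) x * \<bar>b x\<bar>)"
      by (rule pot_mult_integrable(1)) (use a b in auto)
    ultimately show "integrable lborel (\<lambda>x. LINT y|lborel. norm (case (x, y) of (x, y) \<Rightarrow> ker x y * a y * b x))"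
      by (simp only:)
    show "AE x in lborel. integrable lborel (\<lambda>y. case (x, y) of (x, y) \<Rightarrow> ker x y * a y * b x)"
      using pot_integrable[OF a] by auto
  qed
  have "(LINT x|lborel. pot a x * b x) = (LINT x|lborel. LINT y|lborel. ker x y * a y * b x)"
    by (simp add: pot_def)
  also have "\<dots> = (LINT y|lborel. LINT x|lborel. ker x y * a y * b x)"
    using lborel_pair.Fubini_integral[OF int] by simp
  also have "\<dots> = (LINT y|lborel. pot b y * a y)"
  proof (rule Bochner_Integration.integral_cong[OF refl])
    fix y
    have "(LINT x|lborel. ker x y * a y * b x) = (LINT x|lborel. (ker y x * b x) * a y)"
      by (simp add: ker_commute[of y] mult_ac)
    thus "(LINT x|lborel. ker x y * a y * b x) = pot b y * a y" by (simp add: pot_def)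
  qed
  finally show ?thesis .
qed

text \<open>The kernel is bounded and vanishes at infinity, so on sets bounded in \<open>L\<^sup>1\<close> the
  potential is uniformly small as soon as the \<open>L\<^sup>2\<close> norm is.\<close>
lemma pot_small:
  assumes "0 \<le> A" "0 < \<eta>"
  shows "\<exists>\<delta>>0. \<forall>a. integrable lborel a \<longrightarrow> integrable lborel (\<lambda>y. (a y)\<^sup>2) \<longrightarrow> (LINT y|lborel. \<bar>a y\<bar>) \<le> A \<longrightarrow>
     (LINT y|lborel. (a y)\<^sup>2) \<le> \<delta> \<longrightarrow> (\<forall>x. \<bar>pot a x\<bar> \<le> \<eta>)"
proof -
  \<comment> \<open>Beyond distance r the kernel is at most 1 / r, so the L^1 bound contributes at
    most \<eta>/2. Within the ball, Young's inequality with weight \<theta> leaves a constant on the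
    ball and a square term, at most \<eta>/4 each.\<close>
  define r where "r = 2 * A / \<eta> + 1"
  have r: "0 < r" using assms by (simp add: r_def add_nonneg_pos)
  have Ar: "A / r \<le> \<eta> / 2"
  proof -
    have "A = (2 * A / \<eta>) * (\<eta> / 2)" using assms by simp
    also have "\<dots> \<le> r * (\<eta> / 2)" using assms by (intro mult_right_mono) (auto simp: r_def)
    finally show ?thesis using r by (simp add: field_simps)
  qed
  define v where "v = measure lborel (cball (0::R3) r)"
  have v: "measure lborel (cball x r) = v" for x :: R3
    using r by (simp add: v_def content_cball)
  have v0: "0 \<le> v" by (simp add: v_def)
  define k where "k = v + 1"
  have k: "0 < k" "v \<le> k" using v0 by (auto simp: k_def)
  define \<theta> where "\<theta> = \<eta> / (2 * k)"
  have \<theta>: "0 < \<theta>" "\<theta> / 2 * v \<le> \<eta> / 4"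
  proof -
    show "0 < \<theta>" using assms k by (simp add: \<theta>_def)
    hence "\<theta> / 2 * v \<le> \<theta> / 2 * k" using k by (intro mult_left_mono) auto
    also have "\<dots> = \<eta> / 4" using k by (simp add: \<theta>_def)
    finally show "\<theta> / 2 * v \<le> \<eta> / 4" .
  qed
  define \<delta> where "\<delta> = \<eta> * \<theta> / 2"
  have \<delta>: "0 < \<delta>" "\<delta> / (2 * \<theta>) = \<eta> / 4" using assms \<theta> by (auto simp: \<delta>_def)
  have "\<bar>pot a x\<bar> \<le> \<eta>"
    if a: "integrable lborel a" "integrable lborel (\<lambda>y. (a y)\<^sup>2)" "(LINT y|lborel. \<bar>a y\<bar>) \<le> A" "(LINT y|lborel. (a y)\<^sup>2) \<le> \<delta>" for a x
  proof -
    have ind: "integrable lborel (indicator (cball x r) :: R3 \<Rightarrow> real)"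
      using emeasure_bounded_finite[of "cball x r"] by (simp add: integrable_indicator_iff)
    have "\<bar>pot a x\<bar> \<le> (LINT y|lborel. \<bar>a y\<bar> / r + (\<theta> / 2 * indicator (cball x r) y + (a y)\<^sup>2 / (2 * \<theta>)))"
      unfolding pot_def
    proof (rule abs_integral_le(2))
      show "integrable lborel (\<lambda>y. \<bar>a y\<bar> / r + (\<theta> / 2 * indicator (cball x r) y + (a y)\<^sup>2 / (2 * \<theta>)))"
        using a ind by (intro Bochner_Integration.integrable_add integrable_divide integrable_abs integrable_mult_right) auto
      show "(\<lambda>y. ker x y * a y) \<in> borel_measurable lborel" using pot_integrable[OF a(1), of x] by simp
      fix y
      have nn: "0 \<le> \<bar>a y\<bar> / r" "0 \<le> (a y)\<^sup>2 / (2 * \<theta>)" using r \<theta> by auto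
      show "\<bar>ker x y * a y\<bar> \<le> \<bar>a y\<bar> / r + (\<theta> / 2 * indicator (cball x r) y + (a y)\<^sup>2 / (2 * \<theta>))"
      proof (cases "y \<in> cball x r")
        case True
        have "0 \<le> (\<theta> - \<bar>a y\<bar>)\<^sup>2" by simp
        hence "2 * \<theta> * \<bar>a y\<bar> \<le> \<theta> * \<theta> + (a y)\<^sup>2"
          unfolding power2_diff power2_abs power2_eq_square[of \<theta>] by linarith
        hence "\<bar>a y\<bar> \<le> (\<theta> * \<theta> + (a y)\<^sup>2) / (2 * \<theta>)" using \<theta>(1) by (simp add: field_simps)
        also have "\<dots> = \<theta> / 2 + (a y)\<^sup>2 / (2 * \<theta>)" using \<theta>(1) by (simp add: add_divide_distrib)
        finally have "\<bar>a y\<bar> \<le> \<theta> / 2 + (a y)\<^sup>2 / (2 * \<theta>)" .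
        thus ?thesis using abs_ker_mult_le[of x y "a y"] nn True by simp
      next
        case False
        have "\<bar>ker x y * a y\<bar> = ker x y * \<bar>a y\<bar>" using ker_nonneg[of x y] by (simp add: abs_mult)
        also have "\<dots> \<le> 1 / r * \<bar>a y\<bar>"
          using False by (intro mult_right_mono ker_le_inverse r) auto
        finally show ?thesis using nn False by simp
      qed
    qed
    also have "\<dots> = (LINT y|lborel. \<bar>a y\<bar>) / r + (\<theta> / 2 * v + (LINT y|lborel. (a y)\<^sup>2) / (2 * \<theta>))"
      using a ind by (simp add: v)
    also have "\<dots> \<le> A / r + (\<theta> / 2 * v + \<delta> / (2 * \<theta>))"
      using a(3,4) r \<theta> by (intro add_mono divide_right_mono order_refl) auto
    also have "\<dots> \<le> \<eta>" using Ar \<theta>(2) \<delta>(2) by linarith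
    finally show ?thesis .
  qed
  thus ?thesis using \<delta>(1) by blast
qed

lemma phi_nonneg: "0 \<le> phi u x"
  unfolding phi_eq_pot pot_def by (intro integral_nonneg_AE) (auto simp: ker_nonneg)

text \<open>If u did not vanish almost everywhere, there would be a point x with phi u x = 0. The
  kernel is positive off the diagonal, so this single zero already forces u = 0 almost
  everywhere.\<close>

lemma phi_mult_zero_imp_AE:
  assumes u: "sq_integrable u" and z: "(LINT x|lborel. phi u x * (u x)\<^sup>2) = 0"
  shows "AE x in lborel. u x = 0"
proof (rule ccontr)
  assume neg: "\<not> (AE x in lborel. u x = 0)"
  have u2: "integrable lborel (\<lambda>x. (u x)\<^sup>2)" using u by (simp add: sq_integrable_real)
  have i: "integrable lborel (\<lambda>x. phi u x * (u x)\<^sup>2)" unfolding phi_eq_pot by (rule pot_mult_integrable(1)[OF u2 u2])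
  have "AE x in lborel. phi u x * (u x)\<^sup>2 = 0"
    using integral_nonneg_eq_0_iff_AE[OF i] z by (simp add: phi_nonneg)
  hence "\<exists>x. u x \<noteq> 0 \<and> phi u x = 0"
  proof (rule contrapos_pp)
    assume "\<nexists>x. u x \<noteq> 0 \<and> phi u x = 0"
    hence e: "phi u x * (u x)\<^sup>2 = 0 \<longleftrightarrow> u x = 0" for x by auto
    show "\<not> (AE x in lborel. phi u x * (u x)\<^sup>2 = 0)" unfolding e by (rule neg)
  qed
  then obtain x where x: "phi u x = 0" by blast
  have "AE y in lborel. ker x y * (u y)\<^sup>2 = 0"
    using integral_nonneg_eq_0_iff_AE[OF pot_integrable[OF u2, of x]] x
    by (simp add: phi_eq_pot pot_def ker_nonneg)
  moreover have "AE y in lborel. y \<noteq> x" by (rule AE_lborel_singleton)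
  ultimately have "AE y in lborel. u y = 0"
  proof eventually_elim
    case (elim y)
    thus ?case using ker_pos[of x y] by auto
  qed
  thus False using neg by simp
qed

context potential_space
begin

lemma pair_le:
  assumes u: "u \<in> W" and h: "h \<in> W"
  shows "integrable lborel (\<lambda>x. u x * h x)" "(LINT x|lborel. \<bar>u x * h x\<bar>) \<le> norm (emb u) * norm (emb h) / c0"
proof -
  show i: "integrable lborel (\<lambda>x. u x * h x)" by (rule sq_integrable_mult[OF W_sq[OF u] W_sq[OF h]])
  have s: "sq_integrable (\<lambda>x. \<bar>u x\<bar>)" "sq_integrable (\<lambda>x. \<bar>h x\<bar>)" using W_sq[OF u] W_sq[OF h] by (auto simp: sq_integrable_real)
  have n: "norm (mk (\<lambda>x. \<bar>v x\<bar>)) \<le> norm (emb v) / sqrt c0" if v: "v \<in> W" for v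
  proof (rule power2_le_imp_le)
    have "sq_integrable (\<lambda>x. \<bar>v x\<bar>)" using W_sq[OF v] by (auto simp: sq_integrable_real)
    thus "(norm (mk (\<lambda>x. \<bar>v x\<bar>)))\<^sup>2 \<le> (norm (emb v) / sqrt c0)\<^sup>2"
      using L2_le[OF v] c0(1) by (simp add: norm_mk_sq power_divide)
  qed (use c0 in simp)
  have "(LINT x|lborel. \<bar>u x * h x\<bar>) = (LINT x|lborel. \<bar>u x\<bar> * \<bar>h x\<bar>)" by (simp add: abs_mult)
  also have "\<dots> \<le> norm (mk (\<lambda>x. \<bar>u x\<bar>)) * norm (mk (\<lambda>x. \<bar>h x\<bar>))" using inner_le_test[OF s] by simp
  also have "\<dots> \<le> (norm (emb u) / sqrt c0) * (norm (emb h) / sqrt c0)"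
    by (intro mult_mono n u h) (use c0 in auto)
  also have "\<dots> = norm (emb u) * norm (emb h) / c0" using c0(1) by simp
  finally show "(LINT x|lborel. \<bar>u x * h x\<bar>) \<le> norm (emb u) * norm (emb h) / c0" .
qed

lemma W_sq_int: "u \<in> W \<Longrightarrow> integrable lborel (\<lambda>x. (u x)\<^sup>2)"
  using W_sq by (simp add: sq_integrable_real)

lemma pow4: "\<bar>t :: real\<bar> powr 4 = t ^ 4"
  by (cases "t = 0") (simp_all add: powr_numeral)

lemma L4_integrable: "u \<in> W \<Longrightarrow> integrable lborel (\<lambda>x. (u x) ^ 4)"
  using Lp_integrable[of 4 u] by (simp add: pow4)

lemma L4_bound: "\<exists>C>0. \<forall>u\<in>W. (LINT x|lborel. (u x) ^ 4) \<le> C * norm (emb u) ^ 4"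
proof -
  obtain C where "0 < C" "\<forall>u\<in>W. (LINT x|lborel. \<bar>u x\<bar> powr 4) \<le> C * norm (emb u) powr 4" using Lp_bound[of 4] by auto
  thus ?thesis using pow4[of "norm (emb _)"] by (intro exI[of _ C]) (simp add: pow4)
qed

lemma prod_sq_le:
  assumes u: "u \<in> W" and h: "h \<in> W" and \<theta>: "0 < \<theta>"
  shows "integrable lborel (\<lambda>x. (u x * h x)\<^sup>2)"
    "(LINT x|lborel. (u x * h x)\<^sup>2) \<le> (LINT x|lborel. (u x) ^ 4) / \<theta> + \<theta> * (LINT x|lborel. (h x) ^ 4)"
proof -
  have 1: "integrable lborel (\<lambda>x. (u x) ^ 4 / \<theta> + \<theta> * (h x) ^ 4)" using L4_integrable[OF u] L4_integrable[OF h] by simp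
  have 2: "(\<lambda>x. (u x * h x)\<^sup>2) \<in> borel_measurable lborel" using W_meas[OF u] W_meas[OF h] by measurable
  have 3: "\<bar>(u x * h x)\<^sup>2\<bar> \<le> (u x) ^ 4 / \<theta> + \<theta> * (h x) ^ 4" for x
  proof -
    let ?s = "(u x)\<^sup>2" and ?t = "(h x)\<^sup>2"
    have e: "?s * ?s = (u x) ^ 4" "?t * ?t = (h x) ^ 4" by (simp_all add: power2_eq_square power4_eq_xxxx)
    have "?s * ?t \<le> ?s * ?s / \<theta> + \<theta> * (?t * ?t)"
    proof (cases "\<theta> * ?t \<le> ?s")
      case True
      have "?s * ?t \<le> ?s * (?s / \<theta>)" using True \<theta> by (intro mult_left_mono) (auto simp: field_simps)
      thus ?thesis using \<theta> by (simp add: add_increasing2)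
    next
      case False
      have "?s * ?t \<le> (\<theta> * ?t) * ?t" using False by (intro mult_right_mono) auto
      thus ?thesis using \<theta> by (simp add: add_increasing mult.assoc)
    qed
    thus ?thesis unfolding e by (simp add: power_mult_distrib)
  qed
  show "integrable lborel (\<lambda>x. (u x * h x)\<^sup>2)" by (rule abs_integral_le(1)[OF 1 2 3])
  show "(LINT x|lborel. (u x * h x)\<^sup>2) \<le> (LINT x|lborel. (u x) ^ 4) / \<theta> + \<theta> * (LINT x|lborel. (h x) ^ 4)"
    using abs_integral_le(2)[OF 1 2 3] L4_integrable[OF u] L4_integrable[OF h] by simp
qed

lemma phi_pair:
  assumes u: "u \<in> W" and g: "g \<in> W" and h: "h \<in> W"
  shows "integrable lborel (\<lambda>x. phi u x * g x * h x)"
    "\<bar>LINT x|lborel. phi u x * g x * h x\<bar> \<le> ((norm (emb u))\<^sup>2 / c0) * (norm (emb g) * norm (emb h) / c0)"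
proof -
  note gh = pair_le[OF g h]
  have "integrable lborel (\<lambda>x. pot (\<lambda>y. (u y)\<^sup>2) x * (g x * h x))"
    by (rule pot_mult_integrable(1)[OF W_sq_int[OF u] gh(1)])
  thus "integrable lborel (\<lambda>x. phi u x * g x * h x)" by (simp add: phi_eq_pot mult.assoc)
  have "\<bar>LINT x|lborel. pot (\<lambda>y. (u y)\<^sup>2) x * (g x * h x)\<bar> \<le> (LINT x|lborel. \<bar>(u x)\<^sup>2\<bar>) * (LINT x|lborel. \<bar>g x * h x\<bar>)"
    by (rule pot_mult_integrable(2)[OF W_sq_int[OF u] gh(1)])
  also have "\<dots> \<le> ((norm (emb u))\<^sup>2 / c0) * (norm (emb g) * norm (emb h) / c0)"
    by (rule mult_mono) (use L2_le[OF u] gh(2) c0 in \<open>auto intro!: integral_nonneg_AE\<close>)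
  finally show "\<bar>LINT x|lborel. phi u x * g x * h x\<bar> \<le> ((norm (emb u))\<^sup>2 / c0) * (norm (emb g) * norm (emb h) / c0)"
    by (simp add: phi_eq_pot mult.assoc)
qed

text \<open>\<open>pot_small\<close> asks for an L^1 bound on w h, given by the L^2 norms, and for a
  small L^2 norm. For the latter, \<theta> first makes the contribution of h small, and then the L^4
  bound on w is chosen relative to \<theta>.\<close>

lemma prod_small:
  assumes B: "0 \<le> B" and \<eta>: "0 < \<eta>"
  shows "\<exists>\<delta>>0. \<forall>w\<in>W. \<forall>h\<in>W. norm (emb w) \<le> B \<longrightarrow> norm (emb h) \<le> B \<longrightarrow> (LINT x|lborel. (w x) ^ 4) \<le> \<delta> \<longrightarrow>
    (\<forall>x. \<bar>pot (\<lambda>x. w x * h x) x\<bar> \<le> \<eta>)"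
proof -
  obtain C4 where C4: "0 < C4" "\<And>u. u \<in> W \<Longrightarrow> (LINT x|lborel. (u x) ^ 4) \<le> C4 * norm (emb u) ^ 4" using L4_bound by blast
  have "0 \<le> B * B / c0" using c0 B by simp
  from pot_small[OF this \<eta>] obtain d where d: "0 < d"
    "\<And>a x. integrable lborel a \<Longrightarrow> integrable lborel (\<lambda>y. (a y)\<^sup>2) \<Longrightarrow> (LINT y|lborel. \<bar>a y\<bar>) \<le> B * B / c0 \<Longrightarrow>
     (LINT y|lborel. (a y)\<^sup>2) \<le> d \<Longrightarrow> \<bar>pot a x\<bar> \<le> \<eta>" by blast
  define L where "L = C4 * B ^ 4"
  have L: "0 \<le> L" using C4 B by (simp add: L_def)
  define k where "k = L + 1"
  have k: "0 < k" "L \<le> k" using L by (auto simp: k_def)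
  define \<theta> where "\<theta> = d / (2 * k)"
  have \<theta>: "0 < \<theta>" "\<theta> * L \<le> d / 2"
  proof -
    show "0 < \<theta>" using d k by (simp add: \<theta>_def)
    hence "\<theta> * L \<le> \<theta> * k" using k by (intro mult_left_mono) auto
    also have "\<dots> = d / 2" using k by (simp add: \<theta>_def)
    finally show "\<theta> * L \<le> d / 2" .
  qed
  have "\<bar>pot (\<lambda>x. w x * h x) x\<bar> \<le> \<eta>"
    if w: "w \<in> W" "h \<in> W" "norm (emb w) \<le> B" "norm (emb h) \<le> B" "(LINT x|lborel. (w x) ^ 4) \<le> d * \<theta> / 2" for w h x
  proof (rule d(2))
    show "integrable lborel (\<lambda>x. w x * h x)" by (rule pair_le(1)[OF w(1,2)])
    show "integrable lborel (\<lambda>y. (w y * h y)\<^sup>2)" by (rule prod_sq_le(1)[OF w(1,2) \<theta>(1)])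
    have "(LINT y|lborel. \<bar>w y * h y\<bar>) \<le> norm (emb w) * norm (emb h) / c0" by (rule pair_le(2)[OF w(1,2)])
    also have "\<dots> \<le> B * B / c0" using w(3,4) B c0 by (intro divide_right_mono mult_mono) auto
    finally show "(LINT y|lborel. \<bar>w y * h y\<bar>) \<le> B * B / c0" .
    have h4: "(LINT x|lborel. (h x) ^ 4) \<le> L"
      using order_trans[OF C4(2)[OF w(2)], of L] w(4) C4(1) by (simp add: L_def power_mono)
    have "(LINT y|lborel. (w y * h y)\<^sup>2) \<le> (LINT x|lborel. (w x) ^ 4) / \<theta> + \<theta> * (LINT x|lborel. (h x) ^ 4)"
      by (rule prod_sq_le(2)[OF w(1,2) \<theta>(1)])
    also have "\<dots> \<le> (d * \<theta> / 2) / \<theta> + \<theta> * L"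
      using w(5) h4 \<theta>(1) by (intro add_mono divide_right_mono mult_left_mono) auto
    also have "\<dots> \<le> d" using \<theta> by simp
    finally show "(LINT y|lborel. (w y * h y)\<^sup>2) \<le> d" .
  qed
  moreover have "0 < d * \<theta> / 2" using d(1) \<theta>(1) by simp
  ultimately show ?thesis by (intro exI[of _ "d * \<theta> / 2"]) auto
qed

text \<open>With w = u - v and z = u + v the difference is the integral of phi u * w * h plus that
  of pot(w z) * v * h. By symmetry of the kernel the first is the integral of pot(w h) * u^2. In
  both the potential has the factor w, small in L^4, in its density and is uniformly small.\<close>

lemma phi_pair_uniform:
  assumes \<eta>: "0 < \<eta>"
  shows "\<exists>\<delta>>0. \<forall>u\<in>W. \<forall>v\<in>W. norm (emb u) \<le> B \<longrightarrow> norm (emb v) \<le> B \<longrightarrow> (LINT x|lborel. \<bar>u x - v x\<bar> powr 4) \<le> \<delta> \<longrightarrow>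
    (\<forall>h\<in>W. norm (emb h) \<le> 1 \<longrightarrow>
      \<bar>(LINT x|lborel. phi u x * u x * h x) - (LINT x|lborel. phi v x * v x * h x)\<bar> \<le> \<eta>)"
proof -
  \<comment> \<open>D bounds the norms of u, v, u - v, u + v and h simultaneously.\<close>
  define D where "D = 2 * \<bar>B\<bar> + 1"
  have D: "1 \<le> D" "\<bar>B\<bar> \<le> D" by (auto simp: D_def)
  define e where "e = \<eta> * c0 / (2 * (D * D))"
  have e: "0 < e" using \<eta> c0 D by (simp add: e_def)
  have eD: "e * (D * D / c0) = \<eta> / 2" using c0 D by (simp add: e_def)
  obtain \<delta> where \<delta>: "0 < \<delta>" "\<And>w h x. w \<in> W \<Longrightarrow> h \<in> W \<Longrightarrow> norm (emb w) \<le> D \<Longrightarrow> norm (emb h) \<le> D \<Longrightarrow>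
    (LINT x|lborel. (w x) ^ 4) \<le> \<delta> \<Longrightarrow> \<bar>pot (\<lambda>x. w x * h x) x\<bar> \<le> e"
    using prod_small[of D e] D e by auto
  have "\<bar>(LINT x|lborel. phi u x * u x * h x) - (LINT x|lborel. phi v x * v x * h x)\<bar> \<le> \<eta>"
    if u: "u \<in> W" "norm (emb u) \<le> B" and v: "v \<in> W" "norm (emb v) \<le> B" and w4: "(LINT x|lborel. \<bar>u x - v x\<bar> powr 4) \<le> \<delta>"
      and h: "h \<in> W" "norm (emb h) \<le> 1" for u v h
  proof -
    let ?w = "\<lambda>x. u x - v x" and ?z = "\<lambda>x. u x + v x"
    have w: "?w \<in> W" and z: "?z \<in> W" by (intro W_diff W_add u v)+
    have nw: "norm (emb ?w) \<le> D" using norm_triangle_ineq4[of "emb u" "emb v"] u v by (simp add: emb_diff D_def)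
    have nz: "norm (emb ?z) \<le> D" using norm_triangle_ineq[of "emb u" "emb v"] u v by (simp add: emb_add D_def)
    have w4': "(LINT x|lborel. (?w x) ^ 4) \<le> \<delta>" using w4 by (simp add: pow4)
    have iu: "integrable lborel (\<lambda>x. (u x)\<^sup>2)" and iv: "integrable lborel (\<lambda>x. (v x)\<^sup>2)" by (intro W_sq_int u v)+
    have iwh: "integrable lborel (\<lambda>x. ?w x * h x)" and ivh: "integrable lborel (\<lambda>x. v x * h x)"
      and iuh: "integrable lborel (\<lambda>x. u x * h x)" and iwz: "integrable lborel (\<lambda>x. ?w x * ?z x)"
      by (intro pair_le(1) w z u v h)+
    have "(LINT x|lborel. phi u x * u x * h x) - (LINT x|lborel. phi v x * v x * h x)
        = (LINT x|lborel. pot (\<lambda>y. (u y)\<^sup>2) x * (u x * h x)) - (LINT x|lborel. pot (\<lambda>y. (v y)\<^sup>2) x * (v x * h x))"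
      by (simp add: phi_eq_pot mult.assoc)
    also have "\<dots> = (LINT x|lborel. pot (\<lambda>y. (u y)\<^sup>2) x * (u x * h x) - pot (\<lambda>y. (v y)\<^sup>2) x * (v x * h x))"
      using pot_mult_integrable(1)[OF iu iuh] pot_mult_integrable(1)[OF iv ivh] by simp
    also have "\<dots> = (LINT x|lborel. pot (\<lambda>y. (u y)\<^sup>2) x * (?w x * h x) + pot (\<lambda>y. ?w y * ?z y) x * (v x * h x))"
    proof (rule Bochner_Integration.integral_cong[OF refl])
      fix x
      have pw: "pot (\<lambda>y. ?w y * ?z y) x = pot (\<lambda>y. (u y)\<^sup>2) x - pot (\<lambda>y. (v y)\<^sup>2) x"
      proof -
        have "(\<lambda>y. ?w y * ?z y) = (\<lambda>y. 1 * (u y)\<^sup>2 + (-1) * (v y)\<^sup>2)"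
          by (simp add: fun_eq_iff power2_eq_square algebra_simps)
        thus ?thesis using pot_linear[OF iu iv, of 1 "-1" x] by simp
      qed
      show "pot (\<lambda>y. (u y)\<^sup>2) x * (u x * h x) - pot (\<lambda>y. (v y)\<^sup>2) x * (v x * h x)
         = pot (\<lambda>y. (u y)\<^sup>2) x * (?w x * h x) + pot (\<lambda>y. ?w y * ?z y) x * (v x * h x)"
        unfolding pw by (simp add: algebra_simps)
    qed
    also have "\<dots> = (LINT x|lborel. pot (\<lambda>y. (u y)\<^sup>2) x * (?w x * h x)) + (LINT x|lborel. pot (\<lambda>y. ?w y * ?z y) x * (v x * h x))"
      using pot_mult_integrable(1)[OF iu iwh] pot_mult_integrable(1)[OF iwz ivh] by simp
    also have "(LINT x|lborel. pot (\<lambda>y. (u y)\<^sup>2) x * (?w x * h x)) = (LINT x|lborel. pot (\<lambda>x. ?w x * h x) x * (u x)\<^sup>2)"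
      by (rule pot_symmetric[OF iu iwh])
    finally have eq: "(LINT x|lborel. phi u x * u x * h x) - (LINT x|lborel. phi v x * v x * h x)
        = (LINT x|lborel. pot (\<lambda>x. ?w x * h x) x * (u x)\<^sup>2) + (LINT x|lborel. pot (\<lambda>y. ?w y * ?z y) x * (v x * h x))" .
    have "\<bar>LINT x|lborel. pot (\<lambda>x. ?w x * h x) x * (u x)\<^sup>2\<bar> \<le> e * (LINT x|lborel. \<bar>(u x)\<^sup>2\<bar>)"
      by (rule pot_mult_le_sup[OF iwh iu]) (rule \<delta>(2)[OF w h(1) nw _ w4'], use h(2) D in simp)
    also have "\<dots> \<le> e * (D * D / c0)"
    proof (intro mult_left_mono)
      have "(LINT x|lborel. \<bar>(u x)\<^sup>2\<bar>) \<le> (norm (emb u))\<^sup>2 / c0" using L2_le[OF u(1)] by simp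
      also have "\<dots> \<le> D\<^sup>2 / c0" using u(2) D c0 by (intro divide_right_mono power_mono) auto
      finally show "(LINT x|lborel. \<bar>(u x)\<^sup>2\<bar>) \<le> D * D / c0" by (simp add: power2_eq_square)
    qed (use e in simp)
    finally have 1: "\<bar>LINT x|lborel. pot (\<lambda>x. ?w x * h x) x * (u x)\<^sup>2\<bar> \<le> \<eta> / 2" by (simp only: eD)
    have "\<bar>LINT x|lborel. pot (\<lambda>y. ?w y * ?z y) x * (v x * h x)\<bar> \<le> e * (LINT x|lborel. \<bar>v x * h x\<bar>)"
      by (rule pot_mult_le_sup[OF iwz ivh]) (rule \<delta>(2)[OF w z nw nz w4'])
    also have "\<dots> \<le> e * (D * D / c0)"
    proof (intro mult_left_mono)
      have "(LINT x|lborel. \<bar>v x * h x\<bar>) \<le> norm (emb v) * norm (emb h) / c0" by (rule pair_le(2)[OF v(1) h(1)])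
      also have "\<dots> \<le> D * D / c0" using v(2) h(2) D c0 by (intro divide_right_mono mult_mono) auto
      finally show "(LINT x|lborel. \<bar>v x * h x\<bar>) \<le> D * D / c0" .
    qed (use e in simp)
    finally have 2: "\<bar>LINT x|lborel. pot (\<lambda>y. ?w y * ?z y) x * (v x * h x)\<bar> \<le> \<eta> / 2" by (simp only: eD)
    show ?thesis unfolding eq using 1 2 by linarith
  qed
  thus ?thesis using \<delta>(1) by blast
qed

text \<open>Write (u + h)^2 = a + b with a = u^2 and b = 2 u h + h^2. Expanding the symmetric
  bilinear form leaves 2 \<integral> pot a * h^2 + \<integral> pot b * b beyond first order, and
  both terms are quadratic in the norm of h.\<close>

lemma phi_taylor:
  assumes \<eta>: "0 < \<eta>"
  shows "\<exists>\<delta>>0. \<forall>u\<in>W. \<forall>h\<in>W. norm (emb u) \<le> B \<longrightarrow> norm (emb h) \<le> \<delta> \<longrightarrow>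
    \<bar>(LINT x|lborel. phi (\<lambda>x. u x + h x) x * (u x + h x)\<^sup>2) - (LINT x|lborel. phi u x * (u x)\<^sup>2)
       - 4 * (LINT x|lborel. phi u x * u x * h x)\<bar> \<le> \<eta> * norm (emb h)"
proof -
  define D where "D = 2 * (B\<^sup>2 / c0) * (1 / c0) + ((2 * \<bar>B\<bar> + 1) / c0)\<^sup>2"
  have D: "0 < D"
  proof -
    have "0 < (2 * \<bar>B\<bar> + 1) / c0" using c0 by (simp add: add_nonneg_pos)
    hence "0 < ((2 * \<bar>B\<bar> + 1) / c0)\<^sup>2" by (rule zero_less_power)
    moreover have "0 \<le> 2 * (B\<^sup>2 / c0) * (1 / c0)" using c0 by simp
    ultimately show ?thesis unfolding D_def by linarith
  qed
  define \<delta> where "\<delta> = min 1 (\<eta> / D)"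
  have \<delta>: "0 < \<delta>" using \<eta> D by (simp add: \<delta>_def)
  have "\<bar>(LINT x|lborel. phi (\<lambda>x. u x + h x) x * (u x + h x)\<^sup>2) - (LINT x|lborel. phi u x * (u x)\<^sup>2)
       - 4 * (LINT x|lborel. phi u x * u x * h x)\<bar> \<le> \<eta> * norm (emb h)"
    if u: "u \<in> W" "norm (emb u) \<le> B" and h: "h \<in> W" "norm (emb h) \<le> \<delta>" for u h
  proof -
    define \<rho> where "\<rho> = norm (emb h)"
    have \<rho>: "0 \<le> \<rho>" "\<rho> \<le> 1" "D * \<rho> \<le> \<eta>" using h(2) D by (auto simp: \<rho>_def \<delta>_def field_simps)
    let ?a = "\<lambda>x. (u x)\<^sup>2" and ?c = "\<lambda>x. u x * h x" and ?d = "\<lambda>x. (h x)\<^sup>2"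
    let ?b = "\<lambda>x. 2 * ?c x + 1 * ?d x"
    have ia: "integrable lborel ?a" and ic: "integrable lborel ?c" and id: "integrable lborel ?d"
      by (intro W_sq_int pair_le(1) u h)+
    have ib: "integrable lborel ?b" using ic id by simp
    have ab: "(\<lambda>x. (u x + h x)\<^sup>2) = (\<lambda>x. 1 * ?a x + 1 * ?b x)"
      by (simp add: fun_eq_iff power2_eq_square algebra_simps)
    have pab: "phi (\<lambda>x. u x + h x) x = pot ?a x + pot ?b x" for x
      unfolding phi_eq_pot ab using pot_linear[OF ia ib, of 1 1 x] by simp
    have "(LINT x|lborel. phi (\<lambda>x. u x + h x) x * (u x + h x)\<^sup>2)
      = (LINT x|lborel. pot ?a x * ?a x + pot ?a x * ?b x + pot ?b x * ?a x + pot ?b x * ?b x)"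
      unfolding pab by (rule Bochner_Integration.integral_cong[OF refl]) (simp add: power2_eq_square algebra_simps)
    also have "\<dots> = (LINT x|lborel. pot ?a x * ?a x) + (LINT x|lborel. pot ?a x * ?b x) + (LINT x|lborel. pot ?b x * ?a x) + (LINT x|lborel. pot ?b x * ?b x)"
      by (simp only: Bochner_Integration.integral_add Bochner_Integration.integrable_add
           pot_mult_integrable(1)[OF ia ia] pot_mult_integrable(1)[OF ia ib] pot_mult_integrable(1)[OF ib ia] pot_mult_integrable(1)[OF ib ib])
    also have "(LINT x|lborel. pot ?b x * ?a x) = (LINT x|lborel. pot ?a x * ?b x)" by (rule pot_symmetric[OF ib ia])
    also have "(LINT x|lborel. pot ?a x * ?b x) = 2 * (LINT x|lborel. pot ?a x * ?c x) + (LINT x|lborel. pot ?a x * ?d x)"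
    proof -
      have "(LINT x|lborel. pot ?a x * ?b x) = (LINT x|lborel. 2 * (pot ?a x * ?c x) + pot ?a x * ?d x)"
        by (simp add: algebra_simps)
      also have "\<dots> = 2 * (LINT x|lborel. pot ?a x * ?c x) + (LINT x|lborel. pot ?a x * ?d x)"
        using pot_mult_integrable(1)[OF ia ic] pot_mult_integrable(1)[OF ia id] by simp
      finally show ?thesis .
    qed
    finally have eq: "(LINT x|lborel. phi (\<lambda>x. u x + h x) x * (u x + h x)\<^sup>2) - (LINT x|lborel. phi u x * (u x)\<^sup>2)
       - 4 * (LINT x|lborel. phi u x * u x * h x) = 2 * (LINT x|lborel. pot ?a x * ?d x) + (LINT x|lborel. pot ?b x * ?b x)"
      by (simp add: phi_eq_pot mult.assoc)
    have a1: "(LINT x|lborel. \<bar>?a x\<bar>) \<le> B\<^sup>2 / c0"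
    proof -
      have "(norm (emb u))\<^sup>2 / c0 \<le> B\<^sup>2 / c0" using u(2) c0 by (intro divide_right_mono power_mono) auto
      thus ?thesis using L2_le[OF u(1)] by simp
    qed
    have d1: "(LINT x|lborel. \<bar>?d x\<bar>) \<le> \<rho>\<^sup>2 / c0" using L2_le[OF h(1)] by (simp add: \<rho>_def)
    have b1: "(LINT x|lborel. \<bar>?b x\<bar>) \<le> \<rho> * ((2 * \<bar>B\<bar> + 1) / c0)"
    proof -
      have "(LINT x|lborel. \<bar>?b x\<bar>) \<le> (LINT x|lborel. 2 * \<bar>?c x\<bar> + \<bar>?d x\<bar>)"
        by (rule integral_mono) (use ib ic id in \<open>auto intro: order_trans[OF abs_triangle_ineq]\<close>)
      also have "\<dots> = 2 * (LINT x|lborel. \<bar>?c x\<bar>) + (LINT x|lborel. \<bar>?d x\<bar>)" using ic id by simp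
      also have "\<dots> \<le> 2 * (\<bar>B\<bar> * \<rho> / c0) + \<rho> * 1 / c0"
      proof (intro add_mono mult_left_mono)
        have "(LINT x|lborel. \<bar>?c x\<bar>) \<le> norm (emb u) * \<rho> / c0" unfolding \<rho>_def by (rule pair_le(2)[OF u(1) h(1)])
        also have "\<dots> \<le> \<bar>B\<bar> * \<rho> / c0" using u(2) \<rho> c0 by (intro divide_right_mono mult_right_mono) auto
        finally show "(LINT x|lborel. \<bar>?c x\<bar>) \<le> \<bar>B\<bar> * \<rho> / c0" .
        have "\<rho>\<^sup>2 / c0 \<le> \<rho> * 1 / c0" unfolding power2_eq_square using \<rho> c0 by (intro divide_right_mono mult_left_mono) auto
        thus "(LINT x|lborel. \<bar>?d x\<bar>) \<le> \<rho> * 1 / c0" using d1 by linarith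
      qed simp
      also have "\<dots> = \<rho> * ((2 * \<bar>B\<bar> + 1) / c0)" by (simp add: algebra_simps add_divide_distrib)
      finally show ?thesis .
    qed
    have "\<bar>LINT x|lborel. pot ?a x * ?d x\<bar> \<le> (B\<^sup>2 / c0) * (\<rho>\<^sup>2 / c0)"
      by (rule order_trans[OF pot_mult_integrable(2)[OF ia id] mult_mono[OF a1 d1]]) (use c0 in auto)
    moreover have "\<bar>LINT x|lborel. pot ?b x * ?b x\<bar> \<le> (\<rho> * ((2 * \<bar>B\<bar> + 1) / c0)) * (\<rho> * ((2 * \<bar>B\<bar> + 1) / c0))"
      by (rule order_trans[OF pot_mult_integrable(2)[OF ib ib] mult_mono[OF b1 b1]]) (use c0 \<rho> in auto)
    ultimately have "\<bar>2 * (LINT x|lborel. pot ?a x * ?d x) + (LINT x|lborel. pot ?b x * ?b x)\<bar>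
       \<le> 2 * ((B\<^sup>2 / c0) * (\<rho>\<^sup>2 / c0)) + (\<rho> * ((2 * \<bar>B\<bar> + 1) / c0)) * (\<rho> * ((2 * \<bar>B\<bar> + 1) / c0))" by linarith
    also have "\<dots> = (D * \<rho>) * \<rho>" by (simp add: D_def power2_eq_square algebra_simps)
    also have "\<dots> \<le> \<eta> * \<rho>" by (rule mult_right_mono[OF \<rho>(3,1)])
    finally show ?thesis unfolding eq \<rho>_def .
  qed
  thus ?thesis using \<delta> by blast
qed

section \<open>Riesz representatives\<close>

text \<open>Carries functionals given on functions over to classes; \<open>cong\<close> is what
  makes them well defined there.\<close>

lemma riesz_W:
  assumes lin: "\<And>g h a b. g \<in> W \<Longrightarrow> h \<in> W \<Longrightarrow> L (\<lambda>x. a * g x + b * h x) = a * L g + b * L h"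
    and cong: "\<And>g h. g \<in> W \<Longrightarrow> h \<in> W \<Longrightarrow> AE x in lborel. g x = h x \<Longrightarrow> L g = L h"
    and bdd: "\<And>h. h \<in> W \<Longrightarrow> norm (emb h) \<le> 1 \<Longrightarrow> \<bar>L h\<bar> \<le> C"
  shows "\<exists>r. r \<in> WW \<and> (\<forall>h\<in>W. inner r (emb h) = L h)"
proof -
  have lin': "L (pull (a *\<^sub>R U + b *\<^sub>R Z)) = a * L (pull U) + b * L (pull Z)" if UZ: "U \<in> WW" "Z \<in> WW" for U Z a b
  proof -
    have i: "a *\<^sub>R U + b *\<^sub>R Z \<in> WW" using UZ subspace_WW by (simp add: subspace_add subspace_scale)
    have "L (pull (a *\<^sub>R U + b *\<^sub>R Z)) = L (\<lambda>x. a * pull U x + b * pull Z x)"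
      by (rule cong[OF pull(1)[OF i] W_linear[OF pull(1) pull(1)] pull_linear[OF UZ i]]) (use UZ in auto)
    thus ?thesis using lin[OF pull(1) pull(1)] UZ by simp
  qed
  have b: "\<bar>L (pull U)\<bar> \<le> C * norm U" if U: "U \<in> WW" for U
  proof (cases "U = 0")
    case True
    thus ?thesis using lin'[OF U U, of 0 0] by simp
  next
    case False
    have i: "(1 / norm U) *\<^sub>R U + 0 *\<^sub>R U \<in> WW" using U subspace_WW by (simp add: subspace_scale)
    have "\<bar>L (pull ((1 / norm U) *\<^sub>R U + 0 *\<^sub>R U))\<bar> \<le> C"
      by (rule bdd[OF pull(1)[OF i]]) (simp only: pull(2)[OF i], use False in simp)
    hence "\<bar>(1 / norm U) * L (pull U)\<bar> \<le> C" unfolding lin'[OF U U] by simp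
    thus ?thesis using False by (simp add: abs_mult field_simps)
  qed
  obtain r where r: "r \<in> WW" "\<And>U. U \<in> WW \<Longrightarrow> L (pull U) = inner r U"
  proof (rule riesz_representation[OF subspace_WW closed_WW])
    show "L (pull (U + Z)) = L (pull U) + L (pull Z)" if "U \<in> WW" "Z \<in> WW" for U Z using lin'[OF that, of 1 1] by simp
    show "L (pull (a *\<^sub>R U)) = a * L (pull U)" if "U \<in> WW" for a U using lin'[OF that that, of a 0] by simp
  qed (use b in auto)
  have "inner r (emb h) = L h" if h: "h \<in> W" for h
  proof -
    have e: "emb h \<in> WW" using h by (simp add: WW_def)
    have "L h = L (pull (emb h))" by (rule cong[OF pull(1)[OF e] h pull_emb[OF h], symmetric])
    thus ?thesis using r(2)[OF e] by simp
  qed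
  thus ?thesis using r(1) by blast
qed

lemma WW_eqI:
  assumes "r \<in> WW" "s \<in> WW" "\<And>h. h \<in> W \<Longrightarrow> inner r (emb h) = inner s (emb h)"
  shows "r = s"
proof -
  have d: "r - s \<in> WW" using assms subspace_WW by (simp add: subspace_diff)
  have "inner (r - s) (emb (pull (r - s))) = 0"
    using assms(3)[OF pull(1)[OF d]] by (simp add: inner_diff_left)
  thus ?thesis using pull(2)[OF d] by simp
qed

end

section \<open>Solutions as constrained critical points\<close>

locale bopp_podolsky = potential_space + nonlinearity
begin

section \<open>Integral functionals of the nonlinearity\<close>

lemma f_meas: "u \<in> borel_measurable lborel \<Longrightarrow> (\<lambda>x. f (u x)) \<in> borel_measurable lborel"
  by (rule measurable_compose[OF _ borel_measurable_continuous_onI[OF f_cont]]) auto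

lemma F_meas: "u \<in> borel_measurable lborel \<Longrightarrow> (\<lambda>x. Fprim f (u x)) \<in> borel_measurable lborel"
  by (rule measurable_compose[OF _ borel_measurable_continuous_onI])
     (auto intro!: DERIV_continuous_on F_deriv)

lemma Lq_integrable: "u \<in> W \<Longrightarrow> integrable lborel (\<lambda>x. \<bar>u x\<bar> powr q)"
  by (rule Lp_integrable[OF q])

lemma Lq_ball: "\<exists>K\<ge>0. \<forall>u\<in>W. norm (emb u) \<le> B \<longrightarrow> (LINT x|lborel. \<bar>u x\<bar> powr q) \<le> K"
proof -
  obtain C where C: "0 < C" "\<And>u. u \<in> W \<Longrightarrow> (LINT x|lborel. \<bar>u x\<bar> powr q) \<le> C * norm (emb u) powr q" using Lp_bound[OF q] by blast
  have "(LINT x|lborel. \<bar>u x\<bar> powr q) \<le> C * B powr q" if "u \<in> W" "norm (emb u) \<le> B" for u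
  proof -
    have "C * norm (emb u) powr q \<le> C * B powr q" using that C(1) q by (intro mult_left_mono powr_mono2) auto
    thus ?thesis using C(2)[OF that(1)] by linarith
  qed
  moreover have "0 \<le> C * B powr q" using C(1) by simp
  ultimately show ?thesis by blast
qed

lemma L2_ball: "u \<in> W \<Longrightarrow> norm (emb u) \<le> B \<Longrightarrow> (LINT x|lborel. (u x)\<^sup>2) \<le> B\<^sup>2 / c0"
proof -
  assume u: "u \<in> W" "norm (emb u) \<le> B"
  have "(norm (emb u))\<^sup>2 / c0 \<le> B\<^sup>2 / c0" using u(2) c0 by (intro divide_right_mono power_mono) auto
  thus ?thesis using L2_le[OF u(1)] by linarith
qed

lemma f_pair:
  assumes u: "u \<in> W"
  shows "\<exists>C. \<forall>h\<in>W. integrable lborel (\<lambda>x. f (u x) * h x) \<and>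
    (norm (emb h) \<le> 1 \<longrightarrow> \<bar>LINT x|lborel. f (u x) * h x\<bar> \<le> C)"
proof -
  obtain A where A: "0 < A" "\<And>s. \<bar>f s\<bar> \<le> A * (\<bar>s\<bar> + \<bar>s\<bar> powr (q - 1))" using f_growth by blast
  obtain K where K: "\<And>h. h \<in> W \<Longrightarrow> norm (emb h) \<le> 1 \<Longrightarrow> (LINT x|lborel. \<bar>h x\<bar> powr q) \<le> K" using Lq_ball[of 1] by blast
  define C where "C = A * (norm (emb u) / c0 + ((LINT x|lborel. \<bar>u x\<bar> powr q) + K))"
  have "integrable lborel (\<lambda>x. f (u x) * h x) \<and> (norm (emb h) \<le> 1 \<longrightarrow> \<bar>LINT x|lborel. f (u x) * h x\<bar> \<le> C)"
    if h: "h \<in> W" for h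
  proof -
    have 1: "integrable lborel (\<lambda>x. A * (\<bar>u x * h x\<bar> + (\<bar>u x\<bar> powr q + \<bar>h x\<bar> powr q)))"
      using pair_le(1)[OF u h] Lq_integrable[OF u] Lq_integrable[OF h] by simp
    have 2: "(\<lambda>x. f (u x) * h x) \<in> borel_measurable lborel" using f_meas[OF W_meas[OF u]] W_meas[OF h] by measurable
    have 3: "\<bar>f (u x) * h x\<bar> \<le> A * (\<bar>u x * h x\<bar> + (\<bar>u x\<bar> powr q + \<bar>h x\<bar> powr q))" for x
    proof -
      have "\<bar>f (u x) * h x\<bar> \<le> (A * (\<bar>u x\<bar> + \<bar>u x\<bar> powr (q - 1))) * \<bar>h x\<bar>"
        unfolding abs_mult by (rule mult_right_mono[OF A(2)]) simp
      also have "\<dots> = A * (\<bar>u x * h x\<bar> + \<bar>u x\<bar> powr (q - 1) * \<bar>h x\<bar>)" by (simp add: abs_mult algebra_simps)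
      also have "\<dots> \<le> A * (\<bar>u x * h x\<bar> + (\<bar>u x\<bar> powr q + \<bar>h x\<bar> powr q))"
        using A(1) q by (intro mult_left_mono add_left_mono young_powr1) auto
      finally show ?thesis .
    qed
    have "\<bar>LINT x|lborel. f (u x) * h x\<bar> \<le> C" if n: "norm (emb h) \<le> 1"
    proof -
      have "\<bar>LINT x|lborel. f (u x) * h x\<bar> \<le> (LINT x|lborel. A * (\<bar>u x * h x\<bar> + (\<bar>u x\<bar> powr q + \<bar>h x\<bar> powr q)))"
        by (rule abs_integral_le(2)[OF 1 2 3])
      also have "\<dots> = A * ((LINT x|lborel. \<bar>u x * h x\<bar>) + ((LINT x|lborel. \<bar>u x\<bar> powr q) + (LINT x|lborel. \<bar>h x\<bar> powr q)))"
        using pair_le(1)[OF u h] Lq_integrable[OF u] Lq_integrable[OF h] by simp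
      also have "\<dots> \<le> C" unfolding C_def
      proof (intro mult_left_mono add_mono order_refl K h n)
        have "norm (emb u) * norm (emb h) / c0 \<le> norm (emb u) * 1 / c0"
          using n c0 by (intro divide_right_mono mult_left_mono) auto
        thus "(LINT x|lborel. \<bar>u x * h x\<bar>) \<le> norm (emb u) / c0" using pair_le(2)[OF u h] by simp
      qed (use A in simp)
      finally show ?thesis .
    qed
    thus ?thesis using abs_integral_le(1)[OF 1 2 3] by blast
  qed
  thus ?thesis by blast
qed

lemma f_pair_int: "u \<in> W \<Longrightarrow> h \<in> W \<Longrightarrow> integrable lborel (\<lambda>x. f (u x) * h x)"
  using f_pair by blast

text \<open>\<open>f_diff_bound\<close> is integrated against h. Young's inequality leaves three
  shares of \<eta>/3: e times bounded norms, C \<delta> / \<theta> for the L^q distance, and C k K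
  for h, where \<theta>^(q-1) = k.\<close>

lemma f_pair_uniform:
  assumes \<eta>: "0 < \<eta>"
  shows "\<exists>\<delta>>0. \<forall>u\<in>W. \<forall>v\<in>W. norm (emb u) \<le> B \<longrightarrow> norm (emb v) \<le> B \<longrightarrow> (LINT x|lborel. \<bar>u x - v x\<bar> powr q) \<le> \<delta> \<longrightarrow>
    (\<forall>h\<in>W. norm (emb h) \<le> 1 \<longrightarrow>
      \<bar>(LINT x|lborel. f (u x) * h x) - (LINT x|lborel. f (v x) * h x)\<bar> \<le> \<eta>)"
proof -
  define D where "D = max B 1"
  have D: "B \<le> D" "1 \<le> D" by (auto simp: D_def)
  obtain K where K: "0 \<le> K" "\<And>u. u \<in> W \<Longrightarrow> norm (emb u) \<le> D \<Longrightarrow> (LINT x|lborel. \<bar>u x\<bar> powr q) \<le> K" using Lq_ball[of D] by blast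
  define S where "S = 4 * (D\<^sup>2 / c0) + 4 * K + 1"
  have S: "1 \<le> S" using K c0 by (simp add: S_def)
  define e where "e = \<eta> / (3 * S)"
  have e: "0 < e" "e * S = \<eta> / 3" using \<eta> S by (auto simp: e_def)
  obtain C where C: "0 < C" "\<And>s t. \<bar>f s - f t\<bar> \<le> e * (\<bar>s\<bar> + \<bar>t\<bar>) + e * (\<bar>s\<bar> powr (q - 1) + \<bar>t\<bar> powr (q - 1)) + C * \<bar>s - t\<bar> powr (q - 1)"
    using f_diff_bound[OF e(1)] by blast
  define K1 where "K1 = K + 1"
  have K1: "0 < K1" "K \<le> K1" using K by (auto simp: K1_def)
  define k where "k = \<eta> / (3 * C * K1)"
  have k: "0 < k" using \<eta> C K1 by (simp add: k_def)
  define \<theta> where "\<theta> = k powr (1 / (q - 1))"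
  have \<theta>: "0 < \<theta>" "\<theta> powr (q - 1) = k" using k q by (auto simp: \<theta>_def powr_powr)
  have CkK: "C * (k * K) \<le> \<eta> / 3"
  proof -
    have "C * (k * K) \<le> C * (k * K1)" using C k K1 by (intro mult_left_mono) auto
    also have "\<dots> = \<eta> / 3" using C(1) K1(1) by (simp add: k_def)
    finally show ?thesis .
  qed
  define \<delta> where "\<delta> = \<eta> * \<theta> / (3 * C)"
  have \<delta>: "0 < \<delta>" "C * (\<delta> / \<theta>) = \<eta> / 3" using \<eta> \<theta> C by (auto simp: \<delta>_def)
  have "\<bar>(LINT x|lborel. f (u x) * h x) - (LINT x|lborel. f (v x) * h x)\<bar> \<le> \<eta>"
    if u: "u \<in> W" "norm (emb u) \<le> B" and v: "v \<in> W" "norm (emb v) \<le> B" and w: "(LINT x|lborel. \<bar>u x - v x\<bar> powr q) \<le> \<delta>"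
      and h: "h \<in> W" "norm (emb h) \<le> 1" for u v h
  proof -
    let ?G1 = "\<lambda>x. ((u x)\<^sup>2 + (v x)\<^sup>2 + 2 * (h x)\<^sup>2) + (\<bar>u x\<bar> powr q + \<bar>v x\<bar> powr q + 2 * \<bar>h x\<bar> powr q)"
    let ?G2 = "\<lambda>x. \<bar>u x - v x\<bar> powr q / \<theta> + k * \<bar>h x\<bar> powr q"
    note wW = W_diff[OF u(1) v(1)]
    note ints = W_sq_int[OF u(1)] W_sq_int[OF v(1)] W_sq_int[OF h(1)] Lq_integrable[OF u(1)] Lq_integrable[OF v(1)]
      Lq_integrable[OF h(1)] Lq_integrable[OF wW]
    have d1: "(LINT x|lborel. f (u x) * h x) - (LINT x|lborel. f (v x) * h x) = (LINT x|lborel. (f (u x) - f (v x)) * h x)"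
      using f_pair_int[OF u(1) h(1)] f_pair_int[OF v(1) h(1)] by (simp add: left_diff_distrib)
    have d2: "\<bar>LINT x|lborel. (f (u x) - f (v x)) * h x\<bar> \<le> (LINT x|lborel. e * ?G1 x + C * ?G2 x)"
    proof (rule abs_integral_le(2))
      show "integrable lborel (\<lambda>x. e * ?G1 x + C * ?G2 x)" using ints by simp
      show "(\<lambda>x. (f (u x) - f (v x)) * h x) \<in> borel_measurable lborel"
        using f_meas[OF W_meas[OF u(1)]] f_meas[OF W_meas[OF v(1)]] W_meas[OF h(1)] by measurable
      fix x
      have sq: "\<bar>s\<bar> * \<bar>t\<bar> \<le> s\<^sup>2 + t\<^sup>2" for s t :: real
      proof -
        have "0 \<le> (\<bar>s\<bar> - \<bar>t\<bar>)\<^sup>2" "0 \<le> \<bar>s\<bar> * \<bar>t\<bar>" by simp_all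
        thus ?thesis unfolding power2_diff power2_abs by linarith
      qed
      have "\<bar>(f (u x) - f (v x)) * h x\<bar> \<le> (e * (\<bar>u x\<bar> + \<bar>v x\<bar>) + e * (\<bar>u x\<bar> powr (q - 1) + \<bar>v x\<bar> powr (q - 1)) + C * \<bar>u x - v x\<bar> powr (q - 1)) * \<bar>h x\<bar>"
        unfolding abs_mult by (rule mult_right_mono[OF C(2)]) simp
      also have "\<dots> = e * ((\<bar>u x\<bar> * \<bar>h x\<bar> + \<bar>v x\<bar> * \<bar>h x\<bar>) + (\<bar>u x\<bar> powr (q - 1) * \<bar>h x\<bar> + \<bar>v x\<bar> powr (q - 1) * \<bar>h x\<bar>)) + C * (\<bar>u x - v x\<bar> powr (q - 1) * \<bar>h x\<bar>)"
        by (simp add: algebra_simps)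
      also have "\<dots> \<le> e * ((((u x)\<^sup>2 + (h x)\<^sup>2) + ((v x)\<^sup>2 + (h x)\<^sup>2)) + ((\<bar>u x\<bar> powr q + \<bar>h x\<bar> powr q) + (\<bar>v x\<bar> powr q + \<bar>h x\<bar> powr q)))
          + C * (\<bar>u x - v x\<bar> powr q / \<theta> + \<theta> powr (q - 1) * \<bar>h x\<bar> powr q)"
        using e(1) C(1) \<theta>(1) q by (intro add_mono mult_left_mono sq young_powr1 young_powr) auto
      also have "\<dots> = e * ?G1 x + C * ?G2 x" by (simp add: \<theta>(2))
      finally show "\<bar>(f (u x) - f (v x)) * h x\<bar> \<le> e * ?G1 x + C * ?G2 x" .
    qed
    have "(LINT x|lborel. e * ?G1 x + C * ?G2 x)
       = e * (((LINT x|lborel. (u x)\<^sup>2) + (LINT x|lborel. (v x)\<^sup>2) + 2 * (LINT x|lborel. (h x)\<^sup>2))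
           + ((LINT x|lborel. \<bar>u x\<bar> powr q) + (LINT x|lborel. \<bar>v x\<bar> powr q) + 2 * (LINT x|lborel. \<bar>h x\<bar> powr q)))
         + C * ((LINT x|lborel. \<bar>u x - v x\<bar> powr q) / \<theta> + k * (LINT x|lborel. \<bar>h x\<bar> powr q))"
      using ints by simp
    also have "\<dots> \<le> e * ((D\<^sup>2 / c0 + D\<^sup>2 / c0 + 2 * (D\<^sup>2 / c0)) + (K + K + 2 * K)) + C * (\<delta> / \<theta> + k * K)"
      using u v h w D e(1) C(1) \<theta>(1) k
      by (intro add_mono mult_left_mono divide_right_mono L2_ball K(2)) auto
    also have "\<dots> \<le> e * S + (C * (\<delta> / \<theta>) + C * (k * K))"
      using e(1) by (simp add: S_def algebra_simps)
    also have "\<dots> \<le> \<eta>" unfolding e(2) \<delta>(2) using CkK by linarith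
    finally show ?thesis using d1 d2 by linarith
  qed
  thus ?thesis using \<delta>(1) by blast
qed

lemma F_int: "u \<in> W \<Longrightarrow> integrable lborel (\<lambda>x. Fprim f (u x))"
proof -
  assume u: "u \<in> W"
  obtain C where C: "0 < C" "\<And>s k \<rho>. 0 \<le> \<rho> \<Longrightarrow> \<rho> \<le> 1 \<Longrightarrow>
     \<bar>Fprim f (s + \<rho> * k) - Fprim f s - f s * (\<rho> * k)\<bar>
       \<le> \<rho> * (1 * (s\<^sup>2 + k\<^sup>2 + \<bar>s\<bar> powr q + \<bar>k\<bar> powr q) + \<rho> powr (q - 1) * (C * \<bar>k\<bar> powr q))"
    using F_taylor_scaled[of 1] by auto
  show ?thesis
  proof (rule abs_integral_le(1))
    show "integrable lborel (\<lambda>x. (u x)\<^sup>2 + \<bar>u x\<bar> powr q + C * \<bar>u x\<bar> powr q)"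
      using W_sq_int[OF u] Lq_integrable[OF u] by simp
    \<comment> \<open>The expansion at 0 with \<rho> = 1 is a growth bound for F, as F and f vanish
      at 0.\<close>
    show "\<bar>Fprim f (u x)\<bar> \<le> (u x)\<^sup>2 + \<bar>u x\<bar> powr q + C * \<bar>u x\<bar> powr q" for x
      using C(2)[of 1 0 "u x"] by (simp add: F0 f0)
  qed (rule F_meas[OF W_meas[OF u]])
qed

text \<open>The increment is written as \<rho> k with \<rho> = norm (emb h), so that k ranges over
  the unit ball. The remainder is then \<rho> times a quantity made small by e and by
  \<rho>^(q-1).\<close>

lemma F_taylor_int:
  assumes \<eta>: "0 < \<eta>"
  shows "\<exists>\<delta>>0. \<forall>u\<in>W. \<forall>h\<in>W. norm (emb u) \<le> B \<longrightarrow> norm (emb h) \<le> \<delta> \<longrightarrow>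
    \<bar>(LINT x|lborel. Fprim f (u x + h x)) - (LINT x|lborel. Fprim f (u x)) - (LINT x|lborel. f (u x) * h x)\<bar> \<le> \<eta> * norm (emb h)"
proof -
  define D where "D = max B 1"
  have D: "B \<le> D" "1 \<le> D" by (auto simp: D_def)
  obtain K where K: "0 \<le> K" "\<And>u. u \<in> W \<Longrightarrow> norm (emb u) \<le> D \<Longrightarrow> (LINT x|lborel. \<bar>u x\<bar> powr q) \<le> K" using Lq_ball[of D] by blast
  define S where "S = 2 * (D\<^sup>2 / c0) + 2 * K + 1"
  have S: "1 \<le> S" using K c0 by (simp add: S_def)
  define e where "e = \<eta> / (2 * S)"
  have e: "0 < e" "e * S = \<eta> / 2" using \<eta> S by (auto simp: e_def)
  obtain C where C: "0 < C" "\<And>s k \<rho>. 0 \<le> \<rho> \<Longrightarrow> \<rho> \<le> 1 \<Longrightarrow>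
     \<bar>Fprim f (s + \<rho> * k) - Fprim f s - f s * (\<rho> * k)\<bar>
       \<le> \<rho> * (e * (s\<^sup>2 + k\<^sup>2 + \<bar>s\<bar> powr q + \<bar>k\<bar> powr q) + \<rho> powr (q - 1) * (C * \<bar>k\<bar> powr q))"
    using F_taylor_scaled[OF e(1)] by blast
  define m where "m = \<eta> / (2 * (C * (K + 1)))"
  have m: "0 < m" using \<eta> C K by (simp add: m_def)
  define \<delta> where "\<delta> = min 1 (m powr (1 / (q - 1)))"
  have \<delta>: "0 < \<delta>" using m by (simp add: \<delta>_def)
  have "\<bar>(LINT x|lborel. Fprim f (u x + h x)) - (LINT x|lborel. Fprim f (u x)) - (LINT x|lborel. f (u x) * h x)\<bar> \<le> \<eta> * norm (emb h)"
    if u: "u \<in> W" "norm (emb u) \<le> B" and h: "h \<in> W" "norm (emb h) \<le> \<delta>" for u h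
  proof -
    define \<rho> where "\<rho> = norm (emb h)"
    have \<rho>: "0 \<le> \<rho>" "\<rho> \<le> 1" using h(2) by (auto simp: \<rho>_def \<delta>_def)
    have \<rho>m: "\<rho> powr (q - 1) \<le> m"
    proof -
      have "\<rho> powr (q - 1) \<le> (m powr (1 / (q - 1))) powr (q - 1)"
        using h(2) q \<rho> by (intro powr_mono2) (auto simp: \<rho>_def \<delta>_def)
      thus ?thesis using m q by (simp add: powr_powr)
    qed
    define k where "k = (\<lambda>x. (1 / \<rho>) * h x)"
    have k: "k \<in> W" unfolding k_def by (rule W_cmult[OF h(1)])
    have nk: "norm (emb k) \<le> D" unfolding k_def emb_cmult[OF h(1)] using D(2) by (simp add: \<rho>_def)
    \<comment> \<open>For \<rho> = 0 division gives k = 0, while h vanishes only almost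
      everywhere.\<close>
    have hk: "AE x in lborel. h x = \<rho> * k x"
    proof (cases "\<rho> = 0")
      case True
      hence "emb h = emb (\<lambda>x. 0)" using emb_cmult[OF zero_W, of 0] by (simp add: \<rho>_def)
      hence "AE x in lborel. h x = 0" by (rule emb_eq_imp_AE[OF h(1) zero_W])
      thus ?thesis using True by simp
    qed (simp add: k_def)
    note ints = W_sq_int[OF u(1)] W_sq_int[OF k] Lq_integrable[OF u(1)] Lq_integrable[OF k]
    have uh: "(\<lambda>x. u x + h x) \<in> W" by (rule W_add[OF u(1) h(1)])
    have eq: "(LINT x|lborel. Fprim f (u x + h x)) - (LINT x|lborel. Fprim f (u x)) - (LINT x|lborel. f (u x) * h x)
       = (LINT x|lborel. Fprim f (u x + \<rho> * k x) - Fprim f (u x) - f (u x) * (\<rho> * k x))"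
    proof -
      have "(LINT x|lborel. Fprim f (u x + h x)) - (LINT x|lborel. Fprim f (u x)) - (LINT x|lborel. f (u x) * h x)
         = (LINT x|lborel. Fprim f (u x + h x) - Fprim f (u x) - f (u x) * h x)"
        using F_int[OF uh] F_int[OF u(1)] f_pair_int[OF u(1) h(1)] by simp
      also have "\<dots> = (LINT x|lborel. Fprim f (u x + \<rho> * k x) - Fprim f (u x) - f (u x) * (\<rho> * k x))"
      proof (rule integral_cong_AE)
        show "(\<lambda>x. Fprim f (u x + h x) - Fprim f (u x) - f (u x) * h x) \<in> borel_measurable lborel"
          using F_int[OF uh] F_int[OF u(1)] f_pair_int[OF u(1) h(1)] by measurable
        have uk: "(\<lambda>x. u x + \<rho> * k x) \<in> W" by (intro W_add W_cmult u k)
        show "(\<lambda>x. Fprim f (u x + \<rho> * k x) - Fprim f (u x) - f (u x) * (\<rho> * k x)) \<in> borel_measurable lborel"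
          using F_int[OF uk] F_int[OF u(1)] f_pair_int[OF u(1) W_cmult[OF k, of \<rho>]] by measurable
        show "AE x in lborel. Fprim f (u x + h x) - Fprim f (u x) - f (u x) * h x
           = Fprim f (u x + \<rho> * k x) - Fprim f (u x) - f (u x) * (\<rho> * k x)"
          using hk by eventually_elim simp
      qed
      finally show ?thesis .
    qed
    have "\<bar>LINT x|lborel. Fprim f (u x + \<rho> * k x) - Fprim f (u x) - f (u x) * (\<rho> * k x)\<bar>
       \<le> (LINT x|lborel. \<rho> * (e * ((u x)\<^sup>2 + (k x)\<^sup>2 + \<bar>u x\<bar> powr q + \<bar>k x\<bar> powr q) + \<rho> powr (q - 1) * (C * \<bar>k x\<bar> powr q)))"
    proof (rule abs_integral_le(2))
      show "integrable lborel (\<lambda>x. \<rho> * (e * ((u x)\<^sup>2 + (k x)\<^sup>2 + \<bar>u x\<bar> powr q + \<bar>k x\<bar> powr q) + \<rho> powr (q - 1) * (C * \<bar>k x\<bar> powr q)))"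
        using ints by simp
      have uk: "(\<lambda>x. u x + \<rho> * k x) \<in> W" by (intro W_add W_cmult u k)
      show "(\<lambda>x. Fprim f (u x + \<rho> * k x) - Fprim f (u x) - f (u x) * (\<rho> * k x)) \<in> borel_measurable lborel"
        using F_int[OF uk] F_int[OF u(1)] f_pair_int[OF u(1) W_cmult[OF k, of \<rho>]] by measurable
    qed (rule C(2)[OF \<rho>])
    also have "\<dots> = \<rho> * (e * ((LINT x|lborel. (u x)\<^sup>2) + (LINT x|lborel. (k x)\<^sup>2) + (LINT x|lborel. \<bar>u x\<bar> powr q) + (LINT x|lborel. \<bar>k x\<bar> powr q))
        + \<rho> powr (q - 1) * (C * (LINT x|lborel. \<bar>k x\<bar> powr q)))"
      using ints by simp
    also have "\<dots> \<le> \<rho> * (e * (D\<^sup>2 / c0 + D\<^sup>2 / c0 + K + K) + m * (C * (K + 1)))"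
    proof (intro mult_left_mono add_mono mult_mono \<rho>m)
      have "norm (emb u) \<le> D" using u(2) D(1) by simp
      thus "(LINT x|lborel. (u x)\<^sup>2) \<le> D\<^sup>2 / c0" "(LINT x|lborel. \<bar>u x\<bar> powr q) \<le> K" by (auto intro: L2_ball[OF u(1)] K(2)[OF u(1)])
      show "(LINT x|lborel. (k x)\<^sup>2) \<le> D\<^sup>2 / c0" "(LINT x|lborel. \<bar>k x\<bar> powr q) \<le> K" by (rule L2_ball[OF k nk] K(2)[OF k nk])+
      thus "(LINT x|lborel. \<bar>k x\<bar> powr q) \<le> K + 1" by simp
    qed (use \<rho> e(1) C(1) m in auto)
    also have "\<dots> \<le> \<rho> * (e * S + \<eta> / 2)"
    proof (intro mult_left_mono add_mono \<rho>(1))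
      show "D\<^sup>2 / c0 + D\<^sup>2 / c0 + K + K \<le> S" by (simp add: S_def)
      show "m * (C * (K + 1)) \<le> \<eta> / 2" using C(1) K(1) by (simp add: m_def)
    qed (use e(1) in simp)
    also have "\<dots> = \<eta> * \<rho>" using e(2) by simp
    finally show ?thesis unfolding eq \<rho>_def .
  qed
  thus ?thesis using \<delta> by blast
qed

section \<open>The two functionals and their gradients as Riesz representatives\<close>

definition Jf where "Jf U = (LINT x|lborel. Fprim f (pull U x))"
definition Psi where "Psi U = (LINT x|lborel. phi (pull U) x * (pull U x)\<^sup>2)"
text \<open>By \<open>WW_eqI\<close> the chosen representative is the only one. \<open>Rop\<close>
  is the gradient of \<open>Jf\<close>, and \<open>Kop\<close> is a quarter of the gradient of
  \<open>Psi\<close>.\<close>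

definition Rop where "Rop U = (SOME r. r \<in> WW \<and> (\<forall>h\<in>W. inner r (emb h) = (LINT x|lborel. f (pull U x) * h x)))"
definition Kop where "Kop U = (SOME r. r \<in> WW \<and> (\<forall>h\<in>W. inner r (emb h) = (LINT x|lborel. phi (pull U) x * pull U x * h x)))"

lemma Rop:
  assumes U: "U \<in> WW"
  shows "Rop U \<in> WW" "h \<in> W \<Longrightarrow> inner (Rop U) (emb h) = (LINT x|lborel. f (pull U x) * h x)"
proof -
  note u = pull(1)[OF U]
  obtain C where C: "\<And>h. h \<in> W \<Longrightarrow> norm (emb h) \<le> 1 \<Longrightarrow> \<bar>LINT x|lborel. f (pull U x) * h x\<bar> \<le> C" using f_pair[OF u] by blast
  have "\<exists>r. r \<in> WW \<and> (\<forall>h\<in>W. inner r (emb h) = (LINT x|lborel. f (pull U x) * h x))"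
  proof (rule riesz_W)
    show "\<bar>LINT x|lborel. f (pull U x) * h x\<bar> \<le> C" if "h \<in> W" "norm (emb h) \<le> 1" for h by (rule C[OF that])
    show "(LINT x|lborel. f (pull U x) * g x) = (LINT x|lborel. f (pull U x) * h x)"
      if "g \<in> W" "h \<in> W" and ae: "AE x in lborel. g x = h x" for g h
    proof (rule integral_cong_AE)
      show "AE x in lborel. f (pull U x) * g x = f (pull U x) * h x" using ae by eventually_elim simp
    qed (use f_pair_int[OF u] that in auto)
    show "(LINT x|lborel. f (pull U x) * (a * g x + b * h x)) = a * (LINT x|lborel. f (pull U x) * g x) + b * (LINT x|lborel. f (pull U x) * h x)"
      if gh: "g \<in> W" "h \<in> W" for g h a b
    proof -
      have "(LINT x|lborel. f (pull U x) * (a * g x + b * h x)) = (LINT x|lborel. a * (f (pull U x) * g x) + b * (f (pull U x) * h x))"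
        by (simp add: algebra_simps)
      thus ?thesis using f_pair_int[OF u gh(1)] f_pair_int[OF u gh(2)] by simp
    qed
  qed
  from someI_ex[OF this] show "Rop U \<in> WW" "h \<in> W \<Longrightarrow> inner (Rop U) (emb h) = (LINT x|lborel. f (pull U x) * h x)"
    unfolding Rop_def by blast+
qed

lemma Kop:
  assumes U: "U \<in> WW"
  shows "Kop U \<in> WW" "h \<in> W \<Longrightarrow> inner (Kop U) (emb h) = (LINT x|lborel. phi (pull U) x * pull U x * h x)"
proof -
  note u = pull(1)[OF U]
  have "\<exists>r. r \<in> WW \<and> (\<forall>h\<in>W. inner r (emb h) = (LINT x|lborel. phi (pull U) x * pull U x * h x))"
  proof (rule riesz_W)
    show "\<bar>LINT x|lborel. phi (pull U) x * pull U x * h x\<bar> \<le> ((norm U)\<^sup>2 / c0) * (norm U * 1 / c0)"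
      if "h \<in> W" "norm (emb h) \<le> 1" for h
    proof -
      have "((norm U)\<^sup>2 / c0) * (norm U * norm (emb h) / c0) \<le> ((norm U)\<^sup>2 / c0) * (norm U * 1 / c0)"
        using that(2) c0 by (intro mult_left_mono divide_right_mono) auto
      thus ?thesis using phi_pair(2)[OF u u that(1)] unfolding pull(2)[OF U] by linarith
    qed
    show "(LINT x|lborel. phi (pull U) x * pull U x * g x) = (LINT x|lborel. phi (pull U) x * pull U x * h x)"
      if "g \<in> W" "h \<in> W" and ae: "AE x in lborel. g x = h x" for g h
    proof (rule integral_cong_AE)
      show "AE x in lborel. phi (pull U) x * pull U x * g x = phi (pull U) x * pull U x * h x" using ae by eventually_elim simp
    qed (use phi_pair(1)[OF u u] that in auto)
    show "(LINT x|lborel. phi (pull U) x * pull U x * (a * g x + b * h x))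
       = a * (LINT x|lborel. phi (pull U) x * pull U x * g x) + b * (LINT x|lborel. phi (pull U) x * pull U x * h x)"
      if gh: "g \<in> W" "h \<in> W" for g h a b
    proof -
      have "(LINT x|lborel. phi (pull U) x * pull U x * (a * g x + b * h x))
         = (LINT x|lborel. a * (phi (pull U) x * pull U x * g x) + b * (phi (pull U) x * pull U x * h x))"
        by (simp add: algebra_simps)
      thus ?thesis using phi_pair(1)[OF u u gh(1)] phi_pair(1)[OF u u gh(2)] by simp
    qed
  qed
  from someI_ex[OF this] show "Kop U \<in> WW" "h \<in> W \<Longrightarrow> inner (Kop U) (emb h) = (LINT x|lborel. phi (pull U) x * pull U x * h x)"
    unfolding Kop_def by blast+
qed

lemma phi_cong:
  assumes "u \<in> W" "v \<in> W" "AE x in lborel. u x = v x"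
  shows "phi u = phi v"
  unfolding phi_eq_pot
proof (rule pot_cong)
  show "AE x in lborel. (u x)\<^sup>2 = (v x)\<^sup>2" using assms(3) by eventually_elim simp
qed (use W_meas[OF assms(1)] W_meas[OF assms(2)] in measurable)

lemma phi_sq_cong:
  assumes "u \<in> W" "v \<in> W" "AE x in lborel. u x = v x"
  shows "(LINT x|lborel. phi u x * (u x)\<^sup>2) = (LINT x|lborel. phi v x * (v x)\<^sup>2)"
proof (rule integral_cong_AE)
  show "AE x in lborel. phi u x * (u x)\<^sup>2 = phi v x * (v x)\<^sup>2"
    unfolding phi_cong[OF assms] using assms(3) by eventually_elim simp
qed (use phi_pair(1)[OF assms(1) assms(1) assms(1)] phi_pair(1)[OF assms(2) assms(2) assms(2)] in
      \<open>auto simp: power2_eq_square mult.assoc\<close>)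

lemma F_cong:
  assumes "u \<in> W" "v \<in> W" "AE x in lborel. u x = v x"
  shows "(LINT x|lborel. Fprim f (u x)) = (LINT x|lborel. Fprim f (v x))"
proof (rule integral_cong_AE)
  show "AE x in lborel. Fprim f (u x) = Fprim f (v x)" using assms(3) by eventually_elim simp
qed (use F_int assms in auto)

lemma pull_scaleR: "U \<in> WW \<Longrightarrow> AE x in lborel. pull (a *\<^sub>R U) x = a * pull U x"
  using pull_linear[of U U a 0] subspace_scale[OF subspace_WW] by simp

lemma pull_uminus: "U \<in> WW \<Longrightarrow> AE x in lborel. pull (- U) x = - pull U x"
  using pull_scaleR[of U "-1"] by simp

lemma Jf_emb: "u \<in> W \<Longrightarrow> Jf (emb u) = (LINT x|lborel. Fprim f (u x))"
  unfolding Jf_def by (rule F_cong) (auto simp: pull WW_def pull_emb)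

lemma Psi_emb: "u \<in> W \<Longrightarrow> Psi (emb u) = (LINT x|lborel. phi u x * (u x)\<^sup>2)"
  unfolding Psi_def by (rule phi_sq_cong) (auto simp: pull WW_def pull_emb)

lemma Psi_scaleR:
  assumes U: "U \<in> WW" shows "Psi (t *\<^sub>R U) = t ^ 4 * Psi U"
proof -
  note u = pull(1)[OF U]
  have ph: "phi (\<lambda>x. t * pull U x) x = t\<^sup>2 * phi (pull U) x" for x
  proof -
    have "(\<lambda>y. (t * pull U y)\<^sup>2) = (\<lambda>y. t\<^sup>2 * (pull U y)\<^sup>2 + 0 * (pull U y)\<^sup>2)" by (simp add: power_mult_distrib)
    thus ?thesis unfolding phi_eq_pot using pot_linear[OF W_sq_int[OF u] W_sq_int[OF u], of "t\<^sup>2" 0 x] by simp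
  qed
  have "emb (\<lambda>x. t * pull U x) = t *\<^sub>R U" by (simp add: emb_cmult[OF u] pull(2)[OF U])
  hence "Psi (t *\<^sub>R U) = (LINT x|lborel. t\<^sup>2 * phi (pull U) x * (t * pull U x)\<^sup>2)"
    using Psi_emb[OF W_cmult[OF u, of t]] by (simp add: ph)
  also have "(LINT x|lborel. t\<^sup>2 * phi (pull U) x * (t * pull U x)\<^sup>2) = (LINT x|lborel. t ^ 4 * (phi (pull U) x * (pull U x)\<^sup>2))"
    by (rule Bochner_Integration.integral_cong) (simp_all add: power_mult_distrib power2_eq_square power4_eq_xxxx mult_ac)
  finally show ?thesis by (simp add: Psi_def)
qed

lemma Rop_uniform:
  assumes "0 < \<eta>"
  shows "\<exists>\<delta>>0. \<forall>U\<in>WW. \<forall>Z\<in>WW. norm U \<le> B \<longrightarrow> norm Z \<le> B \<longrightarrow>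
       (LINT x|lborel. \<bar>pull U x - pull Z x\<bar> powr q) \<le> \<delta> \<longrightarrow> norm (Rop U - Rop Z) \<le> \<eta>"
proof -
  obtain \<delta> where \<delta>: "0 < \<delta>" "\<And>u v h. u \<in> W \<Longrightarrow> v \<in> W \<Longrightarrow> norm (emb u) \<le> B \<Longrightarrow> norm (emb v) \<le> B \<Longrightarrow>
     (LINT x|lborel. \<bar>u x - v x\<bar> powr q) \<le> \<delta> \<Longrightarrow> h \<in> W \<Longrightarrow> norm (emb h) \<le> 1 \<Longrightarrow>
      \<bar>(LINT x|lborel. f (u x) * h x) - (LINT x|lborel. f (v x) * h x)\<bar> \<le> \<eta>"
    using f_pair_uniform[OF assms, of B] by blast
  have "norm (Rop U - Rop Z) \<le> \<eta>" if UZ: "U \<in> WW" "Z \<in> WW" "norm U \<le> B" "norm Z \<le> B"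
     "(LINT x|lborel. \<bar>pull U x - pull Z x\<bar> powr q) \<le> \<delta>" for U Z
  proof (rule norm_le_by_pairing)
    show "Rop U - Rop Z \<in> WW" using Rop(1) UZ subspace_WW by (simp add: subspace_diff)
    show "inner (Rop U - Rop Z) (emb h) \<le> \<eta>" if h: "h \<in> W" "norm (emb h) \<le> 1" for h
      using \<delta>(2)[OF pull(1)[OF UZ(1)] pull(1)[OF UZ(2)] _ _ UZ(5) h] UZ
      by (simp add: inner_diff_left Rop(2) h pull(2) abs_le_iff)
  qed (use assms in simp)
  thus ?thesis using \<delta>(1) by blast
qed

lemma Kop_uniform:
  assumes "0 < \<eta>"
  shows "\<exists>\<delta>>0. \<forall>U\<in>WW. \<forall>Z\<in>WW. norm U \<le> B \<longrightarrow> norm Z \<le> B \<longrightarrow>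
       (LINT x|lborel. \<bar>pull U x - pull Z x\<bar> powr 4) \<le> \<delta> \<longrightarrow> norm (Kop U - Kop Z) \<le> \<eta>"
proof -
  obtain \<delta> where \<delta>: "0 < \<delta>" "\<And>u v h. u \<in> W \<Longrightarrow> v \<in> W \<Longrightarrow> norm (emb u) \<le> B \<Longrightarrow> norm (emb v) \<le> B \<Longrightarrow>
     (LINT x|lborel. \<bar>u x - v x\<bar> powr 4) \<le> \<delta> \<Longrightarrow> h \<in> W \<Longrightarrow> norm (emb h) \<le> 1 \<Longrightarrow>
      \<bar>(LINT x|lborel. phi u x * u x * h x) - (LINT x|lborel. phi v x * v x * h x)\<bar> \<le> \<eta>"
    using phi_pair_uniform[OF assms, of B] by blast
  have "norm (Kop U - Kop Z) \<le> \<eta>" if UZ: "U \<in> WW" "Z \<in> WW" "norm U \<le> B" "norm Z \<le> B"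
     "(LINT x|lborel. \<bar>pull U x - pull Z x\<bar> powr 4) \<le> \<delta>" for U Z
  proof (rule norm_le_by_pairing)
    show "Kop U - Kop Z \<in> WW" using Kop(1) UZ subspace_WW by (simp add: subspace_diff)
    show "inner (Kop U - Kop Z) (emb h) \<le> \<eta>" if h: "h \<in> W" "norm (emb h) \<le> 1" for h
      using \<delta>(2)[OF pull(1)[OF UZ(1)] pull(1)[OF UZ(2)] _ _ UZ(5) h] UZ
      by (simp add: inner_diff_left Kop(2) h pull(2) abs_le_iff)
  qed (use assms in simp)
  thus ?thesis using \<delta>(1) by blast
qed

text \<open>The joint compactness takes a subsequence for \<open>Rop\<close> from the embedding into
  L^q, and a further one for \<open>Kop\<close> from that into L^4. Positivity of \<open>Psi\<close>
  rests on the positivity of the kernel.\<close>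

sublocale constrained_functional WW Jf Psi Rop Kop
proof
  show "subspace WW" by (rule subspace_WW)
  show "closed WW" by (rule closed_WW)
  show "0 \<le> Jf U" for U unfolding Jf_def by (rule integral_nonneg_AE) (simp add: F_nonneg)
  show "Rop U \<in> WW" "Kop U \<in> WW" if "U \<in> WW" for U using Rop(1) Kop(1) that by auto
  have neg: "- U \<in> WW" if "U \<in> WW" for U using that subspace_WW by (simp add: subspace_neg)
  show "Rop (- U) = - Rop U" if U: "U \<in> WW" for U
  proof (rule WW_eqI[OF Rop(1)[OF neg[OF U]] neg[OF Rop(1)[OF U]]])
    fix h assume h: "h \<in> W"
    have "(LINT x|lborel. f (pull (- U) x) * h x) = (LINT x|lborel. - (f (pull U x) * h x))"
    proof (rule integral_cong_AE)
      show "AE x in lborel. f (pull (- U) x) * h x = - (f (pull U x) * h x)"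
        using pull_uminus[OF U] by eventually_elim (simp add: f_odd)
    qed (use f_pair_int[OF pull(1)[OF neg[OF U]] h] f_pair_int[OF pull(1)[OF U] h] in auto)
    thus "inner (Rop (- U)) (emb h) = inner (- Rop U) (emb h)"
      using Rop(2)[OF neg[OF U] h] Rop(2)[OF U h] by simp
  qed
  show "Kop (- U) = - Kop U" if U: "U \<in> WW" for U
  proof (rule WW_eqI[OF Kop(1)[OF neg[OF U]] neg[OF Kop(1)[OF U]]])
    fix h assume h: "h \<in> W"
    have m: "(\<lambda>x. - pull U x) \<in> W" using W_cmult[OF pull(1)[OF U], of "-1"] by simp
    have "phi (pull (- U)) = phi (\<lambda>x. - pull U x)" by (rule phi_cong[OF pull(1)[OF neg[OF U]] m pull_uminus[OF U]])
    also have "\<dots> = phi (pull U)" by (simp add: phi_eq_pot)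
    finally have p: "phi (pull (- U)) = phi (pull U)" .
    have "(LINT x|lborel. phi (pull (- U)) x * pull (- U) x * h x) = (LINT x|lborel. - (phi (pull U) x * pull U x * h x))"
    proof (rule integral_cong_AE)
      show "AE x in lborel. phi (pull (- U)) x * pull (- U) x * h x = - (phi (pull U) x * pull U x * h x)"
        using pull_uminus[OF U] by eventually_elim (simp add: p)
    qed (use phi_pair(1)[OF pull(1)[OF neg[OF U]] pull(1)[OF neg[OF U]] h] phi_pair(1)[OF pull(1)[OF U] pull(1)[OF U] h] in auto)
    thus "inner (Kop (- U)) (emb h) = inner (- Kop U) (emb h)"
      using Kop(2)[OF neg[OF U] h] Kop(2)[OF U h] by simp
  qed
  show "continuous_on WW Rop" by (rule Lp_uniform_imp_continuous[OF q Rop_uniform])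
  show "continuous_on WW Kop" by (rule Lp_uniform_imp_continuous[OF _ _ Kop_uniform]) auto
  show "\<exists>r l l'. strict_mono (r :: nat \<Rightarrow> nat) \<and> (Rop \<circ> x \<circ> r) \<longlonglongrightarrow> l \<and> (Kop \<circ> x \<circ> r) \<longlonglongrightarrow> l'"
    if x: "\<And>n::nat. x n \<in> WW" "\<And>n. norm (x n) \<le> B" for x B
  proof -
    have "\<exists>r l. strict_mono (r :: nat \<Rightarrow> nat) \<and> (Rop \<circ> x \<circ> r) \<longlonglongrightarrow> l"
      by (rule Lp_uniform_imp_compact[OF q Rop_uniform, where B=B]) (use x in auto)
    then obtain r l where r: "strict_mono (r :: nat \<Rightarrow> nat)" "(Rop \<circ> x \<circ> r) \<longlonglongrightarrow> l" by blast
    have "\<exists>s l'. strict_mono (s :: nat \<Rightarrow> nat) \<and> (Kop \<circ> (x \<circ> r) \<circ> s) \<longlonglongrightarrow> l'"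
      by (rule Lp_uniform_imp_compact[OF _ _ Kop_uniform, where B=B]) (use x in auto)
    then obtain s l' where s: "strict_mono (s :: nat \<Rightarrow> nat)" "(Kop \<circ> (x \<circ> r) \<circ> s) \<longlonglongrightarrow> l'" by blast
    have "(Rop \<circ> x \<circ> (r \<circ> s)) \<longlonglongrightarrow> l" using LIMSEQ_subseq_LIMSEQ[OF r(2) s(1)] by (simp add: comp_assoc)
    moreover have "(Kop \<circ> x \<circ> (r \<circ> s)) \<longlonglongrightarrow> l'" using s(2) by (simp add: comp_assoc)
    ultimately show ?thesis using strict_mono_o[OF r(1) s(1)] by blast
  qed
  show "\<exists>\<delta>>0. \<forall>u\<in>WW. \<forall>h\<in>WW. norm u \<le> B \<longrightarrow> norm h \<le> \<delta> \<longrightarrow>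
       \<bar>Jf (u + h) - Jf u - inner (Rop u) h\<bar> \<le> \<eta> * norm h" if "0 < \<eta>" for B \<eta>
  proof -
    obtain \<delta> where \<delta>: "0 < \<delta>" "\<And>u h. u \<in> W \<Longrightarrow> h \<in> W \<Longrightarrow> norm (emb u) \<le> B \<Longrightarrow> norm (emb h) \<le> \<delta> \<Longrightarrow>
      \<bar>(LINT x|lborel. Fprim f (u x + h x)) - (LINT x|lborel. Fprim f (u x)) - (LINT x|lborel. f (u x) * h x)\<bar> \<le> \<eta> * norm (emb h)"
      using F_taylor_int[OF \<open>0 < \<eta>\<close>, of B] by blast
    have "\<bar>Jf (U + Z) - Jf U - inner (Rop U) Z\<bar> \<le> \<eta> * norm Z"
      if UZ: "U \<in> WW" "Z \<in> WW" "norm U \<le> B" "norm Z \<le> \<delta>" for U Z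
    proof -
      note u = pull[OF UZ(1)] and h = pull[OF UZ(2)]
      have "emb (\<lambda>x. pull U x + pull Z x) = U + Z" by (simp add: emb_add u h)
      hence "Jf (U + Z) = (LINT x|lborel. Fprim f (pull U x + pull Z x))" using Jf_emb[OF W_add[OF u(1) h(1)]] by simp
      moreover have "inner (Rop U) Z = (LINT x|lborel. f (pull U x) * pull Z x)" using Rop(2)[OF UZ(1) h(1)] h(2) by simp
      ultimately show ?thesis using \<delta>(2)[OF u(1) h(1)] UZ u(2) h(2) by (simp add: Jf_def)
    qed
    thus ?thesis using \<delta>(1) by blast
  qed
  show "\<exists>\<delta>>0. \<forall>u\<in>WW. \<forall>h\<in>WW. norm u \<le> B \<longrightarrow> norm h \<le> \<delta> \<longrightarrow>
       \<bar>Psi (u + h) - Psi u - 4 * inner (Kop u) h\<bar> \<le> \<eta> * norm h" if "0 < \<eta>" for B \<eta>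
  proof -
    obtain \<delta> where \<delta>: "0 < \<delta>" "\<And>u h. u \<in> W \<Longrightarrow> h \<in> W \<Longrightarrow> norm (emb u) \<le> B \<Longrightarrow> norm (emb h) \<le> \<delta> \<Longrightarrow>
      \<bar>(LINT x|lborel. phi (\<lambda>x. u x + h x) x * (u x + h x)\<^sup>2) - (LINT x|lborel. phi u x * (u x)\<^sup>2)
       - 4 * (LINT x|lborel. phi u x * u x * h x)\<bar> \<le> \<eta> * norm (emb h)"
      using phi_taylor[OF \<open>0 < \<eta>\<close>, of B] by blast
    have "\<bar>Psi (U + Z) - Psi U - 4 * inner (Kop U) Z\<bar> \<le> \<eta> * norm Z"
      if UZ: "U \<in> WW" "Z \<in> WW" "norm U \<le> B" "norm Z \<le> \<delta>" for U Z
    proof -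
      note u = pull[OF UZ(1)] and h = pull[OF UZ(2)]
      have "emb (\<lambda>x. pull U x + pull Z x) = U + Z" by (simp add: emb_add u h)
      hence "Psi (U + Z) = (LINT x|lborel. phi (\<lambda>x. pull U x + pull Z x) x * (pull U x + pull Z x)\<^sup>2)"
        using Psi_emb[OF W_add[OF u(1) h(1)]] by simp
      moreover have "inner (Kop U) Z = (LINT x|lborel. phi (pull U) x * pull U x * pull Z x)" using Kop(2)[OF UZ(1) h(1)] h(2) by simp
      ultimately show ?thesis using \<delta>(2)[OF u(1) h(1)] UZ u(2) h(2) by (simp add: Psi_def)
    qed
    thus ?thesis using \<delta>(1) by blast
  qed
  show "Psi (t *\<^sub>R U) = t ^ 4 * Psi U" if "U \<in> WW" for U t by (rule Psi_scaleR[OF that])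
  show "inner (Kop U) U = Psi U" if U: "U \<in> WW" for U
    using Kop(2)[OF U pull(1)[OF U]] pull(2)[OF U] by (simp add: Psi_def power2_eq_square mult.assoc)
  show "0 < Psi U" if U: "U \<in> WW" "U \<noteq> 0" for U
  proof -
    note u = pull[OF U(1)]
    have "Psi U \<noteq> 0"
    proof
      assume "Psi U = 0"
      hence "AE x in lborel. pull U x = 0" unfolding Psi_def by (rule phi_mult_zero_imp_AE[OF W_sq[OF u(1)]])
      hence z: "AE x in lborel. (pull U x)\<^sup>2 = 0" by eventually_elim simp
      have "AE x in lborel. comb (pull U) x = comb (\<lambda>x. 0) x"
      proof -
        have ae: "AE x in lborel. pull U x = 0" using z by eventually_elim simp
        have "L2_grad (pull U) (grad (\<lambda>x. 0))"
          by (rule L2_grad_cong[OF L2_grad_grad[OF W_H1[OF zero_W]]]) (use ae W_meas[OF u(1)] in auto)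
        from grad_eqI[OF W_H1[OF u(1)] this] ae show ?thesis
          by eventually_elim (simp add: comb_def)
      qed
      hence "emb (pull U) = emb (\<lambda>x. 0)" unfolding emb_def by (rule mk_cong)
      thus False using U(2) u(2) emb_cmult[OF zero_W, of 0] by simp
    qed
    moreover have "0 \<le> Psi U" unfolding Psi_def by (intro integral_nonneg_AE) (simp add: phi_nonneg)
    ultimately show ?thesis by simp
  qed
  show "\<exists>e :: nat \<Rightarrow> (R3, real \<times> R3) L2. (\<forall>i. e i \<in> WW) \<and> (\<forall>c. (\<Sum>i\<le>n. c i *\<^sub>R e i) = 0 \<longrightarrow> (\<forall>i\<le>n. c i = 0))" for n :: nat
    by (rule infinite_dim_WW)
qed

section \<open>From critical points back to solutions\<close>

lemma energy_emb: "u \<in> W \<Longrightarrow> energy V f \<epsilon> u = I (emb u)"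
  by (simp add: energy_def I_def emb_norm Jf_emb)

lemma emb_in_WW: "u \<in> W \<Longrightarrow> emb u \<in> WW"
  by (simp add: WW_def)

lemma M_set_iff: "u \<in> M_set V \<epsilon> \<longleftrightarrow> u \<in> W \<and> emb u \<in> M"
  by (auto simp: M_set_def M_def Psi_emb emb_in_WW)

text \<open>The equation of \<open>critical_eq\<close>, paired with \<open>emb v\<close>, is the
  weak form of the differential equation, and its multiplier is the negative of \<lambda>.\<close>

lemma critical_imp_solution:
  assumes U: "U \<in> M" "H U = 0"
  defines "u \<equiv> pull U"
  shows "u \<in> M_set V \<epsilon>" "energy V f \<epsilon> u = I U" "W_norm V \<epsilon> u = norm U"
    and "is_solution V f \<epsilon> u (- ((W_norm V \<epsilon> u)\<^sup>2 + (LINT x|lborel. f (u x) * u x)))"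
proof -
  have UW: "U \<in> WW" using U by (simp add: M_def)
  note u = pull[OF UW, folded u_def]
  show "u \<in> M_set V \<epsilon>" using u U by (simp add: M_set_iff)
  show "energy V f \<epsilon> u = I U" using energy_emb[OF u(1)] u(2) by simp
  show n: "W_norm V \<epsilon> u = norm U" using emb_norm[OF u(1)] u(2) by simp
  have fu: "inner (Rop U) U = (LINT x|lborel. f (u x) * u x)" using Rop(2)[OF UW u(1)] u(2) by (simp add: u_def)
  show "is_solution V f \<epsilon> u (- ((W_norm V \<epsilon> u)\<^sup>2 + (LINT x|lborel. f (u x) * u x)))"
    unfolding is_solution_def
  proof (intro conjI ballI u(1))
    fix v assume v: "v \<in> W"
    have "inner (U + Rop U - ((norm U)\<^sup>2 + inner (Rop U) U) *\<^sub>R Kop U) (emb v) = 0"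
      by (simp add: critical_eq[OF U])
    hence "inner U (emb v) + inner (Rop U) (emb v) - ((norm U)\<^sup>2 + inner (Rop U) U) * inner (Kop U) (emb v) = 0"
      by (simp add: inner_add_left inner_diff_left)
    moreover have "inner U (emb v) = (LINT x|lborel. grad u x \<bullet> grad v x) + (LINT x|lborel. V (\<epsilon> *\<^sub>R x) * u x * v x)"
      using emb_inner[OF u(1) v] u(2) by simp
    ultimately show "(LINT x|lborel. grad u x \<bullet> grad v x) + (LINT x|lborel. V (\<epsilon> *\<^sub>R x) * u x * v x)
        + - ((W_norm V \<epsilon> u)\<^sup>2 + (LINT x|lborel. f (u x) * u x)) * (LINT x|lborel. phi u x * u x * v x) + (LINT x|lborel. f (u x) * v x) = 0"
      using Rop(2)[OF UW v, folded u_def] Kop(2)[OF UW v, folded u_def] by (simp add: n fu algebra_simps)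
  qed
qed

lemma W_abs:
  assumes u: "u \<in> W"
  shows "(\<lambda>x. \<bar>u x\<bar>) \<in> W" "norm (emb (\<lambda>x. \<bar>u x\<bar>)) \<le> norm (emb u)"
proof -
  show v: "(\<lambda>x. \<bar>u x\<bar>) \<in> W" using H1_abs(1)[OF W_H1[OF u]] u by (simp add: W_iff)
  have "W_norm V \<epsilon> (\<lambda>x. \<bar>u x\<bar>) \<le> W_norm V \<epsilon> u"
    unfolding W_norm_def using H1_abs(2)[OF W_H1[OF u]] by simp
  thus "norm (emb (\<lambda>x. \<bar>u x\<bar>)) \<le> norm (emb u)" by (simp add: emb_norm u v)
qed

text \<open>Passing to |u| preserves the constraint, since \<open>phi\<close> depends on u^2, and
  the F-term, since F is even; the norm does not increase.\<close>

lemma nonneg_minimizer: "\<exists>U\<in>M. (\<forall>Z\<in>M. I U \<le> I Z) \<and> (AE x in lborel. 0 \<le> pull U x)"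
proof -
  obtain U where U: "U \<in> M" "\<And>Z. Z \<in> M \<Longrightarrow> I U \<le> I Z" using minimizer_exists by blast
  have UW: "U \<in> WW" using U by (simp add: M_def)
  note u = pull[OF UW]
  define v where "v = (\<lambda>x. \<bar>pull U x\<bar>)"
  have v: "v \<in> W" "norm (emb v) \<le> norm U" using W_abs[OF u(1)] u(2) by (auto simp: v_def)
  have Fv: "Fprim f (v x) = Fprim f (pull U x)" for x by (simp add: v_def abs_if F_even)
  have phv: "phi v = phi (pull U)" by (simp add: phi_eq_pot v_def)
  have vM: "emb v \<in> M"
    using U(1) emb_in_WW[OF v(1)] Psi_emb[OF v(1)] by (simp add: M_def phv) (simp add: v_def Psi_def)
  have "I (emb v) \<le> I U"
    using v power_mono[OF v(2), of 2] by (simp add: I_def Jf_emb Fv) (simp add: Jf_def)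
  hence "\<forall>Z\<in>M. I (emb v) \<le> I Z" using U(2) by (meson order_trans)
  moreover have "AE x in lborel. 0 \<le> pull (emb v) x"
    using pull_emb[OF v(1)] by eventually_elim (simp add: v_def)
  ultimately show ?thesis using vM by blast
qed

text \<open>\<open>high_critical\<close> supplies energies of at least n. As I is bounded above on
  every ball, the norms must tend to infinity too, and - \<lambda> is at least the squared norm
  because f t * t \<ge> 0.\<close>

lemma existence:
  "(\<exists>u :: nat \<Rightarrow> R3 \<Rightarrow> real. \<exists>lam :: nat \<Rightarrow> real.
            (\<forall>n. is_solution V f \<epsilon> (u n) (lam n) \<and> u n \<in> M_set V \<epsilon>) \<and>
            filterlim (\<lambda>n. W_norm V \<epsilon> (u n)) at_top sequentially \<and>
            filterlim (\<lambda>n. energy V f \<epsilon> (u n)) at_top sequentially \<and>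
            (\<forall>n. lam n = - ((W_norm V \<epsilon> (u n))\<^sup>2 + (LINT x|lborel. f (u n x) * u n x))) \<and>
            filterlim lam at_bot sequentially)"
proof -
  have "\<exists>U\<in>M. real n \<le> I U \<and> H U = 0" for n by (rule high_critical)
  then obtain X where X: "\<And>n::nat. X n \<in> M" "\<And>n. real n \<le> I (X n)" "\<And>n. H (X n) = 0" by metis
  define u where "u n = pull (X n)" for n
  define lam where "lam n = - ((W_norm V \<epsilon> (u n))\<^sup>2 + (LINT x|lborel. f (u n x) * u n x))" for n
  note sol = critical_imp_solution[OF X(1,3), folded u_def]
  have en: "filterlim (\<lambda>n. energy V f \<epsilon> (u n)) at_top sequentially"
    by (rule filterlim_at_top_mono[OF filterlim_real_sequentially]) (simp add: sol(2) X(2))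
  have XW: "X n \<in> WW" for n using X(1) by (simp add: M_def)
  have nrm: "filterlim (\<lambda>n. norm (X n)) at_top sequentially"
    unfolding filterlim_at_top
  proof
    fix Z :: real
    obtain b where b: "\<And>U. U \<in> WW \<Longrightarrow> norm U \<le> \<bar>Z\<bar> \<Longrightarrow> I U \<le> b"
    proof -
      obtain C where C: "0 < C" "\<And>s k \<rho>. 0 \<le> \<rho> \<Longrightarrow> \<rho> \<le> 1 \<Longrightarrow>
         \<bar>Fprim f (s + \<rho> * k) - Fprim f s - f s * (\<rho> * k)\<bar>
           \<le> \<rho> * (1 * (s\<^sup>2 + k\<^sup>2 + \<bar>s\<bar> powr q + \<bar>k\<bar> powr q) + \<rho> powr (q - 1) * (C * \<bar>k\<bar> powr q))"
        using F_taylor_scaled[of 1] by auto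
      obtain K where K: "0 \<le> K" "\<And>u. u \<in> W \<Longrightarrow> norm (emb u) \<le> \<bar>Z\<bar> \<Longrightarrow> (LINT x|lborel. \<bar>u x\<bar> powr q) \<le> K"
        using Lq_ball[of "\<bar>Z\<bar>"] by blast
      have "I U \<le> Z\<^sup>2 / 2 + (\<bar>Z\<bar>\<^sup>2 / c0 + (1 + C) * K)" if U: "U \<in> WW" "norm U \<le> \<bar>Z\<bar>" for U
      proof -
        note w = pull[OF U(1)]
        have nw: "norm (emb (pull U)) \<le> \<bar>Z\<bar>" using w(2) U(2) by simp
        have "Jf U \<le> (LINT x|lborel. (pull U x)\<^sup>2 + (1 + C) * \<bar>pull U x\<bar> powr q)"
          unfolding Jf_def
        proof (rule integral_mono)
          show "integrable lborel (\<lambda>x. (pull U x)\<^sup>2 + (1 + C) * \<bar>pull U x\<bar> powr q)"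
            using W_sq_int[OF w(1)] Lq_integrable[OF w(1)] by simp
          show "Fprim f (pull U x) \<le> (pull U x)\<^sup>2 + (1 + C) * \<bar>pull U x\<bar> powr q" for x
            using C(2)[of 1 0 "pull U x"] F_nonneg[of "pull U x"] by (simp add: F0 f0 algebra_simps)
        qed (rule F_int[OF w(1)])
        also have "\<dots> = (LINT x|lborel. (pull U x)\<^sup>2) + (1 + C) * (LINT x|lborel. \<bar>pull U x\<bar> powr q)"
          using W_sq_int[OF w(1)] Lq_integrable[OF w(1)] by simp
        also have "\<dots> \<le> \<bar>Z\<bar>\<^sup>2 / c0 + (1 + C) * K"
          using C(1) by (intro add_mono mult_left_mono L2_ball K(2) w(1) nw) auto
        finally show ?thesis using power_mono[OF U(2), of 2] by (simp add: I_def)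
      qed
      thus ?thesis using that by blast
    qed
    show "\<forall>\<^sub>F n in sequentially. Z \<le> norm (X n)"
      unfolding eventually_sequentially
    proof (intro exI allI impI)
      fix n assume "nat \<lceil>b\<rceil> + 1 \<le> n"
      hence "b < real n" by linarith
      hence "\<not> norm (X n) \<le> \<bar>Z\<bar>" using b[OF XW[of n]] X(2)[of n] by linarith
      thus "Z \<le> norm (X n)" by linarith
    qed
  qed
  have lim: "filterlim lam at_bot sequentially"
  proof -
    \<comment> \<open>Divergence of the norms suffices, by t^2 \<ge> 2 t - 1 \<ge> t - 1 for t \<ge>
      0.\<close>
    have le: "- 1 + norm (X n) \<le> - lam n" for n
    proof -
      have "0 \<le> (LINT x|lborel. f (u n x) * u n x)"
      proof (rule integral_nonneg_AE, intro AE_I2)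
        fix x
        have "0 \<le> f t * t" for t
          using f_nonneg[of t] f_nonneg[of "- t"] f_odd[of t] by (cases "0 \<le> t") (auto simp: mult_nonpos_nonpos)
        thus "0 \<le> f (u n x) * u n x" .
      qed
      hence "(norm (X n))\<^sup>2 \<le> - lam n" by (simp add: lam_def sol(3))
      moreover have "0 \<le> (norm (X n) - 1)\<^sup>2" by simp
      hence "2 * norm (X n) - 1 \<le> (norm (X n))\<^sup>2" by (simp add: power2_diff)
      ultimately show ?thesis using norm_ge_zero[of "X n"] by linarith
    qed
    have "filterlim (\<lambda>n. - 1 + norm (X n)) at_top sequentially"
      by (rule filterlim_tendsto_add_at_top[OF tendsto_const nrm])
    hence "filterlim (\<lambda>n. - lam n) at_top sequentially"
      by (rule filterlim_at_top_mono) (intro always_eventually allI le)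
    thus ?thesis by (simp add: filterlim_uminus_at_top)
  qed
  show ?thesis
    by (rule exI[of _ u], rule exI[of _ lam]) (use sol en nrm lim in \<open>simp add: lam_def[abs_def]\<close>)
qed

text \<open>The minimiser is taken over all of M and so has no more energy than any solution in
  M.\<close>

lemma ground_state_exists:
  "\<exists>u lam. ground_state V f \<epsilon> u lam \<and> ((AE x in lborel. u x \<ge> 0) \<or> (AE x in lborel. u x \<le> 0))"
proof -
  obtain U where U: "U \<in> M" "\<And>Z. Z \<in> M \<Longrightarrow> I U \<le> I Z" "AE x in lborel. 0 \<le> pull U x"
    using nonneg_minimizer by blast
  have "H U = 0" by (rule minimizer_imp_critical[OF U(1,2)])
  note sol = critical_imp_solution[OF U(1) this]
  have "energy V f \<epsilon> (pull U) \<le> energy V f \<epsilon> w" if "w \<in> M_set V \<epsilon>" for w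
    using U(2)[of "emb w"] that by (simp add: M_set_iff sol(2) energy_emb)
  hence "ground_state V f \<epsilon> (pull U) (- ((W_norm V \<epsilon> (pull U))\<^sup>2 + (LINT x|lborel. f (pull U x) * pull U x)))"
    using sol(1,4) by (simp add: ground_state_def)
  thus ?thesis using U(3) by blast
qed

end

text \<open>Energies that tend to infinity take infinitely many values, so the sequence contains
  infinitely many distinct solutions. The potential enters the weak form, the norm and the
  constraint set at one fixed \<epsilon>, for which the whole construction is instantiated.\<close>

theorem theorem1p1:
  fixes V :: "R3 \<Rightarrow> real" and f :: "real \<Rightarrow> real"
  assumes V_meas: "V \<in> borel_measurable lborel"
    and V_Linf_loc: "\<And>K. compact K \<Longrightarrow> \<exists>C. AE x in lborel. x \<in> K \<longrightarrow> \<bar>V x\<bar> \<le> C"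
    and V0_pos: "\<exists>c>0. AE x in lborel. c \<le> V x"
    and f_cont: "continuous_on UNIV f"
    and f_odd: "\<And>t. f (- t) = - f t"
    and f_nonneg: "\<And>t. t \<ge> 0 \<Longrightarrow> f t \<ge> 0"
    and f_infty: "\<exists>q. 2 < q \<and> q < 6 \<and> ((\<lambda>t. f t / t powr (q - 1)) \<longlongrightarrow> 0) at_top"
    and f_zero: "((\<lambda>t. f t / t) \<longlongrightarrow> 0) (at 0)"
    and embed: "\<And>\<epsilon> p. \<epsilon> > 0 \<Longrightarrow> 2 < p \<Longrightarrow> p < 6 \<Longrightarrow> compact_embed V \<epsilon> p"
    and eps: "\<epsilon> > 0"
  shows "(\<exists>u :: nat \<Rightarrow> R3 \<Rightarrow> real. \<exists>lam :: nat \<Rightarrow> real.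
            (\<forall>n. is_solution V f \<epsilon> (u n) (lam n) \<and> u n \<in> M_set V \<epsilon>) \<and>
            filterlim (\<lambda>n. W_norm V \<epsilon> (u n)) at_top sequentially \<and>
            filterlim (\<lambda>n. energy V f \<epsilon> (u n)) at_top sequentially \<and>
            (\<forall>n. lam n = - ((W_norm V \<epsilon> (u n))\<^sup>2 + (LINT x|lborel. f (u n x) * u n x))) \<and>
            filterlim lam at_bot sequentially)
       \<and> (\<exists>u lam. ground_state V f \<epsilon> u lam \<and>
            ((AE x in lborel. u x \<ge> 0) \<or> (AE x in lborel. u x \<le> 0)))"
proof -
  obtain c0 where c0: "0 < c0" "AE x in lborel. c0 \<le> V x" using V0_pos by blast
  obtain q where q: "2 < q" "q < 6" "((\<lambda>t. f t / t powr (q - 1)) \<longlongrightarrow> 0) at_top" using f_infty by blast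
  interpret bopp_podolsky V \<epsilon> c0 f q
    by unfold_locales (fact V_meas V_Linf_loc c0 eps embed[OF eps] f_cont f_odd f_nonneg q f_zero)+
  show ?thesis using existence ground_state_exists by (rule conjI)
qed

end
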